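(* The groups $(\mathcal{G},\circ_0)$ and $(\mathcal{G},\circ_0')$ are isomorphic, and thus the groups $(\mathcal{SC}(2,0),\circ)$ and $(\mathcal{SA}_{\mathrm{res}}(1,0),\circ)$ are isomorphic. Similarly, the groups $(\mathcal{G},\circ_\infty)$ and $(\mathcal{G},\circ_\infty')$ are isomorphic, and thus the groups $(\mathcal{SC}(2,\infty),\cdot)$ and $(\mathcal{SA}_{\mathrm{res}}(1,\infty),\cdot')$ are isomorphic. That is, the group of formal $N=2$ superconformal functions vanishing at zero and invertible in a neighborhood of zero is isomorphic to the group of formal $N=1$ superanalytic functions vanishing at zero, invertible in a neighborhood of zero, and with even component vanishing when the even variable is set equal to zero. Similarly, the group of formal $N=2$ superconformal functions vanishing at infinity and invertible in a neighborhood of infinity is isomorphic to the group of formal $N=1$ superanalytic functions vanishing at infinity, invertible in a neighborhood of infinity, and with $x\,\partial/\partial\varphi$ of the even component vanishing when the even variable $x$ approaches infinity.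
   Context: Grassmann algebra: $\bigwedge_L$ ($L\in\mathbb{N}=\{0,1,2,\dots\}$) is the exterior algebra over $\mathbb{C}$ on $L$ generators, $\bigwedge_L\subset\bigwedge_{L+1}$, $\bigwedge_\infty=\bigcup_L\bigwedge_L$; $\bigwedge_*$ is one of these, with even and odd parts $\bigwedge_*^0,\bigwedge_*^1$; $(\bigwedge_*^0)^\times$ is the group of invertible even elements. $\mathbb{Z}_+$ denotes the positive integers. $x$ is an even formal variable; $\varphi,\varphi^{(1)},\varphi^{(2)}$ are odd formal variables (commuting with $x$ and $\bigwedge_*^0$, anticommuting with each other and with $\bigwedge_*^1$, squares zero). Functions are composed by substitution, Taylor expanding in nilpotent terms. $N=2$ functions. Let $D^{(j)}=\frac{\partial}{\partial\varphi^{(j)}}+\varphi^{(j)}\frac{\partial}{\partial x}$, $j=1,2$. A formal function $f(x,\varphi^{(1)},\varphi^{(2)})=(\tilde x,\tilde\varphi^{(1)},\tilde\varphi^{(2)})$ with $\tilde x$ even and $\tilde\varphi^{(j)}$ odd is $N=2$ superconformal if $D^{(1)}\tilde\varphi^{(1)}-D^{(2)}\tilde\varphi^{(2)}=0$, $D^{(1)}\tilde\varphi^{(2)}+D^{(2)}\tilde\varphi^{(1)}=0$ and $D^{(j)}\tilde x-\tilde\varphi^{(1)}D^{(j)}\tilde\varphi^{(1)}-\tilde\varphi^{(2)}D^{(j)}\tilde\varphi^{(2)}=0$ for $j=1,2$. $\mathcal{SC}(2,0)$ is the set of $N=2$ superconformal $f$ with components in $\bigwedge_*[[x]][\varphi^{(1)},\varphi^{(2)}]$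 that vanish at $(0,0,0)$ and are invertible (under composition) in a neighborhood of zero; it is a group under composition. Let $I_2(x,\varphi^{(1)},\varphi^{(2)})=(1/x,i\varphi^{(1)}/x,i\varphi^{(2)}/x)$. $\mathcal{SC}(2,\infty)$ is the set of formal $N=2$ superconformal functions vanishing at $(\infty,0,0)$ and invertible in a neighborhood of it, i.e. those $f$ such that $f\circ I_2^{-1}\in\mathcal{SC}(2,0)$; it is a group under $f_1\cdot f_2=f_1\circ I_2^{-1}\circ f_2$. $N=1$ functions. $\mathcal{SA}_{\mathrm{res}}(1,0)$ is the set of pairs $f(x,\varphi)=(\tilde x,\tilde\varphi)$ with $\tilde x\in x\bigwedge_*^0[[x]]\oplus\varphi x\bigwedge_*^1[[x]]$, $\tilde\varphi\in x\bigwedge_*^1[[x]]\oplus\varphi\bigwedge_*^0[[x]]$, invertible in a neighborhood of zero (the coefficient of $x$ in $\tilde x$ and of $\varphi$ in $\tilde\varphi$ are invertible); it is a group under composition. Let $I_1(x,\varphi)=(1/x,i\varphi/x)$. $\mathcal{SA}_{\mathrm{res}}(1,\infty)$ is the set of pairs $(\tilde x,\tilde\varphi)$ with $\tilde x\in x^{-1}\bigwedge_*^0[[x^{-1}]]\oplus\varphi x^{-2}\bigwedge_*^1[[x^{-1}]]$, $\tilde\varphi\in x^{-1}\bigwedge_*^1[[x^{-1}]]\oplus\varphi x^{-1}\bigwedge_*^0[[x^{-1}]]$, invertible in a neighborhood of $(\infty,0)$ (leading coefficients of $x^{-1}$ in $\tilde x$ and of $\varphi x^{-1}$ in $\tilde\varphi$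 are invertible); it is a group under $f_1\cdot' f_2=f_1\circ I_1^{-1}\circ f_2$. Parameter set. $\mathcal{G}=\big(((\bigwedge_*^0)^\times)^2/\langle(-1,-1)\rangle\big)\times(\bigwedge_*^\infty)^2$, where $\bigwedge_*^\infty=(\bigwedge_*^0)^\infty\oplus(\bigwedge_*^1)^\infty$ (pairs of infinite sequences of even, resp. odd, elements). Elements are written $g=(a_0^{(1)},a_0^{(2)},A^{(1)},A^{(2)},M^{(1)},M^{(2)})$ with $A^{(j)}=\{A^{(j)}_n\}_{n\in\mathbb{Z}_+}\subset\bigwedge_*^0$, $M^{(j)}=\{M^{(j)}_{n-1/2}\}_{n\in\mathbb{Z}_+}\subset\bigwedge_*^1$. $N=2$ derivations, in the variables $(x,\varphi^{(1)},\varphi^{(2)})$: $L_n=-\big(x^{n+1}\frac{\partial}{\partial x}+\frac{n+1}{2}x^n(\varphi^{(1)}\frac{\partial}{\partial\varphi^{(1)}}+\varphi^{(2)}\frac{\partial}{\partial\varphi^{(2)}})\big)$, $J_n=ix^n\big(\varphi^{(1)}\frac{\partial}{\partial\varphi^{(2)}}-\varphi^{(2)}\frac{\partial}{\partial\varphi^{(1)}}\big)$, $G^{(1)}_{n-1/2}=-\big(x^n(\frac{\partial}{\partial\varphi^{(1)}}-\varphi^{(1)}\frac{\partial}{\partial x})-nx^{n-1}\varphi^{(1)}\varphi^{(2)}\frac{\partial}{\partial\varphi^{(2)}}\big)$, $G^{(2)}_{n-1/2}=-\big(x^n(\frac{\partial}{\partial\varphi^{(2)}}-\varphi^{(2)}\frac{\partial}{\partial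 x})+nx^{n-1}\varphi^{(1)}\varphi^{(2)}\frac{\partial}{\partial\varphi^{(1)}}\big)$. $N=1$ derivations, in the variables $(x,\varphi)$: $L_n=-\big(x^{n+1}\frac{\partial}{\partial x}+\frac{n+1}{2}x^n\varphi\frac{\partial}{\partial\varphi}\big)$, $J_n=x^n\varphi\frac{\partial}{\partial\varphi}$, $G^{(j)}_{n-1/2}=(-i)^{j+1}x^n\big(\frac{\partial}{\partial\varphi}+(-1)^j\varphi\frac{\partial}{\partial x}\big)$. For $a\in(\bigwedge_*^0)^\times$ and an integer-diagonalizable even derivation $K$ ($K=\pm2L_0$ or $-J_0$), $a^{K}$ is the automorphism acting as $a^k$ on the $k$-eigenspace of $K$ (e.g. in the $N=1$ case $a^{-2L_0}\cdot(x,\varphi)=(a^2x,a\varphi)$ and $a^{-J_0}\cdot(x,\varphi)=(x,a^{-1}\varphi)$). Operators act on each component of a tuple. Maps. $\hat E_2:\mathcal{G}\to\mathcal{SC}(2,0)$ is the bijection (using the $N=2$ derivations) $\hat E_2(g)=\exp\big(-\sum_{n\in\mathbb{Z}_+}(A^{(1)}_nL_n+A^{(2)}_nJ_n+M^{(1)}_{n-1/2}G^{(1)}_{n-1/2}+M^{(2)}_{n-1/2}G^{(2)}_{n-1/2})\big)\cdot(a_0^{(1)})^{-2L_0}\cdot(a_0^{(2)})^{-J_0}\cdot(x,\varphi^{(1)},\varphi^{(2)})$, and $\hat E_1:\mathcal{G}\to\mathcal{SA}_{\mathrm{res}}(1,0)$ is the bijection given by the same formula using the $N=1$ derivations, applied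 to $(x,\varphi)$. Likewise $\hat E_2^\infty:\mathcal{G}\to\mathcal{SC}(2,\infty)$ is the bijection $\hat E_2^\infty(g)=\exp\big(\sum_{n\in\mathbb{Z}_+}(A^{(1)}_nL_{-n}-A^{(2)}_nJ_{-n}+iM^{(1)}_{n-1/2}G^{(1)}_{-n+1/2}+iM^{(2)}_{n-1/2}G^{(2)}_{-n+1/2})\big)\cdot(a_0^{(1)})^{2L_0}\cdot(a_0^{(2)})^{-J_0}\cdot(1/x,i\varphi^{(1)}/x,i\varphi^{(2)}/x)$ (with the $N=2$ derivations), and $\hat E_1^\infty:\mathcal{G}\to\mathcal{SA}_{\mathrm{res}}(1,\infty)$ is the bijection given by the same formula with the $N=1$ derivations, applied to $(1/x,i\varphi/x)$. Group operations on $\mathcal{G}$: $g\circ_0h=\hat E_2^{-1}(\hat E_2(h)\circ\hat E_2(g))$; $g\circ_0'h=\hat E_1^{-1}(\hat E_1(h)\circ\hat E_1(g))$; $g\circ_\infty h=(\hat E_2^\infty)^{-1}(\hat E_2^\infty(h)\cdot\hat E_2^\infty(g))$; $g\circ_\infty'h=(\hat E_1^\infty)^{-1}(\hat E_1^\infty(h)\cdot'\hat E_1^\infty(g))$. *)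

theory Defs
  imports
    "HOL-Analysis.Infinite_Sum"
    "HOL-Computational_Algebra.Formal_Laurent_Series"
    "HOL-Library.Extended_Nat"
    "HOL-Library.FuncSet"
    "HOL-Algebra.Generated_Groups"
begin

section \<open>Grassmann algebras\<close>

text \<open>
  The odd formal variables are adjoined to the Grassmann algebra as further anticommuting
  generators: \<open>Zeta 0, Zeta 1, \<dots>\<close> generate the coefficient algebra, \<open>Phi\<close> is the odd variable of
  the $N=1$ functions, and \<open>Phi1\<close>, \<open>Phi2\<close> are those of the $N=2$ functions.
\<close>

datatype odd_gen = Zeta nat | Phi | Phi1 | Phi2

text \<open>An arbitrary linear order, used only to write monomials in a fixed order.\<close>

primrec odd_gen_rank :: "odd_gen \<Rightarrow> nat" where
  "odd_gen_rank Phi = 0"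
| "odd_gen_rank Phi1 = 1"
| "odd_gen_rank Phi2 = 2"
| "odd_gen_rank (Zeta k) = k + 3"

lemma odd_gen_rank_inject: "odd_gen_rank g = odd_gen_rank h \<longleftrightarrow> g = h"
  by (cases g; cases h) auto

instantiation odd_gen :: linorder
begin

definition less_eq_odd_gen :: "odd_gen \<Rightarrow> odd_gen \<Rightarrow> bool" where
  "g \<le> h \<longleftrightarrow> odd_gen_rank g \<le> odd_gen_rank h"

definition less_odd_gen :: "odd_gen \<Rightarrow> odd_gen \<Rightarrow> bool" where
  "g < h \<longleftrightarrow> odd_gen_rank g < odd_gen_rank h"

instance
  by standard (auto simp: less_eq_odd_gen_def less_odd_gen_def odd_gen_rank_inject)

end

text \<open>
  An element is given by its coefficients with respect to the basis of monomials
  $e_S = g_1 g_2 \cdots g_k$, where $S = \{g_1 < \dots < g_k\}$.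
\<close>

typedef grass = "{c :: odd_gen set \<Rightarrow> complex. finite {S. c S \<noteq> 0} \<and> (\<forall>S. c S \<noteq> 0 \<longrightarrow> finite S)}"
  morphisms gcoeff Abs_grass
  by (rule exI[of _ "\<lambda>_. 0"]) simp

setup_lifting type_definition_grass

text \<open>$e_S\, e_T = \mathit{msign}\ S\ T \cdot e_{S \cup T}$ for disjoint $S$, $T$.\<close>

definition msign :: "odd_gen set \<Rightarrow> odd_gen set \<Rightarrow> complex" where
  "msign S T = (-1) ^ card {(s, t). s \<in> S \<and> t \<in> T \<and> t < s}"

lemma msign_empty [simp]: "msign {} T = 1" "msign S {} = 1"
  by (simp_all add: msign_def)

lemma finite_inversions:
  assumes "finite S" "finite T"
  shows "finite {(s, t). s \<in> S \<and> t \<in> T \<and> t < s}"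
  by (rule finite_subset[of _ "S \<times> T"]) (use assms in auto)

lemma msign_Un_left:
  assumes "finite S" "finite T" "finite W" "S \<inter> T = {}"
  shows "msign (S \<union> T) W = msign S W * msign T W"
proof -
  have "{(s, t). s \<in> S \<union> T \<and> t \<in> W \<and> t < s} =
        {(s, t). s \<in> S \<and> t \<in> W \<and> t < s} \<union> {(s, t). s \<in> T \<and> t \<in> W \<and> t < s}" by auto
  moreover have "card ({(s, t). s \<in> S \<and> t \<in> W \<and> t < s} \<union> {(s, t). s \<in> T \<and> t \<in> W \<and> t < s}) =
        card {(s, t). s \<in> S \<and> t \<in> W \<and> t < s} + card {(s, t). s \<in> T \<and> t \<in> W \<and> t < s}"
    by (rule card_Un_disjoint) (use assms finite_inversions in auto)
  ultimately show ?thesis by (simp add: msign_def power_add)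
qed

lemma msign_Un_right:
  assumes "finite S" "finite T" "finite W" "T \<inter> W = {}"
  shows "msign S (T \<union> W) = msign S T * msign S W"
proof -
  have "{(s, t). s \<in> S \<and> t \<in> T \<union> W \<and> t < s} =
        {(s, t). s \<in> S \<and> t \<in> T \<and> t < s} \<union> {(s, t). s \<in> S \<and> t \<in> W \<and> t < s}" by auto
  moreover have "card ({(s, t). s \<in> S \<and> t \<in> T \<and> t < s} \<union> {(s, t). s \<in> S \<and> t \<in> W \<and> t < s}) =
        card {(s, t). s \<in> S \<and> t \<in> T \<and> t < s} + card {(s, t). s \<in> S \<and> t \<in> W \<and> t < s}"
    by (rule card_Un_disjoint) (use assms finite_inversions in auto)
  ultimately show ?thesis by (simp add: msign_def power_add)
qed

lemma msign_assoc:
  assumes "finite S" "finite T" "finite W" "S \<inter> T = {}" "S \<inter> W = {}" "T \<inter> W = {}"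
  shows "msign (S \<union> T) W * msign S T = msign S (T \<union> W) * msign T W"
  using assms by (simp add: msign_Un_left msign_Un_right)

instantiation grass :: ring_1
begin

lift_definition zero_grass :: grass is "\<lambda>_. 0" by simp

lift_definition one_grass :: grass is "\<lambda>S. if S = {} then 1 else 0" by simp

lift_definition plus_grass :: "grass \<Rightarrow> grass \<Rightarrow> grass" is "\<lambda>a b S. a S + b S"
proof -
  fix a b :: "odd_gen set \<Rightarrow> complex"
  assume a: "finite {S. a S \<noteq> 0} \<and> (\<forall>S. a S \<noteq> 0 \<longrightarrow> finite S)"
    and b: "finite {S. b S \<noteq> 0} \<and> (\<forall>S. b S \<noteq> 0 \<longrightarrow> finite S)"
  have nz: "a S \<noteq> 0 \<or> b S \<noteq> 0" if "a S + b S \<noteq> 0" for S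
    using that by auto
  then have "{S. a S + b S \<noteq> 0} \<subseteq> {S. a S \<noteq> 0} \<union> {S. b S \<noteq> 0}" by blast
  then have "finite {S. a S + b S \<noteq> 0}"
    by (rule finite_subset) (use a b in simp)
  then show "finite {S. a S + b S \<noteq> 0} \<and> (\<forall>S. a S + b S \<noteq> 0 \<longrightarrow> finite S)"
    using nz a b by blast
qed

lift_definition uminus_grass :: "grass \<Rightarrow> grass" is "\<lambda>a S. - a S" by simp

definition minus_grass :: "grass \<Rightarrow> grass \<Rightarrow> grass" where
  "minus_grass a b = a + - b"

lift_definition times_grass :: "grass \<Rightarrow> grass \<Rightarrow> grass" is
  "\<lambda>a b U. \<Sum>S\<in>Pow U. msign S (U - S) * a S * b (U - S)"
proof -
  fix a b :: "odd_gen set \<Rightarrow> complex"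
  assume a: "finite {S. a S \<noteq> 0} \<and> (\<forall>S. a S \<noteq> 0 \<longrightarrow> finite S)"
    and b: "finite {S. b S \<noteq> 0} \<and> (\<forall>S. b S \<noteq> 0 \<longrightarrow> finite S)"
  let ?c = "\<lambda>U. \<Sum>S\<in>Pow U. msign S (U - S) * a S * b (U - S)"
  have nz: "\<exists>S T. U = S \<union> T \<and> a S \<noteq> 0 \<and> b T \<noteq> 0" if "?c U \<noteq> 0" for U
  proof -
    from that obtain S where "S \<in> Pow U" "msign S (U - S) * a S * b (U - S) \<noteq> 0"
      by (rule sum.not_neutral_contains_not_neutral)
    then show ?thesis by (intro exI[of _ S] exI[of _ "U - S"]) auto
  qed
  have "{U. ?c U \<noteq> 0} \<subseteq> (\<lambda>(S, T). S \<union> T) ` ({S. a S \<noteq> 0} \<times> {T. b T \<noteq> 0})"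
    using nz by fastforce
  then have "finite {U. ?c U \<noteq> 0}"
    using a b by (meson finite_SigmaI finite_imageI finite_subset)
  moreover have "finite U" if "?c U \<noteq> 0" for U
    using nz[OF that] a b by auto
  ultimately show "finite {U. ?c U \<noteq> 0} \<and> (\<forall>U. ?c U \<noteq> 0 \<longrightarrow> finite U)"
    by blast
qed

instance
proof
  fix a b c :: grass
  show "a + b + c = a + (b + c)" by transfer (simp add: add.assoc)
  show "a + b = b + a" by transfer (simp add: add.commute)
  show "0 + a = a" by transfer simp
  show "- a + a = 0" by transfer simp
  show "a - b = a + - b" by (rule minus_grass_def)
  show "(a + b) * c = a * c + b * c"
    by transfer (simp add: fun_eq_iff algebra_simps sum.distrib)
  show "a * (b + c) = a * b + a * c"
    by transfer (simp add: fun_eq_iff algebra_simps sum.distrib)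
  show "(0::grass) \<noteq> 1" by transfer (metis zero_neq_one)
  show "1 * a = a"
  proof transfer
    fix a :: "odd_gen set \<Rightarrow> complex"
    assume a: "finite {S. a S \<noteq> 0} \<and> (\<forall>S. a S \<noteq> 0 \<longrightarrow> finite S)"
    have "(\<Sum>S\<in>Pow U. msign S (U - S) * (if S = {} then 1 else 0) * a (U - S)) = a U" for U
    proof (cases "finite U")
      case True
      have "(\<Sum>S\<in>Pow U. msign S (U - S) * (if S = {} then 1 else 0) * a (U - S)) =
            (\<Sum>S\<in>{{}}. msign S (U - S) * (if S = {} then 1 else 0) * a (U - S))"
        by (rule sum.mono_neutral_right) (use True in auto)
      then show ?thesis by simp
    next
      case False
      then show ?thesis using a by (auto simp: finite_Pow_iff)
    qed
    then show "(\<lambda>U. \<Sum>S\<in>Pow U. msign S (U - S) * (if S = {} then 1 else 0) * a (U - S)) = a"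
      by blast
  qed
  show "a * 1 = a"
  proof transfer
    fix a :: "odd_gen set \<Rightarrow> complex"
    assume a: "finite {S. a S \<noteq> 0} \<and> (\<forall>S. a S \<noteq> 0 \<longrightarrow> finite S)"
    have "(\<Sum>S\<in>Pow U. msign S (U - S) * a S * (if U - S = {} then 1 else 0)) = a U" for U
    proof (cases "finite U")
      case True
      have "(\<Sum>S\<in>Pow U. msign S (U - S) * a S * (if U - S = {} then 1 else 0)) =
            (\<Sum>S\<in>{U}. msign S (U - S) * a S * (if U - S = {} then 1 else 0))"
        by (rule sum.mono_neutral_right) (use True in auto)
      then show ?thesis by simp
    next
      case False
      then show ?thesis using a by (auto simp: finite_Pow_iff)
    qed
    then show "(\<lambda>U. \<Sum>S\<in>Pow U. msign S (U - S) * a S * (if U - S = {} then 1 else 0)) = a"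
      by blast
  qed
  show "a * b * c = a * (b * c)"
  proof transfer
    fix a b c :: "odd_gen set \<Rightarrow> complex"
    have "(\<Sum>V\<in>Pow U. msign V (U - V) * (\<Sum>S\<in>Pow V. msign S (V - S) * a S * b (V - S)) * c (U - V)) =
          (\<Sum>S\<in>Pow U. msign S (U - S) * a S *
             (\<Sum>T\<in>Pow (U - S). msign T (U - S - T) * b T * c (U - S - T)))" (is "?l = ?r") for U
    proof (cases "finite U")
      case True
      have fin: "finite V" if "V \<subseteq> U" for V using that True finite_subset by blast
      have "?l = (\<Sum>(V, S)\<in>Sigma (Pow U) Pow.
                    msign V (U - V) * (msign S (V - S) * a S * b (V - S)) * c (U - V))"
        unfolding sum_distrib_left sum_distrib_right
        by (subst sum.Sigma) (use True fin in auto)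
      also have "\<dots> = (\<Sum>(S, T)\<in>Sigma (Pow U) (\<lambda>S. Pow (U - S)).
                    msign S (U - S) * a S * (msign T (U - S - T) * b T * c (U - S - T)))"
      proof (rule sum.reindex_bij_witness
          [where i = "\<lambda>(S, T). (S \<union> T, S)" and j = "\<lambda>(V, S). (S, V - S)"])
        fix p assume "p \<in> Sigma (Pow U) Pow"
        then obtain V S where p: "p = (V, S)" "V \<subseteq> U" "S \<subseteq> V" by auto
        have e: "S \<union> (V - S) = V" "V - S \<union> (U - V) = U - S" "U - S - (V - S) = U - V"
          using p by auto
        have "msign (S \<union> (V - S)) (U - V) * msign S (V - S) =
              msign S ((V - S) \<union> (U - V)) * msign (V - S) (U - V)"
          by (rule msign_assoc) (use p True fin in \<open>auto intro: finite_subset\<close>)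
        then have "msign V (U - V) * msign S (V - S) = msign S (U - S) * msign (V - S) (U - V)"
          by (simp only: e)
        then show "(case (case p of (V, S) \<Rightarrow> (S, V - S)) of (S, T) \<Rightarrow>
                msign S (U - S) * a S * (msign T (U - S - T) * b T * c (U - S - T))) =
              (case p of (V, S) \<Rightarrow>
                msign V (U - V) * (msign S (V - S) * a S * b (V - S)) * c (U - V))"
          by (simp add: p(1) e(3) mult.assoc[symmetric])
      qed auto
      also have "\<dots> = ?r"
        unfolding sum_distrib_left
        by (subst sum.Sigma) (use True in auto)
      finally show ?thesis .
    next
      case False
      then show ?thesis by (simp add: finite_Pow_iff)
    qed
    then show "(\<lambda>U. \<Sum>V\<in>Pow U. msign V (U - V) *
             (\<Sum>S\<in>Pow V. msign S (V - S) * a S * b (V - S)) * c (U - V)) =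
          (\<lambda>U. \<Sum>S\<in>Pow U. msign S (U - S) * a S *
             (\<Sum>T\<in>Pow (U - S). msign T (U - S - T) * b T * c (U - S - T)))"
      by blast
  qed
qed

end

lift_definition gscal :: "complex \<Rightarrow> grass" is "\<lambda>z S. if S = {} then z else 0" by simp

lift_definition ggen :: "odd_gen \<Rightarrow> grass" is "\<lambda>g S. if S = {g} then 1 else 0" by simp

text \<open>The left derivative $\partial/\partial g$ with respect to a generator.\<close>

lift_definition gderiv :: "odd_gen \<Rightarrow> grass \<Rightarrow> grass" is
  "\<lambda>g c S. if g \<in> S then 0 else (-1) ^ card {s \<in> S. s < g} * c (insert g S)"
proof -
  fix g and c :: "odd_gen set \<Rightarrow> complex"
  assume c: "finite {S. c S \<noteq> 0} \<and> (\<forall>S. c S \<noteq> 0 \<longrightarrow> finite S)"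
  let ?d = "\<lambda>S. if g \<in> S then 0 else (-1) ^ card {s \<in> S. s < g} * c (insert g S)"
  have "{S. ?d S \<noteq> 0} \<subseteq> (\<lambda>S. S - {g}) ` {S. c S \<noteq> 0}"
  proof
    fix S assume "S \<in> {S. ?d S \<noteq> 0}"
    then have "g \<notin> S" "c (insert g S) \<noteq> 0" by (auto split: if_splits)
    then show "S \<in> (\<lambda>S. S - {g}) ` {S. c S \<noteq> 0}"
      by (intro image_eqI[of _ _ "insert g S"]) auto
  qed
  then have "finite {S. ?d S \<noteq> 0}" using c finite_subset by blast
  moreover have "finite S" if "?d S \<noteq> 0" for S
  proof -
    from that have "c (insert g S) \<noteq> 0" by (auto split: if_splits)
    then have "finite (insert g S)" by (rule c[THEN conjunct2, rule_format])
    then show ?thesis by simp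
  qed
  ultimately show "finite {S. ?d S \<noteq> 0} \<and> (\<forall>S. ?d S \<noteq> 0 \<longrightarrow> finite S)" by blast
qed

definition grass_even :: "grass set" where
  "grass_even = {c. \<forall>S. gcoeff c S \<noteq> 0 \<longrightarrow> even (card S)}"

definition grass_odd :: "grass set" where
  "grass_odd = {c. \<forall>S. gcoeff c S \<noteq> 0 \<longrightarrow> odd (card S)}"

text \<open>
  \<open>Lam L V\<close> is $\bigwedge_L[V]$ for a set $V$ of odd formal variables; \<open>L = \<infinity>\<close> is allowed and
  gives $\bigwedge_\infty = \bigcup_L \bigwedge_L$.  The algebra $\bigwedge_L$ itself is \<open>Lam L {}\<close>.
\<close>

definition Lam :: "enat \<Rightarrow> odd_gen set \<Rightarrow> grass set" where
  "Lam L V = {c. \<forall>S. gcoeff c S \<noteq> 0 \<longrightarrow> S \<subseteq> {Zeta k | k. enat k < L} \<union> V}"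

abbreviation Lam_even :: "enat \<Rightarrow> grass set" where
  "Lam_even L \<equiv> Lam L {} \<inter> grass_even"

abbreviation Lam_odd :: "enat \<Rightarrow> grass set" where
  "Lam_odd L \<equiv> Lam L {} \<inter> grass_odd"

definition Lam_units :: "enat \<Rightarrow> grass set" where
  "Lam_units L = {a \<in> Lam_even L. \<exists>b \<in> Lam_even L. a * b = 1}"

unbundle fps_syntax

section \<open>Formal functions\<close>

text \<open>
  A component of a formal function is a Laurent series over the Grassmann algebra, the odd
  variables being among the generators of the latter.  It is expanded either at $0$, as a
  series in $x$, or at $\infty$, as a series in $t = x^{-1}$; the Laurent variable of the type
  \<open>sfun\<close> stands for $x$ or for $t$ accordingly.  The type does not record which, so operations
  depending on it take an argument of type \<open>expansion\<close>.
\<close>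

type_synonym sfun = "grass fls"

datatype expansion = At_0 | At_inf

primrec xpow :: "expansion \<Rightarrow> int \<Rightarrow> sfun" where
  "xpow At_0 n = fls_X_intpow n"
| "xpow At_inf n = fls_X_intpow (- n)"

text \<open>$\partial/\partial x$; at infinity, $\partial/\partial x = -t^2\,\partial/\partial t$.\<close>

primrec d_x :: "expansion \<Rightarrow> sfun \<Rightarrow> sfun" where
  "d_x At_0 f = fls_deriv f"
| "d_x At_inf f = - (fls_X_intpow 2 * fls_deriv f)"

definition d_odd :: "odd_gen \<Rightarrow> sfun \<Rightarrow> sfun" where
  "d_odd g f = Abs_fls (\<lambda>n. gderiv g (f $$ n))"

definition scal :: "complex \<Rightarrow> sfun" where
  "scal z = fls_const (gscal z)"

definition ogen :: "odd_gen \<Rightarrow> sfun" where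
  "ogen g = fls_const (ggen g)"

text \<open>\<open>series A m\<close> is $u^m A[[u]]$, where $u$ is the Laurent variable.\<close>

definition series :: "grass set \<Rightarrow> int \<Rightarrow> sfun set" where
  "series A m = {f. (\<forall>n. f $$ n \<in> A) \<and> (\<forall>n<m. f $$ n = 0)}"

subsection \<open>Substitution and composition\<close>

definition unit_inv :: "'a::ring_1 \<Rightarrow> 'a" where
  "unit_inv a = (THE b. a * b = 1 \<and> b * a = 1)"

definition zpow :: "'a::ring_1 \<Rightarrow> int \<Rightarrow> 'a" where
  "zpow a k = (if 0 \<le> k then a ^ nat k else unit_inv a ^ nat (- k))"

text \<open>
  \<open>gsubst v\<close> replaces every generator \<open>g\<close> by the value \<open>v g\<close>.  \<open>subst u v\<close> moreover replaces the
  Laurent variable by \<open>u\<close>; the sum is taken in the topology of formal Laurent series.  The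
  Taylor expansion in the nilpotent parts is contained in the expansion of the powers of \<open>u\<close>.
\<close>

definition gsubst :: "(odd_gen \<Rightarrow> sfun) \<Rightarrow> grass \<Rightarrow> sfun" where
  "gsubst v c = (\<Sum>S | gcoeff c S \<noteq> 0.
     scal (gcoeff c S) * prod_list (map v (sorted_list_of_set S)))"

definition subst :: "sfun \<Rightarrow> (odd_gen \<Rightarrow> sfun) \<Rightarrow> sfun \<Rightarrow> sfun" where
  "subst u v f = (\<Sum>\<^sub>\<infinity>n. gsubst v (f $$ n) * zpow u n)"

text \<open>
  The value of the Laurent variable of a function expanded at \<open>e\<close> when \<open>x\<close> takes the value \<open>X\<close>.
\<close>

primrec var_at :: "expansion \<Rightarrow> sfun \<Rightarrow> sfun" where
  "var_at At_0 X = X"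
| "var_at At_inf X = unit_inv X"

type_synonym fun1 = "sfun \<times> sfun"
type_synonym fun2 = "sfun \<times> sfun \<times> sfun"

text \<open>
  In \<open>comp1 e f g\<close> and \<open>comp2 e f g\<close> (meaning $f \circ g$), \<open>e\<close> is the point at which the outer
  function \<open>f\<close> is expanded; the result is expanded where \<open>g\<close> is.
\<close>

fun comp1 :: "expansion \<Rightarrow> fun1 \<Rightarrow> fun1 \<Rightarrow> fun1" where
  "comp1 e (X, P) (Y, Q) =
    (let s = subst (var_at e Y) (ogen(Phi := Q)) in (s X, s P))"

fun comp2 :: "expansion \<Rightarrow> fun2 \<Rightarrow> fun2 \<Rightarrow> fun2" where
  "comp2 e (X, P1, P2) (Y, Q1, Q2) =
    (let s = subst (var_at e Y) (ogen(Phi1 := Q1, Phi2 := Q2)) in (s X, s P1, s P2))"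

definition id1 :: "expansion \<Rightarrow> fun1" where
  "id1 e = (xpow e 1, ogen Phi)"

definition id2 :: "expansion \<Rightarrow> fun2" where
  "id2 e = (xpow e 1, ogen Phi1, ogen Phi2)"

definition I1 :: "expansion \<Rightarrow> fun1" where
  "I1 e = (xpow e (-1), scal \<i> * ogen Phi * xpow e (-1))"

definition I2 :: "expansion \<Rightarrow> fun2" where
  "I2 e = (xpow e (-1), scal \<i> * ogen Phi1 * xpow e (-1), scal \<i> * ogen Phi2 * xpow e (-1))"

definition I1_inv :: "expansion \<Rightarrow> fun1" where
  "I1_inv e = (xpow e (-1), scal (- \<i>) * ogen Phi * xpow e (-1))"

definition I2_inv :: "expansion \<Rightarrow> fun2" where
  "I2_inv e =
    (xpow e (-1), scal (- \<i>) * ogen Phi1 * xpow e (-1), scal (- \<i>) * ogen Phi2 * xpow e (-1))"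

subsection \<open>The $N=2$ superconformal groups\<close>

abbreviation Lam2 :: "enat \<Rightarrow> grass set" where
  "Lam2 L \<equiv> Lam L {Phi1, Phi2}"

definition sderiv :: "odd_gen \<Rightarrow> sfun \<Rightarrow> sfun" where
  "sderiv g f = d_odd g f + ogen g * d_x At_0 f"

fun superconformal :: "fun2 \<Rightarrow> bool" where
  "superconformal (X, P1, P2) \<longleftrightarrow>
     sderiv Phi1 P1 - sderiv Phi2 P2 = 0 \<and>
     sderiv Phi1 P2 + sderiv Phi2 P1 = 0 \<and>
     sderiv Phi1 X - P1 * sderiv Phi1 P1 - P2 * sderiv Phi1 P2 = 0 \<and>
     sderiv Phi2 X - P1 * sderiv Phi2 P1 - P2 * sderiv Phi2 P2 = 0"

definition vanishing_fun2 :: "enat \<Rightarrow> fun2 set" where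
  "vanishing_fun2 L =
    {f \<in> series (Lam2 L \<inter> grass_even) 0 \<times> series (Lam2 L \<inter> grass_odd) 0 \<times>
         series (Lam2 L \<inter> grass_odd) 0. comp2 At_0 f (0, 0, 0) = (0, 0, 0)}"

definition SC_0_carrier :: "enat \<Rightarrow> fun2 set" where
  "SC_0_carrier L = {f \<in> vanishing_fun2 L. superconformal f \<and>
     (\<exists>g \<in> vanishing_fun2 L. comp2 At_0 f g = id2 At_0 \<and> comp2 At_0 g f = id2 At_0)}"

definition SC_0 :: "enat \<Rightarrow> fun2 monoid" where
  "SC_0 L = \<lparr>carrier = SC_0_carrier L, mult = comp2 At_0, one = id2 At_0\<rparr>"

definition SC_inf_carrier :: "enat \<Rightarrow> fun2 set" where
  "SC_inf_carrier L =
    {(X, P1, P2). (\<forall>n. X $$ n \<in> Lam2 L \<inter> grass_even \<and>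
         P1 $$ n \<in> Lam2 L \<inter> grass_odd \<and> P2 $$ n \<in> Lam2 L \<inter> grass_odd) \<and>
       comp2 At_inf (X, P1, P2) (I2_inv At_0) \<in> SC_0_carrier L}"

definition SC_inf :: "enat \<Rightarrow> fun2 monoid" where
  "SC_inf L = \<lparr>carrier = SC_inf_carrier L,
     mult = (\<lambda>f1 f2. comp2 At_inf f1 (comp2 At_0 (I2_inv At_0) f2)), one = I2 At_inf\<rparr>"

subsection \<open>The $N=1$ superanalytic groups\<close>

definition SA_0_carrier :: "enat \<Rightarrow> fun1 set" where
  "SA_0_carrier L = {(F + ogen Phi * G, R + ogen Phi * H) | F G R H.
     F \<in> series (Lam_even L) 1 \<and> G \<in> series (Lam_odd L) 1 \<and>
     R \<in> series (Lam_odd L) 1 \<and> H \<in> series (Lam_even L) 0 \<and>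
     F $$ 1 \<in> Lam_units L \<and> H $$ 0 \<in> Lam_units L}"

definition SA_0 :: "enat \<Rightarrow> fun1 monoid" where
  "SA_0 L = \<lparr>carrier = SA_0_carrier L, mult = comp1 At_0, one = id1 At_0\<rparr>"

text \<open>Here the series are in $t = x^{-1}$.\<close>

definition SA_inf_carrier :: "enat \<Rightarrow> fun1 set" where
  "SA_inf_carrier L = {(F + ogen Phi * G, R + ogen Phi * H) | F G R H.
     F \<in> series (Lam_even L) 1 \<and> G \<in> series (Lam_odd L) 2 \<and>
     R \<in> series (Lam_odd L) 1 \<and> H \<in> series (Lam_even L) 1 \<and>
     F $$ 1 \<in> Lam_units L \<and> H $$ 1 \<in> Lam_units L}"

definition SA_inf :: "enat \<Rightarrow> fun1 monoid" where
  "SA_inf L = \<lparr>carrier = SA_inf_carrier L,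
     mult = (\<lambda>f1 f2. comp1 At_inf f1 (comp1 At_0 (I1_inv At_0) f2)), one = I1 At_inf\<rparr>"

section \<open>Derivations\<close>

text \<open>In all families of odd derivations below, index \<open>n\<close> stands for $G^{(j)}_{n-1/2}$.\<close>

definition N2_L :: "expansion \<Rightarrow> int \<Rightarrow> sfun \<Rightarrow> sfun" where
  "N2_L e n f = - (xpow e (n + 1) * d_x e f + scal ((of_int n + 1) / 2) * xpow e n *
     (ogen Phi1 * d_odd Phi1 f + ogen Phi2 * d_odd Phi2 f))"

definition N2_J :: "expansion \<Rightarrow> int \<Rightarrow> sfun \<Rightarrow> sfun" where
  "N2_J e n f = scal \<i> * xpow e n * (ogen Phi1 * d_odd Phi2 f - ogen Phi2 * d_odd Phi1 f)"

definition N2_G1 :: "expansion \<Rightarrow> int \<Rightarrow> sfun \<Rightarrow> sfun" where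
  "N2_G1 e n f = - (xpow e n * (d_odd Phi1 f - ogen Phi1 * d_x e f)
     - scal (of_int n) * xpow e (n - 1) * ogen Phi1 * ogen Phi2 * d_odd Phi2 f)"

definition N2_G2 :: "expansion \<Rightarrow> int \<Rightarrow> sfun \<Rightarrow> sfun" where
  "N2_G2 e n f = - (xpow e n * (d_odd Phi2 f - ogen Phi2 * d_x e f)
     + scal (of_int n) * xpow e (n - 1) * ogen Phi1 * ogen Phi2 * d_odd Phi1 f)"

definition N1_L :: "expansion \<Rightarrow> int \<Rightarrow> sfun \<Rightarrow> sfun" where
  "N1_L e n f = - (xpow e (n + 1) * d_x e f + scal ((of_int n + 1) / 2) * xpow e n *
     ogen Phi * d_odd Phi f)"

definition N1_J :: "expansion \<Rightarrow> int \<Rightarrow> sfun \<Rightarrow> sfun" where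
  "N1_J e n f = xpow e n * ogen Phi * d_odd Phi f"

definition N1_G :: "nat \<Rightarrow> expansion \<Rightarrow> int \<Rightarrow> sfun \<Rightarrow> sfun" where
  "N1_G j e n f = scal ((- \<i>) ^ (j + 1)) * xpow e n *
     (d_odd Phi f + scal ((-1) ^ j) * ogen Phi * d_x e f)"

definition exp_op :: "(sfun \<Rightarrow> sfun) \<Rightarrow> sfun \<Rightarrow> sfun" where
  "exp_op T f = (\<Sum>\<^sub>\<infinity>k. scal (1 / fact k) * (T ^^ k) f)"

text \<open>$a^K$: decompose \<open>f\<close> into \<open>K\<close>-eigenvectors \<open>F k\<close> and scale each by $a^k$.\<close>

definition pow_op :: "grass \<Rightarrow> (sfun \<Rightarrow> sfun) \<Rightarrow> sfun \<Rightarrow> sfun" where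
  "pow_op a K f = (THE h. \<exists>F :: int \<Rightarrow> sfun. (\<forall>k. K (F k) = of_int k * F k) \<and>
     (F has_sum f) UNIV \<and> ((\<lambda>k. fls_const (zpow a k) * F k) has_sum h) UNIV)"

section \<open>The parameter set and the exponential maps\<close>

text \<open>
  A parameter $(a_0^{(1)}, a_0^{(2)}, A^{(1)}, A^{(2)}, M^{(1)}, M^{(2)})$, with the pair of units
  given by its coset modulo $\langle(-1,-1)\rangle$.  The entry $M^{(j)}_{n-1/2}$ is \<open>Mj n\<close>.
\<close>

type_synonym seqs = "(nat \<Rightarrow> grass) \<times> (nat \<Rightarrow> grass) \<times> (nat \<Rightarrow> grass) \<times> (nat \<Rightarrow> grass)"
type_synonym param = "(grass \<times> grass) set \<times> seqs"

definition unit_group :: "enat \<Rightarrow> grass monoid" where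
  "unit_group L = \<lparr>carrier = Lam_units L, mult = (*), one = 1\<rparr>"

definition params :: "enat \<Rightarrow> param set" where
  "params L =
     carrier ((unit_group L \<times>\<times> unit_group L) Mod generate (unit_group L \<times>\<times> unit_group L) {(-1, -1)})
     \<times> ({1..} \<rightarrow>\<^sub>E Lam_even L) \<times> ({1..} \<rightarrow>\<^sub>E Lam_even L)
     \<times> ({1..} \<rightarrow>\<^sub>E Lam_odd L) \<times> ({1..} \<rightarrow>\<^sub>E Lam_odd L)"

type_synonym ops = "int \<Rightarrow> sfun \<Rightarrow> sfun"

fun E_op_0 :: "ops \<Rightarrow> ops \<Rightarrow> ops \<Rightarrow> ops \<Rightarrow> seqs \<Rightarrow> grass \<times> grass \<Rightarrow> sfun \<Rightarrow> sfun" where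
  "E_op_0 L J G1 G2 (A1, A2, M1, M2) (a1, a2) f =
     exp_op (\<lambda>h. - (\<Sum>\<^sub>\<infinity>n\<in>{1..}. fls_const (A1 n) * L (int n) h + fls_const (A2 n) * J (int n) h
                     + fls_const (M1 n) * G1 (int n) h + fls_const (M2 n) * G2 (int n) h))
       (pow_op a1 (\<lambda>h. - 2 * L 0 h) (pow_op a2 (\<lambda>h. - J 0 h) f))"

text \<open>$G^{(j)}_{-n+1/2}$ has index $1-n$ in the convention above.\<close>

fun E_op_inf :: "ops \<Rightarrow> ops \<Rightarrow> ops \<Rightarrow> ops \<Rightarrow> seqs \<Rightarrow> grass \<times> grass \<Rightarrow> sfun \<Rightarrow> sfun" where
  "E_op_inf L J G1 G2 (A1, A2, M1, M2) (a1, a2) f =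
     exp_op (\<lambda>h. \<Sum>\<^sub>\<infinity>n\<in>{1..}. fls_const (A1 n) * L (- int n) h - fls_const (A2 n) * J (- int n) h
                     + scal \<i> * fls_const (M1 n) * G1 (1 - int n) h
                     + scal \<i> * fls_const (M2 n) * G2 (1 - int n) h)
       (pow_op a1 (\<lambda>h. 2 * L 0 h) (pow_op a2 (\<lambda>h. - J 0 h) f))"

text \<open>
  The result does not depend on the representative of the coset; \<open>the_elem\<close> extracts the common
  value.
\<close>

definition E2_0 :: "param \<Rightarrow> fun2" where
  "E2_0 = (\<lambda>(C, s). the_elem ((\<lambda>a.
     let E = E_op_0 (N2_L At_0) (N2_J At_0) (N2_G1 At_0) (N2_G2 At_0) s a
     in map_prod E (map_prod E E) (id2 At_0)) ` C))"

definition E1_0 :: "param \<Rightarrow> fun1" where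
  "E1_0 = (\<lambda>(C, s). the_elem ((\<lambda>a.
     let E = E_op_0 (N1_L At_0) (N1_J At_0) (N1_G 1 At_0) (N1_G 2 At_0) s a
     in map_prod E E (id1 At_0)) ` C))"

definition E2_inf :: "param \<Rightarrow> fun2" where
  "E2_inf = (\<lambda>(C, s). the_elem ((\<lambda>a.
     let E = E_op_inf (N2_L At_inf) (N2_J At_inf) (N2_G1 At_inf) (N2_G2 At_inf) s a
     in map_prod E (map_prod E E) (I2 At_inf)) ` C))"

definition E1_inf :: "param \<Rightarrow> fun1" where
  "E1_inf = (\<lambda>(C, s). the_elem ((\<lambda>a.
     let E = E_op_inf (N1_L At_inf) (N1_J At_inf) (N1_G 1 At_inf) (N1_G 2 At_inf) s a
     in map_prod E E (I1 At_inf)) ` C))"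

text \<open>The group operation on the parameters induced by a bijection \<open>E\<close> onto a group; note the
  reversal of the factors.\<close>

definition pulled_back :: "param set \<Rightarrow> (param \<Rightarrow> 'f) \<Rightarrow> 'f monoid \<Rightarrow> param monoid" where
  "pulled_back P E H =
     \<lparr>carrier = P, mult = (\<lambda>g h. inv_into P E (E h \<otimes>\<^bsub>H\<^esub> E g)), one = inv_into P E \<one>\<^bsub>H\<^esub>\<rparr>"

definition param_group_0 :: "enat \<Rightarrow> param monoid" where
  "param_group_0 L = pulled_back (params L) E2_0 (SC_0 L)"

definition param_group_0' :: "enat \<Rightarrow> param monoid" where
  "param_group_0' L = pulled_back (params L) E1_0 (SA_0 L)"

definition param_group_inf :: "enat \<Rightarrow> param monoid" where
  "param_group_inf L = pulled_back (params L) E2_inf (SC_inf L)"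

definition param_group_inf' :: "enat \<Rightarrow> param monoid" where
  "param_group_inf' L = pulled_back (params L) E1_inf (SA_inf L)"

end

theory Submission
  imports Defs
begin

text \<open>
  In the chiral combinations $\varphi^\pm = \varphi^{(1)} \pm i \varphi^{(2)}$ and
  $D^\pm = D^{(1)} \pm i D^{(2)}$, the superconformal conditions say that
  $\tilde x + i \tilde\varphi^{(1)} \tilde\varphi^{(2)}$ and
  $\tilde\varphi^{(1)} - i \tilde\varphi^{(2)}$ are annihilated by $D^-$, that
  $D^+ \tilde\varphi^+ = 0$, and that $\tilde\varphi^+$ is determined by the other two.
  Functions annihilated by $D^-$ are the functions of
  $(x + i \varphi^{(1)} \varphi^{(2)}, \varphi^-)$, so a superconformal function amounts to an
  $N = 1$ function, compatibly with composition; this is the isomorphism at $0$.  It carries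
  the exponential of the $N = 2$ derivation with given parameters to that of the $N = 1$
  derivation with the same parameters, so only the $N = 1$ exponential map has to be shown
  bijective.  There one uses the filtration in which $x$ has weight $2$ and the odd variables
  have weight $1$: the derivations raise the weight, and a function is matched one weight at a
  time.  The statements at infinity follow by conjugation with $I$.
\<close>

section \<open>Grassmann algebra\<close>

text \<open>The weights come from G^(j)_{1/2}: its part x phi d/dx does not raise the order in x,
  whereas with x of weight 2 and phi of weight 1 the derivations of index n raise the weight by 2n
  (L and J) or 2n - 1 (G), always by at least 1. The missing component of a lift is the quotient in
  D^+ y = phi^+ D^+ phi^-, where D^+ phi^- has an invertible leading coefficient. The exponential of
  an N = 2 derivation V stays superconformal because [D^+, V] = mu D^+ for an even function mu. The
  obstacle on the N = 2 side is that the group is defined by vanishing at the origin and the mere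
  existence of an inverse: the leading coefficients must be shown invertible before substitution is
  known to converge. At infinity the Laurent variable is already 1/x, so I only rescales the odd
  variables. It carries L_{-n}, J_{-n}, G_{-n+1/2} to -L_n, J_n, i G_{n-1/2}, which explains the
  signs in the exponents there.\<close>

lemma grass_eqI: "(\<And>S. gcoeff a S = gcoeff b S) \<Longrightarrow> a = b"
  by (metis gcoeff_inject ext)

lemma gcoeff_finite: "gcoeff a S \<noteq> 0 \<Longrightarrow> finite S"
  using gcoeff[of a] by simp

lemma finite_gsupport: "finite {S. gcoeff a S \<noteq> 0}"
  using gcoeff[of a] by simp

lemma gcoeff_0 [simp]: "gcoeff 0 S = 0"
  by (simp add: zero_grass.rep_eq)

lemma gcoeff_1: "gcoeff 1 S = (if S = {} then 1 else 0)"
  by (simp add: one_grass.rep_eq)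

lemma gcoeff_add [simp]: "gcoeff (a + b) S = gcoeff a S + gcoeff b S"
  by (simp add: plus_grass.rep_eq)

lemma gcoeff_uminus [simp]: "gcoeff (- a) S = - gcoeff a S"
  by (simp add: uminus_grass.rep_eq)

lemma gcoeff_diff [simp]: "gcoeff (a - b) S = gcoeff a S - gcoeff b S"
  unfolding minus_grass_def by (simp only: gcoeff_add gcoeff_uminus) simp

lemma gcoeff_sum [simp]: "gcoeff (sum f A) S = (\<Sum>i\<in>A. gcoeff (f i) S)"
  by (induction A rule: infinite_finite_induct) auto

lemma gcoeff_gscal: "gcoeff (gscal z) S = (if S = {} then z else 0)"
  by (simp add: gscal.rep_eq)

lemma gcoeff_ggen: "gcoeff (ggen g) S = (if S = {g} then 1 else 0)"
  by (simp add: ggen.rep_eq)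

lemma gcoeff_mult: "gcoeff (a * b) U = (\<Sum>S\<in>Pow U. msign S (U - S) * gcoeff a S * gcoeff b (U - S))"
  by (simp add: times_grass.rep_eq)

lemma gcoeff_mult_nonzero:
  assumes "gcoeff (a * b) U \<noteq> 0"
  obtains S where "S \<subseteq> U" "gcoeff a S \<noteq> 0" "gcoeff b (U - S) \<noteq> 0"
proof -
  from assms obtain S where "S \<in> Pow U" "msign S (U - S) * gcoeff a S * gcoeff b (U - S) \<noteq> 0"
    unfolding gcoeff_mult by (rule sum.not_neutral_contains_not_neutral)
  then show ?thesis using that by auto
qed

lemma gcoeff_mult_body [simp]: "gcoeff (a * b) {} = gcoeff a {} * gcoeff b {}"
  by (simp add: gcoeff_mult)

lemma gcoeff_gscal_mult [simp]: "gcoeff (gscal z * a) S = z * gcoeff a S"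
proof (cases "finite S")
  case True
  have "gcoeff (gscal z * a) S = (\<Sum>T\<in>{{}}. msign T (S - T) * gcoeff (gscal z) T * gcoeff a (S - T))"
    unfolding gcoeff_mult by (rule sum.mono_neutral_right) (use True in \<open>auto simp: gcoeff_gscal\<close>)
  then show ?thesis by (simp add: gcoeff_gscal)
next
  case False
  then show ?thesis using gcoeff_finite mult_zero_right by metis
qed

lemma gscal_commute: "gscal z * a = a * gscal z"
proof (rule grass_eqI)
  fix S
  show "gcoeff (gscal z * a) S = gcoeff (a * gscal z) S"
  proof (cases "finite S")
    case True
    have "gcoeff (a * gscal z) S =
        (\<Sum>T\<in>{S}. msign T (S - T) * gcoeff a T * gcoeff (gscal z) (S - T))"
      unfolding gcoeff_mult by (rule sum.mono_neutral_right) (use True in \<open>auto simp: gcoeff_gscal\<close>)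
    then show ?thesis by (simp add: gcoeff_gscal)
  next
    case False
    then show ?thesis using gcoeff_finite by metis
  qed
qed

lemma gscal_0 [simp]: "gscal 0 = 0"
  and gscal_1 [simp]: "gscal 1 = 1"
  and gscal_add: "gscal (z + w) = gscal z + gscal w"
  and gscal_minus: "gscal (- z) = - gscal z"
  and gscal_mult: "gscal (z * w) = gscal z * gscal w"
  by (auto intro!: grass_eqI simp: gcoeff_gscal gcoeff_1)

lemma gscal_of_int: "gscal (of_int k) = of_int k"
proof -
  have n: "gscal (of_nat n) = of_nat n" for n
    by (induction n) (auto simp: gscal_add)
  show ?thesis by (cases k rule: int_cases2) (simp_all add: n gscal_minus)
qed

lemma gcoeff_of_int_mult [simp]: "gcoeff (of_int k * a) S = of_int k * gcoeff a S"
  using gcoeff_gscal_mult[of "of_int k" a S] by (simp add: gscal_of_int)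

lemma gcoeff_ggen_mult:
  "gcoeff (ggen g * a) U =
     (if g \<in> U then (-1) ^ card {t \<in> U. t < g} * gcoeff a (U - {g}) else 0)"
proof (cases "finite U \<and> g \<in> U")
  case True
  have "gcoeff (ggen g * a) U =
      (\<Sum>T\<in>{{g}}. msign T (U - T) * gcoeff (ggen g) T * gcoeff a (U - T))"
    unfolding gcoeff_mult
    by (rule sum.mono_neutral_right) (use True in \<open>auto simp: gcoeff_ggen\<close>)
  moreover have "{(s, t). s \<in> {g} \<and> t \<in> U - {g} \<and> t < s} = Pair g ` {t \<in> U. t < g}"
    by auto
  then have "msign {g} (U - {g}) = (-1) ^ card {t \<in> U. t < g}"
    by (simp add: msign_def card_image inj_on_def)
  ultimately show ?thesis using True by (simp add: gcoeff_ggen)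
next
  case False
  have "gcoeff (ggen g * a) U = 0"
  proof (rule ccontr)
    assume "gcoeff (ggen g * a) U \<noteq> 0"
    then obtain S where S: "S \<subseteq> U" "gcoeff (ggen g) S \<noteq> 0" "gcoeff a (U - S) \<noteq> 0"
      by (rule gcoeff_mult_nonzero)
    then have "S = {g}" "finite U" using gcoeff_finite[of a "U - S"] gcoeff_finite[of "ggen g" S]
      by (auto simp: gcoeff_ggen split: if_splits dest: finite_Diff2[THEN iffD1])
    then show False using S False by auto
  qed
  moreover have "gcoeff a (U - {g}) = 0" if "g \<in> U" "infinite U"
    using that gcoeff_finite[of a "U - {g}"] by auto
  ultimately show ?thesis using False by auto
qed

lemma gcoeff_gderiv:
  "gcoeff (gderiv g c) S = (if g \<in> S then 0 else (-1) ^ card {s \<in> S. s < g} * gcoeff c (insert g S))"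
  by (simp add: gderiv.rep_eq)

lemma ggen_square [simp]: "ggen g * ggen g = 0"
  by (rule grass_eqI) (auto simp: gcoeff_ggen_mult gcoeff_ggen)

text \<open>Stated for any family of anticommuting elements with square zero, since it serves twice:
  for the generators in \<open>gmon\<close>, and in \<open>gsubst_gen_mult\<close> for the odd
  values substituted for them. On its way to its place \<open>w g\<close> passes exactly the smaller
  factors, one sign for each.\<close>

lemma odd_times_sorted_prod:
  fixes w :: "'i::linorder \<Rightarrow> 'r::ring_1"
  assumes anti: "\<And>g h. w g * w h = - (w h * w g)" and sq: "\<And>g. w g * w g = 0" and fin: "finite S"
  shows "w g * prod_list (map w (sorted_list_of_set S)) =
    (if g \<in> S then 0 else (-1) ^ card {s \<in> S. s < g} *
        prod_list (map w (sorted_list_of_set (insert g S))))"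
  using fin
proof (induction S rule: finite_linorder_min_induct)
  case empty
  then show ?case by simp
next
  case (insert b S)
  let ?P = "\<lambda>S. prod_list (map w (sorted_list_of_set S))"
  have P: "?P (Set.insert c T) = w c * ?P T" if "finite T" "\<forall>a\<in>T. c < a" for c T
  proof -
    have "sorted_list_of_set (Set.insert c T) = insort c (sorted_list_of_set T)"
      using that by (subst sorted_list_of_set_insert) auto
    also have "\<dots> = c # sorted_list_of_set T"
      using that by (intro insort_is_Cons) auto
    finally show ?thesis by simp
  qed
  have fin: "finite S" and less: "\<forall>a\<in>S. b < a" using insert by auto
  consider "g < b" | "g = b" | "b < g" by fastforce
  then show ?case
  proof cases
    case 1
    then have a: "\<forall>a\<in>Set.insert b S. g < a" using less by auto
    then have e: "{s \<in> Set.insert b S. s < g} = {}" "g \<notin> Set.insert b S" by force+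
    show ?thesis unfolding e(1) using fin P[OF _ a] e(2) by (simp del: sorted_list_of_set_insert_remove)
  next
    case 2
    then show ?thesis using P[OF fin less] sq[of b] by (simp flip: mult.assoc)
  next
    case 3
    have "w g * ?P (Set.insert b S) = - (w b * (w g * ?P S))"
      using P[OF fin less] anti[of g b] by (simp flip: mult.assoc)
    also have "\<dots> = (if g \<in> S then 0 else (-1) ^ Suc (card {s \<in> S. s < g}) *
          (w b * ?P (Set.insert g S)))"
    proof -
      have "w b * ((-1) ^ k * y) = (-1) ^ k * (w b * y)" for k y
        by (cases "even k") auto
      then show ?thesis by (auto simp: insert.IH)
    qed
    also have "w b * ?P (Set.insert g S) = ?P (Set.insert g (Set.insert b S))"
      using P[of "Set.insert g S" b] fin less 3 by (simp add: insert_commute)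
    also have "Suc (card {s \<in> S. s < g}) = card {s \<in> Set.insert b S. s < g}"
    proof -
      have "{s \<in> Set.insert b S. s < g} = Set.insert b {s \<in> S. s < g}" using 3 by auto
      moreover have "b \<notin> S" using less by auto
      ultimately show ?thesis using fin by simp
    qed
    finally show ?thesis using 3 by (simp split: if_splits) auto
  qed
qed

lemma ggen_anticommute: "ggen g * ggen h = - (ggen h * ggen g)"
proof (rule grass_eqI)
  fix U
  show "gcoeff (ggen g * ggen h) U = gcoeff (- (ggen h * ggen g)) U"
  proof (cases "U = {g, h} \<and> g \<noteq> h")
    case True
    have "{t \<in> {g, h}. t < g} = (if h < g then {h} else {})"
      "{t \<in> {g, h}. t < h} = (if g < h then {g} else {})" "{g, h} - {g} = {h}" "{g, h} - {h} = {g}"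
      using True by auto
    then show ?thesis using True by (auto simp: gcoeff_ggen_mult gcoeff_ggen)
  next
    case False
    then have "\<not> (g \<in> U \<and> U - {g} = {h})" "\<not> (h \<in> U \<and> U - {h} = {g})"
      by auto
    then show ?thesis by (simp add: gcoeff_ggen_mult gcoeff_ggen)
  qed
qed

definition gmon :: "odd_gen set \<Rightarrow> grass" where
  "gmon S = prod_list (map ggen (sorted_list_of_set S))"

lemma ggen_times_gmon:
  "finite S \<Longrightarrow> ggen g * gmon S =
    (if g \<in> S then 0 else (-1) ^ card {s \<in> S. s < g} * gmon (insert g S))"
  unfolding gmon_def by (rule odd_times_sorted_prod[OF ggen_anticommute ggen_square])

lemma gmon_insert_min: "finite S \<Longrightarrow> \<forall>a\<in>S. b < a \<Longrightarrow> gmon (insert b S) = ggen b * gmon S"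
proof -
  assume *: "finite S" "\<forall>a\<in>S. b < a"
  then have e: "{s \<in> S. s < b} = {}" "b \<notin> S" by force+
  show ?thesis unfolding ggen_times_gmon[OF *(1)] e(1) using e(2) by simp
qed

lemma gmon_empty [simp]: "gmon {} = 1"
  by (simp add: gmon_def)

lemma gcoeff_gmon: "finite S \<Longrightarrow> gcoeff (gmon S) T = (if T = S then 1 else 0)"
proof (induction S arbitrary: T rule: finite_linorder_min_induct)
  case (insert b S)
  have b: "b \<notin> S" using insert.hyps by blast
  have c: "card {t \<in> T. t < b} = 0" if "T = Set.insert b S"
  proof -
    have e: "{t \<in> T. t < b} = {}" unfolding that using insert.hyps(2) by force
    show ?thesis unfolding e by simp
  qed
  show ?case
  proof (cases "T = Set.insert b S")
    case True
    then have "b \<in> T" "T - {b} = S" using b by auto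
    then show ?thesis using True c
      unfolding gmon_insert_min[OF insert.hyps] gcoeff_ggen_mult insert.IH by simp
  next
    case False
    then have "b \<in> T \<Longrightarrow> T - {b} \<noteq> S" by auto
    then show ?thesis using False
      unfolding gmon_insert_min[OF insert.hyps] gcoeff_ggen_mult insert.IH by simp
  qed
qed (simp add: gcoeff_1)

lemma grass_expand: "c = (\<Sum>S | gcoeff c S \<noteq> 0. gscal (gcoeff c S) * gmon S)"
proof (rule grass_eqI)
  fix T
  have "gcoeff (\<Sum>S | gcoeff c S \<noteq> 0. gscal (gcoeff c S) * gmon S) T =
      (\<Sum>S | gcoeff c S \<noteq> 0. gcoeff c S * (if T = S then 1 else 0))"
    by (auto intro!: sum.cong simp: gcoeff_gmon gcoeff_finite)
  also have "\<dots> = (\<Sum>S | gcoeff c S \<noteq> 0. if T = S then gcoeff c S else 0)"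
    by (rule sum.cong) auto
  also have "\<dots> = gcoeff c T" by (simp add: finite_gsupport)
  finally show "gcoeff c T = gcoeff (\<Sum>S | gcoeff c S \<noteq> 0. gscal (gcoeff c S) * gmon S) T" ..
qed

text \<open>Monomials arise by left multiplication with generators, and every element is a finite
  sum of monomials by \<open>grass_expand\<close>. Identities additive in an element thus reduce to
  scalars and one generator at a time.\<close>

lemma grass_induct [case_names add scal gen]:
  assumes add: "\<And>a b. P a \<Longrightarrow> P b \<Longrightarrow> P (a + b)" and scal: "\<And>z. P (gscal z)"
    and gen: "\<And>g a. P a \<Longrightarrow> P (ggen g * a)"
  shows "P c"
proof -
  have mon: "P (gscal z * gmon S)" if "finite S" for z S
    using that
  proof (induction S rule: finite_linorder_min_induct)
    case empty
    then show ?case using scal by simp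
  next
    case (insert b S)
    have "gscal z * gmon (Set.insert b S) = ggen b * (gscal z * gmon S)"
      using insert by (simp add: gmon_insert_min flip: mult.assoc) (simp add: gscal_commute)
    then show ?case using gen insert by simp
  qed
  have "P (\<Sum>S\<in>X. gscal (gcoeff c S) * gmon S)" if "finite X" "X \<subseteq> {S. gcoeff c S \<noteq> 0}" for X
    using that
  proof (induction X rule: finite_induct)
    case empty
    show ?case using scal[of 0] by simp
  next
    case (insert S X)
    then have "P (gscal (gcoeff c S) * gmon S)" by (intro mon gcoeff_finite[of c]) auto
    then show ?case using insert add by simp
  qed
  from this[OF finite_gsupport order.refl] show ?thesis
    using grass_expand[of c] by simp
qed

subsection \<open>Parity\<close>

text \<open>The grading automorphism. It turns parity into the equations \<open>gbar a = a\<close>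
  and \<open>gbar a = - a\<close>, and it records the sign that an odd derivation or an odd factor
  produces when it passes an element.\<close>

lift_definition gbar :: "grass \<Rightarrow> grass" is "\<lambda>c S. (-1) ^ card S * c S"
  by simp

lemma gcoeff_gbar [simp]: "gcoeff (gbar a) S = (-1) ^ card S * gcoeff a S"
  by (simp add: gbar.rep_eq)

lemma gbar_add [simp]: "gbar (a + b) = gbar a + gbar b"
  and gbar_uminus [simp]: "gbar (- a) = - gbar a"
  and gbar_diff [simp]: "gbar (a - b) = gbar a - gbar b"
  and gbar_0 [simp]: "gbar 0 = 0"
  and gbar_1 [simp]: "gbar 1 = 1"
  and gbar_gscal [simp]: "gbar (gscal z) = gscal z"
  and gbar_gbar [simp]: "gbar (gbar a) = a"
  and gbar_ggen [simp]: "gbar (ggen g) = - ggen g"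
  by (auto intro!: grass_eqI simp: algebra_simps gcoeff_gscal gcoeff_1 gcoeff_ggen
        simp flip: power_add mult.assoc)

lemma gbar_mult [simp]: "gbar (a * b) = gbar a * gbar b"
proof (rule grass_eqI)
  fix U
  show "gcoeff (gbar (a * b)) U = gcoeff (gbar a * gbar b) U"
  proof (cases "finite U")
    case True
    have "(-1) ^ card U = (-1) ^ card S * ((-1) ^ card (U - S) :: complex)" if "S \<subseteq> U" for S
      using that True by (metis card_mono card_Diff_subset finite_subset le_add_diff_inverse power_add)
    then show ?thesis using True
      by (auto simp: gcoeff_mult sum_distrib_left intro!: sum.cong)
  next
    case False
    then show ?thesis using gcoeff_finite by metis
  qed
qed

lemma grass_even_iff: "a \<in> grass_even \<longleftrightarrow> gbar a = a"
proof -
  have "((-1) ^ card S * gcoeff a S = gcoeff a S) = (gcoeff a S \<noteq> 0 \<longrightarrow> even (card S))" for S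
    by (cases "even (card S)") auto
  moreover have "gbar a = a \<longleftrightarrow> (\<forall>S. gcoeff (gbar a) S = gcoeff a S)"
    using grass_eqI by metis
  ultimately show ?thesis by (simp add: grass_even_def)
qed

lemma grass_odd_iff: "a \<in> grass_odd \<longleftrightarrow> gbar a = - a"
proof -
  have "((-1) ^ card S * gcoeff a S = - gcoeff a S) = (gcoeff a S \<noteq> 0 \<longrightarrow> odd (card S))" for S
    by (cases "even (card S)") auto
  moreover have "gbar a = - a \<longleftrightarrow> (\<forall>S. gcoeff (gbar a) S = gcoeff (- a) S)"
    using grass_eqI by metis
  ultimately show ?thesis by (simp add: grass_odd_def)
qed

lemma ggen_commute: "c * ggen g = ggen g * gbar c"
proof (induction c rule: grass_induct)
  case (add a b)
  then show ?case by (simp add: algebra_simps)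
next
  case (scal z)
  then show ?case by (simp add: gscal_commute)
next
  case (gen h a)
  have "ggen h * a * ggen g = ggen h * (ggen g * gbar a)" using gen by (simp add: mult.assoc)
  also have "\<dots> = - (ggen g * ggen h * gbar a)"
    using ggen_anticommute[of h g] by (simp flip: mult.assoc)
  finally show ?case by (simp add: mult.assoc)
qed

text \<open>Here \<open>a + gbar a\<close> and \<open>a - gbar a\<close> are twice the even and
  twice the odd part of \<open>a\<close>. Multiplying \<open>a\<close> by a generator exchanges the
  two, so both claims are proved together; \<open>c\<close> stays arbitrary because moving a
  generator past it replaces it by \<open>gbar c\<close>.\<close>

lemma parity_commute:
  "(a + gbar a) * c = c * (a + gbar a) \<and> (a - gbar a) * c = gbar c * (a - gbar a)"
proof (induction a arbitrary: c rule: grass_induct)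
  case (add a b)
  show ?case using add(1)[of c] add(2)[of c] by (auto simp: algebra_simps) (metis add.assoc add.commute)+
next
  case (scal z)
  then show ?case by (simp add: gscal_commute distrib_left distrib_right)
next
  case (gen g a)
  have 1: "ggen g * a + gbar (ggen g * a) = ggen g * (a - gbar a)"
    "ggen g * a - gbar (ggen g * a) = ggen g * (a + gbar a)" by (simp_all add: algebra_simps)
  have 2: "ggen g * (a - gbar a) * c = c * (ggen g * (a - gbar a))"
    using gen[of c] ggen_commute[of c g] by (metis mult.assoc)
  have "ggen g * (a + gbar a) * c = gbar c * (ggen g * (a + gbar a))"
    using gen[of c] ggen_commute[of "gbar c" g] by (metis mult.assoc gbar_gbar)
  then show ?case unfolding 1 using 2 by simp
qed

lemma grass_halve: "a + a = b + b \<Longrightarrow> a = (b::grass)"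
proof (rule grass_eqI)
  fix S assume "a + a = b + b"
  then have "gcoeff (a + a) S = gcoeff (b + b) S" by simp
  then show "gcoeff a S = gcoeff b S" by simp
qed

lemma grass_even_commute: "a \<in> grass_even \<Longrightarrow> a * c = c * a"
  by (rule grass_halve)
    (use parity_commute[of a c] in \<open>simp add: grass_even_iff distrib_left distrib_right\<close>)

lemma grass_odd_commute: "a \<in> grass_odd \<Longrightarrow> a * c = gbar c * a"
  by (rule grass_halve)
    (use parity_commute[of a c] in \<open>simp add: grass_odd_iff distrib_left distrib_right\<close>)

section \<open>Left derivatives with respect to generators\<close>

lemma gderiv_add [simp]: "gderiv g (a + b) = gderiv g a + gderiv g b"
  by (auto intro!: grass_eqI simp: gcoeff_gderiv algebra_simps)

lemma gderiv_0 [simp]: "gderiv g 0 = 0"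
  by (auto intro!: grass_eqI simp: gcoeff_gderiv)

lemma gderiv_gscal [simp]: "gderiv g (gscal z) = 0"
  by (auto intro!: grass_eqI simp: gcoeff_gderiv gcoeff_gscal)

lemma gderiv_ggen_mult: "gderiv g (ggen h * a) = (if g = h then a else 0) - ggen h * gderiv g a"
proof (rule grass_eqI)
  fix S
  show "gcoeff (gderiv g (ggen h * a)) S =
      gcoeff ((if g = h then a else 0) - ggen h * gderiv g a) S"
  proof (cases "finite S")
    case False
    then show ?thesis using gcoeff_finite by metis
  next
    case fin: True
    show ?thesis
    proof (cases "g = h")
      case True
      have e: "{t \<in> insert h S. t < h} = {t \<in> S. t < h}" "{t \<in> S - {h}. t < h} = {t \<in> S. t < h}"
        by auto
      have sq: "(-1) ^ k * ((-1) ^ k * z) = (z::complex)" for k z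
        by (simp flip: power_add mult.assoc)
      show ?thesis
      proof (cases "h \<in> S")
        case True
        then have i: "insert h (S - {h}) = S" by auto
        show ?thesis unfolding \<open>g = h\<close>
          unfolding gcoeff_diff gcoeff_gderiv gcoeff_ggen_mult e i using True by (simp add: sq)
      next
        case False
        then show ?thesis unfolding \<open>g = h\<close>
          unfolding gcoeff_diff gcoeff_gderiv gcoeff_ggen_mult e by (simp add: sq)
      qed
    next
      case neq: False
      show ?thesis
      proof (cases "g \<notin> S \<and> h \<in> S")
        case True
        have i: "insert g S - {h} = insert g (S - {h})" using neq by auto
        have A: "{t \<in> insert g S. t < h} = (if g < h then insert g {t \<in> S. t < h} else {t \<in> S. t < h})"
          by auto
        have B: "{s \<in> S. s < g} = (if h < g then insert h {s \<in> S - {h}. s < g} else {s \<in> S - {h}. s < g})"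
          using True by auto
        \<comment> \<open>Whichever of \<open>g\<close> and \<open>h\<close> is smaller adds one to
          exactly one of the two sign exponents; this is the minus sign of the claim.\<close>
        have cA: "card {t \<in> insert g S. t < h} = card {t \<in> S. t < h} + (if g < h then 1 else 0)"
          unfolding A using fin True by (auto simp: card_insert_if)
        have cB: "card {s \<in> S. s < g} = card {s \<in> S - {h}. s < g} + (if h < g then 1 else 0)"
          unfolding B using fin True by (auto simp: card_insert_if)
        have "g < h \<longleftrightarrow> \<not> h < g" using neq by auto
        then show ?thesis using True neq i cA cB
          by (auto simp: gcoeff_gderiv gcoeff_ggen_mult)
      next
        case False
        then show ?thesis using neq by (auto simp: gcoeff_gderiv gcoeff_ggen_mult)
      qed
    qed
  qed
qed

lemma gderiv_gbar: "gderiv g (gbar a) = - gbar (gderiv g a)"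
proof (rule grass_eqI)
  fix S show "gcoeff (gderiv g (gbar a)) S = gcoeff (- gbar (gderiv g a)) S"
    using gcoeff_finite[of a "insert g S"]
    by (cases "finite S") (auto simp: gcoeff_gderiv algebra_simps)
qed

lemma gderiv_mult: "gderiv g (a * b) = gderiv g a * b + gbar a * gderiv g b"
proof (induction a rule: grass_induct)
  case (add a b)
  then show ?case by (simp add: algebra_simps)
next
  case (scal z)
  have "gderiv g (gscal z * b) = gscal z * gderiv g b"
    by (rule grass_eqI) (auto simp: gcoeff_gderiv)
  then show ?case by simp
next
  case (gen h a)
  then show ?case by (simp add: gderiv_ggen_mult mult.assoc algebra_simps)
qed

lemma gderiv_gderiv [simp]: "gderiv g (gderiv g a) = 0"
  by (rule grass_eqI) (simp add: gcoeff_gderiv)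

lemma gderiv_ggen: "gderiv g (ggen h) = (if g = h then 1 else 0)"
  by (rule grass_eqI) (auto simp: gcoeff_gderiv gcoeff_ggen gcoeff_1)

section \<open>Laurent series over the Grassmann algebra\<close>

text \<open>A lower bound on the order rather than the subdegree: it makes no exception for the zero
  series and passes directly through sums, products and additive maps.\<close>

definition ord_ge :: "int \<Rightarrow> 'a::zero fls \<Rightarrow> bool" where
  "ord_ge n f \<longleftrightarrow> (\<forall>k<n. f $$ k = 0)"

lemma ord_ge_exists: "\<exists>n. ord_ge n f"
  unfolding ord_ge_def by (rule fls_nth_vanishes_belowE[of f]) blast

lemma ord_ge_mono: "ord_ge n f \<Longrightarrow> m \<le> n \<Longrightarrow> ord_ge m f"
  by (auto simp: ord_ge_def)

lemma ord_ge_0 [simp]: "ord_ge n 0"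
  by (simp add: ord_ge_def)

lemma ord_ge_add: "ord_ge n f \<Longrightarrow> ord_ge n g \<Longrightarrow> ord_ge n (f + g)" for f :: "'a::monoid_add fls"
  by (simp add: ord_ge_def)

lemma ord_ge_uminus: "ord_ge n f \<Longrightarrow> ord_ge n (- f)" for f :: "'a::group_add fls"
  by (simp add: ord_ge_def)

lemma ord_ge_diff: "ord_ge n f \<Longrightarrow> ord_ge n g \<Longrightarrow> ord_ge n (f - g)" for f :: "'a::group_add fls"
  by (simp add: ord_ge_def)

lemma ord_ge_all_zero: "(\<And>n. ord_ge n f) \<Longrightarrow> f = 0"
  by (rule fls_eqI) (metis fls_zero_nth lt_ex ord_ge_def less_add_one)

text \<open>Any lower bounds may replace the subdegrees, because the additional terms vanish. The
  same index range then serves for \<open>f\<close> and for its image under a coefficientwise map,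
  whose subdegree may be different.\<close>

lemma fls_times_nth_bounds:
  fixes f g :: "'a::semiring_0 fls"
  assumes "ord_ge a f" "ord_ge b g"
  shows "(f * g) $$ n = (\<Sum>i=a..n-b. f $$ i * g $$ (n - i))"
proof -
  let ?df = "fls_subdegree f" and ?dg = "fls_subdegree g"
  let ?I = "{min a ?df..max (n - b) (n - ?dg)}"
  have "(\<Sum>i=?df..n - ?dg. f $$ i * g $$ (n - i)) = (\<Sum>i\<in>?I. f $$ i * g $$ (n - i))"
  proof (rule sum.mono_neutral_left)
    show "\<forall>i\<in>?I - {?df..n - ?dg}. f $$ i * g $$ (n - i) = 0"
    proof
      fix i assume "i \<in> ?I - {?df..n - ?dg}"
      then have "i < ?df \<or> n - i < ?dg" by auto
      then show "f $$ i * g $$ (n - i) = 0"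
        using fls_eq0_below_subdegree[of i f] fls_eq0_below_subdegree[of "n - i" g] by auto
    qed
  qed auto
  also have "\<dots> = (\<Sum>i=a..n-b. f $$ i * g $$ (n - i))"
  proof (rule sum.mono_neutral_right)
    show "\<forall>i\<in>?I - {a..n - b}. f $$ i * g $$ (n - i) = 0"
      using assms by (fastforce simp: ord_ge_def)
  qed auto
  finally show ?thesis by (simp add: fls_times_nth(2))
qed

lemma ord_ge_mult: "ord_ge a f \<Longrightarrow> ord_ge b g \<Longrightarrow> ord_ge (a + b) (f * g)"
  for f :: "'a::semiring_0 fls"
  unfolding ord_ge_def[of "a + b"] using fls_times_nth_bounds[of a f b g] by simp

lemma nth_Abs_fls_map:
  assumes "h 0 = 0"
  shows "Abs_fls (\<lambda>n. h (f $$ n)) $$ n = h (f $$ n)"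
proof -
  obtain N where "ord_ge N f" using ord_ge_exists by blast
  then show ?thesis using assms by (intro nth_Abs_fls_lower_bound[of N]) (simp add: ord_ge_def)
qed

subsection \<open>Convergent sums\<close>

text \<open>Distances are 0 or powers of 2, so strictness of the inequality amounts to one more
  vanishing coefficient, hence \<open>int N + 1\<close>.\<close>

lemma dist_fls_less_iff: "dist a b < inverse (2 ^ N) \<longleftrightarrow> ord_ge (int N + 1) (a - b)"
  for a b :: "'a::group_add fls"
proof (cases "a = b")
  case True
  then show ?thesis by (simp add: dist_fls_def)
next
  case False
  then have nz: "a - b \<noteq> 0" by simp
  have o: "ord_ge m (a - b) \<longleftrightarrow> m \<le> fls_subdegree (a - b)" for m
  proof
    assume "ord_ge m (a - b)"
    then show "m \<le> fls_subdegree (a - b)"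
      using nth_fls_subdegree_nonzero[OF nz] unfolding ord_ge_def by (metis not_le)
  next
    assume "m \<le> fls_subdegree (a - b)"
    then show "ord_ge m (a - b)" unfolding ord_ge_def by (intro allI impI fls_eq0_below_subdegree) simp
  qed
  show ?thesis
  proof (cases "fls_subdegree (a - b) \<ge> 0")
    case True
    have "(inverse (2 ^ nat (fls_subdegree (a - b))) < inverse (2 ^ N :: real)) \<longleftrightarrow>
        N < nat (fls_subdegree (a - b))"
      by simp
    then show ?thesis using True False by (auto simp: dist_fls_def o)
  next
    case neg: False
    have "inverse (2 ^ N :: real) \<le> 1" by (simp add: inverse_le_1_iff)
    moreover have "(1::real) \<le> 2 ^ nat (- fls_subdegree (a - b))" by simp
    ultimately have "\<not> 2 ^ nat (- fls_subdegree (a - b)) < inverse (2 ^ N :: real)" by linarith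
    then show ?thesis using neg False by (auto simp: dist_fls_def o)
  qed
qed

lemma small_inverse_power: "0 < e \<Longrightarrow> \<exists>N. inverse (2 ^ N) < (e::real)"
  using real_arch_pow_inv[of e "1/2"] by (auto simp: power_one_over inverse_eq_divide)

lemma dist_fls_add_le: "dist (a + c) (b + d) \<le> dist a b + dist c d"
  for a b c d :: "'a::ab_group_add fls"
proof -
  have "dist (a + c) (b + c) = dist a b" "dist (b + c) (b + d) = dist c d"
    by (simp_all add: dist_fls_def)
  then show ?thesis using dist_triangle[of "a + c" "b + d" "b + c"] by simp
qed

text \<open>The metric is translation invariant, so addition is continuous. This class is what
  \<open>has_sum_add\<close> asks for.\<close>

instance fls :: (ab_group_add) topological_comm_monoid_add
proof
  fix a b :: "'a fls"
  have "((\<lambda>x. dist (fst x + snd x) (a + b)) \<longlongrightarrow> 0) (nhds a \<times>\<^sub>F nhds b)"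
  proof (rule tendsto_0_le[where K = 1])
    show "\<forall>\<^sub>F x in nhds a \<times>\<^sub>F nhds b. norm (dist (fst x + snd x) (a + b)) \<le> norm (dist (fst x) a + dist (snd x) b) * 1"
      by (intro always_eventually allI) (simp add: dist_fls_add_le)
    have 1: "((\<lambda>x. dist (fst x) a) \<longlongrightarrow> dist a a) (nhds a \<times>\<^sub>F nhds b)"
      by (intro tendsto_dist filterlim_fst tendsto_const)
    have 2: "((\<lambda>x. dist (snd x) b) \<longlongrightarrow> dist b b) (nhds a \<times>\<^sub>F nhds b)"
      by (intro tendsto_dist filterlim_snd tendsto_const)
    show "((\<lambda>x. dist (fst x) a + dist (snd x) b) \<longlongrightarrow> 0) (nhds a \<times>\<^sub>F nhds b)"
      using tendsto_add[OF 1 2] by simp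
  qed
  then show "((\<lambda>x. fst x + snd x) \<longlongrightarrow> a + b) (nhds a \<times>\<^sub>F nhds b)"
    by (rule tendsto_dist_iff[THEN iffD2])
qed

text \<open>\<open>has_sum_Sigma\<close> asks for uniform continuity of addition; half the error in
  each argument is enough.\<close>

lemma uniformly_continuous_fls_add:
  "uniformly_continuous_on UNIV (\<lambda>(x::'a::ab_group_add fls, y). x + y)"
  unfolding uniformly_continuous_on_def
proof (intro allI impI)
  fix e :: real assume "e > 0"
  have *: "dist (fst x' + snd x') (fst x + snd x) < e" if "dist x' x < e / 2" for x x' :: "'a fls \<times> 'a fls"
    using dist_fls_add_le[of "fst x'" "snd x'" "fst x" "snd x"]
      dist_fst_le[of x' x] dist_snd_le[of x' x] that by linarith
  have "0 < e / 2" using \<open>e > 0\<close> by simp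
  then show "\<exists>d>0. \<forall>x\<in>UNIV. \<forall>x'\<in>UNIV. dist x' x < d \<longrightarrow>
      dist ((case x' of (x, y) \<Rightarrow> x + y) :: 'a fls) (case x of (x, y) \<Rightarrow> x + y) < e"
    unfolding case_prod_beta
    using * by blast
qed

lemma fls_sum_nth: "sum F X $$ n = (\<Sum>i\<in>X. F i $$ n)" for F :: "'i \<Rightarrow> 'a::comm_monoid_add fls"
  by (induction X rule: infinite_finite_induct) auto

lemma has_sum_fls_iff:
  fixes F :: "'i \<Rightarrow> 'a::ab_group_add fls"
  shows "(F has_sum s) A \<longleftrightarrow>
    (\<forall>N. \<exists>X0. finite X0 \<and> X0 \<subseteq> A \<and> (\<forall>X. finite X \<and> X0 \<subseteq> X \<and> X \<subseteq> A \<longrightarrow> ord_ge N (sum F X - s)))"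
    (is "_ \<longleftrightarrow> ?R")
proof -
  have "(F has_sum s) A \<longleftrightarrow> (\<forall>e>0. \<exists>X0. finite X0 \<and> X0 \<subseteq> A \<and>
      (\<forall>X. finite X \<and> X0 \<subseteq> X \<and> X \<subseteq> A \<longrightarrow> dist (sum F X) s < e))"
    unfolding has_sum_def tendsto_iff eventually_finite_subsets_at_top ..
  also have "\<dots> \<longleftrightarrow> ?R"
  proof safe
    fix N :: int
    assume *: "\<forall>e>0. \<exists>X0. finite X0 \<and> X0 \<subseteq> A \<and>
      (\<forall>X. finite X \<and> X0 \<subseteq> X \<and> X \<subseteq> A \<longrightarrow> dist (sum F X) s < e)"
    have "inverse (2 ^ nat N) > (0::real)" by simp
    from *[rule_format, OF this] obtain X0 where X0: "finite X0" "X0 \<subseteq> A"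
      "\<And>X. finite X \<and> X0 \<subseteq> X \<and> X \<subseteq> A \<Longrightarrow> ord_ge (int (nat N) + 1) (sum F X - s)"
      unfolding dist_fls_less_iff by metis
    have "ord_ge N (sum F X - s)" if "finite X \<and> X0 \<subseteq> X \<and> X \<subseteq> A" for X
      using X0(3)[OF that] by (rule ord_ge_mono) simp
    then show "\<exists>X0. finite X0 \<and> X0 \<subseteq> A \<and> (\<forall>X. finite X \<and> X0 \<subseteq> X \<and> X \<subseteq> A \<longrightarrow> ord_ge N (sum F X - s))"
      using X0(1,2) by (intro exI[of _ X0]) simp
  next
    fix e :: real assume "0 < e" and *: ?R
    then obtain N where N: "inverse (2 ^ N) < e" using small_inverse_power by blast
    from *[rule_format, of "int N + 1"] obtain X0 where X0: "finite X0" "X0 \<subseteq> A"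
      "\<And>X. finite X \<and> X0 \<subseteq> X \<and> X \<subseteq> A \<Longrightarrow> dist (sum F X) s < inverse (2 ^ N)"
      unfolding dist_fls_less_iff by metis
    have "dist (sum F X) s < e" if "finite X \<and> X0 \<subseteq> X \<and> X \<subseteq> A" for X
      using X0(3)[OF that] N by linarith
    then show "\<exists>X0. finite X0 \<and> X0 \<subseteq> A \<and>
        (\<forall>X. finite X \<and> X0 \<subseteq> X \<and> X \<subseteq> A \<longrightarrow> dist (sum F X) s < e)"
      using X0(1,2) by (intro exI[of _ X0]) simp
  qed
  finally show ?thesis .
qed

text \<open>Large partial sums agree with the limit below order \<open>N\<close>; comparing one of
  them with and without the index \<open>i\<close> shows that the term at \<open>i\<close> itself
  has order at least \<open>N\<close>.\<close>

lemma has_sum_fls_nth: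
  fixes F :: "'i \<Rightarrow> 'a::ab_group_add fls"
  assumes "(F has_sum s) A"
  shows "\<exists>X. finite X \<and> X \<subseteq> A \<and> (\<forall>i\<in>A - X. ord_ge N (F i)) \<and> (\<forall>n<N. s $$ n = (\<Sum>i\<in>X. F i $$ n))"
proof -
  from assms obtain X0 where X0: "finite X0" "X0 \<subseteq> A"
    "\<And>X. finite X \<and> X0 \<subseteq> X \<and> X \<subseteq> A \<Longrightarrow> ord_ge N (sum F X - s)"
    unfolding has_sum_fls_iff by metis
  have "ord_ge N (F i)" if "i \<in> A - X0" for i
  proof -
    have "ord_ge N ((sum F (insert i X0) - s) - (sum F X0 - s))"
      by (intro ord_ge_diff X0(3)) (use X0(1,2) that in auto)
    then show ?thesis using that X0(1) by simp
  qed
  moreover have "s $$ n = (\<Sum>i\<in>X0. F i $$ n)" if "n < N" for n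
  proof -
    have n: "sum F X0 $$ n = (\<Sum>i\<in>X0. F i $$ n)"
      by (rule fls_sum_nth)
    have "(sum F X0 - s) $$ n = 0" using X0(3)[of X0] X0(1,2) that by (simp add: ord_ge_def)
    then show ?thesis using n by simp
  qed
  ultimately show ?thesis using X0(1,2) by (intro exI[of _ X0]) simp
qed

definition locally_finite :: "('i \<Rightarrow> 'a::zero fls) \<Rightarrow> 'i set \<Rightarrow> bool" where
  "locally_finite F A \<longleftrightarrow> (\<forall>N. finite {i \<in> A. \<not> ord_ge N (F i)})"

lemma locally_finite_summable:
  fixes F :: "'i \<Rightarrow> 'a::ab_group_add fls"
  assumes lf: "locally_finite F A"
  shows "F summable_on A"
proof -
  define X where "X N = {i \<in> A. \<not> ord_ge N (F i)}" for N
  have X: "finite (X N)" "X N \<subseteq> A" for N using lf by (auto simp: X_def locally_finite_def)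
  define c where "c n = (\<Sum>i\<in>X (n + 1). F i $$ n)" for n
  have stable: "(\<Sum>i\<in>Y. F i $$ n) = c n" if "finite Y" "X (n + 1) \<subseteq> Y" "Y \<subseteq> A" for Y n
    unfolding c_def by (rule sum.mono_neutral_right) (use that in \<open>auto simp: X_def ord_ge_def\<close>)
  \<comment> \<open>Terms outside \<open>X 0\<close> have order at least 0 and \<open>X 0\<close> is
    finite, so one bound serves all terms; hence \<open>c\<close> really defines a Laurent
    series.\<close>
  obtain N0 where N0: "\<And>i. i \<in> X 0 \<Longrightarrow> ord_ge N0 (F i)" "N0 \<le> 0"
  proof -
    have "\<forall>i. \<exists>b. ord_ge b (F i)" using ord_ge_exists by blast
    then obtain b where b: "\<And>i. ord_ge (b i) (F i)" by metis
    have "ord_ge (Min (insert 0 (b ` X 0))) (F i)" if "i \<in> X 0" for i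
      by (rule ord_ge_mono[OF b]) (use X that in auto)
    moreover have "Min (insert 0 (b ` X 0)) \<le> 0" using X by simp
    ultimately show ?thesis using that by blast
  qed
  have X0: "X m \<subseteq> X 0" if "m \<le> 0" for m
    using that ord_ge_mono unfolding X_def by blast
  have "c n = 0" if "n < N0" for n
    unfolding c_def by (rule sum.neutral) (use that N0 X0[of "n+1"] in \<open>auto simp: ord_ge_def\<close>)
  then have c: "Abs_fls c $$ n = c n" for n
    by (intro nth_Abs_fls_lower_bound) blast
  have "(F has_sum Abs_fls c) A"
    unfolding has_sum_fls_iff
  proof
    fix N
    have "ord_ge N (sum F Y - Abs_fls c)" if "finite Y" "X N \<subseteq> Y" "Y \<subseteq> A" for Y
      unfolding ord_ge_def
    proof (intro allI impI)
      fix k assume "k < N"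
      then have "X (k + 1) \<subseteq> X N" using ord_ge_mono unfolding X_def by (smt (verit) Collect_mono_iff)
      then have "(\<Sum>i\<in>Y. F i $$ k) = c k" using that by (intro stable) auto
      then show "(sum F Y - Abs_fls c) $$ k = 0" using fls_sum_nth[of F Y k] by (simp add: c)
    qed
    then show "\<exists>X0. finite X0 \<and> X0 \<subseteq> A \<and>
        (\<forall>X. finite X \<and> X0 \<subseteq> X \<and> X \<subseteq> A \<longrightarrow> ord_ge N (sum F X - Abs_fls c))"
      using X[of N] by blast
  qed
  then show ?thesis by (auto simp: summable_on_def)
qed

text \<open>Half the index, because weight counts x twice: when the weight grows by 1 with each
  \<open>k\<close>, the order is only sure to grow with every second \<open>k\<close>.\<close>

lemma locally_finiteI_nat:
  assumes "\<And>k. ord_ge (b + int (k div 2)) (F k)"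
  shows "locally_finite F A"
  unfolding locally_finite_def
proof
  fix N
  have "{i \<in> A. \<not> ord_ge N (F i)} \<subseteq> {..2 * nat (N - b)}"
  proof
    fix i assume i: "i \<in> {i \<in> A. \<not> ord_ge N (F i)}"
    then have "\<not> N \<le> b + int (i div 2)" using assms[of i] ord_ge_mono by blast
    then show "i \<in> {..2 * nat (N - b)}" by (cases "N \<le> b") auto
  qed
  then show "finite {i \<in> A. \<not> ord_ge N (F i)}" by (rule finite_subset) simp
qed

text \<open>Lowering the order by at most a constant is a uniform form of continuity, stable under
  sums and composition and easy to check. Such maps commute with convergent sums
  (\<open>bounded_additive_has_sum\<close>).\<close>

definition bounded_additive :: "('a::ab_group_add fls \<Rightarrow> 'b::ab_group_add fls) \<Rightarrow> bool" where
  "bounded_additive T \<longleftrightarrow>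
     (\<forall>f g. T (f + g) = T f + T g) \<and> (\<exists>d. \<forall>n f. ord_ge n f \<longrightarrow> ord_ge (n - d) (T f))"

lemma bounded_additiveI:
  "(\<And>f g. T (f + g) = T f + T g) \<Longrightarrow> (\<And>n f. ord_ge n f \<Longrightarrow> ord_ge (n - d) (T f)) \<Longrightarrow> bounded_additive T"
  unfolding bounded_additive_def by (intro conjI exI[of _ d]) simp_all

lemma bounded_additive_add: "bounded_additive T \<Longrightarrow> T (f + g) = T f + T g"
  by (simp add: bounded_additive_def)

lemma bounded_additive_0: "bounded_additive T \<Longrightarrow> T 0 = 0"
  using bounded_additive_add[of T 0 0] by simp

lemma bounded_additive_minus: "bounded_additive T \<Longrightarrow> T (- f) = - T f"
  using bounded_additive_add[of T f "- f"] bounded_additive_0[of T]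
  by (simp add: minus_unique)

lemma bounded_additive_diff: "bounded_additive T \<Longrightarrow> T (f - g) = T f - T g"
  using bounded_additive_add[of T f "- g"] by (simp add: bounded_additive_minus)

lemma bounded_additive_sum: "bounded_additive T \<Longrightarrow> T (sum f A) = (\<Sum>i\<in>A. T (f i))"
  by (induction A rule: infinite_finite_induct) (auto simp: bounded_additive_0 bounded_additive_add)

lemma bounded_additive_comp:
  assumes "bounded_additive S" "bounded_additive T" shows "bounded_additive (\<lambda>f. S (T f))"
proof -
  obtain d where d: "\<And>n f. ord_ge n f \<Longrightarrow> ord_ge (n - d) (S f)"
    using assms(1) unfolding bounded_additive_def by blast
  obtain e where e: "\<And>n f. ord_ge n f \<Longrightarrow> ord_ge (n - e) (T f)"
    using assms(2) unfolding bounded_additive_def by blast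
  have "ord_ge (n - (e + d)) (S (T f))" if "ord_ge n f" for n f
    using d[OF e[OF that]] by (simp add: algebra_simps)
  then show ?thesis
    by (intro bounded_additiveI) (simp add: bounded_additive_add assms)
qed

lemma bounded_additive_plus:
  assumes "bounded_additive S" "bounded_additive T" shows "bounded_additive (\<lambda>f. S f + T f)"
proof -
  obtain d where d: "\<And>n f. ord_ge n f \<Longrightarrow> ord_ge (n - d) (S f)"
    using assms(1) unfolding bounded_additive_def by blast
  obtain e where e: "\<And>n f. ord_ge n f \<Longrightarrow> ord_ge (n - e) (T f)"
    using assms(2) unfolding bounded_additive_def by blast
  have "ord_ge (n - max d e) (S f + T f)" if "ord_ge n f" for n f
    by (rule ord_ge_add) (rule ord_ge_mono[OF d[OF that]] ord_ge_mono[OF e[OF that]], simp)+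
  then show ?thesis
    by (intro bounded_additiveI) (simp_all add: bounded_additive_add assms)
qed

lemma bounded_additive_id: "bounded_additive (\<lambda>f. f)"
  by (rule bounded_additiveI[of _ 0]) auto

lemma bounded_additive_uminus: "bounded_additive T \<Longrightarrow> bounded_additive (\<lambda>f. - T f)"
  by (rule bounded_additive_comp[of uminus], rule bounded_additiveI[of _ 0]) (auto intro: ord_ge_uminus)

lemma bounded_additive_left_mult:
  fixes g :: "'a::ring fls" shows "bounded_additive (\<lambda>f. g * f)"
proof -
  obtain d where "ord_ge d g" using ord_ge_exists by blast
  then have "ord_ge (n - (- d)) (g * f)" if "ord_ge n f" for n f
    using ord_ge_mult[of d g n f] that by (simp add: add.commute)
  then show ?thesis by (intro bounded_additiveI[of _ "- d"]) (simp_all add: distrib_left)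
qed

lemma bounded_additive_right_mult:
  fixes g :: "'a::ring fls" shows "bounded_additive (\<lambda>f. f * g)"
proof -
  obtain d where "ord_ge d g" using ord_ge_exists by blast
  then have "ord_ge (n - (- d)) (f * g)" if "ord_ge n f" for n f
    using ord_ge_mult[of n f d g] that by simp
  then show ?thesis by (intro bounded_additiveI[of _ "- d"]) (simp_all add: distrib_right)
qed

lemma bounded_additive_has_sum:
  assumes T: "bounded_additive T" and F: "(F has_sum s) A"
  shows "((\<lambda>i. T (F i)) has_sum T s) A"
  unfolding has_sum_fls_iff
proof
  fix N
  obtain d where d: "\<And>n f. ord_ge n f \<Longrightarrow> ord_ge (n - d) (T f)"
    using T unfolding bounded_additive_def by blast
  from F obtain X0 where X0: "finite X0" "X0 \<subseteq> A"
    "\<And>X. finite X \<and> X0 \<subseteq> X \<and> X \<subseteq> A \<Longrightarrow> ord_ge (N + d) (sum F X - s)"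
    unfolding has_sum_fls_iff by metis
  have "ord_ge N ((\<Sum>i\<in>X. T (F i)) - T s)" if "finite X \<and> X0 \<subseteq> X \<and> X \<subseteq> A" for X
    using d[OF X0(3)[OF that]] by (simp add: bounded_additive_diff[OF T] bounded_additive_sum[OF T])
  then show "\<exists>X0. finite X0 \<and> X0 \<subseteq> A \<and>
      (\<forall>X. finite X \<and> X0 \<subseteq> X \<and> X \<subseteq> A \<longrightarrow> ord_ge N ((\<Sum>i\<in>X. T (F i)) - T s))"
    using X0(1,2) by blast
qed

subsection \<open>Monomials and uniqueness of bounded additive maps\<close>

definition xp :: "int \<Rightarrow> 'a::ring_1 fls" where
  "xp n = fls_X_intpow n"

lemma xpow_xp [simp]: "xpow At_0 n = xp n" "xpow At_inf n = xp (- n)"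
  by (simp_all add: xp_def)

lemma xp_nth: "xp n $$ k = (if k = n then 1 else 0)"
  by (simp add: xp_def)

lemma xp_mult_nth: "(xp n * f) $$ k = f $$ (k - n)"
  unfolding xp_def by (simp add: fls_X_intpow_times_conv_shift)

lemma xp_commute: "f * xp n = xp n * f"
  unfolding xp_def by (rule fls_X_intpow_times_comm[symmetric])

lemma xp_mult_xp: "xp m * xp n = xp (m + n)"
  unfolding xp_def by (rule fls_X_intpow_times_fls_X_intpow)

lemma xp_0 [simp]: "xp 0 = 1"
  by (simp add: xp_def)

lemma ord_ge_xp: "ord_ge n (xp n)"
  by (simp add: ord_ge_def xp_nth)

lemma fls_expand: "((\<lambda>n. fls_const (f $$ n) * xp n) has_sum f) UNIV"
proof -
  obtain N0 where N0: "ord_ge N0 f" using ord_ge_exists by blast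
  have t: "(fls_const (f $$ n) * xp n) $$ k = (if k = n then f $$ n else 0)" for n k
    by (simp add: xp_nth)
  show ?thesis
    unfolding has_sum_fls_iff
  proof
    fix N
    have "ord_ge N ((\<Sum>n\<in>X. fls_const (f $$ n) * xp n) - f)" if "finite X \<and> {N0..<N} \<subseteq> X" for X
      unfolding ord_ge_def
    proof (intro allI impI)
      fix k assume "k < N"
      then have "k \<in> X \<or> f $$ k = 0" using that N0 unfolding ord_ge_def
        by (cases "k < N0") auto
      then show "((\<Sum>n\<in>X. fls_const (f $$ n) * xp n) - f) $$ k = 0"
        using that unfolding fls_minus_nth fls_sum_nth t by (auto simp: sum.delta)
    qed
    then show "\<exists>X0. finite X0 \<and> X0 \<subseteq> UNIV \<and> (\<forall>X. finite X \<and> X0 \<subseteq> X \<and> X \<subseteq> UNIV \<longrightarrow>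
        ord_ge N ((\<Sum>n\<in>X. fls_const (f $$ n) * xp n) - f))"
      by (intro exI[of _ "{N0..<N}"]) auto
  qed
qed

lemma scal_nth: "scal z $$ n = (if n = 0 then gscal z else 0)"
  by (simp add: scal_def)

lemma scal_mult_nth [simp]: "(scal z * f) $$ n = gscal z * f $$ n"
  by (simp add: scal_def)

lemma scal_commute: "scal z * f = f * scal z"
  by (rule fls_eqI) (simp add: scal_def gscal_commute)

lemma scal_left_commute: "f * (scal z * g) = scal z * (f * g)"
  by (metis scal_commute mult.assoc)

lemma scal_0 [simp]: "scal 0 = 0"
  and scal_1 [simp]: "scal 1 = 1"
  by (simp_all add: scal_def)

lemma scal_add: "scal (z + w) = scal z + scal w"
  by (auto intro!: fls_eqI simp: scal_def gscal_add)

lemma scal_minus: "scal (- z) = - scal z"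
  by (auto intro!: fls_eqI simp: scal_def gscal_minus)

lemma scal_diff: "scal (z - w) = scal z - scal w"
  using scal_add[of z "- w"] by (simp add: scal_minus)

lemma scal_mult: "scal (z * w) = scal z * scal w"
  by (simp add: scal_def gscal_mult)

lemma scal_of_int: "scal (of_int k) = of_int k"
  by (simp add: scal_def gscal_of_int fls_of_int)

lemma ogen_mult_nth [simp]: "(ogen g * f) $$ n = ggen g * f $$ n"
  by (simp add: ogen_def)

lemma ogen_nth: "ogen g $$ n = (if n = 0 then ggen g else 0)"
  by (simp add: ogen_def)

lemma ogen_square [simp]: "ogen g * ogen g = 0"
  by (simp add: ogen_def)

lemma ogen_square_left [simp]: "ogen g * (ogen g * f) = 0"
  by (simp flip: mult.assoc)

text \<open>By continuity it suffices to treat a constant times a power of x, and induction on the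
  Grassmann constant leaves complex multiples of powers of x and left multiplication by one
  generator. Multiplicativity and associativity of substitution and the chain rule are all proved in
  this way.\<close>

theorem bounded_additive_eqI:
  assumes S: "bounded_additive S" and T: "bounded_additive T"
    and mon: "\<And>z n. S (scal z * xp n) = T (scal z * xp n)"
    and gen: "\<And>g f. S f = T f \<Longrightarrow> S (ogen g * f) = T (ogen g * f)"
  shows "S f = T f"
proof -
  have c: "S (fls_const c * xp n) = T (fls_const c * xp n)" for c :: grass and n
  proof (induction c rule: grass_induct)
    case (add a b)
    have "fls_const (a + b) = fls_const a + fls_const b" by (rule fls_plus_const[symmetric])
    then show ?case
      using add by (simp add: distrib_right bounded_additive_add[OF S] bounded_additive_add[OF T])
  next
    case (scal z)
    then show ?case using mon[of z n] by (simp add: scal_def)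
  next
    case (gen h a)
    have "fls_const (ggen h * a) * xp n = ogen h * (fls_const a * xp n)"
      by (simp add: ogen_def flip: mult.assoc)
    then show ?case using assms(4)[OF gen] by metis
  qed
  have "((\<lambda>n. S (fls_const (f $$ n) * xp n)) has_sum S f) UNIV"
    by (rule bounded_additive_has_sum[OF S fls_expand])
  moreover have "((\<lambda>n. T (fls_const (f $$ n) * xp n)) has_sum T f) UNIV"
    by (rule bounded_additive_has_sum[OF T fls_expand])
  ultimately show ?thesis unfolding c by (rule has_sum_unique)
qed

subsection \<open>Parity and derivatives\<close>

definition sbar :: "sfun \<Rightarrow> sfun" where
  "sbar f = Abs_fls (\<lambda>n. gbar (f $$ n))"

lemma sbar_nth [simp]: "sbar f $$ n = gbar (f $$ n)"
  unfolding sbar_def by (rule nth_Abs_fls_map) simp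

lemma d_odd_nth [simp]: "d_odd g f $$ n = gderiv g (f $$ n)"
  unfolding d_odd_def by (rule nth_Abs_fls_map) simp

lemma ord_ge_sbar: "ord_ge n f \<Longrightarrow> ord_ge n (sbar f)"
  and ord_ge_d_odd: "ord_ge n f \<Longrightarrow> ord_ge n (d_odd g f)"
  and ord_ge_deriv: "ord_ge n f \<Longrightarrow> ord_ge (n - 1) (fls_deriv f)"
  by (simp_all add: ord_ge_def)

lemma sbar_add [simp]: "sbar (f + g) = sbar f + sbar g"
  and sbar_diff [simp]: "sbar (f - g) = sbar f - sbar g"
  and sbar_uminus [simp]: "sbar (- f) = - sbar f"
  and sbar_0 [simp]: "sbar 0 = 0"
  and sbar_sbar [simp]: "sbar (sbar f) = f"
  and sbar_ogen [simp]: "sbar (ogen k) = - ogen k"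
  and sbar_scal [simp]: "sbar (scal z) = scal z"
  and sbar_const [simp]: "sbar (fls_const c) = fls_const (gbar c)"
  and sbar_xp [simp]: "sbar (xp n) = xp n"
  by (auto intro!: fls_eqI simp: ogen_def scal_def xp_nth)

lemma sbar_1 [simp]: "sbar 1 = 1"
  using sbar_scal[of 1] by simp

lemma gbar_sum: "gbar (sum f A) = (\<Sum>i\<in>A. gbar (f i))"
  by (induction A rule: infinite_finite_induct) auto

lemma gderiv_sum: "gderiv g (sum f A) = (\<Sum>i\<in>A. gderiv g (f i))"
  by (induction A rule: infinite_finite_induct) auto

lemma sbar_mult [simp]: "sbar (f * h) = sbar f * sbar h"
proof (rule fls_eqI)
  fix n
  obtain a b where ab: "ord_ge a f" "ord_ge b h" using ord_ge_exists by metis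
  show "sbar (f * h) $$ n = (sbar f * sbar h) $$ n"
    by (simp add: fls_times_nth_bounds[OF ab] fls_times_nth_bounds[OF ab[THEN ord_ge_sbar]] gbar_sum)
qed

lemma d_odd_mult: "d_odd g (f * h) = d_odd g f * h + sbar f * d_odd g h"
proof (rule fls_eqI)
  fix n
  obtain a b where ab: "ord_ge a f" "ord_ge b h" using ord_ge_exists by metis
  show "d_odd g (f * h) $$ n = (d_odd g f * h + sbar f * d_odd g h) $$ n"
    by (simp add: fls_times_nth_bounds[OF ab] gderiv_sum gderiv_mult sum.distrib
        fls_times_nth_bounds[OF ord_ge_d_odd[OF ab(1)] ab(2)]
        fls_times_nth_bounds[OF ord_ge_sbar[OF ab(1)] ord_ge_d_odd[OF ab(2)]])
qed

lemma d_odd_add [simp]: "d_odd g (f + h) = d_odd g f + d_odd g h"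
  and d_odd_0 [simp]: "d_odd g 0 = 0"
  and d_odd_scal [simp]: "d_odd g (scal z) = 0"
  and d_odd_xp [simp]: "d_odd g (xp n) = 0"
  and d_odd_ogen: "d_odd g (ogen k) = (if g = k then 1 else 0)"
  and d_odd_d_odd [simp]: "d_odd g (d_odd g f) = 0"
  using gderiv_gscal[of g 1]
  by (auto intro!: fls_eqI simp: scal_def ogen_def xp_nth gderiv_ggen)

lemma bounded_additive_sbar: "bounded_additive sbar"
  by (rule bounded_additiveI[of _ 0]) (auto intro: ord_ge_sbar)

lemma bounded_additive_d_odd: "bounded_additive (d_odd g)"
  by (rule bounded_additiveI[of _ 0]) (auto intro: ord_ge_d_odd)

lemma bounded_additive_deriv: "bounded_additive (fls_deriv :: sfun \<Rightarrow> sfun)"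
  by (rule bounded_additiveI[of _ 1]) (auto intro: ord_ge_deriv)

lemma d_odd_diff [simp]: "d_odd g (f - h) = d_odd g f - d_odd g h"
  and d_odd_uminus [simp]: "d_odd g (- f) = - d_odd g f"
  using bounded_additive_diff[OF bounded_additive_d_odd] bounded_additive_minus[OF bounded_additive_d_odd]
  by blast+

definition even_s :: "sfun \<Rightarrow> bool" where "even_s f \<longleftrightarrow> sbar f = f"
definition odd_s :: "sfun \<Rightarrow> bool" where "odd_s f \<longleftrightarrow> sbar f = - f"

lemma even_s_iff: "even_s f \<longleftrightarrow> (\<forall>n. f $$ n \<in> grass_even)"
  by (auto simp: even_s_def grass_even_iff fls_eq_iff)

lemma odd_s_iff: "odd_s f \<longleftrightarrow> (\<forall>n. f $$ n \<in> grass_odd)"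
  by (auto simp: odd_s_def grass_odd_iff fls_eq_iff)

lemma even_s_commute:
  assumes "even_s f" shows "f * h = h * f"
proof (rule fls_eqI)
  fix n
  obtain a b where ab: "ord_ge a f" "ord_ge b h" using ord_ge_exists by metis
  have "(\<Sum>i=a..n-b. f $$ i * h $$ (n - i)) = (\<Sum>i=b..n-a. h $$ i * f $$ (n - i))"
    by (rule sum.reindex_bij_witness[of _ "\<lambda>i. n - i" "\<lambda>i. n - i"])
      (use assms in \<open>auto simp: even_s_iff intro: grass_even_commute[symmetric]\<close>)
  then show "(f * h) $$ n = (h * f) $$ n"
    by (simp add: fls_times_nth_bounds[OF ab] fls_times_nth_bounds[OF ab(2,1)])
qed

lemma odd_s_commute:
  assumes "odd_s f" shows "f * h = sbar h * f"
proof (rule fls_eqI)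
  fix n
  obtain a b where ab: "ord_ge a f" "ord_ge b h" using ord_ge_exists by metis
  have "(\<Sum>i=a..n-b. f $$ i * h $$ (n - i)) = (\<Sum>i=b..n-a. sbar h $$ i * f $$ (n - i))"
    by (rule sum.reindex_bij_witness[of _ "\<lambda>i. n - i" "\<lambda>i. n - i"])
      (use assms in \<open>auto simp: odd_s_iff intro: grass_odd_commute[symmetric]\<close>)
  then show "(f * h) $$ n = (sbar h * f) $$ n"
    by (simp add: fls_times_nth_bounds[OF ab] fls_times_nth_bounds[OF ord_ge_sbar[OF ab(2)] ab(1)])
qed

lemma odd_s_anticommute: "odd_s f \<Longrightarrow> odd_s h \<Longrightarrow> f * h = - (h * f)"
  using odd_s_commute[of f h] by (simp add: odd_s_def)

lemma sfun_halve: "a + a = b + b \<Longrightarrow> a = (b::sfun)"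
  by (rule fls_eqI) (metis fls_plus_nth grass_halve)

lemma odd_s_square: assumes "odd_s f" shows "f * f = 0"
proof (rule sfun_halve)
  have "f * f + f * f = f * f + - (f * f)"
    by (rule arg_cong[OF odd_s_anticommute[OF assms assms]])
  then show "f * f + f * f = 0 + 0" unfolding right_minus by (simp only: add_0_right)
qed

lemma even_s_intros:
  "even_s f \<Longrightarrow> even_s h \<Longrightarrow> even_s (f + h)" "even_s f \<Longrightarrow> even_s h \<Longrightarrow> even_s (f - h)"
  "even_s f \<Longrightarrow> even_s (- f)" "even_s f \<Longrightarrow> even_s h \<Longrightarrow> even_s (f * h)"
  "odd_s f \<Longrightarrow> odd_s h \<Longrightarrow> even_s (f * h)" "even_s (scal z)" "even_s (xp n)" "even_s 0" "even_s 1"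
  "c \<in> grass_even \<Longrightarrow> even_s (fls_const c)"
  by (auto simp: even_s_def odd_s_def grass_even_iff)

lemma odd_s_intros:
  "odd_s f \<Longrightarrow> odd_s h \<Longrightarrow> odd_s (f + h)" "odd_s f \<Longrightarrow> odd_s h \<Longrightarrow> odd_s (f - h)"
  "odd_s f \<Longrightarrow> odd_s (- f)" "even_s f \<Longrightarrow> odd_s h \<Longrightarrow> odd_s (f * h)"
  "odd_s f \<Longrightarrow> even_s h \<Longrightarrow> odd_s (f * h)" "odd_s (ogen g)" "odd_s 0"
  "c \<in> grass_odd \<Longrightarrow> odd_s (fls_const c)"
  by (auto simp: even_s_def odd_s_def grass_odd_iff)

lemma d_odd_sbar: "d_odd g (sbar f) = - sbar (d_odd g f)"
  by (rule fls_eqI) (simp add: gderiv_gbar)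

lemma gbar_of_int [simp]: "gbar (of_int k) = of_int k"
  by (metis gbar_gscal gscal_of_int)

lemma deriv_sbar: "fls_deriv (sbar f) = sbar (fls_deriv f)"
  by (rule fls_eqI) (simp del: of_int_add)

lemma gderiv_of_int_mult: "gderiv g (of_int k * a) = of_int k * gderiv g a"
  by (metis (no_types, lifting) add_0 gbar_gscal gderiv_gscal gderiv_mult gscal_of_int mult_zero_left)

lemma d_odd_deriv: "d_odd g (fls_deriv f) = fls_deriv (d_odd g f)"
  by (rule fls_eqI) (simp add: gderiv_of_int_mult del: of_int_add)

lemma parity_d_odd: "odd_s f \<Longrightarrow> even_s (d_odd g f)" "even_s f \<Longrightarrow> odd_s (d_odd g f)"
  using d_odd_sbar[of g f] unfolding even_s_def odd_s_def by (metis d_odd_uminus minus_minus)+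

lemma parity_deriv: "odd_s f \<Longrightarrow> odd_s (fls_deriv f)" "even_s f \<Longrightarrow> even_s (fls_deriv f)"
  using deriv_sbar[of f] by (auto simp: even_s_def odd_s_def)

lemma deriv_mult: "fls_deriv (f * h) = fls_deriv f * h + f * fls_deriv h"
  by (simp add: add.commute)

lemma deriv_ogen [simp]: "fls_deriv (ogen g) = 0"
  and deriv_scal [simp]: "fls_deriv (scal z) = 0"
  by (simp_all add: ogen_def scal_def)

lemma deriv_xp: "fls_deriv (xp n :: sfun) = scal (of_int n) * xp (n - 1)"
  by (rule fls_eqI) (auto simp: xp_nth scal_of_int gscal_of_int simp del: of_int_add)

subsection \<open>Supports and weights\<close>

text \<open>Restricts the monomials \<open>x^n e_S\<close> that may occur. The weight filtration
  \<open>W\<close> and the coefficient condition \<open>over\<close> are two instances, so their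
  closure properties have a common source.\<close>

definition spt :: "(int \<Rightarrow> odd_gen set \<Rightarrow> bool) \<Rightarrow> sfun \<Rightarrow> bool" where
  "spt Q f \<longleftrightarrow> (\<forall>n S. gcoeff (f $$ n) S \<noteq> 0 \<longrightarrow> Q n S)"

lemma sptD: "spt Q f \<Longrightarrow> gcoeff (f $$ n) S \<noteq> 0 \<Longrightarrow> Q n S"
  by (simp add: spt_def)

lemma spt_mono: "spt Q f \<Longrightarrow> (\<And>n S. Q n S \<Longrightarrow> R n S) \<Longrightarrow> spt R f"
  by (simp add: spt_def)

lemma spt_0 [simp]: "spt Q 0"
  by (simp add: spt_def)

lemma spt_add: "spt Q f \<Longrightarrow> spt Q g \<Longrightarrow> spt Q (f + g)"
  unfolding spt_def by (metis add.right_neutral fls_plus_nth gcoeff_add)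

lemma spt_uminus: "spt Q f \<Longrightarrow> spt Q (- f)"
  by (simp add: spt_def)

lemma spt_diff: "spt Q f \<Longrightarrow> spt Q g \<Longrightarrow> spt Q (f - g)"
  using spt_add[of Q f "- g"] spt_uminus by simp

lemma spt_sum: "(\<And>i. i \<in> A \<Longrightarrow> spt Q (f i)) \<Longrightarrow> spt Q (sum f A)"
  by (induction A rule: infinite_finite_induct) (auto intro: spt_add)

lemma spt_scal_mult: "spt Q f \<Longrightarrow> spt Q (scal z * f)"
  by (simp add: spt_def)

lemma spt_has_sum:
  assumes F: "\<And>i. i \<in> A \<Longrightarrow> spt Q (F i)" and s: "(F has_sum s) A"
  shows "spt Q s"
  unfolding spt_def
proof (intro allI impI)
  fix n S assume nz: "gcoeff (s $$ n) S \<noteq> 0"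
  obtain X where X: "X \<subseteq> A" "\<forall>m<n+1. s $$ m = (\<Sum>i\<in>X. F i $$ m)"
    using has_sum_fls_nth[OF s, of "n + 1"] by metis
  have "s $$ n = (\<Sum>i\<in>X. F i $$ n)" using X(2) by simp
  then have "gcoeff (\<Sum>i\<in>X. F i $$ n) S \<noteq> 0" using nz by metis
  then have "(\<Sum>i\<in>X. gcoeff (F i $$ n) S) \<noteq> 0" by simp
  then obtain i where "i \<in> X" "gcoeff (F i $$ n) S \<noteq> 0" by (rule sum.not_neutral_contains_not_neutral)
  then show "Q n S" using F[of i] X(1) by (auto simp: spt_def)
qed

lemma spt_mult:
  assumes f: "spt Q1 f" and g: "spt Q2 g"
    and Q: "\<And>n S m T. Q1 n S \<Longrightarrow> Q2 m T \<Longrightarrow> S \<inter> T = {} \<Longrightarrow> finite S \<Longrightarrow> finite T \<Longrightarrow> Q (n + m) (S \<union> T)"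
  shows "spt Q (f * g)"
  unfolding spt_def
proof (intro allI impI)
  fix k U assume nz: "gcoeff ((f * g) $$ k) U \<noteq> 0"
  obtain a b where ab: "ord_ge a f" "ord_ge b g" using ord_ge_exists by metis
  have "(\<Sum>i=a..k-b. gcoeff (f $$ i * g $$ (k - i)) U) \<noteq> 0"
    using nz by (simp add: fls_times_nth_bounds[OF ab])
  then obtain i where "gcoeff (f $$ i * g $$ (k - i)) U \<noteq> 0"
    by (rule sum.not_neutral_contains_not_neutral)
  then obtain S where S: "S \<subseteq> U" "gcoeff (f $$ i) S \<noteq> 0" "gcoeff (g $$ (k - i)) (U - S) \<noteq> 0"
    by (rule gcoeff_mult_nonzero)
  have "Q (i + (k - i)) (S \<union> (U - S))"
  proof (rule Q)
    show "Q1 i S" "Q2 (k - i) (U - S)" using f g S by (auto dest: sptD)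
    show "finite S" "finite (U - S)" using S gcoeff_finite by auto
  qed auto
  then show "Q k U" using S(1) by (simp add: Un_absorb1)
qed

lemma spt_sbar: "spt Q f \<Longrightarrow> spt Q (sbar f)"
  by (simp add: spt_def)

lemma spt_d_odd:
  assumes "spt Q f" "\<And>n S. Q n (insert g S) \<Longrightarrow> g \<notin> S \<Longrightarrow> finite S \<Longrightarrow> R n S"
  shows "spt R (d_odd g f)"
  using assms gcoeff_finite[of "f $$ _" "insert g _"] unfolding spt_def
  by (auto simp: gcoeff_gderiv split: if_splits)

lemma spt_deriv:
  assumes "spt Q f" "\<And>n S. Q (n + 1) S \<Longrightarrow> R n S"
  shows "spt R (fls_deriv f)"
  using assms unfolding spt_def by (auto simp del: of_int_add)

lemma spt_ogen: "Q 0 {g} \<Longrightarrow> spt Q (ogen g)"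
  by (auto simp: spt_def ogen_nth gcoeff_ggen)

lemma spt_xp: "Q n {} \<Longrightarrow> spt Q (xp n)"
  by (auto simp: spt_def xp_nth gcoeff_1)

lemma spt_scal: "Q 0 {} \<Longrightarrow> spt Q (scal z)"
  by (auto simp: spt_def scal_nth gcoeff_gscal)

text \<open>The generators \<open>Zeta k\<close> belong to the coefficients and have weight 0. There
  are only three formal odd variables, so the weight of a monomial exceeds twice its order by at
  most 3.\<close>

definition wt :: "odd_gen set \<Rightarrow> int" where
  "wt S = int (card (S \<inter> {Phi, Phi1, Phi2}))"

lemma wt_bounds: "0 \<le> wt S" "wt S \<le> 3"
proof -
  have "card (S \<inter> {Phi, Phi1, Phi2}) \<le> card {Phi, Phi1, Phi2}" by (rule card_mono) auto
  then show "wt S \<le> 3" by (simp add: wt_def)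
qed (simp add: wt_def)

lemma wt_Un: "S \<inter> T = {} \<Longrightarrow> wt (S \<union> T) = wt S + wt T"
  unfolding wt_def Int_Un_distrib2 by (subst card_Un_disjoint) auto

lemma wt_insert: "g \<notin> S \<Longrightarrow> wt (insert g S) = wt S + wt {g}"
  using wt_Un[of S "{g}"] by simp

lemma wt_singleton [simp]: "wt {} = 0" "wt {Phi} = 1" "wt {Phi1} = 1" "wt {Phi2} = 1" "wt {Zeta k} = 0"
  by (simp_all add: wt_def)

text \<open>The weight filtration: \<open>x\<close> has weight 2, each odd variable weight 1.\<close>

definition W :: "int \<Rightarrow> sfun \<Rightarrow> bool" where
  "W m = spt (\<lambda>n S. m \<le> 2 * n + wt S)"

lemma W_mono: "W m f \<Longrightarrow> k \<le> m \<Longrightarrow> W k f"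
  unfolding W_def by (erule spt_mono) auto

lemma W_mult: "W a f \<Longrightarrow> W b g \<Longrightarrow> W (a + b) (f * g)"
  unfolding W_def by (erule (1) spt_mult) (simp add: wt_Un)

lemma W_xp: "W (2 * n) (xp n)"
  unfolding W_def by (rule spt_xp) simp

lemma W_scal: "W 0 (scal z)"
  unfolding W_def by (rule spt_scal) simp

lemma W_1: "W 0 1"
  using W_scal[of 1] by simp

lemma W_ogen: "W (wt {g}) (ogen g)"
  unfolding W_def by (rule spt_ogen) simp

lemma W_0 [simp]: "W m 0"
  by (simp add: W_def)

lemma W_arith: "W m f \<Longrightarrow> W m g \<Longrightarrow> W m (f + g)" "W m f \<Longrightarrow> W m g \<Longrightarrow> W m (f - g)"
  "W m f \<Longrightarrow> W m (- f)" "W m f \<Longrightarrow> W m (scal z * f)" "W m f \<Longrightarrow> W m (sbar f)"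
  unfolding W_def by (auto intro: spt_add spt_diff spt_uminus spt_scal_mult spt_sbar)

lemma W_d_odd: "W m f \<Longrightarrow> W (m - 1) (d_odd g f)"
  unfolding W_def by (erule spt_d_odd) (cases g; simp add: wt_insert)

lemma W_deriv: "W m f \<Longrightarrow> W (m - 2) (fls_deriv f)"
  unfolding W_def by (erule spt_deriv) simp

lemma W_power: "W a f \<Longrightarrow> W (int k * a) (f ^ k)"
proof (induction k)
  case (Suc k)
  have "W (a + int k * a) (f * f ^ k)" using Suc by (intro W_mult) auto
  then show ?case by (simp add: algebra_simps)
qed (simp add: W_1)

text \<open>As \<open>wt\<close> lies between 0 and 3, weight and order control each other, and both
  filtrations give the same topology; the margin of 2 in \<open>W_ord_ge\<close> accounts for the
  odd variables.\<close>

lemma ord_ge_W: "ord_ge n f \<Longrightarrow> W (2 * n) f"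
  unfolding W_def spt_def ord_ge_def
  by (metis (no_types, lifting) add_increasing2 gcoeff_0 mult_le_cancel_left_pos not_le wt_bounds(1) zero_less_numeral)

lemma W_ord_ge: "W m f \<Longrightarrow> 2 * n + 2 \<le> m \<Longrightarrow> ord_ge n f"
proof -
  assume W: "W m f" and n: "2 * n + 2 \<le> m"
  have "gcoeff (f $$ k) S = 0" if "k < n" for k S
  proof (rule ccontr)
    assume "gcoeff (f $$ k) S \<noteq> 0"
    then have "m \<le> 2 * k + wt S" using W unfolding W_def by (rule sptD[rotated])
    then show False using wt_bounds(2)[of S] n that by linarith
  qed
  then show ?thesis unfolding ord_ge_def by (auto intro: grass_eqI)
qed

lemma W_all_zero: "(\<And>m. W m f) \<Longrightarrow> f = 0"
  using W_ord_ge by (intro ord_ge_all_zero) blast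

lemma W_const: "W 0 (fls_const c)"
  using ord_ge_W[of 0 "fls_const c"] by (simp add: ord_ge_def)

lemma bounded_additiveI_W:
  assumes "\<And>f g. T (f + g) = T f + T g" "\<And>m f. W m f \<Longrightarrow> W (m - d) (T f)"
  shows "bounded_additive T"
proof (rule bounded_additiveI[of _ "\<bar>d\<bar> + 1"])
  show "T (f + g) = T f + T g" for f g by (rule assms(1))
  show "ord_ge (n - (\<bar>d\<bar> + 1)) (T f)" if "ord_ge n f" for n f
    by (rule W_ord_ge[OF assms(2)[OF ord_ge_W[OF that]]]) (simp add: abs_if)
qed

lemma W_locally_finite: "(\<And>k::nat. W (b + int k) (F k)) \<Longrightarrow> locally_finite F A"
proof (rule locally_finiteI_nat)
  fix k assume "\<And>k. W (b + int k) (F k)"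
  from this[of k] show "ord_ge ((b - 2) div 2 + int (k div 2)) (F k)"
  proof (rule W_ord_ge)
    show "2 * ((b - 2) div 2 + int (k div 2)) + 2 \<le> b + int k" by presburger
  qed
qed

definition over :: "enat \<Rightarrow> odd_gen set \<Rightarrow> sfun \<Rightarrow> bool" where
  "over L V = spt (\<lambda>n S. S \<subseteq> {Zeta k | k. enat k < L} \<union> V)"

lemma over_iff: "over L V f \<longleftrightarrow> (\<forall>n. f $$ n \<in> Lam L V)"
  by (auto simp: over_def spt_def Lam_def)

lemma over_arith: "over L V f \<Longrightarrow> over L V g \<Longrightarrow> over L V (f + g)"
  "over L V f \<Longrightarrow> over L V g \<Longrightarrow> over L V (f - g)" "over L V f \<Longrightarrow> over L V (- f)"
  "over L V (scal z)" "over L V (xp n)" "over L V f \<Longrightarrow> over L V (sbar f)" "over L V 0"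
  "k \<in> V \<Longrightarrow> over L V (ogen k)" "over L V f \<Longrightarrow> over L V (d_odd k f)"
  "over L V f \<Longrightarrow> over L V (fls_deriv f)"
  unfolding over_def
  by (auto intro: spt_add spt_diff spt_uminus spt_scal spt_sbar spt_xp spt_ogen)
    (erule spt_d_odd spt_deriv; auto)+

lemma over_1: "over L V 1"
  using over_arith(4)[of L V 1] by simp

lemma over_mult: "over L V f \<Longrightarrow> over L V g \<Longrightarrow> over L V (f * g)"
  unfolding over_def by (erule (1) spt_mult) auto

lemma over_mono: "over L V f \<Longrightarrow> V \<subseteq> V' \<Longrightarrow> over L V' f"
  unfolding over_def by (erule spt_mono) auto

lemma over_const: "c \<in> Lam L V \<Longrightarrow> over L V (fls_const c)"
  by (auto simp: over_def spt_def Lam_def)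

lemma over_has_sum: "(\<And>i. i \<in> A \<Longrightarrow> over L V (F i)) \<Longrightarrow> (F has_sum s) A \<Longrightarrow> over L V s"
  unfolding over_def by (rule spt_has_sum)

lemma over_power: "over L V f \<Longrightarrow> over L V (f ^ n)"
  by (induction n) (auto intro: over_1 over_mult)

lemma parity_has_sum:
  assumes "(F has_sum s) A"
  shows "(\<And>i. even_s (F i)) \<Longrightarrow> even_s s" "(\<And>i. odd_s (F i)) \<Longrightarrow> odd_s s"
proof -
  have b: "((\<lambda>i. sbar (F i)) has_sum sbar s) A"
    by (rule bounded_additive_has_sum[OF bounded_additive_sbar assms])
  show "even_s s" if "\<And>i. even_s (F i)"
    using b that assms unfolding even_s_def by (metis (no_types, lifting) has_sum_cong has_sum_unique)
  have m: "((\<lambda>i. - F i) has_sum - s) A"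
    by (rule bounded_additive_has_sum[OF bounded_additive_uminus[OF bounded_additive_id] assms])
  show "odd_s s" if "\<And>i. odd_s (F i)"
    using b that m unfolding odd_s_def by (metis (no_types, lifting) has_sum_cong has_sum_unique)
qed

section \<open>Substitution\<close>

subsection \<open>Integer powers\<close>

lemma unit_inv_eq: "a * b = 1 \<Longrightarrow> b * a = 1 \<Longrightarrow> unit_inv a = b" for a :: "'a::ring_1"
  unfolding unit_inv_def by (rule the_equality) (simp, metis mult.assoc mult.right_neutral mult_1)

lemma zpow_0 [simp]: "zpow a 0 = 1" and zpow_1 [simp]: "zpow a 1 = a"
  by (simp_all add: zpow_def)

lemma zpow_Suc:
  fixes a :: "'a::ring_1" assumes ab: "a * b = 1" "b * a = 1"
  shows "zpow a (n + 1) = a * zpow a n"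
proof (cases "0 \<le> n")
  case True
  then show ?thesis by (simp add: zpow_def nat_add_distrib)
next
  case False
  then obtain k where k: "nat (- n) = Suc k" by (metis Suc_pred neg_0_less_iff_less not_le zero_less_nat_eq)
  then have n: "n + 1 = - int k" using False by linarith
  have "zpow a n = b ^ Suc k"
    using False k by (simp add: zpow_def unit_inv_eq[OF ab] del: power_Suc)
  moreover have "zpow a (n + 1) = b ^ k"
    unfolding n by (cases k) (simp_all add: zpow_def unit_inv_eq[OF ab] nat_add_distrib del: power_Suc)
  ultimately show ?thesis using ab by (simp flip: mult.assoc)
qed

lemma zpow_add:
  fixes a :: "'a::ring_1" assumes ab: "a * b = 1" "b * a = 1"
  shows "zpow a (m + n) = zpow a m * zpow a n"
proof (induction m rule: int_induct[of _ 0])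
  case base
  show ?case by simp
next
  case (step1 i)
  have "zpow a (i + 1 + n) = a * zpow a (i + n)"
    using zpow_Suc[OF ab, of "i + n"] by (simp add: add_ac)
  then show ?case using step1 by (simp add: zpow_Suc[OF ab] mult.assoc)
next
  case (step2 i)
  have "a * zpow a (i - 1 + n) = zpow a (i + n)"
    using zpow_Suc[OF ab, of "i - 1 + n"] by (simp add: algebra_simps)
  also have "\<dots> = a * zpow a (i - 1) * zpow a n"
    using step2 zpow_Suc[OF ab, of "i - 1"] by simp
  finally have "b * a * zpow a (i - 1 + n) = b * a * zpow a (i - 1) * zpow a n"
    by (simp add: mult.assoc)
  then show ?case using ab by simp
qed

lemma zpow_minus_1: "a * b = 1 \<Longrightarrow> b * a = 1 \<Longrightarrow> zpow a (-1) = b"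
  by (simp add: zpow_def unit_inv_eq)

lemma zpow_xp [simp]: "zpow (xp 1 :: sfun) n = xp n"
proof -
  have i: "unit_inv (xp 1 :: sfun) = xp (-1)" by (rule unit_inv_eq) (simp_all add: xp_mult_xp)
  have p: "(xp m :: sfun) ^ k = xp (int k * m)" for m k
    by (induction k) (simp_all add: xp_mult_xp algebra_simps)
  show ?thesis by (auto simp: zpow_def i p)
qed

lemma W_zpow:
  assumes "a * b = 1" "b * a = 1" "W c a" "W (-c) b" shows "W (n * c) (zpow a n)"
proof (cases "0 \<le> n")
  case True
  then show ?thesis using W_power[OF assms(3), of "nat n"] by (simp add: zpow_def)
next
  case False
  then show ?thesis using W_power[OF assms(4), of "nat (- n)"]
    by (simp add: zpow_def unit_inv_eq[OF assms(1,2)])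
qed

lemma even_s_power: "even_s a \<Longrightarrow> even_s (a ^ k)"
  by (induction k) (auto intro: even_s_intros)

lemma even_s_inverse:
  assumes "even_s a" "a * b = 1" "b * a = 1" shows "even_s b"
proof -
  have "a * sbar b = sbar (a * b)" using assms(1) by (simp add: even_s_def)
  then have "b * (a * sbar b) = b" using assms(2) by simp
  then show ?thesis using assms(3) by (simp add: even_s_def flip: mult.assoc)
qed

lemma even_s_zpow:
  assumes "even_s a" "a * b = 1" "b * a = 1" shows "even_s (zpow a n)"
  using even_s_power[OF assms(1)] even_s_power[OF even_s_inverse[OF assms]]
  by (simp add: zpow_def unit_inv_eq[OF assms(2,3)])

subsection \<open>Substitution for the generators\<close>

lemma gsubst_superset:
  assumes "finite X" "{S. gcoeff c S \<noteq> 0} \<subseteq> X"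
  shows "gsubst v c = (\<Sum>S\<in>X. scal (gcoeff c S) * prod_list (map v (sorted_list_of_set S)))"
  unfolding gsubst_def by (rule sum.mono_neutral_left) (use assms in auto)

lemma gsubst_add: "gsubst v (a + b) = gsubst v a + gsubst v b"
proof -
  let ?X = "{S. gcoeff a S \<noteq> 0} \<union> {S. gcoeff b S \<noteq> 0}"
  have X: "finite ?X" by (simp add: finite_gsupport)
  show ?thesis
    by (subst (1 2 3) gsubst_superset[OF X])
      (auto simp: scal_add distrib_right sum.distrib)
qed

lemma gsubst_0 [simp]: "gsubst v 0 = 0"
  by (simp add: gsubst_def)

lemma gsubst_sum: "gsubst v (sum f A) = (\<Sum>i\<in>A. gsubst v (f i))"
  by (induction A rule: infinite_finite_induct) (auto simp: gsubst_add)

lemma gsubst_gmon: "finite S \<Longrightarrow> gsubst v (gscal z * gmon S) = scal z * prod_list (map v (sorted_list_of_set S))"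
  by (subst gsubst_superset[of "{S}"]) (auto simp: gcoeff_gmon)

lemma gsubst_gscal [simp]: "gsubst v (gscal z) = scal z"
  using gsubst_gmon[of "{}" v z] by simp

lemma gsubst_cong: "(\<And>S g. gcoeff c S \<noteq> 0 \<Longrightarrow> g \<in> S \<Longrightarrow> v g = w g) \<Longrightarrow> gsubst v c = gsubst w c"
  unfolding gsubst_def
  by (intro sum.cong refl arg_cong2[where f = "(*)"] arg_cong[where f = prod_list] map_cong)
    (auto simp: gcoeff_finite)

text \<open>The generators and their odd values obey the same rule
  \<open>odd_times_sorted_prod\<close>, so the reordering signs agree monomial by monomial.\<close>

lemma gsubst_gen_mult:
  assumes v: "\<And>g. odd_s (v g)"
  shows "gsubst v (ggen g * c) = v g * gsubst v c"
proof -
  let ?P = "\<lambda>S. prod_list (map v (sorted_list_of_set S))"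
  have mon: "gsubst v (ggen g * (gscal z * gmon S)) = v g * (scal z * ?P S)" if S: "finite S" for z S
  proof (cases "g \<in> S")
    case True
    have "ggen g * (gscal z * gmon S) = gscal z * (ggen g * gmon S)"
      by (metis gscal_commute mult.assoc)
    moreover have "v g * ?P S = 0"
      using odd_times_sorted_prod[of v S g] True S odd_s_anticommute[OF v v] odd_s_square[OF v] by metis
    ultimately show ?thesis using True S
      by (simp add: ggen_times_gmon scal_left_commute)
  next
    case False
    let ?k = "card {s \<in> S. s < g}"
    have "ggen g * (gscal z * gmon S) = gscal z * (ggen g * gmon S)"
      by (metis gscal_commute mult.assoc)
    also have "\<dots> = gscal ((-1) ^ ?k * z) * gmon (insert g S)"
      using False S by (cases "even ?k") (simp_all add: ggen_times_gmon gscal_minus)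
    finally have "gsubst v (ggen g * (gscal z * gmon S)) = scal ((-1) ^ ?k * z) * ?P (insert g S)"
      using S by (simp only: gsubst_gmon finite_insert)
    also have "\<dots> = scal z * ((-1) ^ ?k * ?P (insert g S))"
      by (cases "even ?k") (simp_all add: scal_minus)
    also have "(-1) ^ ?k * ?P (insert g S) = v g * ?P S"
      using odd_times_sorted_prod[of v S g] False S odd_s_anticommute[OF v v] odd_s_square[OF v] by metis
    finally show ?thesis by (simp only: scal_left_commute)
  qed
  have "gsubst v (ggen g * (\<Sum>S\<in>X. gscal (gcoeff c S) * gmon S)) =
      v g * (\<Sum>S\<in>X. scal (gcoeff c S) * ?P S)" if "\<And>S. S \<in> X \<Longrightarrow> finite S" for X
    using that by (simp add: sum_distrib_left gsubst_sum mon)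
  from this[of "{S. gcoeff c S \<noteq> 0}"] show ?thesis
    using grass_expand[of c] gcoeff_finite[of c] by (simp add: gsubst_def)
qed

text \<open>The weights \<open>a g\<close> of the values may differ from those of the generators: at
  infinity the odd variables receive values of weight -1.\<close>

lemma W_gsubst:
  assumes "\<And>g. W (a g) (v g)" and "\<And>S. gcoeff c S \<noteq> 0 \<Longrightarrow> d \<le> (\<Sum>g\<in>S. a g)"
  shows "W d (gsubst v c)"
proof -
  have l: "W (sum_list (map a xs)) (prod_list (map v xs))" for xs
    by (induction xs) (auto intro: W_1 W_mult assms(1))
  have "W d (prod_list (map v (sorted_list_of_set S)))" if "gcoeff c S \<noteq> 0" for S
  proof (rule W_mono[OF l])
    have "sum_list (map a (sorted_list_of_set S)) = sum a S"
      using gcoeff_finite[OF that] by (simp add: sum_list_distinct_conv_sum_set)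
    then show "d \<le> sum_list (map a (sorted_list_of_set S))" using assms(2)[OF that] by simp
  qed
  then show ?thesis
    unfolding gsubst_def W_def by (intro spt_sum spt_scal_mult) auto
qed

lemma over_gsubst:
  assumes "\<And>g S. gcoeff c S \<noteq> 0 \<Longrightarrow> g \<in> S \<Longrightarrow> over L V (v g)"
  shows "over L V (gsubst v c)"
proof -
  have l: "over L V (prod_list (map v xs))" if "\<And>g. g \<in> set xs \<Longrightarrow> over L V (v g)" for xs
    using that by (induction xs) (auto intro: over_1 over_mult)
  have "over L V (prod_list (map v (sorted_list_of_set S)))" if "gcoeff c S \<noteq> 0" for S
    using assms that gcoeff_finite[OF that] by (intro l) auto
  then show ?thesis
    unfolding gsubst_def over_def by (intro spt_sum spt_scal_mult) auto
qed

subsection \<open>Admissible substitutions\<close>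

text \<open>As \<open>u\<close> and its inverse have weights at least 2 and -2, every power
  \<open>u^n\<close> has weight at least 2n and the sum defining the substitution converges. The
  uniform bound \<open>d\<close> may be negative, because at infinity an odd variable is replaced by
  a multiple of phi/x.\<close>

definition subst_ok :: "sfun \<Rightarrow> (odd_gen \<Rightarrow> sfun) \<Rightarrow> bool" where
  "subst_ok u v \<longleftrightarrow> even_s u \<and> W 2 u \<and> (\<exists>u'. u * u' = 1 \<and> u' * u = 1 \<and> W (-2) u') \<and>
     (\<forall>g. odd_s (v g)) \<and> (\<exists>d. \<forall>c. W d (gsubst v c))"

lemma subst_ok_zpow:
  assumes "subst_ok u v"
  shows "W (2 * n) (zpow u n)" "even_s (zpow u n)" "zpow u (m + n) = zpow u m * zpow u n"
proof -
  from assms obtain u' where u: "even_s u" "W 2 u" "u * u' = 1" "u' * u = 1" "W (-2) u'"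
    unfolding subst_ok_def by blast
  show "W (2 * n) (zpow u n)" using W_zpow[OF u(3,4,2,5), of n] by (simp add: mult.commute)
  show "even_s (zpow u n)" by (rule even_s_zpow[OF u(1,3,4)])
  show "zpow u (m + n) = zpow u m * zpow u n" by (rule zpow_add[OF u(3,4)])
qed

lemma subst_okD: "subst_ok u v \<Longrightarrow> odd_s (v g)" "subst_ok u v \<Longrightarrow> even_s u"
  by (simp_all add: subst_ok_def)

lemma has_sum_subst:
  assumes ok: "subst_ok u v"
  shows "((\<lambda>n. gsubst v (f $$ n) * zpow u n) has_sum subst u v f) UNIV"
proof -
  from ok obtain d where d: "\<And>c. W d (gsubst v c)" unfolding subst_ok_def by blast
  obtain N0 where N0: "ord_ge N0 f" using ord_ge_exists by blast
  let ?F = "\<lambda>n. gsubst v (f $$ n) * zpow u n"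
  have W: "W (d + 2 * n) (?F n)" for n by (intro W_mult d subst_ok_zpow[OF ok])
  have "locally_finite ?F UNIV"
    unfolding locally_finite_def
  proof
    fix N
    have "{n \<in> UNIV. \<not> ord_ge N (?F n)} \<subseteq> {N0..N + 1 + \<bar>d\<bar>}"
    proof
      fix n assume n: "n \<in> {n \<in> UNIV. \<not> ord_ge N (?F n)}"
      have "N0 \<le> n"
      proof (rule ccontr)
        assume "\<not> N0 \<le> n"
        then have "f $$ n = 0" using N0 by (simp add: ord_ge_def)
        then show False using n by simp
      qed
      moreover have "n \<le> N + 1 + \<bar>d\<bar>"
      proof (rule ccontr)
        assume "\<not> n \<le> N + 1 + \<bar>d\<bar>"
        then have "2 * N + 2 \<le> d + 2 * n" by linarith
        then show False using n W_ord_ge[OF W] by blast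
      qed
      ultimately show "n \<in> {N0..N + 1 + \<bar>d\<bar>}" by simp
    qed
    then show "finite {n \<in> UNIV. \<not> ord_ge N (?F n)}" by (rule finite_subset) simp
  qed
  then have "?F summable_on UNIV" by (rule locally_finite_summable)
  then show ?thesis unfolding subst_def by (rule has_sum_infsum)
qed

lemma subst_eqI:
  "subst_ok u v \<Longrightarrow> ((\<lambda>n. gsubst v (f $$ n) * zpow u n) has_sum s) UNIV \<Longrightarrow> subst u v f = s"
  using has_sum_subst has_sum_unique by blast

lemma subst_monom: "subst u v (fls_const c * xp n) = gsubst v c * zpow u n"
proof -
  have "((\<lambda>k. gsubst v ((fls_const c * xp n) $$ k) * zpow u k) has_sum gsubst v c * zpow u n) UNIV"
    by (rule has_sum_cong_neutral[THEN iffD1, OF _ _ _ has_sum_finiteI[of "{n}"]])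
      (auto simp: xp_nth)
  then show ?thesis unfolding subst_def by (rule infsumI)
qed

lemma subst_add: "subst_ok u v \<Longrightarrow> subst u v (f + g) = subst u v f + subst u v g"
  by (rule subst_eqI) (auto simp: gsubst_add distrib_right intro: has_sum_add has_sum_subst)

lemma bounded_additive_subst:
  assumes ok: "subst_ok u v" shows "bounded_additive (subst u v)"
proof -
  from ok obtain d where d: "\<And>c. W d (gsubst v c)" unfolding subst_ok_def by blast
  have "ord_ge (n - (\<bar>d\<bar> + 1)) (subst u v f)" if n: "ord_ge n f" for n f
  proof (rule W_ord_ge)
    show "W (d + 2 * n) (subst u v f)"
      unfolding W_def
    proof (rule spt_has_sum[OF _ has_sum_subst[OF ok]], fold W_def)
      fix k
      show "W (d + 2 * n) (gsubst v (f $$ k) * zpow u k)"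
      proof (cases "n \<le> k")
        case True
        have "W (d + 2 * k) (gsubst v (f $$ k) * zpow u k)" by (intro W_mult d subst_ok_zpow[OF ok])
        then show ?thesis by (rule W_mono) (use True in simp)
      next
        case False
        then show ?thesis using n by (simp add: ord_ge_def)
      qed
    qed
    show "2 * (n - (\<bar>d\<bar> + 1)) + 2 \<le> d + 2 * n" by arith
  qed
  then show ?thesis by (intro bounded_additiveI subst_add[OF ok]) blast
qed

lemmas subst_diff = bounded_additive_diff[OF bounded_additive_subst]
lemmas subst_uminus = bounded_additive_minus[OF bounded_additive_subst]
lemmas subst_0 = bounded_additive_0[OF bounded_additive_subst]

lemma subst_ogen_mult:
  assumes ok: "subst_ok u v" shows "subst u v (ogen g * f) = v g * subst u v f"
proof (rule subst_eqI[OF ok])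
  have "((\<lambda>n. v g * (gsubst v (f $$ n) * zpow u n)) has_sum v g * subst u v f) UNIV"
    by (rule bounded_additive_has_sum[OF bounded_additive_left_mult has_sum_subst[OF ok]])
  then show "((\<lambda>n. gsubst v ((ogen g * f) $$ n) * zpow u n) has_sum v g * subst u v f) UNIV"
    by (simp add: gsubst_gen_mult subst_okD[OF ok] mult.assoc)
qed

lemma subst_scal_xp: "subst u v (scal z * xp n) = scal z * zpow u n"
  using subst_monom[of u v "gscal z" n] by (simp add: scal_def[of z])

lemma subst_xp [simp]: "subst u v (xp n) = zpow u n"
  using subst_scal_xp[of u v 1 n] by simp

lemma subst_scal [simp]: "subst u v (scal z) = scal z"
  using subst_scal_xp[of u v z 0] by simp

lemma subst_1 [simp]: "subst u v 1 = 1"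
  using subst_scal[of u v 1] by simp

lemma subst_ogen: "subst_ok u v \<Longrightarrow> subst u v (ogen g) = v g"
  using subst_ogen_mult[of u v g 1] by simp

lemma subst_const: "subst u v (fls_const c) = gsubst v c"
  using subst_monom[of u v c 0] by simp

text \<open>The reduction to monomials is applied first to the left and then to the right factor. In
  the last case an odd value must move past a power of \<open>u\<close>, which evenness of
  \<open>u\<close> permits.\<close>

theorem subst_mult:
  assumes ok: "subst_ok u v" shows "subst u v (f * g) = subst u v f * subst u v g"
proof (rule bounded_additive_eqI[where f = f])
  note b = bounded_additive_subst[OF ok]
  show "bounded_additive (\<lambda>f. subst u v (f * g))"
    by (rule bounded_additive_comp[OF b bounded_additive_right_mult])
  show "bounded_additive (\<lambda>f. subst u v f * subst u v g)"
    by (rule bounded_additive_comp[OF bounded_additive_right_mult b])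
  show "subst u v (ogen h * f * g) = subst u v (ogen h * f) * subst u v g"
    if "subst u v (f * g) = subst u v f * subst u v g" for h f
    using that by (simp add: mult.assoc subst_ogen_mult[OF ok])
  show "subst u v (scal z * xp n * g) = subst u v (scal z * xp n) * subst u v g" for z n
  proof (rule bounded_additive_eqI[where f = g])
    show "bounded_additive (\<lambda>g. subst u v (scal z * xp n * g))"
      by (rule bounded_additive_comp[OF b bounded_additive_left_mult])
    show "bounded_additive (\<lambda>g. subst u v (scal z * xp n) * subst u v g)"
      by (rule bounded_additive_comp[OF bounded_additive_left_mult b])
    show "subst u v (scal z * xp n * (scal w * xp m)) = subst u v (scal z * xp n) * subst u v (scal w * xp m)"
      for w m
    proof -
      have "scal z * xp n * (scal w * xp m) = scal (z * w) * xp (n + m)"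
        by (metis mult.assoc scal_left_commute scal_mult xp_mult_xp)
      moreover have "scal z * zpow u n * (scal w * zpow u m) = scal (z * w) * zpow u (n + m)"
        by (metis mult.assoc scal_left_commute scal_mult subst_ok_zpow(3)[OF ok])
      ultimately show ?thesis by (simp only: subst_scal_xp)
    qed
    show "subst u v (scal z * xp n * (ogen h * f)) = subst u v (scal z * xp n) * subst u v (ogen h * f)"
      if IH: "subst u v (scal z * xp n * f) = subst u v (scal z * xp n) * subst u v f" for h f
    proof -
      have c: "even_s (scal z * xp n)" "even_s (scal z * zpow u n)"
        by (intro even_s_intros subst_ok_zpow[OF ok])+
      have "scal z * xp n * (ogen h * f) = ogen h * (scal z * xp n * f)"
        using even_s_commute[OF c(1), of "ogen h"] by (metis mult.assoc)
      moreover have "scal z * zpow u n * (v h * subst u v f) = v h * (scal z * zpow u n * subst u v f)"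
        using even_s_commute[OF c(2), of "v h"] by (metis mult.assoc)
      ultimately show ?thesis using IH by (simp add: subst_ogen_mult[OF ok] subst_scal_xp)
    qed
  qed
qed

lemma subst_scal_mult: "subst_ok u v \<Longrightarrow> subst u v (scal z * f) = scal z * subst u v f"
  by (simp add: subst_mult)

lemma subst_power: "subst_ok u v \<Longrightarrow> subst u v (f ^ n) = subst u v f ^ n"
  by (induction n) (simp_all add: subst_mult)

lemma subst_sbar:
  assumes ok: "subst_ok u v" shows "subst u v (sbar f) = sbar (subst u v f)"
proof (rule bounded_additive_eqI[where f = f])
  note b = bounded_additive_subst[OF ok]
  show "bounded_additive (\<lambda>f. subst u v (sbar f))"
    by (rule bounded_additive_comp[OF b bounded_additive_sbar])
  show "bounded_additive (\<lambda>f. sbar (subst u v f))"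
    by (rule bounded_additive_comp[OF bounded_additive_sbar b])
  show "subst u v (sbar (scal z * xp n)) = sbar (subst u v (scal z * xp n))" for z n
    using subst_ok_zpow(2)[OF ok] by (simp add: subst_scal_xp even_s_def)
  show "subst u v (sbar (ogen g * f)) = sbar (subst u v (ogen g * f))"
    if "subst u v (sbar f) = sbar (subst u v f)" for g f
    using that subst_okD(1)[OF ok, of g] by (simp add: subst_ogen_mult[OF ok] subst_uminus[OF ok] odd_s_def)
qed

lemma parity_subst:
  assumes "subst_ok u v"
  shows "even_s f \<Longrightarrow> even_s (subst u v f)" "odd_s f \<Longrightarrow> odd_s (subst u v f)"
  using subst_sbar[OF assms, of f] subst_uminus[OF assms, of f] by (auto simp: even_s_def odd_s_def)

text \<open>Both sides are additive and continuous, agree on powers of x and treat left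
  multiplication by a generator alike. Admissibility of the composite is a hypothesis because it is
  established differently at zero, from weights (\<open>subst_ok_comp\<close>), and at infinity,
  from the explicit values.\<close>

theorem subst_subst:
  assumes ok: "subst_ok u v" and ok': "subst_ok u' v'"
    and ok'': "subst_ok (subst u v u') (\<lambda>g. subst u v (v' g))"
  shows "subst u v (subst u' v' f) = subst (subst u v u') (\<lambda>g. subst u v (v' g)) f"
proof (rule bounded_additive_eqI[where f = f])
  show "bounded_additive (\<lambda>f. subst u v (subst u' v' f))"
    by (rule bounded_additive_comp[OF bounded_additive_subst[OF ok] bounded_additive_subst[OF ok']])
  show "bounded_additive (subst (subst u v u') (\<lambda>g. subst u v (v' g)))"
    by (rule bounded_additive_subst[OF ok''])
  show "subst u v (subst u' v' (scal z * xp n)) =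
      subst (subst u v u') (\<lambda>g. subst u v (v' g)) (scal z * xp n)" for z n
  proof -
    obtain w where w: "u' * w = 1" "w * u' = 1" using ok' unfolding subst_ok_def by blast
    have w': "subst u v u' * subst u v w = 1" "subst u v w * subst u v u' = 1"
      using w by (simp_all flip: subst_mult[OF ok])
    have "zpow (subst u v u') n = subst u v (zpow u' n)"
      by (simp add: zpow_def unit_inv_eq[OF w] unit_inv_eq[OF w'] subst_power[OF ok])
    then show ?thesis by (simp add: subst_scal_xp subst_scal_mult[OF ok])
  qed
  show "subst u v (subst u' v' (ogen g * f)) =
      subst (subst u v u') (\<lambda>g. subst u v (v' g)) (ogen g * f)"
    if "subst u v (subst u' v' f) = subst (subst u v u') (\<lambda>g. subst u v (v' g)) f" for g f
    using that by (simp only: subst_ogen_mult[OF ok'] subst_ogen_mult[OF ok''] subst_mult[OF ok])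
qed

lemma subst_cong:
  assumes "\<And>n S g. gcoeff (f $$ n) S \<noteq> 0 \<Longrightarrow> g \<in> S \<Longrightarrow> v g = w g"
  shows "subst u v f = subst u w f"
proof -
  have "gsubst v (f $$ n) = gsubst w (f $$ n)" for n by (rule gsubst_cong) (rule assms)
  then show ?thesis by (simp add: subst_def)
qed

lemma over_subst:
  assumes ok: "subst_ok u v" and f: "over L V f" and u: "\<And>n. over L V' (zpow u n)"
    and v: "\<And>g. g \<in> V \<Longrightarrow> over L V' (v g)" "\<And>k. enat k < L \<Longrightarrow> over L V' (v (Zeta k))"
  shows "over L V' (subst u v f)"
proof (rule over_has_sum[OF _ has_sum_subst[OF ok]])
  fix n
  show "over L V' (gsubst v (f $$ n) * zpow u n)"
  proof (intro over_mult u over_gsubst)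
    fix g S assume "gcoeff (f $$ n) S \<noteq> 0" "g \<in> S"
    then have "g \<in> {Zeta k | k. enat k < L} \<union> V" using f unfolding over_def spt_def by blast
    then show "over L V' (v g)" using v by auto
  qed
qed

text \<open>If every generator is replaced by something of at least its own weight, then no monomial
  loses weight, since \<open>u^n\<close> has weight at least 2n.\<close>

lemma W_subst:
  assumes ok: "subst_ok u v" and f: "W m f" and v: "\<And>g. W (wt {g}) (v g)"
  shows "W m (subst u v f)"
  unfolding W_def
proof (rule spt_has_sum[OF _ has_sum_subst[OF ok]], fold W_def)
  fix n :: int
  have "W (m - 2 * n) (gsubst v (f $$ n))"
  proof (rule W_gsubst)
    show "W (wt {g}) (v g)" for g by (rule v)
    fix S assume S: "gcoeff (f $$ n) S \<noteq> 0"
    have "(\<Sum>g\<in>T. wt {g}) = wt T" if "finite T" for T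
      using that
    proof (induction T rule: finite_induct)
      case (insert g T)
      then show ?case using wt_insert[of g T] by simp
    qed simp
    from this[OF gcoeff_finite[OF S]] have "(\<Sum>g\<in>S. wt {g}) = wt S" .
    moreover have "m \<le> 2 * n + wt S" using f S unfolding W_def by (rule sptD)
    ultimately show "m - 2 * n \<le> (\<Sum>g\<in>S. wt {g})" by simp
  qed
  then have "W (m - 2 * n + 2 * n) (gsubst v (f $$ n) * zpow u n)"
    by (intro W_mult subst_ok_zpow[OF ok])
  then show "W m (gsubst v (f $$ n) * zpow u n)" by simp
qed

lemma subst_ok_id: "subst_ok (xp 1) ogen"
proof -
  have "W 0 (gsubst ogen c)" for c
    by (rule W_gsubst[OF W_ogen]) (simp add: sum_nonneg wt_bounds)
  moreover have "xp 1 * xp (-1) = (1::sfun)" "xp (-1) * xp 1 = (1::sfun)" by (simp_all add: xp_mult_xp)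
  ultimately show ?thesis
    unfolding subst_ok_def using W_xp[of 1] W_xp[of "-1"] by (auto intro: even_s_intros odd_s_intros)
qed

lemma subst_id: "subst (xp 1) ogen f = f"
proof (rule bounded_additive_eqI[where f = f])
  show "bounded_additive (subst (xp 1) ogen)" by (rule bounded_additive_subst[OF subst_ok_id])
  show "bounded_additive (\<lambda>f :: sfun. f)" by (rule bounded_additive_id)
qed (simp_all add: subst_scal_xp subst_ogen_mult[OF subst_ok_id])

section \<open>Exponentials of weight-raising operators\<close>

text \<open>A strict gain in weight makes the exponential series converge on every function. Complex
  linearity is what the factors 1/k! require.\<close>

definition raising :: "(sfun \<Rightarrow> sfun) \<Rightarrow> bool" where
  "raising T \<longleftrightarrow> (\<forall>f g. T (f + g) = T f + T g) \<and> (\<forall>z f. T (scal z * f) = scal z * T f) \<and>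
     (\<forall>m f. W m f \<longrightarrow> W (m + 1) (T f))"

lemma W_exists: "\<exists>m. W m f"
  using ord_ge_exists ord_ge_W by blast

lemma raising_funpow:
  assumes "raising T"
  shows "(T ^^ k) (f + g) = (T ^^ k) f + (T ^^ k) g" "(T ^^ k) (scal z * f) = scal z * (T ^^ k) f"
    "W m f \<Longrightarrow> W (m + int k) ((T ^^ k) f)"
proof -
  show "(T ^^ k) (f + g) = (T ^^ k) f + (T ^^ k) g" "(T ^^ k) (scal z * f) = scal z * (T ^^ k) f"
    using assms by (induction k) (simp_all add: raising_def)
  show "W (m + int k) ((T ^^ k) f)" if "W m f"
    using that
  proof (induction k)
    case (Suc k)
    then have "W (m + int k + 1) (T ((T ^^ k) f))" using assms unfolding raising_def by blast
    then show ?case by (simp add: add_ac)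
  qed simp
qed

lemma raising_bounded: "raising T \<Longrightarrow> bounded_additive T"
  by (rule bounded_additiveI_W[of _ "-1"]) (auto simp: raising_def)

lemma W_summable:
  assumes "\<And>k::nat. W (b + int k) (F k)" shows "(F has_sum infsum F UNIV) UNIV"
  by (rule has_sum_infsum[OF locally_finite_summable[OF W_locally_finite[OF assms]]])

lemma has_sum_exp_op:
  assumes "raising T"
  shows "((\<lambda>k. scal (1 / fact k) * (T ^^ k) f) has_sum exp_op T f) UNIV"
proof -
  obtain m where "W m f" using W_exists by blast
  then show ?thesis
    unfolding exp_op_def by (intro W_summable[of m] W_arith raising_funpow(3)[OF assms])
qed

lemma exp_op_eqI:
  "((\<lambda>k. scal (1 / fact k) * (T ^^ k) f) has_sum s) UNIV \<Longrightarrow> exp_op T f = s"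
  unfolding exp_op_def by (rule infsumI)

lemma W_has_sum: "(\<And>i. i \<in> A \<Longrightarrow> W m (F i)) \<Longrightarrow> (F has_sum s) A \<Longrightarrow> W m s"
  unfolding W_def by (rule spt_has_sum)

lemma W_exp_op: "raising T \<Longrightarrow> W m f \<Longrightarrow> W m (exp_op T f)"
  by (rule W_has_sum[OF _ has_sum_exp_op])
    (auto intro!: W_arith intro: W_mono[OF raising_funpow(3)])

lemma exp_op_add:
  assumes "raising T" shows "exp_op T (f + g) = exp_op T f + exp_op T g"
  by (rule exp_op_eqI)
    (simp add: raising_funpow(1)[OF assms] distrib_left has_sum_add has_sum_exp_op[OF assms])

lemma bounded_additive_exp_op: "raising T \<Longrightarrow> bounded_additive (exp_op T)"
  by (rule bounded_additiveI_W[of _ 0]) (simp_all add: exp_op_add W_exp_op)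

text \<open>The predicate \<open>P\<close> describes a set stable under \<open>T\<close> on which
  the two operators are intertwined; for \<open>iota\<close> this is the set of functions of x and
  Phi. Convergence of the series for \<open>U\<close> at \<open>A f\<close> is inherited from the
  one for \<open>T\<close>.\<close>

lemma exp_op_intertwine:
  assumes T: "raising T" and A: "bounded_additive A" "\<And>z f. A (scal z * f) = scal z * A f"
    and inv: "\<And>g. P g \<Longrightarrow> P (T g)" "\<And>g. P g \<Longrightarrow> A (T g) = U (A g)" and f: "P f"
  shows "exp_op U (A f) = A (exp_op T f)"
proof (rule exp_op_eqI)
  have P: "P ((T ^^ k) f)" for k by (induction k) (auto intro: inv f)
  have "A ((T ^^ k) f) = (U ^^ k) (A f)" for k
    by (induction k) (simp_all add: inv(2)[OF P])
  then show "((\<lambda>k. scal (1 / fact k) * (U ^^ k) (A f)) has_sum A (exp_op T f)) UNIV"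
    using bounded_additive_has_sum[OF A(1) has_sum_exp_op[OF T, of f]] by (simp add: A(2))
qed

lemma exp_op_diff: "raising T \<Longrightarrow> exp_op T (f - g) = exp_op T f - exp_op T g"
  by (rule bounded_additive_diff[OF bounded_additive_exp_op])

lemma over_exp_op:
  assumes "raising T" "over L V f" "\<And>g. over L V g \<Longrightarrow> over L V (T g)"
  shows "over L V (exp_op T f)"
proof (rule over_has_sum[OF _ has_sum_exp_op[OF assms(1)]])
  have "over L V ((T ^^ k) f)" for k by (induction k) (simp_all add: assms)
  then show "over L V (scal (1 / fact k) * (T ^^ k) f)" for k by (intro over_mult over_arith)
qed

lemma parity_exp_op:
  assumes "raising T" "\<And>g. sbar (T g) = T (sbar g)"
  shows "even_s f \<Longrightarrow> even_s (exp_op T f)" "odd_s f \<Longrightarrow> odd_s (exp_op T f)"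
proof -
  have s: "exp_op T (sbar f) = sbar (exp_op T f)"
    by (rule exp_op_intertwine[where P = "\<lambda>_. True" and A = sbar])
      (simp_all add: assms bounded_additive_sbar)
  have "exp_op T (- f) = - exp_op T f"
    by (rule bounded_additive_minus[OF bounded_additive_exp_op[OF assms(1)]])
  then show "even_s f \<Longrightarrow> even_s (exp_op T f)" "odd_s f \<Longrightarrow> odd_s (exp_op T f)"
    using s by (auto simp: even_s_def odd_s_def)
qed

text \<open>The bound \<open>m + i + j\<close> makes the double family locally finite, so it may be
  summed by rows or along antidiagonals.\<close>

lemma has_sum_diagonal:
  fixes G :: "nat \<Rightarrow> nat \<Rightarrow> sfun"
  assumes W: "\<And>i j. W (m + int i + int j) (G i j)"
    and b: "\<And>i. (G i has_sum b i) UNIV" and s: "(b has_sum s) UNIV"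
  shows "((\<lambda>k. \<Sum>i\<le>k. G i (k - i)) has_sum s) UNIV"
proof -
  let ?F = "\<lambda>(i, j). G i j"
  have "locally_finite ?F UNIV"
    unfolding locally_finite_def
  proof
    fix N
    have "{p \<in> UNIV. \<not> ord_ge N (?F p)} \<subseteq> {..nat (2 * N + 2 - m)} \<times> {..nat (2 * N + 2 - m)}"
    proof
      fix p assume p: "p \<in> {p \<in> UNIV. \<not> ord_ge N (?F p)}"
      obtain i j where ij: "p = (i, j)" by fastforce
      then have "\<not> 2 * N + 2 \<le> m + int i + int j" using p W_ord_ge[OF W[of i j]] by auto
      then have "int i \<le> 2 * N + 2 - m" "int j \<le> 2 * N + 2 - m" by linarith+
      then show "p \<in> {..nat (2 * N + 2 - m)} \<times> {..nat (2 * N + 2 - m)}"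
        using nat_mono[of "int i" "2 * N + 2 - m"] nat_mono[of "int j" "2 * N + 2 - m"] by (simp add: ij)
    qed
    then show "finite {p \<in> UNIV. \<not> ord_ge N (?F p)}" by (rule finite_subset) simp
  qed
  then have "?F summable_on UNIV" by (rule locally_finite_summable)
  then have F: "(?F has_sum infsum ?F UNIV) UNIV" by (rule has_sum_infsum)
  then have "(?F has_sum infsum ?F UNIV) (Sigma UNIV (\<lambda>_. UNIV))" by simp
  then have "(b has_sum infsum ?F UNIV) UNIV"
    by (rule has_sum_Sigma[OF uniformly_continuous_fls_add]) (simp add: b)
  then have s': "infsum ?F UNIV = s" using s has_sum_unique by blast
  let ?S = "Sigma UNIV (\<lambda>k. {..k}) :: (nat \<times> nat) set"
  let ?h = "\<lambda>(k, i). (i, k - i)"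
  have "bij_betw ?h ?S UNIV"
    by (rule bij_betw_byWitness[where f' = "\<lambda>(i, j). (i + j, i)"]) auto
  then have h: "inj_on ?h ?S" "?h ` ?S = UNIV" by (auto simp: bij_betw_def)
  have "((?F \<circ> ?h) has_sum s) ?S"
    using F has_sum_reindex[OF h(1), of ?F s] unfolding h(2) s' by blast
  then show ?thesis
    by (rule has_sum_Sigma[OF uniformly_continuous_fls_add]) auto
qed

text \<open>Two operators occur so that \<open>U\<close> may be a derivation plus multiplication by
  a function, with \<open>T\<close> its derivation part; \<open>exp_vop2_Dp\<close> relies on this.
  For \<open>T = U\<close> it says that the exponential of a derivation is multiplicative.\<close>

lemma exp_op_mult:
  assumes T: "raising T" and U: "raising U" and leib: "\<And>f g. U (f * g) = T f * g + f * U g"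
  shows "exp_op U (f * g) = exp_op T f * exp_op U g"
proof (rule exp_op_eqI)
  define t where "t i = scal (1 / fact i) * (T ^^ i) f" for i
  define u where "u j = scal (1 / fact j) * (U ^^ j) g" for j
  have Tt: "T (t i) = scal (of_nat (Suc i)) * t (Suc i)" for i
  proof -
    have "scal (of_nat (Suc i)) * t (Suc i) = scal (of_nat (Suc i) * (1 / fact (Suc i))) * (T ^^ Suc i) f"
      by (simp only: t_def scal_mult mult.assoc)
    also have "of_nat (Suc i) * (1 / fact (Suc i)) = (1 / fact i :: complex)"
      by (simp add: fact_Suc del: of_nat_Suc)
    finally show ?thesis using T by (simp add: t_def raising_def)
  qed
  have Uu: "U (u i) = scal (of_nat (Suc i)) * u (Suc i)" for i
  proof -
    have "scal (of_nat (Suc i)) * u (Suc i) = scal (of_nat (Suc i) * (1 / fact (Suc i))) * (U ^^ Suc i) g"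
      by (simp only: u_def scal_mult mult.assoc)
    also have "of_nat (Suc i) * (1 / fact (Suc i)) = (1 / fact i :: complex)"
      by (simp add: fact_Suc del: of_nat_Suc)
    finally show ?thesis using U by (simp add: u_def raising_def)
  qed
  \<comment> \<open>The k-th term for the product is the Cauchy product of the terms
    \<open>t\<close> and \<open>u\<close>. In the induction both sides are multiplied by k + 1, and
    \<open>Tt\<close> and \<open>Uu\<close> turn the operators into index shifts.\<close>
  have *: "scal (1 / fact k) * (U ^^ k) (f * g) = (\<Sum>i\<le>k. t i * u (k - i))" for k
  proof (induction k)
    case 0
    show ?case by (simp add: t_def u_def)
  next
    case (Suc k)
    let ?p = "\<lambda>i. t i * u (Suc k - i)"
    have "scal (of_nat (Suc k)) * (scal (1 / fact (Suc k)) * (U ^^ Suc k) (f * g)) =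
        scal (of_nat (Suc k) * (1 / fact (Suc k))) * (U ^^ Suc k) (f * g)"
      by (simp only: scal_mult mult.assoc)
    also have "of_nat (Suc k) * (1 / fact (Suc k)) = (1 / fact k :: complex)"
      by (simp add: fact_Suc del: of_nat_Suc)
    also have "scal (1 / fact k) * (U ^^ Suc k) (f * g) = U (\<Sum>i\<le>k. t i * u (k - i))"
      using U by (simp add: raising_def flip: Suc)
    also have "\<dots> = (\<Sum>i\<le>k. scal (of_nat (Suc i)) * ?p (Suc i)) + (\<Sum>i\<le>k. scal (of_nat (Suc k - i)) * ?p i)"
    proof -
      have "U (t i * u (k - i)) = scal (of_nat (Suc i)) * ?p (Suc i) + scal (of_nat (Suc k - i)) * ?p i"
        if "i \<le> k" for i
        using that by (simp only: leib Tt Uu Suc_diff_le diff_Suc_Suc mult.assoc scal_left_commute)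
      then show ?thesis
        by (simp add: bounded_additive_sum[OF raising_bounded[OF U]] sum.distrib)
    qed
    also have "(\<Sum>i\<le>k. scal (of_nat (Suc i)) * ?p (Suc i)) = (\<Sum>i\<le>Suc k. scal (of_nat i) * ?p i)"
      by (subst sum.atMost_Suc_shift) simp
    also have "(\<Sum>i\<le>k. scal (of_nat (Suc k - i)) * ?p i) = (\<Sum>i\<le>Suc k. scal (of_nat (Suc k - i)) * ?p i)"
      by simp
    also have "(\<Sum>i\<le>Suc k. scal (of_nat i) * ?p i) + (\<Sum>i\<le>Suc k. scal (of_nat (Suc k - i)) * ?p i) =
        (\<Sum>i\<le>Suc k. scal (of_nat (Suc k)) * ?p i)"
      unfolding sum.distrib[symmetric]
    proof (rule sum.cong[OF refl])
      fix i assume "i \<in> {..Suc k}"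
      then have "(of_nat i :: complex) + of_nat (Suc k - i) = of_nat (Suc k)"
        by (metis atMost_iff le_add_diff_inverse of_nat_add)
      then show "scal (of_nat i) * ?p i + scal (of_nat (Suc k - i)) * ?p i = scal (of_nat (Suc k)) * ?p i"
        by (metis distrib_right scal_add)
    qed
    finally have e: "scal (of_nat (Suc k)) * (scal (1 / fact (Suc k)) * (U ^^ Suc k) (f * g)) =
        scal (of_nat (Suc k)) * (\<Sum>i\<le>Suc k. ?p i)"
      by (simp only: sum_distrib_left)
    have c: "scal (1 / of_nat (Suc k)) * (scal (of_nat (Suc k)) * h) = h" for h
    proof -
      have "(1 / of_nat (Suc k)) * of_nat (Suc k) = (1 :: complex)" by (simp del: of_nat_Suc)
      then show ?thesis by (metis mult.assoc scal_mult scal_1 mult_1)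
    qed
    show ?case using arg_cong[OF e, of "(*) (scal (1 / of_nat (Suc k)))"] unfolding c .
  qed
  obtain a b where ab: "W a f" "W b g" using W_exists by metis
  show "((\<lambda>k. scal (1 / fact k) * (U ^^ k) (f * g)) has_sum exp_op T f * exp_op U g) UNIV"
    unfolding *
  proof (rule has_sum_diagonal[where m = "a + b"])
    show "W (a + b + int i + int j) (t i * u j)" for i j
    proof -
      have "W (a + int i + (b + int j)) (t i * u j)"
        unfolding t_def u_def
        by (intro W_mult W_arith raising_funpow(3)[OF T] raising_funpow(3)[OF U] ab)
      then show ?thesis by (simp add: algebra_simps)
    qed
    show "((\<lambda>j. t i * u j) has_sum t i * exp_op U g) UNIV" for i
      unfolding u_def by (rule bounded_additive_has_sum[OF bounded_additive_left_mult has_sum_exp_op[OF U]])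
    show "((\<lambda>i. t i * exp_op U g) has_sum exp_op T f * exp_op U g) UNIV"
      unfolding t_def by (rule bounded_additive_has_sum[OF bounded_additive_right_mult has_sum_exp_op[OF T]])
  qed
qed

lemma raising_uminus: "raising T \<Longrightarrow> raising (\<lambda>f. - T f)"
  unfolding raising_def by (auto intro: W_arith)

text \<open>Along the antidiagonals the coefficient of \<open>T^k f\<close> is (1 - 1)^k / k!, which
  vanishes for k > 0.\<close>

lemma exp_op_inverse:
  assumes T: "raising T" shows "exp_op T (exp_op (\<lambda>f. - T f) f) = f"
proof -
  let ?N = "\<lambda>f. - T f"
  have N: "(?N ^^ j) f = scal ((-1) ^ j) * (T ^^ j) f" for j
    using T by (induction j) (simp_all add: raising_def scal_minus)
  define G where "G i j = scal (1 / fact i) * (T ^^ i) (scal (1 / fact j) * (?N ^^ j) f)" for i j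
  obtain m where m: "W m f" using W_exists by blast
  have "((\<lambda>k. \<Sum>i\<le>k. G i (k - i)) has_sum exp_op T (exp_op ?N f)) UNIV"
  proof (rule has_sum_diagonal[where m = m])
    show "W (m + int i + int j) (G i j)" for i j
    proof -
      have "W (m + int j + int i) (G i j)"
        unfolding G_def
        by (intro W_arith raising_funpow(3)[OF T] raising_funpow(3)[OF raising_uminus[OF T]] m)
      then show ?thesis by (simp add: algebra_simps)
    qed
    have b: "bounded_additive (\<lambda>h. scal (1 / fact i) * (T ^^ i) h)" for i
      by (rule bounded_additiveI_W[of _ 0])
        (auto simp: raising_funpow(1)[OF T] distrib_left intro!: W_arith intro: W_mono[OF raising_funpow(3)[OF T]])
    show "(G i has_sum scal (1 / fact i) * (T ^^ i) (exp_op ?N f)) UNIV" for i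
      unfolding G_def by (rule bounded_additive_has_sum[OF b has_sum_exp_op[OF raising_uminus[OF T]]])
    show "((\<lambda>i. scal (1 / fact i) * (T ^^ i) (exp_op ?N f)) has_sum exp_op T (exp_op ?N f)) UNIV"
      by (rule has_sum_exp_op[OF T])
  qed
  moreover have "(\<Sum>i\<le>k. G i (k - i)) = (if k = 0 then f else 0)" for k
  proof -
    have "G i (k - i) = scal ((-1) ^ (k - i) / (fact i * fact (k - i))) * (T ^^ k) f" if "i \<le> k" for i
    proof -
      have "G i (k - i) = scal (1 / fact i * (1 / fact (k - i)) * (-1) ^ (k - i)) * ((T ^^ i) ((T ^^ (k - i)) f))"
        unfolding G_def N raising_funpow(2)[OF T] scal_mult mult.assoc ..
      also have "(T ^^ i) ((T ^^ (k - i)) f) = (T ^^ k) f"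
        using that by (metis comp_apply funpow_add le_add_diff_inverse)
      finally show ?thesis by (simp add: field_simps)
    qed
    then have "(\<Sum>i\<le>k. G i (k - i)) = scal (\<Sum>i\<le>k. (-1) ^ (k - i) / (fact i * fact (k - i))) * (T ^^ k) f"
    proof -
      have "scal (sum c A) = (\<Sum>i\<in>A. scal (c i))" for c :: "nat \<Rightarrow> complex" and A
        by (induction A rule: infinite_finite_induct) (simp_all add: scal_add)
      then show ?thesis
        using \<open>\<And>i. i \<le> k \<Longrightarrow> G i (k - i) = _\<close> by (simp add: sum_distrib_right)
    qed
    also have "(\<Sum>i\<le>k. (-1) ^ (k - i) / (fact i * fact (k - i))) = (if k = 0 then 1 else 0 :: complex)"
    proof (cases "k = 0")
      case False
      have "(\<Sum>i\<le>k. (-1) ^ (k - i) / (fact i * fact (k - i)) :: complex) =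
          (\<Sum>i\<le>k. (-1) ^ i * of_nat (k choose i) / fact k)"
        by (rule sum.reindex_bij_witness[of _ "\<lambda>i. k - i" "\<lambda>i. k - i"])
          (auto simp: binomial_fact field_simps)
      also have "\<dots> = (\<Sum>i\<le>k. (-1) ^ i * of_nat (k choose i)) / fact k"
        by (rule sum_divide_distrib[symmetric])
      also have "\<dots> = 0" using choose_alternating_sum[of k] False by simp
      finally show ?thesis using False by simp
    qed simp
    finally show ?thesis by (cases "k = 0") simp_all
  qed
  ultimately have "((\<lambda>k::nat. if k = 0 then f else 0) has_sum exp_op T (exp_op ?N f)) UNIV" by simp
  moreover have "((\<lambda>k::nat. if k = 0 then f else 0) has_sum f) UNIV"
    by (rule has_sum_cong_neutral[THEN iffD1, OF _ _ _ has_sum_finiteI[of "{0::nat}" f "\<lambda>_. f"]]) auto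
  ultimately show ?thesis by (rule has_sum_unique)
qed

section \<open>Inverses\<close>

text \<open>The geometric series converges because \<open>m\<close> has positive weight. Being a
  limit of polynomials in \<open>m\<close>, the inverse stays in every coefficient algebra that
  contains \<open>m\<close>.\<close>

lemma inverse_one_minus:
  assumes m: "W 1 m"
  obtains w where "(1 - m) * w = 1" "w * (1 - m) = 1" "W 0 w" "\<And>L V. over L V m \<Longrightarrow> over L V w"
proof
  define w where "w = (\<Sum>\<^sub>\<infinity>k. m ^ k)"
  have W: "W (0 + int k) (m ^ k)" for k using W_power[OF m, of k] by simp
  have w: "((\<lambda>k. m ^ k) has_sum w) UNIV" unfolding w_def by (rule W_summable[OF W])
  \<comment> \<open>Removing the term with k = 0 lets the remaining series be recognised as
    \<open>m\<close> times the whole, from the left or from the right.\<close>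
  have split: "w = 1 + h" if "((\<lambda>k. m ^ Suc k) has_sum h) UNIV" for h
  proof -
    have "((\<lambda>k. m ^ k) has_sum h) (range Suc)"
      using that by (subst has_sum_reindex) (simp_all add: o_def)
    then have "((\<lambda>k. if k = 0 then 0 else m ^ k) has_sum h) UNIV"
      by (rule has_sum_cong_neutral[THEN iffD1, rotated 3]) (auto simp: image_iff gr0_conv_Suc dest: not0_implies_Suc)
    moreover have "((\<lambda>k::nat. if k = 0 then 1 else 0) has_sum (1::sfun)) UNIV"
      by (rule has_sum_cong_neutral[THEN iffD1, OF _ _ _ has_sum_finiteI[of "{0::nat}" 1 "\<lambda>_. 1"]]) auto
    ultimately have "((\<lambda>k. (if k = 0 then 1 else 0) + (if k = 0 then 0 else m ^ k)) has_sum 1 + h) UNIV"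
      by (rule has_sum_add[rotated])
    then have "((\<lambda>k. m ^ k) has_sum 1 + h) UNIV"
      by (rule has_sum_cong[THEN iffD1, rotated]) auto
    then show ?thesis using w by (rule has_sum_unique[rotated])
  qed
  have 1: "w = 1 + m * w"
    by (rule split) (use bounded_additive_has_sum[OF bounded_additive_left_mult w, of m] in simp)
  have 2: "w = 1 + w * m"
    by (rule split) (use bounded_additive_has_sum[OF bounded_additive_right_mult w, of m] in
        \<open>simp add: power_commutes\<close>)
  show "(1 - m) * w = 1" unfolding left_diff_distrib mult_1 by (metis 1 add_diff_cancel_right')
  show "w * (1 - m) = 1" unfolding right_diff_distrib mult_1_right by (metis 2 add_diff_cancel_right')
  show "W 0 w" by (rule W_has_sum[OF _ w], rule W_mono[OF W]) simp
  show "over L V w" if "over L V m" for L V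
    by (rule over_has_sum[OF _ w]) (rule over_power[OF that])
qed

section \<open>First-order operators and the chain rule\<close>

text \<open>One shape for all vector fields: \<open>b\<close> is the component along Phi, for N = 1,
  while \<open>b1\<close> and \<open>b2\<close> are those along Phi1 and Phi2, for N = 2.\<close>

definition fo :: "sfun \<Rightarrow> sfun \<Rightarrow> sfun \<Rightarrow> sfun \<Rightarrow> sfun \<Rightarrow> sfun" where
  "fo a b b1 b2 h = a * fls_deriv h + b * d_odd Phi h + b1 * d_odd Phi1 h + b2 * d_odd Phi2 h"

lemma d_odd_scal_mult [simp]: "d_odd g (scal z * f) = scal z * d_odd g f"
  by (simp add: d_odd_mult)

lemma deriv_scal_mult: "fls_deriv (scal z * f) = scal z * fls_deriv (f::sfun)"
  by simp

lemma fo_add: "fo a b b1 b2 (f + g) = fo a b b1 b2 f + fo a b b1 b2 g"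
  by (simp add: fo_def distrib_left add_ac)

lemma fo_scal: "fo a b b1 b2 (scal z * f) = scal z * fo a b b1 b2 f"
  by (simp add: fo_def distrib_left scal_left_commute)

text \<open>The derivative in x lowers the weight by 2 and an odd derivative by 1, so coefficients
  of weight 3 and 2 leave a gain of 1.\<close>

lemma raising_fo:
  assumes "W 3 a" "W 2 b" "W 2 b1" "W 2 b2" shows "raising (fo a b b1 b2)"
proof -
  have "W (m + 1) (fo a b b1 b2 f)" if f: "W m f" for m f
  proof -
    have "W (3 + (m - 2)) (a * fls_deriv f)" by (intro W_mult assms W_deriv f)
    moreover have "W (2 + (m - 1)) (b * d_odd Phi f)" by (intro W_mult assms W_d_odd f)
    moreover have "W (2 + (m - 1)) (b1 * d_odd Phi1 f)" by (intro W_mult assms W_d_odd f)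
    moreover have "W (2 + (m - 1)) (b2 * d_odd Phi2 f)" by (intro W_mult assms W_d_odd f)
    moreover have "3 + (m - 2) = m + 1" "2 + (m - 1) = m + 1" by simp_all
    ultimately show ?thesis unfolding fo_def by (metis W_arith(1))
  qed
  then show ?thesis by (auto simp: raising_def fo_add fo_scal)
qed

lemma odd_mult_bar: "odd_s b \<Longrightarrow> b * (sbar f * h) = f * (b * h)"
  using odd_s_commute[of b "sbar f"] by (simp flip: mult.assoc)

lemma even_mult_left: "even_s a \<Longrightarrow> a * (f * h) = f * (a * h)"
  using even_s_commute[of a f] by (simp flip: mult.assoc)

lemma fo_mult:
  assumes "even_s a" "odd_s b" "odd_s b1" "odd_s b2"
  shows "fo a b b1 b2 (f * g) = fo a b b1 b2 f * g + f * fo a b b1 b2 g"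
  unfolding fo_def deriv_mult d_odd_mult
  by (simp add: distrib_left distrib_right odd_mult_bar assms even_mult_left[OF assms(1)] mult.assoc add_ac
      del: fls_deriv_mult)

lemma fo_sbar:
  assumes "even_s a" "odd_s b" "odd_s b1" "odd_s b2"
  shows "sbar (fo a b b1 b2 f) = fo a b b1 b2 (sbar f)"
  using assms by (simp add: fo_def even_s_def odd_s_def d_odd_sbar deriv_sbar)

lemma over_fo:
  assumes "over L V a" "over L V b" "over L V b1" "over L V b2" "over L V f"
  shows "over L V (fo a b b1 b2 f)"
  unfolding fo_def by (intro over_arith over_mult assms)

text \<open>The sign \<open>s\<close> is 1 for even and -1 for odd derivations, so that one chain
  rule covers both. The last two conditions express the parity of \<open>\<delta>\<close> itself,
  through the way its values pass odd elements.\<close>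

definition sder :: "complex \<Rightarrow> (sfun \<Rightarrow> sfun) \<Rightarrow> bool" where
  "sder s \<delta> \<longleftrightarrow> bounded_additive \<delta> \<and> (\<forall>z. \<delta> (scal z) = 0) \<and> (\<forall>k. \<delta> (ogen (Zeta k)) = 0) \<and>
     (\<forall>w h. even_s w \<longrightarrow> \<delta> (w * h) = \<delta> w * h + w * \<delta> h) \<and>
     (\<forall>w h. odd_s w \<longrightarrow> \<delta> (w * h) = \<delta> w * h + scal s * w * \<delta> h) \<and>
     (\<forall>w r. even_s w \<longrightarrow> odd_s r \<longrightarrow> \<delta> w * r = scal s * r * \<delta> w) \<and>
     (\<forall>w r. odd_s w \<longrightarrow> odd_s r \<longrightarrow> \<delta> w * r = - (scal s * r * \<delta> w))"

lemma sderD: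
  assumes "sder s \<delta>"
  shows "bounded_additive \<delta>" "\<delta> (scal z) = 0" "\<delta> (ogen (Zeta k)) = 0"
    "even_s w \<Longrightarrow> \<delta> (w * h) = \<delta> w * h + w * \<delta> h"
    "odd_s w \<Longrightarrow> \<delta> (w * h) = \<delta> w * h + scal s * w * \<delta> h"
    "even_s w \<Longrightarrow> odd_s r \<Longrightarrow> \<delta> w * r = scal s * r * \<delta> w"
    "odd_s w \<Longrightarrow> odd_s r \<Longrightarrow> \<delta> w * r = - (scal s * r * \<delta> w)"
  using assms unfolding sder_def by blast+

lemma sder_zpow:
  assumes d: "sder s \<delta>" and ok: "subst_ok u v"
  shows "\<delta> (zpow u n) = scal (of_int n) * (\<delta> u * zpow u (n - 1))"
proof -
  have u: "even_s u" using ok by (rule subst_okD)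
  have S: "u * zpow u i = zpow u (i + 1)" for i using subst_ok_zpow(3)[OF ok, of 1 i] by (simp add: add.commute)
  have step: "\<delta> (zpow u (i + 1)) = \<delta> u * zpow u i + u * \<delta> (zpow u i)" for i
    using sderD(4)[OF d u, of "zpow u i"] unfolding S .
  show ?thesis
  proof (induction n rule: int_induct[of _ 0])
    case base
    show ?case using sderD(2)[OF d, of 1] by simp
  next
    case (step1 i)
    have "u * (\<delta> u * zpow u (i - 1)) = \<delta> u * zpow u i"
      using even_mult_left[OF u, of "\<delta> u" "zpow u (i - 1)"] S[of "i - 1"] by simp
    then show ?case using step[of i] step1
      by (simp add: scal_left_commute scal_add distrib_right)
  next
    case (step2 i)
    have "u * \<delta> (zpow u (i - 1)) = \<delta> (zpow u i) - \<delta> u * zpow u (i - 1)"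
      using step[of "i - 1"] by simp
    also have "\<dots> = scal (of_int (i - 1)) * (\<delta> u * zpow u (i - 1))"
      using step2 by (simp add: scal_diff left_diff_distrib)
    also have "\<dots> = scal (of_int (i - 1)) * (\<delta> u * (u * zpow u (i - 1 - 1)))"
      using S[of "i - 1 - 1"] by simp
    also have "\<dots> = u * (scal (of_int (i - 1)) * (\<delta> u * zpow u (i - 1 - 1)))"
      using even_mult_left[OF u, of "\<delta> u"] by (simp add: scal_left_commute)
    finally have e: "u * \<delta> (zpow u (i - 1)) = u * (scal (of_int (i - 1)) * (\<delta> u * zpow u (i - 1 - 1)))" .
    \<comment> \<open>In the downward step the formula is known after multiplication by
      \<open>u\<close>, which is now cancelled.\<close>
    have "zpow u (-1) * u = 1" using subst_ok_zpow(3)[OF ok, of "-1" 1] by simp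
    then have "zpow u (-1) * (u * h) = h" for h by (simp flip: mult.assoc)
    then show ?case using arg_cong[OF e, of "(*) (zpow u (-1))"] by simp
  qed
qed

lemma d_odd_ogen_mult: "d_odd g (ogen k * h) = (if g = k then h else 0) - ogen k * d_odd g h"
  by (simp add: d_odd_mult d_odd_ogen)

text \<open>Checked on monomials in x and under left multiplication by a generator \<open>k\<close>.
  There one term arises from \<open>\<delta>\<close> acting on \<open>v k\<close>; in the others
  \<open>v k\<close> moves to the front, with the same sign \<open>s\<close> on both sides.\<close>

theorem chain_rule:
  assumes d: "sder s \<delta>" and ok: "subst_ok u v" and z: "\<And>k. v (Zeta k) = ogen (Zeta k)"
  shows "\<delta> (subst u v h) = \<delta> u * subst u v (fls_deriv h) + \<delta> (v Phi) * subst u v (d_odd Phi h) +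
     \<delta> (v Phi1) * subst u v (d_odd Phi1 h) + \<delta> (v Phi2) * subst u v (d_odd Phi2 h)"
proof (rule bounded_additive_eqI[where f = h])
  note b = bounded_additive_subst[OF ok]
  have u: "even_s u" and v: "odd_s (v g)" for g using ok by (auto intro: subst_okD)
  show "bounded_additive (\<lambda>h. \<delta> (subst u v h))" by (rule bounded_additive_comp[OF sderD(1)[OF d] b])
  have t: "bounded_additive (\<lambda>h. w * subst u v (d_odd g h))" for w g
    by (rule bounded_additive_comp[OF bounded_additive_left_mult bounded_additive_comp[OF b bounded_additive_d_odd]])
  have t': "bounded_additive (\<lambda>h. w * subst u v (fls_deriv h))" for w
    by (rule bounded_additive_comp[OF bounded_additive_left_mult bounded_additive_comp[OF b bounded_additive_deriv]])
  show "bounded_additive (\<lambda>h. \<delta> u * subst u v (fls_deriv h) + \<delta> (v Phi) * subst u v (d_odd Phi h) +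
     \<delta> (v Phi1) * subst u v (d_odd Phi1 h) + \<delta> (v Phi2) * subst u v (d_odd Phi2 h))"
    by (rule bounded_additive_plus[OF bounded_additive_plus[OF bounded_additive_plus[OF t' t] t] t])
  show "\<delta> (subst u v (scal c * xp n)) = \<delta> u * subst u v (fls_deriv (scal c * xp n)) +
      \<delta> (v Phi) * subst u v (d_odd Phi (scal c * xp n)) +
      \<delta> (v Phi1) * subst u v (d_odd Phi1 (scal c * xp n)) + \<delta> (v Phi2) * subst u v (d_odd Phi2 (scal c * xp n))"
    for c n
  proof -
    have z0: "d_odd g (scal c * xp n) = 0" for g by simp
    have "\<delta> (scal c * zpow u n) = scal c * (scal (of_int n) * (\<delta> u * zpow u (n - 1)))"
      by (simp add: sderD(2,4)[OF d] even_s_intros sder_zpow[OF d ok])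
    moreover have "fls_deriv (scal c * xp n) = scal (c * of_int n) * xp (n - 1)"
      unfolding deriv_scal_mult deriv_xp scal_mult mult.assoc ..
    moreover have "\<delta> u * subst u v (scal (c * of_int n) * xp (n - 1)) =
        scal c * (scal (of_int n) * (\<delta> u * zpow u (n - 1)))"
      unfolding subst_scal_xp by (simp only: scal_mult mult.assoc scal_left_commute[of "\<delta> u"])
    ultimately show ?thesis
      by (simp only: z0 subst_0[OF ok] mult_zero_right add_0_right subst_scal_xp)
  qed
  show "\<delta> (subst u v (ogen k * h)) = \<delta> u * subst u v (fls_deriv (ogen k * h)) +
      \<delta> (v Phi) * subst u v (d_odd Phi (ogen k * h)) +
      \<delta> (v Phi1) * subst u v (d_odd Phi1 (ogen k * h)) + \<delta> (v Phi2) * subst u v (d_odd Phi2 (ogen k * h))"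
    if IH: "\<delta> (subst u v h) = \<delta> u * subst u v (fls_deriv h) + \<delta> (v Phi) * subst u v (d_odd Phi h) +
     \<delta> (v Phi1) * subst u v (d_odd Phi1 h) + \<delta> (v Phi2) * subst u v (d_odd Phi2 h)" for k h
  proof -
    have "\<delta> (subst u v (ogen k * h)) = \<delta> (v k) * subst u v h + scal s * v k * \<delta> (subst u v h)"
      by (simp only: subst_ogen_mult[OF ok] sderD(5)[OF d v])
    moreover have e: "\<delta> (v g) * (v k * H) = - (scal s * v k * (\<delta> (v g) * H))" for g H
    proof -
      have "\<delta> (v g) * (v k * H) = \<delta> (v g) * v k * H" by (simp only: mult.assoc)
      also have "\<dots> = - (scal s * v k * \<delta> (v g)) * H" by (simp only: sderD(7)[OF d v v])
      finally show ?thesis by (simp only: mult.assoc mult_minus_left)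
    qed
    have "\<delta> (v g) * subst u v (d_odd g (ogen k * h)) =
        (if g = k then \<delta> (v k) * subst u v h else 0) + scal s * v k * (\<delta> (v g) * subst u v (d_odd g h))" for g
      unfolding d_odd_ogen_mult subst_diff[OF ok] subst_ogen_mult[OF ok] right_diff_distrib e
      by (simp add: subst_0[OF ok])
    moreover have "\<delta> u * subst u v (fls_deriv (ogen k * h)) = scal s * v k * (\<delta> u * subst u v (fls_deriv h))"
    proof -
      have "\<delta> u * (v k * subst u v (fls_deriv h)) = scal s * v k * (\<delta> u * subst u v (fls_deriv h))"
      proof -
        have "\<delta> u * (v k * subst u v (fls_deriv h)) = \<delta> u * v k * subst u v (fls_deriv h)"
          by (simp only: mult.assoc)
        also have "\<dots> = scal s * v k * \<delta> u * subst u v (fls_deriv h)" by (simp only: sderD(6)[OF d u v])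
        finally show ?thesis by (simp only: mult.assoc)
      qed
      then show ?thesis by (simp add: subst_ogen_mult[OF ok])
    qed
    moreover have "\<delta> (v k) = 0" if "k \<noteq> Phi" "k \<noteq> Phi1" "k \<noteq> Phi2"
      using that z sderD(3)[OF d] by (cases k) auto
    ultimately show ?thesis
      unfolding IH by (cases k) (simp_all add: distrib_left add_ac)
  qed
qed

lemma sder_d_odd: "(\<And>k. g \<noteq> Zeta k) \<Longrightarrow> sder (-1) (d_odd g)"
  unfolding sder_def
proof (intro conjI allI impI)
  fix w r assume "even_s w" "odd_s r"
  then show "d_odd g w * r = scal (- 1) * r * d_odd g w"
    using odd_s_anticommute[OF parity_d_odd(2)] by (simp add: scal_minus)
next
  fix w r assume "odd_s w" "odd_s r"
  then show "d_odd g w * r = - (scal (- 1) * r * d_odd g w)"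
    using even_s_commute[OF parity_d_odd(1)] by (simp add: scal_minus)
qed (auto simp: bounded_additive_d_odd d_odd_ogen d_odd_mult even_s_def odd_s_def scal_minus)

lemma sder_deriv: "sder 1 fls_deriv"
  unfolding sder_def
proof (intro conjI allI impI)
  fix w r assume "even_s w" "odd_s r"
  then show "fls_deriv w * r = scal 1 * r * fls_deriv w"
    using even_s_commute[OF parity_deriv(2)] by simp
next
  fix w r assume "odd_s w" "odd_s r"
  then show "fls_deriv w * r = - (scal 1 * r * fls_deriv w)"
    using odd_s_anticommute[OF parity_deriv(1)] by simp
qed (auto simp: bounded_additive_deriv)

section \<open>Powers of integer-diagonalizable operators\<close>

text \<open>Applying \<open>\<kappa>\<close> to the relation and subtracting \<open>l\<close> times
  the relation eliminates the eigenvalue \<open>l\<close>. Additivity of \<open>\<kappa>\<close> is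
  enough for this, because the eigenvalues are integers.\<close>

lemma eigenvectors_independent:
  fixes c :: "int \<Rightarrow> grass"
  assumes add: "\<And>a b. \<kappa> (a + b) = \<kappa> a + \<kappa> b" and "finite A"
    and "\<And>k. k \<in> A \<Longrightarrow> \<kappa> (c k) = of_int k * c k" "sum c A = 0"
  shows "\<forall>k\<in>A. c k = 0"
  using assms(2-4)
proof (induction A arbitrary: c rule: finite_induct)
  case (insert l A)
  have z: "\<kappa> 0 = 0" using add[of 0 0] by simp
  have sum: "\<kappa> (sum f X) = (\<Sum>i\<in>X. \<kappa> (f i))" for f :: "int \<Rightarrow> grass" and X
    by (induction X rule: infinite_finite_induct) (simp_all add: z add)
  have "\<forall>k\<in>A. of_int (k - l) * c k = 0"
  proof (rule insert.IH)
    fix k assume "k \<in> A"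
    then have k: "\<kappa> (c k) = of_int k * c k" using insert.prems(1) by blast
    have m: "\<kappa> (of_nat n * c k) = of_nat n * \<kappa> (c k)" for n
      by (induction n) (simp_all add: z add distrib_right)
    have neg: "\<kappa> (- a) = - \<kappa> a" for a using add[of a "- a"] z by (simp add: minus_unique)
    have "\<kappa> (of_int j * c k) = of_int j * \<kappa> (c k)" for j
      by (cases j rule: int_cases2) (simp_all add: m neg)
    then show "\<kappa> (of_int (k - l) * c k) = of_int k * (of_int (k - l) * c k)"
      unfolding k by (metis mult.assoc mult.commute of_int_mult)
  next
    have "(\<Sum>k\<in>insert l A. of_int k * c k) = \<kappa> (\<Sum>k\<in>insert l A. c k)"
      unfolding sum using insert.prems(1) by (intro sum.cong) auto
    then have "(\<Sum>k\<in>insert l A. of_int k * c k) - of_int l * (\<Sum>k\<in>insert l A. c k) = 0"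
      using insert.prems(2) z by simp
    then show "(\<Sum>k\<in>A. of_int (k - l) * c k) = 0"
      using insert.hyps by (simp add: sum_distrib_left distrib_left left_diff_distrib sum_subtractf)
  qed
  then have A: "c k = 0" if "k \<in> A" for k
  proof -
    have "of_int (k - l) * c k = 0" using that \<open>\<forall>k\<in>A. _\<close> by blast
    then have "of_int (k - l) * gcoeff (c k) S = 0" for S
      by (metis gcoeff_0 gcoeff_of_int_mult)
    moreover have "k \<noteq> l" using that insert.hyps by blast
    ultimately show ?thesis by (intro grass_eqI) simp
  qed
  then show ?case using insert.prems(2) insert.hyps by simp
qed simp

lemma has_sum_fls_nth_finite:
  fixes F :: "'i \<Rightarrow> 'a::ab_group_add fls"
  assumes "(F has_sum s) A"
  shows "\<exists>X. finite X \<and> X \<subseteq> A \<and> (\<forall>i\<in>A - X. F i $$ n = 0) \<and> s $$ n = (\<Sum>i\<in>X. F i $$ n)"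
proof -
  obtain X where "finite X" "X \<subseteq> A" "\<forall>i\<in>A - X. ord_ge (n + 1) (F i)" "\<forall>m<n+1. s $$ m = (\<Sum>i\<in>X. F i $$ m)"
    using has_sum_fls_nth[OF assms, of "n + 1"] by metis
  then show ?thesis by (intro exI[of _ X]) (simp add: ord_ge_def)
qed

text \<open>The definite description in \<open>pow_op\<close> needs a unique eigenvector
  decomposition. As \<open>K\<close> acts on each coefficient separately and only finitely many
  summands meet a given coefficient, uniqueness reduces to
  \<open>eigenvectors_independent\<close>.\<close>

lemma pow_op_eqI:
  assumes K: "\<And>f n. K f $$ n = \<kappa> n (f $$ n)" "\<And>n a b. \<kappa> n (a + b) = \<kappa> n a + \<kappa> n b"
    and F: "\<And>k. K (F k) = of_int k * F k" "(F has_sum f) UNIV"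
    and h: "((\<lambda>k. fls_const (zpow a k) * F k) has_sum h) UNIV"
  shows "pow_op a K f = h"
proof -
  have unique: "F' = F" if F': "\<forall>k. K (F' k) = of_int k * F' k" "(F' has_sum f) UNIV" for F'
  proof
    fix k
    show "F' k = F k"
    proof (rule fls_eqI)
      fix n
      obtain X where X: "finite X" "\<forall>i\<in>UNIV - X. F i $$ n = 0" "f $$ n = (\<Sum>i\<in>X. F i $$ n)"
        using has_sum_fls_nth_finite[OF F(2)] by blast
      obtain Y where Y: "finite Y" "\<forall>i\<in>UNIV - Y. F' i $$ n = 0" "f $$ n = (\<Sum>i\<in>Y. F' i $$ n)"
        using has_sum_fls_nth_finite[OF F'(2)] by blast
      have "(\<Sum>i\<in>X. F i $$ n) = (\<Sum>i\<in>X \<union> Y. F i $$ n)"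
        by (rule sum.mono_neutral_left) (use X Y in auto)
      moreover have "(\<Sum>i\<in>Y. F' i $$ n) = (\<Sum>i\<in>X \<union> Y. F' i $$ n)"
        by (rule sum.mono_neutral_left) (use X Y in auto)
      ultimately have 0: "(\<Sum>i\<in>X \<union> Y. F' i $$ n - F i $$ n) = 0"
        using X(3) Y(3) by (simp add: sum_subtractf)
      have i: "(of_int j * G) $$ n = of_int j * G $$ n" for j and G :: sfun
        by (metis gscal_of_int scal_mult_nth scal_of_int)
      have e: "\<kappa> n (F' j $$ n - F j $$ n) = of_int j * (F' j $$ n - F j $$ n)" for j
      proof -
        have "\<kappa> n (F' j $$ n - F j $$ n) = \<kappa> n (F' j $$ n) - \<kappa> n (F j $$ n)"
          using K(2)[of n "F' j $$ n - F j $$ n" "F j $$ n"] by simp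
        then show ?thesis using F(1) F'(1) by (simp add: i right_diff_distrib flip: K(1))
      qed
      have "\<forall>j\<in>X \<union> Y. F' j $$ n - F j $$ n = 0"
        by (rule eigenvectors_independent[of "\<kappa> n", OF K(2) _ e 0]) (use X Y in simp)
      then show "F' k $$ n = F k $$ n" using X Y by (cases "k \<in> X \<union> Y") auto
    qed
  qed
  show ?thesis
    unfolding pow_op_def
  proof (rule the_equality)
    show "\<exists>F. (\<forall>k. K (F k) = of_int k * F k) \<and> (F has_sum f) UNIV \<and>
        ((\<lambda>k. fls_const (zpow a k) * F k) has_sum h) UNIV"
      using F h by blast
    show "h' = h" if "\<exists>F. (\<forall>k. K (F k) = of_int k * F k) \<and> (F has_sum f) UNIV \<and>
        ((\<lambda>k. fls_const (zpow a k) * F k) has_sum h') UNIV" for h'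
      using that unique has_sum_unique[OF _ h] by metis
  qed
qed

lemma has_sum_finite_support:
  assumes "finite A" shows "((\<lambda>k. if k \<in> A then F k else 0) has_sum sum F A) UNIV"
proof -
  have "(F has_sum sum F A) A" by (rule has_sum_finite[OF assms])
  then show ?thesis by (rule has_sum_cong_neutral[THEN iffD1, rotated 3]) auto
qed

lemma pow_op_sum:
  assumes K: "\<And>f n. K f $$ n = \<kappa> n (f $$ n)" "\<And>n a b. \<kappa> n (a + b) = \<kappa> n a + \<kappa> n b"
    and F: "finite A" "\<And>k. k \<in> A \<Longrightarrow> K (F k) = of_int k * F k"
  shows "pow_op a K (\<Sum>k\<in>A. F k) = (\<Sum>k\<in>A. fls_const (zpow a k) * F k)"
proof (rule pow_op_eqI[OF K, where F = "\<lambda>k. if k \<in> A then F k else 0"])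
  have "K 0 = 0"
  proof (rule fls_eqI)
    fix n show "K 0 $$ n = 0 $$ n" using K(1)[of 0 n] K(2)[of n 0 0] by simp
  qed
  then show "K (if k \<in> A then F k else 0) = of_int k * (if k \<in> A then F k else 0)" for k
    using F by simp
  show "((\<lambda>k. if k \<in> A then F k else 0) has_sum sum F A) UNIV"
    by (rule has_sum_finite_support[OF F(1)])
  have "(\<lambda>k. fls_const (zpow a k) * (if k \<in> A then F k else 0)) =
      (\<lambda>k. if k \<in> A then fls_const (zpow a k) * F k else 0)" by auto
  then show "((\<lambda>k. fls_const (zpow a k) * (if k \<in> A then F k else 0)) has_sum
      (\<Sum>k\<in>A. fls_const (zpow a k) * F k)) UNIV"
    using has_sum_finite_support[OF F(1), of "\<lambda>k. fls_const (zpow a k) * F k"] by simp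
qed

section \<open>Units of the coefficient algebra\<close>

lemma Lam_arith: "a \<in> Lam L V \<Longrightarrow> b \<in> Lam L V \<Longrightarrow> a + b \<in> Lam L V"
  "a \<in> Lam L V \<Longrightarrow> b \<in> Lam L V \<Longrightarrow> a - b \<in> Lam L V" "a \<in> Lam L V \<Longrightarrow> - a \<in> Lam L V"
  "a \<in> Lam L V \<Longrightarrow> b \<in> Lam L V \<Longrightarrow> a * b \<in> Lam L V" "gscal z \<in> Lam L V" "0 \<in> Lam L V" "1 \<in> Lam L V"
proof -
  assume a: "a \<in> Lam L V" and b: "b \<in> Lam L V"
  have "over L V (fls_const a + fls_const b)" "over L V (fls_const a - fls_const b)"
    "over L V (fls_const a * fls_const b)"
    by (intro over_arith over_mult over_const a b)+
  then show "a + b \<in> Lam L V" "a - b \<in> Lam L V" "a * b \<in> Lam L V"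
    unfolding over_iff by (metis fls_const_nth fls_plus_nth fls_minus_nth fls_const_mult_const)+
qed (auto simp: Lam_def gcoeff_gscal gcoeff_1)

lemma even_arith: "a \<in> grass_even \<Longrightarrow> b \<in> grass_even \<Longrightarrow> a + b \<in> grass_even"
  "a \<in> grass_even \<Longrightarrow> b \<in> grass_even \<Longrightarrow> a - b \<in> grass_even" "a \<in> grass_even \<Longrightarrow> - a \<in> grass_even"
  "a \<in> grass_even \<Longrightarrow> b \<in> grass_even \<Longrightarrow> a * b \<in> grass_even" "gscal z \<in> grass_even"
  "0 \<in> grass_even" "1 \<in> grass_even"
  by (auto simp: grass_even_iff)

lemma Lam_even_power: "a \<in> Lam_even L \<Longrightarrow> a ^ k \<in> Lam_even L"
  by (induction k) (auto intro: Lam_arith even_arith)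

text \<open>A monomial of \<open>m^k\<close> is a product of k disjoint nonempty monomials of
  \<open>m\<close>; it involves at least k generators, all from the finite set occurring in
  \<open>m\<close>.\<close>

lemma nilpotent_if_body_0:
  assumes "gcoeff m {} = 0" shows "\<exists>K. m ^ K = 0"
proof -
  let ?V = "\<Union> {S. gcoeff m S \<noteq> 0}"
  have V: "finite ?V" using finite_gsupport gcoeff_finite by (intro finite_Union) auto
  have *: "k \<le> card S \<and> S \<subseteq> ?V" if "gcoeff (m ^ k) S \<noteq> 0" for k S
    using that
  proof (induction k arbitrary: S)
    case 0
    then show ?case by (simp add: gcoeff_1 split: if_splits)
  next
    case (Suc k)
    from Suc.prems have "gcoeff (m * m ^ k) S \<noteq> 0" by simp
    then obtain T where T: "T \<subseteq> S" "gcoeff m T \<noteq> 0" "gcoeff (m ^ k) (S - T) \<noteq> 0"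
      by (rule gcoeff_mult_nonzero)
    have "k \<le> card (S - T)" "S - T \<subseteq> ?V" using Suc.IH[OF T(3)] by auto
    moreover have "T \<noteq> {}" "finite T" "finite (S - T)" "T \<subseteq> ?V"
      using T assms gcoeff_finite by auto
    moreover have "card S = card T + card (S - T)"
      using T(1) calculation by (metis Diff_disjoint Un_Diff_cancel Un_absorb1 card_Un_disjoint)
    moreover have "0 < card T" using calculation(3,4) by (simp add: card_gt_0_iff)
    moreover have "S = T \<union> (S - T)" using T(1) by auto
    ultimately show ?case by (intro conjI) (linarith, blast)
  qed
  have "m ^ Suc (card ?V) = 0"
  proof (rule grass_eqI)
    fix S
    have "\<not> (Suc (card ?V) \<le> card S \<and> S \<subseteq> ?V)" using V card_mono[OF V, of S] by auto
    then show "gcoeff (m ^ Suc (card ?V)) S = gcoeff 0 S" by (metis * gcoeff_0)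
  qed
  then show ?thesis ..
qed

lemma Lam_units_I: "a \<in> Lam_even L \<Longrightarrow> b \<in> Lam_even L \<Longrightarrow> a * b = 1 \<Longrightarrow> a \<in> Lam_units L"
  unfolding Lam_units_def by blast

text \<open>Divided by its body, the element is 1 minus a nilpotent one, for which the geometric
  series is finite.\<close>

lemma Lam_units_if_body:
  assumes c: "c \<in> Lam_even L" and nz: "gcoeff c {} \<noteq> 0"
  shows "c \<in> Lam_units L"
proof -
  define z where "z = gcoeff c {}"
  define m where "m = 1 - gscal (1 / z) * c"
  have m: "m \<in> Lam_even L" unfolding m_def using c by (intro IntI Lam_arith even_arith) auto
  have "gcoeff m {} = 0" using nz by (simp add: m_def z_def gcoeff_1 gcoeff_gscal)
  then obtain K where K: "m ^ K = 0" using nilpotent_if_body_0 by blast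
  define w where "w = (\<Sum>k<K. m ^ k)"
  have w: "w \<in> Lam_even L" unfolding w_def
    by (induction K) (auto intro: Lam_arith even_arith Lam_even_power[OF m, THEN IntD1] Lam_even_power[OF m, THEN IntD2])
  have tel: "(1 - m) * (\<Sum>k<n. m ^ k) = 1 - m ^ n" for n
    by (induction n) (simp_all add: distrib_left left_diff_distrib)
  have "gscal (1 / z) * c * w = 1" using tel[of K] K by (simp add: m_def w_def)
  then have "c * (gscal (1 / z) * w) = 1" using gscal_commute[of "1 / z" c] by (simp add: mult.assoc)
  then show ?thesis using w c by (intro Lam_units_I[of c L "gscal (1 / z) * w"]) (auto intro: Lam_arith even_arith)
qed

lemma Lam_unitsD:
  assumes "a \<in> Lam_units L"
  shows "a \<in> Lam_even L" "a \<in> Lam L {}" "a \<in> grass_even" "gcoeff a {} \<noteq> 0"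
    "a * unit_inv a = 1" "unit_inv a * a = 1" "unit_inv a \<in> Lam_units L" "a * h = h * a"
proof -
  obtain b where b: "b \<in> Lam_even L" "a * b = 1" and a: "a \<in> Lam_even L"
    using assms unfolding Lam_units_def by blast
  show "a \<in> Lam_even L" "a \<in> Lam L {}" "a \<in> grass_even" using a by auto
  have "gcoeff (a * b) {} = 1" using b by (simp add: gcoeff_1)
  then show "gcoeff a {} \<noteq> 0" by auto
  have ba: "b * a = 1" using b a grass_even_commute[of a b] by simp
  then have "unit_inv a = b" using b by (intro unit_inv_eq)
  then show "a * unit_inv a = 1" "unit_inv a * a = 1" "unit_inv a \<in> Lam_units L"
    using a b ba Lam_units_I by auto
  show "a * h = h * a" using a by (intro grass_even_commute) auto
qed

lemma Lam_units_mult: "a \<in> Lam_units L \<Longrightarrow> b \<in> Lam_units L \<Longrightarrow> a * b \<in> Lam_units L"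
proof (rule Lam_units_if_body)
  assume "a \<in> Lam_units L" "b \<in> Lam_units L"
  note D = Lam_unitsD(2-4)[OF this(1)] Lam_unitsD(2-4)[OF this(2)]
  show "a * b \<in> Lam_even L" using D by (intro IntI Lam_arith even_arith)
  show "gcoeff (a * b) {} \<noteq> 0" using D by simp
qed

lemma Lam_units_minus: "a \<in> Lam_units L \<Longrightarrow> - a \<in> Lam_units L"
  by (rule Lam_units_if_body) (auto dest: Lam_unitsD(2-4) intro: Lam_arith even_arith)

lemma Lam_units_1: "1 \<in> Lam_units L"
  by (rule Lam_units_if_body) (auto intro: Lam_arith even_arith simp: gcoeff_1)

lemma gscal_left_commute: "a * (gscal z * b) = gscal z * (a * b)"
  by (metis gscal_commute mult.assoc)

lemma even_left_commute: "a \<in> grass_even \<Longrightarrow> b * (a * c) = a * (b * c)"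
  by (metis grass_even_commute mult.assoc)

text \<open>After division by the body, a root of \<open>1 + m\<close> with \<open>m\<close>
  nilpotent is found by successive corrections. Surjectivity of the exponential map depends on it,
  since there the coefficient of x has the form \<open>a1 * a1\<close>.\<close>

lemma Lam_units_sqrt:
  assumes c: "c \<in> Lam_units L"
  obtains s where "s \<in> Lam_units L" "s * s = c"
proof -
  define z where "z = gcoeff c {}"
  have z: "z \<noteq> 0" using Lam_unitsD(4)[OF c] by (simp add: z_def)
  define m where "m = gscal (1 / z) * c - 1"
  have m: "m \<in> Lam_even L" unfolding m_def using Lam_unitsD(1)[OF c] by (intro IntI Lam_arith even_arith) auto
  have "gcoeff m {} = 0" using z by (simp add: m_def z_def gcoeff_1 gcoeff_gscal)
  then obtain K where K: "m ^ K = 0" using nilpotent_if_body_0 by blast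
  have comm: "a * b = b * a" if "a \<in> Lam_even L" for a b
    using that by (intro grass_even_commute) auto
  \<comment> \<open>The last condition keeps \<open>s\<close> equal to 1 modulo \<open>m\<close>.
    Adding half of the error to \<open>s\<close> therefore removes the error up to one more factor
    \<open>m\<close>.\<close>
  have "\<exists>s q r. s \<in> Lam_even L \<and> q \<in> Lam_even L \<and> r \<in> Lam_even L \<and>
      1 + m - s * s = m ^ Suc k * q \<and> 1 - s = m * r" for k
  proof (induction k)
    case 0
    have "1 \<in> Lam_even L" "0 \<in> Lam_even L" by (auto intro: Lam_arith even_arith)
    then show ?case by (intro exI[of _ 1] exI[of _ 0]) auto
  next
    case (Suc k)
    then obtain s q r where s: "s \<in> Lam_even L" and q: "q \<in> Lam_even L" and r: "r \<in> Lam_even L"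
      and e: "1 + m - s * s = m ^ Suc k * q" "1 - s = m * r" by blast
    define p where "p = m ^ Suc k"
    have p: "p \<in> Lam_even L" unfolding p_def by (rule Lam_even_power[OF m])
    define h where "h = gscal (1 / 2) * (p * q)"
    define h' where "h' = gscal (1 / 2) * (m ^ k * q)"
    have h': "h' \<in> Lam_even L" unfolding h'_def
      using Lam_even_power[OF m, of k] q by (intro IntI Lam_arith even_arith) auto
    have hm: "h = m * h'"
      unfolding h_def h'_def p_def power_Suc by (simp only: mult.assoc gscal_left_commute[of m])
    have h: "h \<in> Lam_even L" unfolding hm using m h' by (intro IntI Lam_arith even_arith) auto
    have hh: "h + h = p * q"
    proof -
      have "gscal (1 / 2) + gscal (1 / 2) = 1" by (simp flip: gscal_add)
      then show ?thesis unfolding h_def by (simp only: mult_1 flip: distrib_right)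
    qed
    have "1 + m - (s + h) * (s + h) = (1 + m - s * s) - s * (h + h) - h * h"
      using comm[OF h, of s] by (simp add: algebra_simps)
    also have "\<dots> = p * q - s * (p * q) - h * h" unfolding e(1) hh p_def ..
    also have "\<dots> = (1 - s) * (p * q) - h * h" by (simp add: left_diff_distrib)
    also have "(1 - s) * (p * q) = m ^ Suc (Suc k) * (r * q)"
      unfolding e(2) p_def[symmetric] power_Suc[of m "Suc k"]
      by (simp only: mult.assoc even_left_commute[OF p[THEN IntD2], of r])
    also have "h * h = m ^ Suc (Suc k) * (gscal (1 / 2) * (q * h'))"
      unfolding p_def[symmetric] power_Suc[of m "Suc k"]
    proof -
      have "h * h = gscal (1 / 2) * (p * q) * (m * h')" using h_def hm by simp
      also have "\<dots> = m * (gscal (1 / 2) * (p * q) * h')" by (simp only: mult.assoc even_left_commute[OF m[THEN IntD2]])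
      also have "\<dots> = m * (p * (gscal (1 / 2) * (q * h')))" by (simp only: mult.assoc gscal_left_commute[of p])
      finally show "h * h = m * p * (gscal (1 / 2) * (q * h'))" by (simp add: mult.assoc)
    qed
    finally have 1: "1 + m - (s + h) * (s + h) = m ^ Suc (Suc k) * (r * q - gscal (1 / 2) * (q * h'))"
      by (simp add: right_diff_distrib)
    have 2: "1 - (s + h) = m * (r - h')" using e(2) hm by (simp add: right_diff_distrib algebra_simps)
    show ?case
      by (rule exI[of _ "s + h"], rule exI[of _ "r * q - gscal (1 / 2) * (q * h')"], rule exI[of _ "r - h'"])
        (use 1 2 s h r q h' in \<open>auto intro: Lam_arith even_arith\<close>)
  qed
  then obtain s q where s: "s \<in> Lam_even L" "1 + m - s * s = m ^ Suc K * q" by blast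
  then have ss: "s * s = 1 + m" using K by simp
  have sz: "gscal (csqrt z) * gscal (csqrt z) = gscal z"
    by (metis gscal_mult power2_csqrt power2_eq_square)
  define t where "t = gscal (csqrt z) * s"
  have tt: "t * t = c"
  proof -
    have "t * t = gscal (csqrt z) * (gscal (csqrt z) * (s * s))"
      unfolding t_def by (simp only: mult.assoc gscal_left_commute[of s])
    also have "\<dots> = gscal z * (1 + m)" by (simp only: ss sz flip: mult.assoc)
    also have "\<dots> = gscal z * gscal (1 / z) * c" by (simp add: m_def mult.assoc)
    also have "\<dots> = c" using z by (simp flip: gscal_mult)
    finally show ?thesis .
  qed
  have "t \<in> Lam_even L" unfolding t_def using s by (intro IntI Lam_arith even_arith) auto
  moreover have "gcoeff t {} \<noteq> 0" using tt Lam_unitsD(4)[OF c] by (metis gcoeff_mult_body mult_zero_left)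
  ultimately have "t \<in> Lam_units L" by (rule Lam_units_if_body)
  then show ?thesis using that tt by blast
qed

text \<open>The product of \<open>s - t\<close> and \<open>s + t\<close> vanishes, and one of them
  is a unit because their bodies add up to twice that of \<open>s\<close>. This sign ambiguity is
  what the quotient by (-1, -1) in the parameters removes.\<close>

lemma Lam_units_sqrt_unique:
  assumes s: "s \<in> Lam_units L" and t: "t \<in> Lam_units L" and e: "s * s = t * t"
  shows "s = t \<or> s = - t"
proof -
  note S = Lam_unitsD[OF s] and T = Lam_unitsD[OF t]
  have z: "(s - t) * (s + t) = 0"
    using S(8)[of t] e by (simp add: algebra_simps)
  have u: "gcoeff (s - t) {} \<noteq> 0 \<or> gcoeff (s + t) {} \<noteq> 0" using S(4) T(4)
    by (auto simp: eq_neg_iff_add_eq_0)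
  have m: "s - t \<in> Lam_even L" "s + t \<in> Lam_even L" using S(2,3) T(2,3) by (auto intro: Lam_arith even_arith)
  show ?thesis
  proof (cases "gcoeff (s - t) {} \<noteq> 0")
    case True
    then have d: "s - t \<in> Lam_units L" using m(1) by (intro Lam_units_if_body)
    have "unit_inv (s - t) * ((s - t) * (s + t)) = s + t"
      using Lam_unitsD(6)[OF d] by (simp flip: mult.assoc)
    then show ?thesis unfolding z by (simp add: eq_neg_iff_add_eq_0)
  next
    case False
    then have d: "s + t \<in> Lam_units L" using u m(2) by (intro Lam_units_if_body) auto
    have "((s - t) * (s + t)) * unit_inv (s + t) = s - t"
      using Lam_unitsD(5)[OF d] by (simp add: mult.assoc)
    then show ?thesis unfolding z by simp
  qed
qed

section \<open>Leading terms\<close>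

lemma const_unit_inverse:
  assumes c: "c \<in> Lam_units L"
  shows "fls_const c * fls_const (unit_inv c) = 1" "fls_const (unit_inv c) * fls_const c = 1"
    "even_s (fls_const c)" "over L V (fls_const c)" "fls_const c * h = h * fls_const c"
proof -
  show "fls_const c * fls_const (unit_inv c) = 1" "fls_const (unit_inv c) * fls_const c = 1"
    using Lam_unitsD(5,6)[OF c] by simp_all
  show e: "even_s (fls_const c)" using Lam_unitsD(3)[OF c] by (rule even_s_intros)
  show "over L V (fls_const c)" by (rule over_mono[OF over_const[OF Lam_unitsD(2)[OF c]]]) simp
  show "fls_const c * h = h * fls_const c" by (rule even_s_commute[OF e])
qed

lemma inverse_lead_const:
  assumes c: "c \<in> Lam_units L" and q: "W 1 (q - fls_const c)"
  obtains w where "q * w = 1" "w * q = 1" "W 0 w" "\<And>V. over L V q \<Longrightarrow> over L V w"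
proof -
  let ?i = "fls_const (unit_inv c)"
  define m where "m = 1 - ?i * q"
  have m': "m = - (?i * (q - fls_const c))"
    unfolding m_def right_diff_distrib using const_unit_inverse(2)[OF c] by simp
  have "W (0 + 1) (?i * (q - fls_const c))" by (rule W_mult[OF W_const q])
  then have "W 1 m" unfolding m' by (simp add: W_arith)
  then obtain w where w: "(1 - m) * w = 1" "w * (1 - m) = 1" "W 0 w" "\<And>L V. over L V m \<Longrightarrow> over L V w"
    by (rule inverse_one_minus) blast
  have iq: "1 - m = ?i * q" by (simp add: m_def)
  have q': "q = fls_const c * (1 - m)"
    unfolding iq using const_unit_inverse(1)[OF c] by (simp flip: mult.assoc)
  have 1: "(w * ?i) * q = 1" using w(2) unfolding iq by (simp add: mult.assoc)
  have 2: "q * (w * ?i) = 1"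
  proof -
    have "q * (w * ?i) = fls_const c * ((1 - m) * w) * ?i" by (subst q') (simp add: mult.assoc)
    then show ?thesis using w(1) const_unit_inverse(1)[OF c] by simp
  qed
  have "W (0 + 0) (w * ?i)" by (rule W_mult[OF w(3) W_const])
  moreover have "over L V (w * ?i)" if "over L V q" for V
    by (intro over_mult w(4) const_unit_inverse(4)[OF Lam_unitsD(7)[OF c]])
      (auto simp: m_def intro!: over_arith over_1 over_mult that const_unit_inverse(4)[OF Lam_unitsD(7)[OF c]])
  ultimately show ?thesis using 1 2 that by simp
qed

lemma inverse_lead:
  assumes c: "c \<in> Lam_units L" and u: "W 3 (u - fls_const c * xp 1)"
  obtains w where "u * w = 1" "w * u = 1" "W (-2) w" "\<And>V. over L V u \<Longrightarrow> over L V w"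
proof -
  have xx: "xp 1 * xp (-1) = (1::sfun)" "xp (-1) * xp 1 = (1::sfun)" by (simp_all add: xp_mult_xp)
  let ?q = "u * xp (-1)"
  have "W (3 + 2 * (-1)) ((u - fls_const c * xp 1) * xp (-1))" by (rule W_mult[OF u W_xp])
  also have "(u - fls_const c * xp 1) * xp (-1) = ?q - fls_const c"
    by (simp add: left_diff_distrib mult.assoc xx)
  finally have "W 1 (?q - fls_const c)" by simp
  then obtain w where w: "?q * w = 1" "w * ?q = 1" "W 0 w" "\<And>V. over L V ?q \<Longrightarrow> over L V w"
    by (rule inverse_lead_const[OF c]) blast
  have "W (2 * (-1) + 0) (xp (-1) * w)" by (rule W_mult[OF W_xp w(3)])
  moreover have "u * (xp (-1) * w) = 1" using w(1) by (simp add: mult.assoc)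
  moreover have "xp (-1) * w * u = 1" using w(2) xp_commute[of "xp (-1) * w * u" 1]
    by (metis mult.assoc mult_1_right xp_commute xx(1))
  moreover have "over L V (xp (-1) * w)" if "over L V u" for V
    by (intro over_mult over_arith w(4) that)
  ultimately show ?thesis using that by simp
qed

lemma W_lead: "W 3 (u - fls_const c * xp 1) \<Longrightarrow> W 2 u"
proof -
  assume "W 3 (u - fls_const c * xp 1)"
  moreover have "W (0 + 2 * 1) (fls_const c * xp 1)" by (rule W_mult[OF W_const W_xp])
  ultimately have "W 2 ((u - fls_const c * xp 1) + fls_const c * xp 1)"
    by (intro W_arith(1)) (auto intro: W_mono)
  then show ?thesis by simp
qed

lemma subst_ok_lead:
  assumes c: "c \<in> Lam_units L" and u: "even_s u" "W 3 (u - fls_const c * xp 1)"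
    and v: "\<And>g. odd_s (v g)" "\<And>g. W (wt {g}) (v g)"
  shows "subst_ok u v"
proof -
  obtain w where "u * w = 1" "w * u = 1" "W (-2) w" using inverse_lead[OF c u(2)] by metis
  moreover have "W 0 (gsubst v d)" for d by (rule W_gsubst[OF v(2)]) (simp add: sum_nonneg wt_bounds)
  ultimately show ?thesis unfolding subst_ok_def using u v(1) W_lead[OF u(2)] by blast
qed

lemma over_zpow_lead:
  assumes c: "c \<in> Lam_units L" and u: "W 3 (u - fls_const c * xp 1)" "over L V u"
  shows "over L V (zpow u n)"
proof -
  obtain w where w: "u * w = 1" "w * u = 1" "over L V w" using inverse_lead[OF c u(1)] u(2) by metis
  then show ?thesis using over_power u(2) by (simp add: zpow_def unit_inv_eq[OF w(1,2)])
qed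

lemma gsubst_Lam:
  assumes "\<And>k. v (Zeta k) = ogen (Zeta k)" "c \<in> Lam L {}"
  shows "gsubst v c = fls_const c"
proof -
  have "gsubst v c = gsubst ogen c"
    by (rule gsubst_cong) (use assms in \<open>auto simp: Lam_def\<close>)
  also have "\<dots> = subst (xp 1) ogen (fls_const c)" by (simp add: subst_const)
  finally show ?thesis by (simp add: subst_id)
qed

text \<open>A continuous homomorphism is determined by its values on x and on the generators. With
  the exponential of a derivation for \<open>A\<close>, this identifies a flow with a
  substitution.\<close>

lemma hom_eq_subst:
  assumes A: "bounded_additive A" "\<And>f g. A (f * g) = A f * A g" "\<And>z. A (scal z) = scal z"
    and ok: "subst_ok (A (xp 1)) (\<lambda>g. A (ogen g))"
  shows "A h = subst (A (xp 1)) (\<lambda>g. A (ogen g)) h"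
proof (rule bounded_additive_eqI[where f = h])
  show "bounded_additive A" by (rule A(1))
  show "bounded_additive (subst (A (xp 1)) (\<lambda>g. A (ogen g)))" by (rule bounded_additive_subst[OF ok])
  show "A (scal z * xp n) = subst (A (xp 1)) (\<lambda>g. A (ogen g)) (scal z * xp n)" for z n
  proof -
    have one: "A 1 = 1" using A(3)[of 1] by simp
    have i: "A (xp 1) * A (xp (-1)) = 1" "A (xp (-1)) * A (xp 1) = 1"
      by (simp_all add: xp_mult_xp one flip: A(2))
    have p: "A (f ^ k) = A f ^ k" for f k by (induction k) (simp_all add: one A(2))
    have x: "(xp m :: sfun) ^ k = xp (int k * m)" for m k
      by (induction k) (simp_all add: xp_mult_xp algebra_simps)
    have "zpow (A (xp 1)) n = A (xp n)"
      by (auto simp: zpow_def unit_inv_eq[OF i] x simp flip: p)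
    then show ?thesis by (simp add: subst_scal_xp A)
  qed
  show "A (ogen g * f) = subst (A (xp 1)) (\<lambda>g. A (ogen g)) (ogen g * f)"
    if "A f = subst (A (xp 1)) (\<lambda>g. A (ogen g)) f" for g f
    using that by (simp add: A(2) subst_ogen_mult[OF ok])
qed

text \<open>These are the two coefficients of \<open>f\<close> as a polynomial of degree at most 1
  in \<open>g\<close>. The derivative in \<open>g\<close> kills both, and an element so killed
  contains no monomial with \<open>g\<close>.\<close>

lemma over_split:
  assumes "over L (insert g V) f"
  shows "over L V (d_odd g f)" "over L V (f - ogen g * d_odd g f)"
proof -
  have z: "g \<notin> S" if "d_odd g h = 0" "gcoeff (h $$ n) S \<noteq> 0" for h n S
  proof
    assume "g \<in> S"
    then have i: "insert g S = S" by auto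
    have "gcoeff (d_odd g h $$ n) (S - {g}) = 0" using that(1) by simp
    then show False using that(2) by (simp add: gcoeff_gderiv i)
  qed
  have s: "over L V h" if "d_odd g h = 0" "over L (insert g V) h" for h
    unfolding over_def spt_def
  proof (intro allI impI)
    fix n S assume nz: "gcoeff (h $$ n) S \<noteq> 0"
    show "S \<subseteq> {Zeta k |k. enat k < L} \<union> V"
      using that(2) nz z[OF that(1) nz] unfolding over_def spt_def by blast
  qed
  show "over L V (d_odd g f)" by (rule s) (simp_all add: over_arith assms)
  show "over L V (f - ogen g * d_odd g f)"
    by (rule s) (auto simp: d_odd_ogen_mult intro!: over_arith over_mult assms)
qed

text \<open>Without formal odd variables the weight is exactly twice the order, so an odd bound can
  be rounded up.\<close>

lemma W_over_empty: "W m f \<Longrightarrow> over L {} f \<Longrightarrow> m \<le> 2 * n + 1 \<Longrightarrow> ord_ge ((m + 1) div 2) f"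
  unfolding ord_ge_def
proof (intro allI impI grass_eqI)
  fix k S assume *: "W m f" "over L {} f" "k < (m + 1) div 2"
  show "gcoeff (f $$ k) S = gcoeff 0 S"
  proof (rule ccontr)
    assume "gcoeff (f $$ k) S \<noteq> gcoeff 0 S"
    then have nz: "gcoeff (f $$ k) S \<noteq> 0" by simp
    have "S \<inter> {Phi, Phi1, Phi2} = {}" using *(2) nz unfolding over_def spt_def by fastforce
    then have "wt S = 0" by (simp add: wt_def)
    moreover have "m \<le> 2 * k + wt S" using *(1) nz unfolding W_def by (rule sptD)
    ultimately show False using *(3) by simp
  qed
qed

section \<open>The group of \<open>N = 1\<close> superanalytic functions\<close>

text \<open>Up to higher weight the function is the dilation sending x to \<open>c\<close> x and Phi
  to \<open>d\<close> Phi.\<close>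

definition lead1 :: "grass \<Rightarrow> grass \<Rightarrow> fun1 \<Rightarrow> bool" where
  "lead1 c d f \<longleftrightarrow> W 3 (fst f - fls_const c * xp 1) \<and> W 2 (snd f - fls_const d * ogen Phi)"

definition typed1 :: "enat \<Rightarrow> fun1 \<Rightarrow> bool" where
  "typed1 L f \<longleftrightarrow> even_s (fst f) \<and> odd_s (snd f) \<and> over L {Phi} (fst f) \<and> over L {Phi} (snd f)"

lemma series_iff: "f \<in> series A m \<longleftrightarrow> (\<forall>n. f $$ n \<in> A) \<and> ord_ge m f"
  by (simp add: series_def ord_ge_def)

lemma series_even_iff: "f \<in> series (Lam L V \<inter> grass_even) m \<longleftrightarrow> over L V f \<and> even_s f \<and> ord_ge m f"
  and series_odd_iff: "f \<in> series (Lam L V \<inter> grass_odd) m \<longleftrightarrow> over L V f \<and> odd_s f \<and> ord_ge m f"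
  by (auto simp: series_iff over_iff even_s_iff odd_s_iff)

lemma W_ogen_Phi: "W 1 (ogen Phi)" "W 1 (ogen Phi1)" "W 1 (ogen Phi2)" "W 0 (ogen (Zeta k))"
  using W_ogen[of Phi] W_ogen[of Phi1] W_ogen[of Phi2] W_ogen[of "Zeta k"] by simp_all

text \<open>The prescribed shape is what the weights see: Phi G with G starting at x has weight 3
  and R starting at x has weight 2, just above the leading terms of weights 2 and 1. Conversely
  \<open>W_over_empty\<close> recovers the orders of the four components from their weights.\<close>

lemma SA_0_carrier_iff:
  "f \<in> SA_0_carrier L \<longleftrightarrow> typed1 L f \<and> (\<exists>c\<in>Lam_units L. \<exists>d\<in>Lam_units L. lead1 c d f)"
proof
  assume "f \<in> SA_0_carrier L"
  then obtain F G R H where f: "f = (F + ogen Phi * G, R + ogen Phi * H)"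
    and F: "over L {} F" "even_s F" "ord_ge 1 F" and G: "over L {} G" "odd_s G" "ord_ge 1 G"
    and R: "over L {} R" "odd_s R" "ord_ge 1 R" and H: "over L {} H" "even_s H" "ord_ge 0 H"
    and u: "F $$ 1 \<in> Lam_units L" "H $$ 0 \<in> Lam_units L"
    unfolding SA_0_carrier_def by (auto simp: series_even_iff series_odd_iff)
  have "typed1 L f"
    unfolding typed1_def f using F G R H
    by (auto intro!: over_arith over_mult intro: over_mono even_s_intros odd_s_intros)
  moreover have "lead1 (F $$ 1) (H $$ 0) f"
  proof -
    have "ord_ge 2 (F - fls_const (F $$ 1) * xp 1)"
      using F(3) by (auto simp: ord_ge_def xp_nth)
    then have "W 3 (F - fls_const (F $$ 1) * xp 1)" by (rule W_mono[OF ord_ge_W]) simp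
    moreover have "W (1 + 2 * 1) (ogen Phi * G)" by (intro W_mult W_ogen_Phi ord_ge_W G)
    ultimately have "W 3 ((F - fls_const (F $$ 1) * xp 1) + ogen Phi * G)" by (intro W_arith(1)) simp_all
    moreover have "W (2 * 1) R" by (rule ord_ge_W[OF R(3)])
    moreover have "ord_ge 1 (H - fls_const (H $$ 0))" using H(3) by (auto simp: ord_ge_def)
    then have "W (1 + 2 * 1) (ogen Phi * (H - fls_const (H $$ 0)))" by (intro W_mult W_ogen_Phi ord_ge_W)
    then have "W 2 (ogen Phi * (H - fls_const (H $$ 0)))" by (rule W_mono) simp
    ultimately have "W 3 (F - fls_const (F $$ 1) * xp 1 + ogen Phi * G)"
      "W 2 (R + ogen Phi * (H - fls_const (H $$ 0)))"
      by (auto intro: W_arith(1))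
    then have "W 3 (F + ogen Phi * G - fls_const (F $$ 1) * xp 1)"
      "W 2 (R + ogen Phi * (H - fls_const (H $$ 0)))"
      by (simp_all add: algebra_simps)
    moreover have "ogen Phi * fls_const (H $$ 0) = fls_const (H $$ 0) * ogen Phi"
      using const_unit_inverse(5)[OF u(2)] by simp
    ultimately show ?thesis unfolding lead1_def f by (simp add: right_diff_distrib add_diff_eq)
  qed
  ultimately show "typed1 L f \<and> (\<exists>c\<in>Lam_units L. \<exists>d\<in>Lam_units L. lead1 c d f)" using u by blast
next
  assume "typed1 L f \<and> (\<exists>c\<in>Lam_units L. \<exists>d\<in>Lam_units L. lead1 c d f)"
  then obtain c d where t: "typed1 L f" and c: "c \<in> Lam_units L" and d: "d \<in> Lam_units L"
    and l: "lead1 c d f" by blast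
  obtain X P where f: "f = (X, P)" by fastforce
  have X: "even_s X" "over L {Phi} X" "W 3 (X - fls_const c * xp 1)"
    and P: "odd_s P" "over L {Phi} P" "W 2 (P - fls_const d * ogen Phi)"
    using t l unfolding typed1_def lead1_def f by auto
  let ?G = "d_odd Phi X" and ?H = "d_odd Phi P"
  let ?F = "X - ogen Phi * ?G" and ?R = "P - ogen Phi * ?H"
  have oc: "over L {} (fls_const c * xp 1)" "over L {} (fls_const d)"
    by (intro over_mult over_arith const_unit_inverse(4)[OF c] const_unit_inverse(4)[OF d])+
  have dz: "d_odd Phi (fls_const e) = 0" if "e \<in> Lam_units L" for e
  proof -
    have "gderiv Phi e = 0"
    proof (rule grass_eqI)
      fix S show "gcoeff (gderiv Phi e) S = gcoeff 0 S"
        using Lam_unitsD(2)[OF that] by (auto simp: gcoeff_gderiv Lam_def)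
    qed
    then show ?thesis by (intro fls_eqI) simp
  qed
  have oF: "over L {} ?F" "over L {} ?G" "over L {} ?R" "over L {} ?H"
    using over_split[of L Phi "{}"] X(2) P(2) by auto
  have G3: "W 2 ?G"
  proof -
    have "W (3 - 1) (d_odd Phi (X - fls_const c * xp 1))" by (rule W_d_odd[OF X(3)])
    then show ?thesis by (simp add: d_odd_mult dz[OF c])
  qed
  have G: "ord_ge 1 ?G" using W_over_empty[OF G3 oF(2), of 1] by simp
  have "W (1 + 2) (ogen Phi * ?G)" by (intro W_mult W_ogen_Phi G3)
  then have "W 3 ((X - fls_const c * xp 1) - ogen Phi * ?G)" by (intro W_arith(2)[OF X(3)]) simp
  then have "W 3 (?F - fls_const c * xp 1)" by (simp add: algebra_simps)
  from W_over_empty[OF this, of L 1] have "ord_ge 2 (?F - fls_const c * xp 1)"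
    using oF(1) oc by (simp add: over_arith)
  then have F: "ord_ge 1 ?F" "?F $$ 1 = c"
    unfolding ord_ge_def by (auto simp: xp_nth dest!: spec[of _ 1])
  have "W (2 - 1) (d_odd Phi (P - fls_const d * ogen Phi))" by (rule W_d_odd[OF P(3)])
  moreover have "d_odd Phi (P - fls_const d * ogen Phi) = ?H - fls_const d"
    using Lam_unitsD(3)[OF d] by (simp add: d_odd_mult dz[OF d] d_odd_ogen grass_even_iff)
  ultimately have H1: "W 1 (?H - fls_const d)" by simp
  from W_over_empty[OF this, of L 0] have H0: "ord_ge 1 (?H - fls_const d)"
    using oF(4) oc by (simp add: over_arith)
  then have Hk: "(?H - fls_const d) $$ k = 0" if "k < 1" for k using that by (simp add: ord_ge_def)
  have "?H $$ k = 0" if "k < 0" for k using Hk[of k] that by simp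
  then have H: "ord_ge 0 ?H" "?H $$ 0 = d" using Hk[of 0] by (simp_all add: ord_ge_def)
  have "W (1 + 1) (ogen Phi * (?H - fls_const d))" by (intro W_mult W_ogen_Phi H1)
  then have "W 2 ((P - fls_const d * ogen Phi) - ogen Phi * (?H - fls_const d))"
    by (intro W_arith(2)[OF P(3)]) simp
  also have "(P - fls_const d * ogen Phi) - ogen Phi * (?H - fls_const d) = ?R"
    using const_unit_inverse(5)[OF d, of "ogen Phi"] by (simp add: right_diff_distrib)
  finally have R: "ord_ge 1 ?R" using W_over_empty[OF _ oF(3), of 2 1] by simp
  have par: "even_s ?F" "odd_s ?G" "odd_s ?R" "even_s ?H"
    using X(1) P(1) by (auto intro!: even_s_intros odd_s_intros parity_d_odd)
  show "f \<in> SA_0_carrier L"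
    unfolding SA_0_carrier_def mem_Collect_eq series_even_iff series_odd_iff
    by (intro exI[of _ ?F] exI[of _ ?G] exI[of _ ?R] exI[of _ ?H])
      (use oF par F G H R c d in \<open>simp add: f\<close>)
qed

declare xpow.simps [simp del]

definition sub1 :: "fun1 \<Rightarrow> sfun \<Rightarrow> sfun" where
  "sub1 g = subst (fst g) (ogen(Phi := snd g))"

lemma comp1_At_0: "comp1 At_0 f g = map_prod (sub1 g) (sub1 g) f"
  by (cases f; cases g) (simp add: sub1_def Let_def)

lemma over_Zeta: "enat k < L \<Longrightarrow> over L V (ogen (Zeta k))"
  unfolding over_def by (rule spt_ogen) auto

lemma W_lead_odd: "W 2 (P - fls_const d * ogen g) \<Longrightarrow> W 1 (ogen g) \<Longrightarrow> W 1 P"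
proof -
  assume "W 2 (P - fls_const d * ogen g)" "W 1 (ogen g)"
  then have "W 1 (P - fls_const d * ogen g)" "W (0 + 1) (fls_const d * ogen g)"
    by (auto intro: W_mono intro!: W_mult[of 0 _ 1] W_const)
  then have "W 1 (P - fls_const d * ogen g + fls_const d * ogen g)" by (intro W_arith(1)) simp_all
  then show ?thesis by simp
qed

lemma subst_ok_sub1:
  assumes "typed1 L f" "c \<in> Lam_units L" "lead1 c d f"
  shows "subst_ok (fst f) (ogen(Phi := snd f))"
proof (rule subst_ok_lead[OF assms(2)])
  show "even_s (fst f)" "W 3 (fst f - fls_const c * xp 1)" using assms by (auto simp: typed1_def lead1_def)
  have "W 1 (snd f)" using assms(3) W_lead_odd W_ogen_Phi(1) unfolding lead1_def by blast
  then show "W (wt {g}) ((ogen(Phi := snd f)) g)" for g using W_ogen[of g] by simp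
  show "odd_s ((ogen(Phi := snd f)) g)" for g using assms(1) by (simp add: typed1_def odd_s_intros)
qed

lemma SA_0_E:
  assumes "f \<in> SA_0_carrier L"
  obtains c d where "c \<in> Lam_units L" "d \<in> Lam_units L" "typed1 L f" "lead1 c d f"
    "subst_ok (fst f) (ogen(Phi := snd f))"
  using assms subst_ok_sub1 unfolding SA_0_carrier_iff by blast

lemma sub1_const:
  assumes "subst_ok (fst g) (ogen(Phi := snd g))" "c \<in> Lam L {}"
  shows "sub1 g (fls_const c * h) = fls_const c * sub1 g h"
  unfolding sub1_def subst_mult[OF assms(1)] subst_const using gsubst_Lam[OF _ assms(2)] by simp

lemma sub1_simps:
  assumes "subst_ok (fst g) (ogen(Phi := snd g))"
  shows "sub1 g (xp 1) = fst g" "sub1 g (ogen Phi) = snd g" "k \<noteq> Phi \<Longrightarrow> sub1 g (ogen k) = ogen k"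
  unfolding sub1_def using subst_ogen[OF assms] by simp_all

text \<open>Substituting \<open>g\<close> respects the weight filtration and fixes constants, so
  only the leading terms of \<open>f\<close> and \<open>g\<close> meet in the leading terms of the
  composite, and their coefficients multiply.\<close>

lemma comp1_typed_lead:
  assumes f: "typed1 L f" "lead1 c d f" and cd: "c \<in> Lam_units L" "d \<in> Lam_units L"
    and g: "typed1 L g" "lead1 c' d' g" and cd': "c' \<in> Lam_units L" "d' \<in> Lam_units L"
  shows "typed1 L (comp1 At_0 f g)" "lead1 (c * c') (d * d') (comp1 At_0 f g)"
proof -
  note ok = subst_ok_sub1[OF g(1) cd'(1) g(2)]
  have v: "W (wt {k}) ((ogen(Phi := snd g)) k)" for k
  proof -
    have "W 1 (snd g)" using g(2) W_lead_odd W_ogen_Phi(1) unfolding lead1_def by blast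
    then show ?thesis using W_ogen[of k] by simp
  qed
  have o: "over L {Phi} (sub1 g h)" if "over L {Phi} h" for h
    unfolding sub1_def
  proof (rule over_subst[OF ok that])
    show "over L {Phi} (zpow (fst g) n)" for n
      by (rule over_zpow_lead[OF cd'(1)]) (use g in \<open>auto simp: typed1_def lead1_def\<close>)
  qed (use g in \<open>auto simp: typed1_def over_Zeta\<close>)
  show "typed1 L (comp1 At_0 f g)"
    using f(1) o parity_subst[OF ok] unfolding typed1_def comp1_At_0 by (auto simp: sub1_def)
  have "W 3 (sub1 g (fst f - fls_const c * xp 1))"
    unfolding sub1_def by (rule W_subst[OF ok _ v]) (use f(2) in \<open>simp add: lead1_def\<close>)
  moreover have "sub1 g (fst f - fls_const c * xp 1) = sub1 g (fst f) - fls_const c * fst g"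
    using sub1_const[OF ok Lam_unitsD(2)[OF cd(1)], of "xp 1"] sub1_simps(1)[OF ok]
    by (simp add: sub1_def subst_diff[OF ok])
  moreover have "W (0 + 3) (fls_const c * (fst g - fls_const c' * xp 1))"
    using g(2) by (intro W_mult W_const) (simp add: lead1_def)
  ultimately have 1: "W 3 (sub1 g (fst f) - fls_const c * fst g + fls_const c * (fst g - fls_const c' * xp 1))"
    by (intro W_arith(1)) simp_all
  have "W 2 (sub1 g (snd f - fls_const d * ogen Phi))"
    unfolding sub1_def by (rule W_subst[OF ok _ v]) (use f(2) in \<open>simp add: lead1_def\<close>)
  moreover have "sub1 g (snd f - fls_const d * ogen Phi) = sub1 g (snd f) - fls_const d * snd g"
    using sub1_const[OF ok Lam_unitsD(2)[OF cd(2)], of "ogen Phi"] sub1_simps(2)[OF ok]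
    by (simp add: sub1_def subst_diff[OF ok])
  moreover have "W (0 + 2) (fls_const d * (snd g - fls_const d' * ogen Phi))"
    using g(2) by (intro W_mult W_const) (simp add: lead1_def)
  ultimately have 2: "W 2 (sub1 g (snd f) - fls_const d * snd g + fls_const d * (snd g - fls_const d' * ogen Phi))"
    by (intro W_arith(1)) simp_all
  show "lead1 (c * c') (d * d') (comp1 At_0 f g)"
    using 1 2 unfolding lead1_def comp1_At_0
    by (simp add: right_diff_distrib flip: fls_const_mult_const mult.assoc)
qed

lemma SA_0_closed: "f \<in> SA_0_carrier L \<Longrightarrow> g \<in> SA_0_carrier L \<Longrightarrow> comp1 At_0 f g \<in> SA_0_carrier L"
proof -
  assume f: "f \<in> SA_0_carrier L" and g: "g \<in> SA_0_carrier L"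
  from f obtain c d where F: "typed1 L f" "lead1 c d f" "c \<in> Lam_units L" "d \<in> Lam_units L"
    unfolding SA_0_carrier_iff by blast
  from g obtain c' d' where G: "typed1 L g" "lead1 c' d' g" "c' \<in> Lam_units L" "d' \<in> Lam_units L"
    unfolding SA_0_carrier_iff by blast
  show ?thesis
    unfolding SA_0_carrier_iff
    using comp1_typed_lead[OF F G] Lam_units_mult[OF F(3) G(3)] Lam_units_mult[OF F(4) G(4)] by blast
qed

lemma sub1_sub1:
  assumes f: "f \<in> SA_0_carrier L" and g: "g \<in> SA_0_carrier L"
  shows "sub1 g (sub1 f h) = sub1 (comp1 At_0 f g) h"
proof -
  obtain okf: "subst_ok (fst f) (ogen(Phi := snd f))" using f by (rule SA_0_E)
  obtain okg: "subst_ok (fst g) (ogen(Phi := snd g))" using g by (rule SA_0_E)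
  obtain okc: "subst_ok (fst (comp1 At_0 f g)) (ogen(Phi := snd (comp1 At_0 f g)))"
    using SA_0_closed[OF f g] by (rule SA_0_E)
  have e: "(\<lambda>k. subst (fst g) (ogen(Phi := snd g)) ((ogen(Phi := snd f)) k)) =
      ogen(Phi := snd (comp1 At_0 f g))"
    using sub1_simps(3)[OF okg] by (auto simp: comp1_At_0 fun_eq_iff) (auto simp: sub1_def)
  have e': "subst (fst g) (ogen(Phi := snd g)) (fst f) = fst (comp1 At_0 f g)"
    by (simp add: comp1_At_0 sub1_def)
  show ?thesis
    unfolding sub1_def e[symmetric] e'[symmetric]
    by (rule subst_subst[OF okg okf]) (use okc in \<open>simp only: e e'\<close>)
qed

lemma comp1_assoc:
  assumes "f \<in> SA_0_carrier L" "g \<in> SA_0_carrier L" "h \<in> SA_0_carrier L"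
  shows "comp1 At_0 (comp1 At_0 f g) h = comp1 At_0 f (comp1 At_0 g h)"
proof -
  have s: "sub1 h (sub1 g k) = sub1 (comp1 At_0 g h) k" for k by (rule sub1_sub1[OF assms(2,3)])
  have "comp1 At_0 (comp1 At_0 f g) h = map_prod (sub1 h) (sub1 h) (map_prod (sub1 g) (sub1 g) f)"
    by (simp only: comp1_At_0)
  also have "\<dots> = map_prod (sub1 (comp1 At_0 g h)) (sub1 (comp1 At_0 g h)) f"
    by (cases f) (simp only: map_prod_simp s)
  also have "\<dots> = comp1 At_0 f (comp1 At_0 g h)" by (rule comp1_At_0[symmetric])
  finally show ?thesis .
qed

definition dil1 :: "grass \<Rightarrow> grass \<Rightarrow> fun1" where
  "dil1 c d = (fls_const c * xp 1, fls_const d * ogen Phi)"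

lemma dil1_SA_0:
  assumes "c \<in> Lam_units L" "d \<in> Lam_units L"
  shows "typed1 L (dil1 c d)" "lead1 c d (dil1 c d)" "dil1 c d \<in> SA_0_carrier L"
proof -
  show "typed1 L (dil1 c d)"
    unfolding typed1_def dil1_def fst_conv snd_conv
  proof (intro conjI)
    show "even_s (fls_const c * xp 1)"
      by (rule even_s_intros(4)[OF const_unit_inverse(3)[OF assms(1)] even_s_intros(7)])
    show "odd_s (fls_const d * ogen Phi)"
      by (rule odd_s_intros(4)[OF const_unit_inverse(3)[OF assms(2)] odd_s_intros(6)])
    show "over L {Phi} (fls_const c * xp 1)"
      by (rule over_mult[OF const_unit_inverse(4)[OF assms(1)] over_arith(5)])
    show "over L {Phi} (fls_const d * ogen Phi)"
      by (rule over_mult[OF const_unit_inverse(4)[OF assms(2)] over_arith(8)]) simp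
  qed
  show "lead1 c d (dil1 c d)" by (simp add: lead1_def dil1_def)
  with \<open>typed1 L (dil1 c d)\<close> show "dil1 c d \<in> SA_0_carrier L" using assms unfolding SA_0_carrier_iff by blast
qed

lemma id1_dil1: "id1 At_0 = dil1 1 1"
  by (simp add: id1_def dil1_def fls_const_1)

lemma comp1_id_left: "f \<in> SA_0_carrier L \<Longrightarrow> comp1 At_0 (id1 At_0) f = f"
  unfolding comp1_At_0 id1_def by (elim SA_0_E) (simp add: sub1_simps)

section \<open>The exponential map on \<open>N = 1\<close> vector fields\<close>

lemma has_sum_tail:
  fixes t :: "nat \<Rightarrow> sfun"
  assumes "(t has_sum s) UNIV"
  shows "((\<lambda>k. if k < n then 0 else t k) has_sum s - (\<Sum>k<n. t k)) UNIV"
proof -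
  have "((\<lambda>k. if k \<in> {..<n} then t k else 0) has_sum (\<Sum>k<n. t k)) UNIV"
    by (rule has_sum_finite_support) simp
  then have "((\<lambda>k. - (if k \<in> {..<n} then t k else 0)) has_sum - (\<Sum>k<n. t k)) UNIV"
    by (rule bounded_additive_has_sum[OF bounded_additive_uminus[OF bounded_additive_id]])
  from has_sum_add[OF assms this]
  have "((\<lambda>k. t k + - (if k \<in> {..<n} then t k else 0)) has_sum s - (\<Sum>k<n. t k)) UNIV" by simp
  also have "(\<lambda>k. t k + - (if k \<in> {..<n} then t k else 0)) = (\<lambda>k. if k < n then 0 else t k)"
    by (rule ext) simp
  finally show ?thesis .
qed

lemma exp_op_fix: "raising T \<Longrightarrow> T f = 0 \<Longrightarrow> exp_op T f = f"
proof (rule exp_op_eqI)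
  assume T: "raising T" "T f = 0"
  have z: "T 0 = 0" by (rule bounded_additive_0[OF raising_bounded[OF T(1)]])
  have "(T ^^ k) f = 0" if "k \<noteq> 0" for k
    using that
  proof (induction k)
    case (Suc k)
    then show ?case using T(2) z by (cases "k = 0") simp_all
  qed simp
  then have "(\<lambda>k. scal (1 / fact k) * (T ^^ k) f) = (\<lambda>k. if k \<in> {0::nat} then f else 0)"
    by (auto simp: fun_eq_iff)
  then show "((\<lambda>k. scal (1 / fact k) * (T ^^ k) f) has_sum f) UNIV"
    using has_sum_finite_support[of "{0::nat}" "\<lambda>_. f"] by simp
qed

text \<open>Exponent 0 contributes nothing to the difference and exponent 1 contributes
  \<open>T f - U f\<close>; every further application of the operators gains at least one more
  weight.\<close>

lemma W_exp_op_diff: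
  assumes T: "raising T" and U: "raising U" and m: "0 \<le> m"
    and D: "\<And>k f. W k f \<Longrightarrow> W (k + m + 1) (T f - U f)" and f: "W k f"
  shows "W (k + m + 2) (exp_op T f - exp_op U f - (T f - U f))"
    "W (k + m + 1) (exp_op T f - exp_op U f)"
proof -
  have pow: "W (k + m + int j) ((T ^^ j) f - (U ^^ j) f)" for j
  proof (induction j)
    case (Suc j)
    have "W (k + m + int j + 1) (T ((T ^^ j) f - (U ^^ j) f))"
      using Suc T unfolding raising_def by blast
    moreover have "W (k + int j + m + 1) (T ((U ^^ j) f) - U ((U ^^ j) f))"
      by (intro D raising_funpow(3)[OF U f])
    ultimately have "W (k + m + int (Suc j)) (T ((T ^^ j) f - (U ^^ j) f) + (T ((U ^^ j) f) - U ((U ^^ j) f)))"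
      by (intro W_arith(1)) (simp_all add: algebra_simps)
    then show ?case by (simp add: bounded_additive_diff[OF raising_bounded[OF T]])
  qed simp
  define t where "t j = scal (1 / fact j) * ((T ^^ j) f - (U ^^ j) f)" for j
  have tW: "W (k + m + int j) (t j)" for j unfolding t_def by (intro W_arith(4) pow)
  have "((\<lambda>j. scal (1 / fact j) * (T ^^ j) f + - (scal (1 / fact j) * (U ^^ j) f)) has_sum
      exp_op T f + - exp_op U f) UNIV"
    by (intro has_sum_add has_sum_exp_op T
        bounded_additive_has_sum[OF bounded_additive_uminus[OF bounded_additive_id]] U)
  then have t: "(t has_sum (exp_op T f - exp_op U f)) UNIV"
    unfolding t_def right_diff_distrib by simp
  have "(\<Sum>j<2. t j) = T f - U f" by (simp add: t_def numeral_2_eq_2)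
  with has_sum_tail[OF t, of 2]
  have "((\<lambda>j. if j < 2 then 0 else t j) has_sum (exp_op T f - exp_op U f - (T f - U f))) UNIV" by simp
  then show 2: "W (k + m + 2) (exp_op T f - exp_op U f - (T f - U f))"
    by (rule W_has_sum[rotated]) (auto intro!: W_mono[OF tW])
  have "W (k + m + 1) (exp_op T f - exp_op U f - (T f - U f) + (T f - U f))"
    by (rule W_arith(1)[OF W_mono[OF 2] D[OF f]]) simp
  then show "W (k + m + 1) (exp_op T f - exp_op U f)" by simp
qed

definition vop :: "sfun \<times> sfun \<Rightarrow> sfun \<Rightarrow> sfun" where
  "vop p = fo (fst p) (snd p) 0 0"

definition vfields :: "enat \<Rightarrow> fun1 set" where
  "vfields L = {p. typed1 L p \<and> W 3 (fst p) \<and> W 2 (snd p)}"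

definition exp1 :: "sfun \<times> sfun \<Rightarrow> fun1" where
  "exp1 p = (exp_op (vop p) (xp 1), exp_op (vop p) (ogen Phi))"

lemma raising_vop: "W 3 (fst p) \<Longrightarrow> W 2 (snd p) \<Longrightarrow> raising (vop p)"
  unfolding vop_def by (rule raising_fo) simp_all

lemma vfieldsD:
  assumes "p \<in> vfields L"
  shows "raising (vop p)" "vop p (f * g) = vop p f * g + f * vop p g" "sbar (vop p f) = vop p (sbar f)"
    "over L {Phi} f \<Longrightarrow> over L {Phi} (vop p f)"
proof -
  note p = assms[unfolded vfields_def typed1_def mem_Collect_eq]
  show "raising (vop p)" using p by (intro raising_vop) simp_all
  have "odd_s 0" by (simp add: odd_s_def)
  then show "vop p (f * g) = vop p f * g + f * vop p g" "sbar (vop p f) = vop p (sbar f)"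
    unfolding vop_def using p by (intro fo_mult fo_sbar; simp)+
  show "over L {Phi} f \<Longrightarrow> over L {Phi} (vop p f)"
    unfolding vop_def using p by (intro over_fo) (simp_all add: over_arith)
qed

lemma vop_gen: "vop p (xp 1) = fst p" "vop p (ogen g) = (if g = Phi then snd p else 0)" "vop p (scal z) = 0"
  using deriv_xp[of 1] by (simp_all add: vop_def fo_def d_odd_ogen)

lemma exp1_SA_0:
  assumes p: "p \<in> vfields L"
  shows "typed1 L (exp1 p)" "lead1 1 1 (exp1 p)" "exp1 p \<in> SA_0_carrier L"
proof -
  note r = vfieldsD(1)[OF p]
  show t: "typed1 L (exp1 p)"
    unfolding typed1_def exp1_def
    by (auto intro!: parity_exp_op[OF r vfieldsD(3)[OF p]] over_exp_op[OF r _ vfieldsD(4)[OF p]] even_s_intros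
        odd_s_intros over_arith)
  have z: "raising (\<lambda>f. 0)" unfolding raising_def by simp
  have d: "W (k + 0 + 1) (vop p f - 0)" if "W k f" for k f using r that unfolding raising_def by simp
  \<comment> \<open>The field is compared with the zero field, whose exponential is the identity;
    this yields the leading terms.\<close>
  have e0: "exp_op (\<lambda>f. 0) f = f" for f :: sfun by (rule exp_op_fix[OF z]) simp
  have "W (2 + 0 + 1) (exp_op (vop p) (xp 1) - exp_op (\<lambda>f. 0) (xp 1))"
    by (rule W_exp_op_diff(2)[OF r z _ d]) (use W_xp[of 1] in simp_all)
  moreover have "W (1 + 0 + 1) (exp_op (vop p) (ogen Phi) - exp_op (\<lambda>f. 0) (ogen Phi))"
    by (rule W_exp_op_diff(2)[OF r z _ d]) (use W_ogen_Phi(1) in simp_all)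
  ultimately show l: "lead1 1 1 (exp1 p)"
    by (simp add: lead1_def exp1_def e0 fls_const_1)
  show "exp1 p \<in> SA_0_carrier L" unfolding SA_0_carrier_iff using t l Lam_units_1 by blast
qed

lemma exp_op_vop:
  assumes p: "p \<in> vfields L" shows "exp_op (vop p) h = sub1 (exp1 p) h"
proof -
  note r = vfieldsD(1)[OF p]
  have e: "(\<lambda>g. exp_op (vop p) (ogen g)) = ogen(Phi := snd (exp1 p))"
    by (auto simp: fun_eq_iff exp1_def intro!: exp_op_fix[OF r] simp: vop_gen)
  obtain ok: "subst_ok (fst (exp1 p)) (ogen(Phi := snd (exp1 p)))" using exp1_SA_0(3)[OF p] by (rule SA_0_E)
  have "exp_op (vop p) h = subst (exp_op (vop p) (xp 1)) (\<lambda>g. exp_op (vop p) (ogen g)) h"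
  proof (rule hom_eq_subst)
    show "bounded_additive (exp_op (vop p))" by (rule bounded_additive_exp_op[OF r])
    show "exp_op (vop p) (f * g) = exp_op (vop p) f * exp_op (vop p) g" for f g
      by (rule exp_op_mult[OF r r vfieldsD(2)[OF p]])
    show "exp_op (vop p) (scal z) = scal z" for z by (rule exp_op_fix[OF r vop_gen(3)])
    show "subst_ok (exp_op (vop p) (xp 1)) (\<lambda>g. exp_op (vop p) (ogen g))"
      unfolding e using ok by (simp add: exp1_def)
  qed
  then show ?thesis unfolding e by (simp add: sub1_def exp1_def)
qed

lemma exp1_inverse:
  assumes p: "p \<in> vfields L"
  shows "(- fst p, - snd p) \<in> vfields L" "comp1 At_0 (exp1 (- fst p, - snd p)) (exp1 p) = id1 At_0"
proof -
  show "(- fst p, - snd p) \<in> vfields L"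
    using p unfolding vfields_def typed1_def by (auto intro: even_s_intros odd_s_intros over_arith W_arith)
  have n: "vop (- fst p, - snd p) = (\<lambda>f. - vop p f)"
    by (simp add: vop_def fo_def fun_eq_iff)
  show "comp1 At_0 (exp1 (- fst p, - snd p)) (exp1 p) = id1 At_0"
    unfolding comp1_At_0 exp1_def[of "(- fst p, - snd p)"] n id1_def
    using exp_op_inverse[OF vfieldsD(1)[OF p]] by (simp flip: exp_op_vop[OF p])
qed

lemma vop_diff: "vop p f - vop q f = vop (fst p - fst q, snd p - snd q) f"
  by (simp add: vop_def fo_def algebra_simps)

lemma W_vop:
  assumes "W (m + 3) (fst p)" "W (m + 2) (snd p)" "W k f" shows "W (k + m + 1) (vop p f)"
proof -
  have "W (m + 3 + (k - 2)) (fst p * fls_deriv f)" "W (m + 2 + (k - 1)) (snd p * d_odd Phi f)"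
    by (intro W_mult assms W_deriv W_d_odd)+
  moreover have "m + 3 + (k - 2) = k + m + 1" "m + 2 + (k - 1) = k + m + 1" by simp_all
  ultimately show ?thesis unfolding vop_def fo_def by (simp add: W_arith(1))
qed

text \<open>The components are shifted differently because x and Phi have weights 2 and 1. To
  leading order the exponential changes by exactly the change of the field; injectivity and
  surjectivity both rest on this.\<close>

lemma exp1_diff:
  assumes p: "W 3 (fst p)" "W 2 (snd p)" and q: "W 3 (fst q)" "W 2 (snd q)" and m: "0 \<le> m"
    and d: "W (m + 3) (fst p - fst q)" "W (m + 2) (snd p - snd q)"
  shows "W (m + 4) (fst (exp1 p) - fst (exp1 q) - (fst p - fst q))"
    "W (m + 3) (snd (exp1 p) - snd (exp1 q) - (snd p - snd q))"
    "W (m + 3) (fst (exp1 p) - fst (exp1 q))" "W (m + 2) (snd (exp1 p) - snd (exp1 q))"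
proof -
  have D: "W (k + m + 1) (vop p f - vop q f)" if "W k f" for k f
    unfolding vop_diff by (rule W_vop[OF _ _ that]) (use d in simp_all)
  have E: "W (k + m + 2) (exp_op (vop p) f - exp_op (vop q) f - (vop p f - vop q f))"
    "W (k + m + 1) (exp_op (vop p) f - exp_op (vop q) f)" if "W k f" for k f
    by (rule W_exp_op_diff[OF raising_vop[OF p] raising_vop[OF q] m _ that], erule D)+
  have x: "W 2 (xp 1)" using W_xp[of 1] by simp
  show "W (m + 4) (fst (exp1 p) - fst (exp1 q) - (fst p - fst q))" "W (m + 3) (fst (exp1 p) - fst (exp1 q))"
    using E[OF x] by (simp_all add: exp1_def vop_gen add.commute)
  show "W (m + 3) (snd (exp1 p) - snd (exp1 q) - (snd p - snd q))" "W (m + 2) (snd (exp1 p) - snd (exp1 q))"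
    using E[OF W_ogen_Phi(1)] by (simp_all add: exp1_def vop_gen add.commute)
qed

text \<open>If two fields with the same exponential agree up to some weight,
  \<open>exp1_diff\<close> shows that they agree one weight further.\<close>

lemma exp1_inj:
  assumes p: "p \<in> vfields L" and q: "q \<in> vfields L" and e: "exp1 p = exp1 q"
  shows "p = q"
proof -
  have W: "W 3 (fst p)" "W 2 (snd p)" "W 3 (fst q)" "W 2 (snd q)" using p q by (auto simp: vfields_def)
  have "W (int m + 3) (fst p - fst q) \<and> W (int m + 2) (snd p - snd q)" for m
  proof (induction m)
    case 0
    then show ?case using W by (simp add: W_arith)
  next
    case (Suc m)
    have "W (int m + 4) (- (fst p - fst q))" "W (int m + 3) (- (snd p - snd q))"
      using exp1_diff(1,2)[OF W(1,2,3,4) _ Suc[THEN conjunct1] Suc[THEN conjunct2]] e by simp_all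
    from this[THEN W_arith(3)] show ?case by (simp add: algebra_simps)
  qed
  note I = this
  have "W m (fst p - fst q)" "W m (snd p - snd q)" for m
    by (rule W_mono[OF I[THEN conjunct1], of _ "nat m"], simp)
      (rule W_mono[OF I[THEN conjunct2], of _ "nat m"], simp)
  then have "fst p - fst q = 0" "snd p - snd q = 0" using W_all_zero by blast+
  then show ?thesis by (simp add: prod_eq_iff)
qed

text \<open>Adding the error \<open>f - exp1 p\<close> to the field cancels the leading part of the
  error, by \<open>exp1_diff\<close>, so each step gains one weight. The corrections are then
  summable, and their sum is the field.\<close>

lemma exp1_surj:
  assumes f: "typed1 L f" "lead1 1 1 f"
  obtains p where "p \<in> vfields L" "exp1 p = f"
proof -
  define step where "step p = (fst p + (fst f - fst (exp1 p)), snd p + (snd f - snd (exp1 p)))" for p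
  define q where "q n = (step ^^ n) (0, 0)" for n
  have q0: "q 0 = (0, 0)" and qS: "q (Suc n) = step (q n)" for n by (simp_all add: q_def)
  have e0: "exp1 (0, 0) = id1 At_0"
  proof -
    have v: "vop (0, 0) = (\<lambda>f. 0)" by (simp add: vop_def fo_def fun_eq_iff)
    have z: "raising (\<lambda>f. 0)" unfolding raising_def by simp
    show ?thesis unfolding exp1_def v by (simp add: exp_op_fix[OF z] id1_def)
  qed
  have inv: "q n \<in> vfields L \<and> W (int n + 3) (fst f - fst (exp1 (q n))) \<and> W (int n + 2) (snd f - snd (exp1 (q n)))" for n
  proof (induction n)
    case 0
    have "(0, 0) \<in> vfields L"
      by (simp add: vfields_def typed1_def even_s_intros odd_s_intros over_arith)
    then show ?case using f(2) unfolding q0 e0 by (simp add: lead1_def id1_def fls_const_1)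
  next
    case (Suc n)
    let ?p = "q n" and ?p' = "q (Suc n)"
    have p: "?p \<in> vfields L" using Suc by blast
    have Wp: "W 3 (fst ?p)" "W 2 (snd ?p)" using p by (auto simp: vfields_def)
    have D: "fst ?p' - fst ?p = fst f - fst (exp1 ?p)" "snd ?p' - snd ?p = snd f - snd (exp1 ?p)"
      by (simp_all add: qS step_def)
    have WD: "W (int n + 3) (fst ?p' - fst ?p)" "W (int n + 2) (snd ?p' - snd ?p)" using Suc by (simp_all add: D)
    have "W 3 (fst ?p + (fst ?p' - fst ?p))" "W 2 (snd ?p + (snd ?p' - snd ?p))"
      by (rule W_arith(1)[OF Wp(1) W_mono[OF WD(1)]], simp) (rule W_arith(1)[OF Wp(2) W_mono[OF WD(2)]], simp)
    then have Wp': "W 3 (fst ?p')" "W 2 (snd ?p')" by simp_all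
    have "typed1 L ?p'"
      using p f(1) exp1_SA_0(1)[OF p] unfolding qS step_def typed1_def vfields_def
      by (auto intro!: even_s_intros(1,2) odd_s_intros(1,2) over_arith(1,2))
    moreover note E = exp1_diff(1,2)[OF Wp' Wp _ WD]
    have "W (int n + 4) (- (fst (exp1 ?p') - fst (exp1 ?p) - (fst ?p' - fst ?p)))"
      "W (int n + 3) (- (snd (exp1 ?p') - snd (exp1 ?p) - (snd ?p' - snd ?p)))"
      by (rule W_arith(3), rule E, simp)+
    then have "W (int n + 4) (fst f - fst (exp1 ?p'))" "W (int n + 3) (snd f - snd (exp1 ?p'))"
      unfolding D by simp_all
    ultimately show ?case using Wp' by (simp add: vfields_def add.commute)
  qed
  define a where "a n = fst f - fst (exp1 (q n))" for n
  define b where "b n = snd f - snd (exp1 (q n))" for n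
  have aW: "W (3 + int n) (a n)" and bW: "W (2 + int n) (b n)" for n
    using inv[of n] by (simp_all add: a_def b_def add.commute)
  have sa: "(a has_sum infsum a UNIV) UNIV" by (rule W_summable[OF aW])
  have sb: "(b has_sum infsum b UNIV) UNIV" by (rule W_summable[OF bW])
  define p where "p = (infsum a UNIV, infsum b UNIV)"
  \<comment> \<open>The approximation \<open>q n\<close> is a partial sum of the errors, so
    \<open>p\<close> is the limit of the approximations.\<close>
  have qsum: "q n = (\<Sum>i<n. a i, \<Sum>i<n. b i)" for n
    by (induction n) (simp_all add: q0 qS step_def a_def b_def)
  have tail: "W (int n + 3) (fst p - fst (q n))" "W (int n + 2) (snd p - snd (q n))" for n
  proof -
    show "W (int n + 3) (fst p - fst (q n))"
      unfolding p_def qsum fst_conv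
      by (rule W_has_sum[OF _ has_sum_tail[OF sa, of n]]) (auto intro!: W_mono[OF aW])
    show "W (int n + 2) (snd p - snd (q n))"
      unfolding p_def qsum snd_conv
      by (rule W_has_sum[OF _ has_sum_tail[OF sb, of n]]) (auto intro!: W_mono[OF bW])
  qed
  have Wp: "W 3 (fst p)" "W 2 (snd p)" using tail[of 0] by (simp_all add: q0)
  have ta: "typed1 L (a n, b n)" for n
    using f(1) exp1_SA_0(1)[of "q n"] inv[of n] unfolding a_def b_def typed1_def
    by (auto intro!: even_s_intros(2) odd_s_intros(2) over_arith(2))
  have "even_s (fst p)" unfolding p_def fst_conv
    by (rule parity_has_sum(1)[OF sa]) (use ta in \<open>simp add: typed1_def\<close>)
  moreover have "odd_s (snd p)" unfolding p_def snd_conv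
    by (rule parity_has_sum(2)[OF sb]) (use ta in \<open>simp add: typed1_def\<close>)
  moreover have "over L {Phi} (fst p)" unfolding p_def fst_conv
    by (rule over_has_sum[OF _ sa]) (use ta in \<open>simp add: typed1_def\<close>)
  moreover have "over L {Phi} (snd p)" unfolding p_def snd_conv
    by (rule over_has_sum[OF _ sb]) (use ta in \<open>simp add: typed1_def\<close>)
  ultimately have p: "p \<in> vfields L" using Wp by (simp add: vfields_def typed1_def)
  \<comment> \<open>The error at \<open>q n\<close> and the difference between the exponentials of
    \<open>p\<close> and of \<open>q n\<close> both have weight growing with
    \<open>n\<close>.\<close>
  have I: "W (int n + 2) (fst f - fst (exp1 p)) \<and> W (int n + 2) (snd f - snd (exp1 p))" for n
  proof -
    have Wq: "W 3 (fst (q n))" "W 2 (snd (q n))" using inv[of n] by (auto simp: vfields_def)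
    note E = exp1_diff(3,4)[OF Wp Wq _ tail[of n]]
    have "W (int n + 2) ((fst f - fst (exp1 (q n))) - (fst (exp1 p) - fst (exp1 (q n))))"
      by (rule W_mono[OF W_arith(2)[OF inv[THEN conjunct2, THEN conjunct1] E(1)]]) simp_all
    moreover have "W (int n + 2) ((snd f - snd (exp1 (q n))) - (snd (exp1 p) - snd (exp1 (q n))))"
      by (rule W_arith(2)[OF inv[THEN conjunct2, THEN conjunct2] E(2)]) simp
    ultimately show ?thesis by simp
  qed
  have "W m (fst f - fst (exp1 p))" "W m (snd f - snd (exp1 p))" for m
    by (rule W_mono[OF I[THEN conjunct1], of _ "nat m"], simp)
      (rule W_mono[OF I[THEN conjunct2], of _ "nat m"], simp)
  then have "fst f - fst (exp1 p) = 0" "snd f - snd (exp1 p) = 0" using W_all_zero by blast+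
  then show ?thesis using that[OF p] by (simp add: prod_eq_iff)
qed

text \<open>Dividing the components by their leading units brings the leading terms to x and Phi,
  where \<open>exp1_surj\<close> applies; an outer dilation multiplies the units back.\<close>

lemma SA_0_factor:
  assumes c: "c \<in> Lam_units L" and d: "d \<in> Lam_units L" and f: "typed1 L f" "lead1 c d f"
  obtains p where "p \<in> vfields L" "f = comp1 At_0 (dil1 c d) (exp1 p)"
proof -
  let ?c = "unit_inv c" and ?d = "unit_inv d"
  have u: "?c \<in> Lam_units L" "?d \<in> Lam_units L" using Lam_unitsD(7) c d by auto
  define e where "e = (fls_const ?c * fst f, fls_const ?d * snd f)"
  have "typed1 L e"
    unfolding typed1_def e_def using f(1) const_unit_inverse(3,4)[OF u(1)] const_unit_inverse(3,4)[OF u(2)]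
    by (auto simp: typed1_def intro!: even_s_intros(4) odd_s_intros(4) over_mult)
  moreover have "lead1 1 1 e"
  proof -
    have "W (0 + 3) (fls_const ?c * (fst f - fls_const c * xp 1))"
      by (rule W_mult[OF W_const]) (use f(2) in \<open>simp add: lead1_def\<close>)
    moreover have "W (0 + 2) (fls_const ?d * (snd f - fls_const d * ogen Phi))"
      by (rule W_mult[OF W_const]) (use f(2) in \<open>simp add: lead1_def\<close>)
    moreover have "fls_const ?c * (fls_const c * h) = h" "fls_const ?d * (fls_const d * h) = h" for h
      using const_unit_inverse(2)[OF c] const_unit_inverse(2)[OF d] by (simp_all flip: mult.assoc)
    ultimately show ?thesis by (simp add: lead1_def e_def fls_const_1 right_diff_distrib)
  qed
  ultimately obtain p where p: "p \<in> vfields L" "exp1 p = e" by (rule exp1_surj)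
  obtain ok: "subst_ok (fst e) (ogen(Phi := snd e))" using exp1_SA_0(3)[OF p(1)] unfolding p(2) by (rule SA_0_E)
  have "fls_const c * (fls_const ?c * h) = h" "fls_const d * (fls_const ?d * h) = h" for h
    using const_unit_inverse(1)[OF c] const_unit_inverse(1)[OF d] by (simp_all flip: mult.assoc)
  moreover have "sub1 e (fls_const c * xp 1) = fls_const c * fst e" "sub1 e (fls_const d * ogen Phi) = fls_const d * snd e"
    by (simp_all add: sub1_const[OF ok Lam_unitsD(2)[OF c]] sub1_const[OF ok Lam_unitsD(2)[OF d]] sub1_simps[OF ok])
  ultimately have "comp1 At_0 (dil1 c d) (exp1 p) = f"
    unfolding comp1_At_0 dil1_def p(2) map_prod_simp by (simp add: e_def)
  then show ?thesis using that p(1) by metis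
qed

lemma comp1_dil1:
  assumes u: "c \<in> Lam_units L" "d \<in> Lam_units L"
  shows "comp1 At_0 (dil1 (unit_inv c) (unit_inv d)) (dil1 c d) = id1 At_0"
proof -
  obtain ok: "subst_ok (fst (dil1 c d)) (ogen(Phi := snd (dil1 c d)))"
    using dil1_SA_0(3)[OF u] by (rule SA_0_E)
  have "fls_const (unit_inv c) * (fls_const c * h) = h" "fls_const (unit_inv d) * (fls_const d * h) = h" for h
    using const_unit_inverse(2)[OF u(1)] const_unit_inverse(2)[OF u(2)] by (simp_all flip: mult.assoc)
  then show ?thesis
    unfolding comp1_At_0 dil1_def[of "unit_inv c"] id1_def
    by (simp add: sub1_const[OF ok Lam_unitsD(2)[OF Lam_unitsD(7)[OF u(1)]]]
        sub1_const[OF ok Lam_unitsD(2)[OF Lam_unitsD(7)[OF u(2)]]] sub1_simps[OF ok])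
      (simp add: dil1_def)
qed

theorem group_SA_0: "group (SA_0 L)"
proof (rule groupI)
  fix f g h assume f: "f \<in> carrier (SA_0 L)" and g: "g \<in> carrier (SA_0 L)" and h: "h \<in> carrier (SA_0 L)"
  show "f \<otimes>\<^bsub>SA_0 L\<^esub> g \<in> carrier (SA_0 L)" using f g SA_0_closed by (simp add: SA_0_def)
  show "f \<otimes>\<^bsub>SA_0 L\<^esub> g \<otimes>\<^bsub>SA_0 L\<^esub> h = f \<otimes>\<^bsub>SA_0 L\<^esub> (g \<otimes>\<^bsub>SA_0 L\<^esub> h)"
    using f g h comp1_assoc by (simp add: SA_0_def)
next
  show "\<one>\<^bsub>SA_0 L\<^esub> \<in> carrier (SA_0 L)" using dil1_SA_0[OF Lam_units_1 Lam_units_1] by (simp add: SA_0_def id1_dil1)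
next
  fix f assume f: "f \<in> carrier (SA_0 L)"
  show "\<one>\<^bsub>SA_0 L\<^esub> \<otimes>\<^bsub>SA_0 L\<^esub> f = f" using f comp1_id_left by (simp add: SA_0_def)
  from f have "f \<in> SA_0_carrier L" by (simp add: SA_0_def)
  then obtain c d where cd: "c \<in> Lam_units L" "d \<in> Lam_units L" and t: "typed1 L f" "lead1 c d f" by (rule SA_0_E)
  obtain p where p: "p \<in> vfields L" and fp: "f = comp1 At_0 (dil1 c d) (exp1 p)"
    using SA_0_factor[OF cd t] by metis
  \<comment> \<open>In \<open>f\<close> the dilation is composed after the flow, so in the inverse
    the reversed flow \<open>?e\<close> stands outermost.\<close>
  let ?e = "exp1 (- fst p, - snd p)" and ?l = "dil1 (unit_inv c) (unit_inv d)"
  note C = exp1_SA_0(3)[OF exp1_inverse(1)[OF p]] dil1_SA_0(3)[OF Lam_unitsD(7)[OF cd(1)] Lam_unitsD(7)[OF cd(2)]]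
    dil1_SA_0(3)[OF cd] exp1_SA_0(3)[OF p]
  have "comp1 At_0 (comp1 At_0 ?e ?l) f = comp1 At_0 ?e (comp1 At_0 ?l (comp1 At_0 (dil1 c d) (exp1 p)))"
    unfolding fp by (rule comp1_assoc[OF C(1,2) SA_0_closed[OF C(3,4)]])
  also have "comp1 At_0 ?l (comp1 At_0 (dil1 c d) (exp1 p)) = comp1 At_0 (comp1 At_0 ?l (dil1 c d)) (exp1 p)"
    by (rule comp1_assoc[OF C(2-4), symmetric])
  also have "comp1 At_0 ?e \<dots> = id1 At_0"
    unfolding comp1_dil1[OF cd] comp1_id_left[OF C(4)] by (rule exp1_inverse(2)[OF p])
  finally have "comp1 At_0 (comp1 At_0 ?e ?l) f = id1 At_0" .
  then show "\<exists>g\<in>carrier (SA_0 L). g \<otimes>\<^bsub>SA_0 L\<^esub> f = \<one>\<^bsub>SA_0 L\<^esub>"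
    using SA_0_closed[OF C(1,2)] by (auto simp: SA_0_def simp del: comp1.simps)
qed

section \<open>Parameters\<close>

lemma group_unit_group: "group (unit_group L)"
proof (rule groupI)
  fix a assume a: "a \<in> carrier (unit_group L)"
  then show "\<exists>b\<in>carrier (unit_group L). b \<otimes>\<^bsub>unit_group L\<^esub> a = \<one>\<^bsub>unit_group L\<^esub>"
    using Lam_unitsD(6,7)[of a L] by (auto simp: unit_group_def)
qed (auto simp: unit_group_def mult.assoc intro: Lam_units_mult Lam_units_1)

lemma generate_minus_one:
  "generate (unit_group L \<times>\<times> unit_group L) {(-1, -1)} = {(1, 1), (-1, -1)}" (is "generate ?G _ = _")
proof
  interpret group ?G by (intro DirProd_group group_unit_group)
  have m: "(- 1, - 1) \<in> carrier ?G" using Lam_units_minus[OF Lam_units_1] by (simp add: unit_group_def)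
  have i: "inv\<^bsub>?G\<^esub> (- 1, - 1) = (- 1, - 1)"
    by (rule inv_equality) (use m in \<open>simp_all add: unit_group_def\<close>)
  show "generate ?G {(- 1, - 1)} \<subseteq> {(1, 1), (- 1, - 1)}"
  proof
    fix p assume "p \<in> generate ?G {(- 1, - 1)}"
    then show "p \<in> {(1, 1), (- 1, - 1)}"
    proof (induction rule: generate.induct)
      case (inv h)
      then show ?case using i by simp
    next
      case (eng h k)
      then show ?case by (auto simp: unit_group_def)
    qed (simp_all add: unit_group_def)
  qed
  have "\<one>\<^bsub>?G\<^esub> \<in> generate ?G {(- 1, - 1)}" by (rule generate.one)
  moreover have "(- 1, - 1) \<in> generate ?G {(- 1, - 1)}" by (rule generate.incl) simp
  ultimately show "{(1, 1), (- 1, - 1)} \<subseteq> generate ?G {(- 1, - 1)}" by (simp add: unit_group_def)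
qed

lemma carrier_unit_pairs:
  "carrier ((unit_group L \<times>\<times> unit_group L) Mod generate (unit_group L \<times>\<times> unit_group L) {(-1, -1)}) =
     {{(a, b), (- a, - b)} | a b. a \<in> Lam_units L \<and> b \<in> Lam_units L}"
proof -
  let ?G = "unit_group L \<times>\<times> unit_group L" and ?H = "{(1, 1), (-1, -1)} :: (grass \<times> grass) set"
  have coset: "?H #>\<^bsub>?G\<^esub> (a, b) = {(a, b), (- a, - b)}" for a b
    by (auto simp: r_coset_def unit_group_def)
  have "carrier (?G Mod ?H) = (\<Union>p\<in>Lam_units L \<times> Lam_units L. {?H #>\<^bsub>?G\<^esub> p})"
    by (simp add: FactGroup_def RCOSETS_def unit_group_def)
  also have "\<dots> = (\<Union>a\<in>Lam_units L. \<Union>b\<in>Lam_units L. {?H #>\<^bsub>?G\<^esub> (a, b)})" by auto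
  finally show ?thesis unfolding generate_minus_one coset by blast
qed

definition seqs :: "enat \<Rightarrow> seqs set" where
  "seqs L = ({1..} \<rightarrow>\<^sub>E Lam_even L) \<times> ({1..} \<rightarrow>\<^sub>E Lam_even L) \<times> ({1..} \<rightarrow>\<^sub>E Lam_odd L) \<times> ({1..} \<rightarrow>\<^sub>E Lam_odd L)"

lemma params_E:
  assumes "p \<in> params L"
  obtains a1 a2 s where "p = ({(a1, a2), (- a1, - a2)}, s)" "s \<in> seqs L" "a1 \<in> Lam_units L" "a2 \<in> Lam_units L"
proof -
  obtain C s where p: "p = (C, s)" by (cases p) blast
  have "C \<in> {{(a, b), (- a, - b)} | a b. a \<in> Lam_units L \<and> b \<in> Lam_units L}" "s \<in> seqs L"
    using assms unfolding params_def carrier_unit_pairs seqs_def p by (simp_all only: mem_Sigma_iff)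
  then show ?thesis using that p by blast
qed

lemma params_I:
  assumes "s \<in> seqs L" "a1 \<in> Lam_units L" "a2 \<in> Lam_units L"
  shows "({(a1, a2), (- a1, - a2)}, s) \<in> params L"
proof -
  have "{(a1, a2), (- a1, - a2)} \<in> {{(a, b), (- a, - b)} | a b. a \<in> Lam_units L \<and> b \<in> Lam_units L}"
    using assms(2,3) by blast
  then show ?thesis
    using assms(1) unfolding params_def carrier_unit_pairs seqs_def by (simp only: mem_Sigma_iff)
qed

text \<open>Packing a parameter sequence into its generating series turns the infinite sum of
  derivations into a single first-order operator.\<close>

definition ps :: "(nat \<Rightarrow> grass) \<Rightarrow> sfun" where
  "ps c = Abs_fls (\<lambda>k. if k \<ge> 1 then c (nat k) else 0)"

lemma ps_nth: "ps c $$ k = (if k \<ge> 1 then c (nat k) else 0)"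
  unfolding ps_def by (rule nth_Abs_fls_lower_bound[of 1]) simp

lemma ord_ge_ps: "ord_ge 1 (ps c)"
  by (simp add: ord_ge_def ps_nth)

lemma has_sum_ps: "((\<lambda>n. fls_const (c n) * xp (int n)) has_sum ps c) {1..}"
proof -
  have "((\<lambda>k. fls_const (ps c $$ k) * xp k) has_sum ps c) (int ` {1..})"
  proof (rule has_sum_cong_neutral[THEN iffD1, OF _ _ _ fls_expand[of "ps c"]])
    fix k assume k: "k \<in> UNIV - int ` {1..}"
    have "\<not> k \<ge> 1"
    proof
      assume "k \<ge> 1"
      then have "k = int (nat k)" "nat k \<in> {1..}" by auto
      then show False using k by (metis DiffD2 imageI)
    qed
    then show "fls_const (ps c $$ k) * xp k = 0" by (simp add: ps_nth)
  qed auto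
  then have "((\<lambda>n. fls_const (ps c $$ int n) * xp (int n)) has_sum ps c) {1..}"
    by (subst (asm) has_sum_reindex) (simp_all add: o_def)
  then show ?thesis by (rule has_sum_cong[THEN iffD1, rotated]) (simp add: ps_nth)
qed

lemma has_sum_ps_mult: "((\<lambda>n. fls_const (c n) * (xp (int n) * h)) has_sum ps c * h) {1..}"
  using bounded_additive_has_sum[OF bounded_additive_right_mult[of h] has_sum_ps] by (simp add: mult.assoc)

lemma has_sum_ps_shift:
  "((\<lambda>n. fls_const (c n) * (xp (int n + k) * h)) has_sum ps c * (xp k * h)) {1..}"
  using has_sum_ps_mult[of c "xp k * h"] by (simp add: xp_mult_xp flip: mult.assoc)

text \<open>The factor n + 1 in L_n and the factor n in the N = 2 derivations G_{n-1/2} come from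
  differentiating the generating series; these are the cases \<open>k = 1\<close> and
  \<open>k = 0\<close>.\<close>

lemma has_sum_ps_deriv:
  "((\<lambda>n. fls_const (c n) * (scal (of_int (int n + k)) * (xp (int n + k - 1) * h))) has_sum
      fls_deriv (ps c * xp k) * h) {1..}"
proof -
  have "((\<lambda>n. fls_const (c n) * (xp (int n + k) * 1)) has_sum ps c * (xp k * 1)) {1..}"
    by (rule has_sum_ps_shift)
  from bounded_additive_has_sum[OF bounded_additive_right_mult[of h] bounded_additive_has_sum[OF bounded_additive_deriv this]]
  have "((\<lambda>n. fls_deriv (fls_const (c n) * (xp (int n + k) * 1)) * h) has_sum fls_deriv (ps c * (xp k * 1)) * h) {1..}" .
  moreover have "fls_deriv (fls_const (c n) * (xp (int n + k) * 1)) * h =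
      fls_const (c n) * (scal (of_int (int n + k)) * (xp (int n + k - 1) * h))" for n
    by (simp add: deriv_xp mult.assoc del: of_int_add)
  ultimately show ?thesis by simp
qed

lemma ps_typed:
  assumes "c \<in> {1..} \<rightarrow>\<^sub>E Lam L {} \<inter> G"
  shows "over L {} (ps c)" "G = grass_even \<Longrightarrow> even_s (ps c)" "G = grass_odd \<Longrightarrow> odd_s (ps c)" "W 2 (ps c)"
proof -
  have c: "c (nat k) \<in> Lam L {} \<inter> G" if "k \<ge> 1" for k :: int using assms that by (auto simp: PiE_iff)
  show "over L {} (ps c)" using c Lam_arith(6) by (auto simp: over_iff ps_nth)
  show "even_s (ps c)" if "G = grass_even" using c that by (auto simp: even_s_iff ps_nth even_arith)
  show "odd_s (ps c)" if "G = grass_odd" using c that by (auto simp: odd_s_iff ps_nth) (simp add: grass_odd_iff)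
  show "W 2 (ps c)" using ord_ge_W[OF ord_ge_ps, of c] by simp
qed

lemma ps_inj: "c \<in> {1..} \<rightarrow>\<^sub>E A \<Longrightarrow> c' \<in> {1..} \<rightarrow>\<^sub>E A \<Longrightarrow> ps c = ps c' \<Longrightarrow> c = c'"
proof (rule PiE_ext)
  fix n :: nat assume "ps c = ps c'" "n \<in> {1..}"
  then have "ps c $$ int n = ps c' $$ int n" "int n \<ge> 1" by auto
  then show "c n = c' n" by (simp add: ps_nth)
qed

lemma ps_surj:
  assumes "ord_ge 1 f" "\<And>n. f $$ n \<in> A"
  obtains c where "c \<in> {1..} \<rightarrow>\<^sub>E A" "ps c = f"
proof
  let ?c = "\<lambda>n\<in>{1::nat..}. f $$ int n"
  show "?c \<in> {1..} \<rightarrow>\<^sub>E A" using assms(2) by auto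
  show "ps ?c = f"
    by (rule fls_eqI) (use assms(1) in \<open>auto simp: ps_nth ord_ge_def\<close>)
qed

lemma d_odd_over: "over L V f \<Longrightarrow> g \<notin> V \<Longrightarrow> (\<And>k. g \<noteq> Zeta k) \<Longrightarrow> d_odd g f = 0"
proof (rule fls_eqI, rule grass_eqI)
  fix n S assume f: "over L V f" and g: "g \<notin> V" "\<And>k. g \<noteq> Zeta k"
  show "gcoeff (d_odd g f $$ n) S = gcoeff (0 $$ n) S"
  proof (rule ccontr)
    assume "gcoeff (d_odd g f $$ n) S \<noteq> gcoeff (0 $$ n) S"
    then have "gcoeff (f $$ n) (insert g S) \<noteq> 0" by (auto simp: gcoeff_gderiv split: if_splits)
    then show False using f g unfolding over_def spt_def by blast
  qed
qed

text \<open>The component along d/dx, and in \<open>beta1\<close> the one along d/dPhi, of minus the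
  sum of the N = 1 derivations. Moving the odd parameters to the right of Phi has changed their sign
  here.\<close>

definition alpha1 :: "seqs \<Rightarrow> sfun" where
  "alpha1 = (\<lambda>(A1, A2, M1, M2). xp 1 * ps A1 + ogen Phi * (ps M1 + scal \<i> * ps M2))"

definition beta1 :: "seqs \<Rightarrow> sfun" where
  "beta1 = (\<lambda>(A1, A2, M1, M2). ps M1 - scal \<i> * ps M2 +
     ogen Phi * (scal (1 / 2) * fls_deriv (xp 1 * ps A1) - ps A2))"

definition vf1 :: "seqs \<Rightarrow> sfun \<times> sfun" where
  "vf1 s = (alpha1 s, beta1 s)"

lemma seqsD:
  assumes "(A1, A2, M1, M2) \<in> seqs L"
  shows "over L {} (ps A1)" "over L {} (ps A2)" "over L {} (ps M1)" "over L {} (ps M2)"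
    "even_s (ps A1)" "even_s (ps A2)" "odd_s (ps M1)" "odd_s (ps M2)"
    "W 2 (ps A1)" "W 2 (ps A2)" "W 2 (ps M1)" "W 2 (ps M2)"
    "even_s (scal (1 / 2) * fls_deriv (xp 1 * ps A1))" "over L {} (scal (1 / 2) * fls_deriv (xp 1 * ps A1))"
    "W 2 (scal (1 / 2) * fls_deriv (xp 1 * ps A1))"
proof -
  show p: "over L {} (ps A1)" "over L {} (ps A2)" "over L {} (ps M1)" "over L {} (ps M2)"
    "even_s (ps A1)" "even_s (ps A2)" "odd_s (ps M1)" "odd_s (ps M2)"
    "W 2 (ps A1)" "W 2 (ps A2)" "W 2 (ps M1)" "W 2 (ps M2)"
    using assms ps_typed[of A1 L grass_even] ps_typed[of A2 L grass_even] ps_typed[of M1 L grass_odd]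
      ps_typed[of M2 L grass_odd] by (simp_all add: seqs_def)
  show "even_s (scal (1 / 2) * fls_deriv (xp 1 * ps A1))"
    by (intro even_s_intros(4) even_s_intros(6,7) parity_deriv p)
  show "over L {} (scal (1 / 2) * fls_deriv (xp 1 * ps A1))"
    by (intro over_mult over_arith p)
  have "W (2 * 1 + 2) (xp 1 * ps A1)" by (rule W_mult[OF W_xp p(9)])
  then have "W (2 * 1 + 2 - 2) (fls_deriv (xp 1 * ps A1))" by (rule W_deriv)
  then show "W 2 (scal (1 / 2) * fls_deriv (xp 1 * ps A1))" by (intro W_arith(4)) simp
qed

lemma vf1_vfields:
  assumes "s \<in> seqs L" shows "vf1 s \<in> vfields L"
proof -
  obtain A1 A2 M1 M2 where s: "s = (A1, A2, M1, M2)" by (cases s) auto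
  note p = seqsD[OF assms[unfolded s]]
  note o = over_mono[OF _ empty_subsetI, of L _ "{Phi}"]
  have m: "even_s (xp 1 * ps A1)" "odd_s (ps M1 + scal \<i> * ps M2)" "odd_s (ps M1 - scal \<i> * ps M2)"
    "even_s (scal (1 / 2) * fls_deriv (xp 1 * ps A1) - ps A2)"
    by (intro even_s_intros(2,4,7) odd_s_intros(1,2,4) even_s_intros(6) p)+
  have "typed1 L (vf1 s)"
    unfolding typed1_def vf1_def alpha1_def beta1_def s fst_conv snd_conv prod.case
    by (intro conjI even_s_intros(1)[OF m(1) even_s_intros(5)[OF odd_s_intros(6) m(2)]]
        odd_s_intros(1)[OF m(3) odd_s_intros(5)[OF odd_s_intros(6) m(4)]]
        over_arith(1,2) over_mult over_arith(4,5,8) o p) simp_all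
  moreover have "W (2 * 1 + 2) (xp 1 * ps A1)" "W (1 + 2) (ogen Phi * (ps M1 + scal \<i> * ps M2))"
    by (intro W_mult W_xp W_ogen_Phi p W_arith(1) W_arith(4))+
  then have "W 3 (alpha1 s)" unfolding alpha1_def s prod.case
    by (intro W_arith(1)) (auto intro: W_mono)
  moreover have "W (1 + 2) (ogen Phi * (scal (1 / 2) * fls_deriv (xp 1 * ps A1) - ps A2))"
    by (rule W_mult[OF W_ogen_Phi(1) W_arith(2)[OF p(15,10)]])
  then have "W 2 (ogen Phi * (scal (1 / 2) * fls_deriv (xp 1 * ps A1) - ps A2))" by (rule W_mono) simp
  then have "W 2 (beta1 s)" unfolding beta1_def s prod.case
    by (rule W_arith(1)[OF W_arith(2)[OF p(11) W_arith(4)[OF p(12)]]])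
  ultimately show ?thesis by (simp add: vfields_def vf1_def)
qed

lemma scal_cancel: "z \<noteq> 0 \<Longrightarrow> scal z * a = scal z * b \<Longrightarrow> a = b"
proof -
  assume z: "z \<noteq> 0" and e: "scal z * a = scal z * b"
  have "scal (1 / z) * (scal z * h) = h" for h using z by (simp flip: mult.assoc scal_mult)
  then show "a = b" using e by metis
qed

lemma vf1_inj:
  assumes "s \<in> seqs L" "s' \<in> seqs L" "vf1 s = vf1 s'" shows "s = s'"
proof -
  obtain A1 A2 M1 M2 where s: "s = (A1, A2, M1, M2)" by (cases s) auto
  obtain B1 B2 N1 N2 where s': "s' = (B1, B2, N1, N2)" by (cases s') auto
  note p = seqsD[OF assms(1)[unfolded s]] and p' = seqsD[OF assms(2)[unfolded s']]
  have z: "d_odd Phi f = 0" if "over L {} f" for f using that by (rule d_odd_over) auto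
  have a: "alpha1 s = alpha1 s'" and b: "beta1 s = beta1 s'" using assms(3) by (auto simp: vf1_def)
  have o: "over L {} (xp 1 * ps A1)" "over L {} (ps M1 + scal \<i> * ps M2)" "over L {} (ps M1 - scal \<i> * ps M2)"
    "over L {} (scal (1 / 2) * fls_deriv (xp 1 * ps A1) - ps A2)"
    "over L {} (xp 1 * ps B1)" "over L {} (ps N1 + scal \<i> * ps N2)" "over L {} (ps N1 - scal \<i> * ps N2)"
    "over L {} (scal (1 / 2) * fls_deriv (xp 1 * ps B1) - ps B2)"
    by (intro over_arith(1,2) over_mult over_arith(4,5) p p')+
  have 1: "ps M1 + scal \<i> * ps M2 = ps N1 + scal \<i> * ps N2"
    using arg_cong[OF a, of "d_odd Phi"] unfolding alpha1_def s s' prod.case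
      d_odd_add[of Phi "xp 1 * ps A1"] d_odd_add[of Phi "xp 1 * ps B1"] d_odd_ogen_mult
      z[OF o(1)] z[OF o(2)] z[OF o(5)] z[OF o(6)] by simp
  have 2: "scal (1 / 2) * fls_deriv (xp 1 * ps A1) - ps A2 = scal (1 / 2) * fls_deriv (xp 1 * ps B1) - ps B2"
    using arg_cong[OF b, of "d_odd Phi"] unfolding beta1_def s s' prod.case
      d_odd_add[of Phi "ps M1 - scal \<i> * ps M2"] d_odd_add[of Phi "ps N1 - scal \<i> * ps N2"] d_odd_ogen_mult
      z[OF o(3)] z[OF o(4)] z[OF o(7)] z[OF o(8)] by simp
  have 3: "xp 1 * ps A1 = xp 1 * ps B1" using a 1 by (simp add: alpha1_def s s')
  have 4: "ps M1 - scal \<i> * ps M2 = ps N1 - scal \<i> * ps N2" using b 2 by (simp add: beta1_def s s')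
  have "xp (-1) * (xp 1 * h) = h" for h :: sfun by (simp add: xp_mult_xp flip: mult.assoc)
  then have A1: "ps A1 = ps B1" using 3 by metis
  then have A2: "ps A2 = ps B2" using 2 by simp
  have "ps M1 + ps M1 = (ps M1 + scal \<i> * ps M2) + (ps M1 - scal \<i> * ps M2)" by simp
  also have "\<dots> = (ps N1 + scal \<i> * ps N2) + (ps N1 - scal \<i> * ps N2)" by (simp only: 1 4)
  also have "\<dots> = ps N1 + ps N1" by simp
  finally have M1: "ps M1 = ps N1" by (rule sfun_halve)
  then have M2: "ps M2 = ps N2" using 1 scal_cancel[of \<i>] by simp
  show ?thesis
    using assms(1,2) A1 A2 M1 M2 ps_inj unfolding s s' seqs_def by blast
qed

lemma vf1_surj:
  assumes "p \<in> vfields L" obtains s where "s \<in> seqs L" "vf1 s = p"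
proof -
  obtain a b where p: "p = (a, b)" by fastforce
  have a: "even_s a" "over L {Phi} a" "W 3 a" and b: "odd_s b" "over L {Phi} b" "W 2 b"
    using assms by (auto simp: vfields_def typed1_def p)
  let ?G = "d_odd Phi a" and ?H = "d_odd Phi b"
  let ?F = "a - ogen Phi * ?G" and ?R = "b - ogen Phi * ?H"
  have o: "over L {} ?F" "over L {} ?G" "over L {} ?R" "over L {} ?H"
    using over_split[of L Phi "{}"] a(2) b(2) by auto
  have par: "even_s ?F" "odd_s ?G" "odd_s ?R" "even_s ?H"
    using a(1) b(1) by (auto intro!: even_s_intros odd_s_intros parity_d_odd)
  have G: "W (3 - 1) ?G" by (rule W_d_odd[OF a(3)])
  have H: "W (2 - 1) ?H" by (rule W_d_odd[OF b(3)])
  have "W (1 + (3 - 1)) (ogen Phi * ?G)" "W (1 + (2 - 1)) (ogen Phi * ?H)"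
    by (intro W_mult W_ogen_Phi G H)+
  then have FR: "W 3 ?F" "W 2 ?R" using a(3) b(3) by (auto intro: W_arith(2))
  have ge: "ord_ge 2 ?F" "ord_ge 1 ?G" "ord_ge 1 ?R" "ord_ge 1 ?H"
    using W_over_empty[OF FR(1) o(1), of 1] W_over_empty[OF G o(2), of 1] W_over_empty[OF FR(2) o(3), of 1]
      W_over_empty[OF H o(4), of 0] by simp_all
  \<comment> \<open>The four components of the field are solved for the generating series;
    \<open>q1\<close> and \<open>q2\<close> invert the relations \<open>q1 + i q2 = ?G\<close> and
    \<open>q1 - i q2 = ?R\<close>.\<close>
  define p1 where "p1 = xp (-1) * ?F"
  define q1 where "q1 = scal (1 / 2) * (?G + ?R)"
  define q2 where "q2 = scal (1 / (2 * \<i>)) * (?G - ?R)"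
  define p2 where "p2 = scal (1 / 2) * fls_deriv ?F - ?H"
  have x: "xp 1 * p1 = ?F" by (simp add: p1_def xp_mult_xp flip: mult.assoc)
  have "ord_ge (-1 + 2) p1" unfolding p1_def by (rule ord_ge_mult[OF ord_ge_xp ge(1)])
  then have g1: "ord_ge 1 p1" by simp
  have sc: "ord_ge 1 (scal z * f)" if "ord_ge 1 f" for z f using that by (simp add: ord_ge_def)
  have "ord_ge (2 - 1) (fls_deriv ?F)" by (rule ord_ge_deriv[OF ge(1)])
  then have g2: "ord_ge 1 p2" unfolding p2_def by (intro ord_ge_diff sc ge(4)) simp
  have g3: "ord_ge 1 q1" "ord_ge 1 q2" unfolding q1_def q2_def by (intro sc ord_ge_add ord_ge_diff ge)+
  have oo: "over L {} p1" "over L {} p2" "over L {} q1" "over L {} q2"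
    unfolding p1_def p2_def q1_def q2_def
    by (rule over_mult[OF over_arith(5) o(1)]
        over_arith(2)[OF over_mult[OF over_arith(4) over_arith(10)[OF o(1)]] o(4)]
        over_mult[OF over_arith(4) over_arith(1)[OF o(2,3)]] over_mult[OF over_arith(4) over_arith(2)[OF o(2,3)]])+
  have pp: "even_s p1" "even_s p2" "odd_s q1" "odd_s q2"
    unfolding p1_def p2_def q1_def q2_def
    by (rule even_s_intros(4)[OF even_s_intros(7) par(1)]
        even_s_intros(2)[OF even_s_intros(4)[OF even_s_intros(6) parity_deriv(2)[OF par(1)]] par(4)]
        odd_s_intros(4)[OF even_s_intros(6) odd_s_intros(1)[OF par(2,3)]]
        odd_s_intros(4)[OF even_s_intros(6) odd_s_intros(2)[OF par(2,3)]])+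
  have "p1 $$ n \<in> Lam_even L" "p2 $$ n \<in> Lam_even L" "q1 $$ n \<in> Lam_odd L" "q2 $$ n \<in> Lam_odd L" for n
    using oo pp by (auto simp: over_iff even_s_iff odd_s_iff)
  then obtain A1 A2 M1 M2 where s: "A1 \<in> {1..} \<rightarrow>\<^sub>E Lam_even L" "ps A1 = p1" "A2 \<in> {1..} \<rightarrow>\<^sub>E Lam_even L" "ps A2 = p2"
    "M1 \<in> {1..} \<rightarrow>\<^sub>E Lam_odd L" "ps M1 = q1" "M2 \<in> {1..} \<rightarrow>\<^sub>E Lam_odd L" "ps M2 = q2"
    using ps_surj[OF g1, of "Lam_even L"] ps_surj[OF g2, of "Lam_even L"]
      ps_surj[OF g3(1), of "Lam_odd L"] ps_surj[OF g3(2), of "Lam_odd L"] by metis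
  have iq: "scal \<i> * q2 = scal (1 / 2) * (?G - ?R)"
    unfolding q2_def by (simp add: field_simps flip: mult.assoc scal_mult)
  have h: "scal (1 / 2) * f + scal (1 / 2) * f = f" for f
  proof -
    have "scal (1 / 2) + scal (1 / 2) = 1" by (simp flip: scal_add)
    then show ?thesis by (simp only: mult_1 flip: distrib_right)
  qed
  have "q1 + scal \<i> * q2 = scal (1 / 2) * ?G + scal (1 / 2) * ?G"
    "q1 - scal \<i> * q2 = scal (1 / 2) * ?R + scal (1 / 2) * ?R"
    unfolding iq unfolding q1_def by (simp_all add: distrib_left right_diff_distrib)
  then have q: "q1 + scal \<i> * q2 = ?G" "q1 - scal \<i> * q2 = ?R" by (simp_all only: h)
  have "vf1 (A1, A2, M1, M2) = p"
    unfolding vf1_def alpha1_def beta1_def prod.case s x q by (simp add: p2_def p)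
  moreover have "(A1, A2, M1, M2) \<in> seqs L" using s by (simp add: seqs_def)
  ultimately show ?thesis using that by blast
qed

subsection \<open>The exponential map \<open>E1_0\<close>\<close>

definition gen_0 :: "ops \<Rightarrow> ops \<Rightarrow> ops \<Rightarrow> ops \<Rightarrow> seqs \<Rightarrow> sfun \<Rightarrow> nat \<Rightarrow> sfun" where
  "gen_0 L J G1 G2 s h n = (case s of (A1, A2, M1, M2) \<Rightarrow>
     fls_const (A1 n) * L (int n) h + fls_const (A2 n) * J (int n) h
       + fls_const (M1 n) * G1 (int n) h + fls_const (M2 n) * G2 (int n) h)"

lemma E_op_0_gen:
  "E_op_0 L J G1 G2 s (a1, a2) f =
     exp_op (\<lambda>h. - (\<Sum>\<^sub>\<infinity>n\<in>{1..}. gen_0 L J G1 G2 s h n))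
       (pow_op a1 (\<lambda>h. - 2 * L 0 h) (pow_op a2 (\<lambda>h. - J 0 h) f))"
  by (cases s) (simp add: gen_0_def)

lemma scal_i_powers: "scal ((- \<i>) ^ (1 + 1)) = - 1" "scal ((- \<i>) ^ (2 + 1)) = scal \<i>"
  by (simp_all add: power_Suc numeral_2_eq_2 numeral_3_eq_3 scal_minus)

lemma gen_0_N1:
  assumes s: "s \<in> seqs L"
  shows "(gen_0 (N1_L At_0) (N1_J At_0) (N1_G 1 At_0) (N1_G 2 At_0) s h has_sum - vop (vf1 s) h) {1..}"
proof -
  obtain A1 A2 M1 M2 where s': "s = (A1, A2, M1, M2)" by (cases s) auto
  note p = seqsD[OF s[unfolded s']]
  let ?d = "d_odd Phi h" and ?h = "fls_deriv h" and ?f = "ogen Phi"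
  have um: "((\<lambda>n. - F n) has_sum - S) {1..}" if "(F has_sum S) {1..}" for F :: "nat \<Rightarrow> sfun" and S
    using bounded_additive_has_sum[OF bounded_additive_uminus[OF bounded_additive_id] that] .
  have sm: "((\<lambda>n. scal z * F n) has_sum scal z * S) {1..}" if "(F has_sum S) {1..}" for F :: "nat \<Rightarrow> sfun" and S z
    using bounded_additive_has_sum[OF bounded_additive_left_mult that] .
  have 1: "((\<lambda>n. fls_const (A1 n) * N1_L At_0 (int n) h) has_sum
      - (ps A1 * (xp 1 * ?h) + scal (1 / 2) * (fls_deriv (ps A1 * xp 1) * (?f * ?d)))) {1..}"
  proof -
    have "fls_const (A1 n) * N1_L At_0 (int n) h = - (fls_const (A1 n) * (xp (int n + 1) * ?h) +
        scal (1 / 2) * (fls_const (A1 n) * (scal (of_int (int n + 1)) * (xp (int n + 1 - 1) * (?f * ?d)))))" for n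
    proof -
      have "scal ((of_int (int n) + 1) / 2) = scal (1 / 2) * scal (of_int (int n + 1))"
        by (simp flip: scal_mult)
      then show ?thesis
        unfolding N1_L_def xpow_xp d_x.simps
        by (simp only: scal_left_commute[of "fls_const _"] mult_minus_right distrib_left mult.assoc add_diff_cancel_right')
    qed
    then show ?thesis
      by (simp only: um has_sum_add[OF has_sum_ps_shift sm[OF has_sum_ps_deriv]])
  qed
  have 2: "((\<lambda>n. fls_const (A2 n) * N1_J At_0 (int n) h) has_sum ps A2 * (?f * ?d)) {1..}"
    using has_sum_ps_mult[of A2 "?f * ?d"] by (simp add: N1_J_def mult.assoc)
  have 3: "((\<lambda>n. fls_const (M1 n) * N1_G 1 At_0 (int n) h) has_sum - (ps M1 * (?d - ?f * ?h))) {1..}"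
    using um[OF has_sum_ps_mult[of M1 "?d - ?f * ?h"]] unfolding N1_G_def scal_i_powers xpow_xp d_x.simps
    by (simp add: mult.assoc scal_minus)
  have 4: "((\<lambda>n. fls_const (M2 n) * N1_G 2 At_0 (int n) h) has_sum scal \<i> * (ps M2 * (?d + ?f * ?h))) {1..}"
    using sm[OF has_sum_ps_mult[of M2 "?d + ?f * ?h"], of \<i>] unfolding N1_G_def scal_i_powers xpow_xp d_x.simps
    by (simp add: mult.assoc scal_left_commute[of "fls_const _"])
  have "- (ps A1 * (xp 1 * ?h) + scal (1 / 2) * (fls_deriv (ps A1 * xp 1) * (?f * ?d))) + ps A2 * (?f * ?d)
      + - (ps M1 * (?d - ?f * ?h)) + scal \<i> * (ps M2 * (?d + ?f * ?h)) = - vop (vf1 s) h" (is "?S = _")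
  proof -
    define r where "r = scal (1 / 2) * fls_deriv (xp 1 * ps A1)"
    have r: "scal (1 / 2) * (fls_deriv (ps A1 * xp 1) * k) = r * k" for k
      unfolding r_def xp_commute[of "ps A1"] mult.assoc ..
    have c: "ps M1 * (?f * k) = - (?f * (ps M1 * k))" "ps M2 * (?f * k) = - (?f * (ps M2 * k))"
      "r * (?f * k) = ?f * (r * k)" "ps A2 * (?f * k) = ?f * (ps A2 * k)" "ps A1 * (xp 1 * k) = xp 1 * (ps A1 * k)" for k
      using odd_s_anticommute[OF p(7) odd_s_intros(6)[of Phi]] odd_s_anticommute[OF p(8) odd_s_intros(6)[of Phi]]
        even_s_commute[OF p(13), of ?f] even_s_commute[OF p(6), of ?f] xp_commute[of "ps A1" 1]
      unfolding r_def by (simp_all flip: mult.assoc)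
    show ?thesis
      unfolding vop_def fo_def vf1_def alpha1_def beta1_def s' prod.case fst_conv snd_conv r r_def[symmetric]
      by (simp add: algebra_simps c scal_left_commute[of ?f])
  qed
  moreover have "gen_0 (N1_L At_0) (N1_J At_0) (N1_G 1 At_0) (N1_G 2 At_0) s h = (\<lambda>n.
      fls_const (A1 n) * N1_L At_0 (int n) h + fls_const (A2 n) * N1_J At_0 (int n) h
       + fls_const (M1 n) * N1_G 1 At_0 (int n) h + fls_const (M2 n) * N1_G 2 At_0 (int n) h)"
    by (rule ext) (simp only: gen_0_def s' prod.case)
  ultimately show ?thesis
    using has_sum_add[OF has_sum_add[OF has_sum_add[OF 1 2] 3] 4] by (simp only:)
qed

lemma numeral_2_nth: "(- 2 * f) $$ n = - 2 * (f $$ n)" for f :: sfun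
  by (simp add: mult_2)

text \<open>The condition under which \<open>pow_op_eqI\<close> makes the eigenvector decomposition
  unique.\<close>

definition coeffwise :: "(sfun \<Rightarrow> sfun) \<Rightarrow> bool" where
  "coeffwise K \<longleftrightarrow> (\<exists>\<kappa>. \<forall>n. (\<forall>f. K f $$ n = \<kappa> n (f $$ n)) \<and> (\<forall>a b. \<kappa> n (a + b) = \<kappa> n a + \<kappa> n b))"

lemma coeffwiseI:
  "(\<And>f n. K f $$ n = \<kappa> n (f $$ n)) \<Longrightarrow> (\<And>n a b. \<kappa> n (a + b) = \<kappa> n a + \<kappa> n b) \<Longrightarrow> coeffwise K"
  unfolding coeffwise_def by blast

lemma pow_op_coeffwise:
  assumes "coeffwise K" "finite A" "\<And>k. k \<in> A \<Longrightarrow> K (F k) = of_int k * F k"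
  shows "pow_op a K (\<Sum>k\<in>A. F k) = (\<Sum>k\<in>A. fls_const (zpow a k) * F k)"
proof -
  obtain \<kappa> where "\<And>f n. K f $$ n = \<kappa> n (f $$ n)" "\<And>n a b. \<kappa> n (a + b) = \<kappa> n a + \<kappa> n b"
    using assms(1) unfolding coeffwise_def by metis
  from pow_op_sum[OF this assms(2,3)] show ?thesis .
qed

text \<open>Stated for eigenvectors transported by \<open>A\<close>, so as to serve both expansions.\<close>

lemma pow_op_eigen:
  assumes K': "coeffwise K'" and A: "\<And>z f. A (scal z * f) = scal z * A f" "\<And>f. K' (A f) = A (K f)"
    and F: "K f = of_int k * f"
  shows "pow_op a K' (A f) = fls_const (zpow a k) * A f"
proof -
  have "K' (A f) = of_int k * A f" unfolding A(2) F scal_of_int[symmetric] A(1) ..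
  then show ?thesis using pow_op_coeffwise[OF K', of "{k}" "\<lambda>_. A f" a] by simp
qed

lemma gderiv_Lam: "c \<in> Lam L V \<Longrightarrow> g \<notin> V \<Longrightarrow> (\<And>k. g \<noteq> Zeta k) \<Longrightarrow> d_odd g (fls_const c) = 0"
  by (rule d_odd_over[OF over_const])

lemma coeffwise_N1:
  "coeffwise (\<lambda>h. - N1_J e 0 h)" "coeffwise (\<lambda>h. - 2 * N1_L At_0 0 h)" "coeffwise (\<lambda>h. 2 * N1_L At_inf 0 h)"
proof -
  show "coeffwise (\<lambda>h. - N1_J e 0 h)"
    by (rule coeffwiseI[of _ "\<lambda>n c. - (ggen Phi * gderiv Phi c)"])
      (cases e; simp add: N1_J_def mult.assoc distrib_left)+
  show "coeffwise (\<lambda>h. - 2 * N1_L At_0 0 h)"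
    by (rule coeffwiseI[of _ "\<lambda>n c. 2 * (of_int n * c + gscal (1 / 2) * (ggen Phi * gderiv Phi c))"])
      (unfold numeral_2_nth, simp_all add: N1_L_def xp_mult_nth mult.assoc distrib_left)
  show "coeffwise (\<lambda>h. 2 * N1_L At_inf 0 h)"
    by (rule coeffwiseI[of _ "\<lambda>n c. 2 * (of_int n * c - gscal (1 / 2) * (ggen Phi * gderiv Phi c))"])
      (simp_all add: mult_2 N1_L_def xp_mult_nth mult.assoc algebra_simps flip: xp_def)
qed

text \<open>The map \<open>A\<close> is the identity at zero and \<open>toinf\<close> at infinity.
  The eigenvalues on x and Phi are 2 and 1 for -2 L_0, and 0 and -1 for -J_0; this produces the
  factors \<open>a1^2\<close> and \<open>a1 / a2\<close>.\<close>

lemma pow_op_N1: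
  assumes a: "a1 \<in> Lam_units L" "a2 \<in> Lam_units L" and cw: "coeffwise L'" "coeffwise J'"
    and A: "\<And>f. L' (A f) = A (- 2 * N1_L At_0 0 f)" "\<And>f. J' (A f) = A (- N1_J At_0 0 f)"
      "\<And>z f. A (scal z * f) = scal z * A f" "\<And>c f. c \<in> Lam_units L \<Longrightarrow> A (fls_const c * f) = fls_const c * A f"
  shows "pow_op a1 L' (pow_op a2 J' (A (xp 1))) = A (fls_const (a1 * a1) * xp 1)"
    "pow_op a1 L' (pow_op a2 J' (A (ogen Phi))) = A (fls_const (a1 * unit_inv a2) * ogen Phi)"
proof -
  let ?J = "\<lambda>h. - N1_J At_0 0 h" and ?L = "\<lambda>h. - 2 * N1_L At_0 0 h"
  note eJ = pow_op_eigen[where A = A and K = ?J, OF cw(2) A(3,2)] and eL = pow_op_eigen[where A = A and K = ?L, OF cw(1) A(3,1)]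
  have "?J (xp 1) = of_int 0 * xp 1" by (simp add: N1_J_def)
  note x1 = eJ[OF this, of a2]
  have "?J (ogen Phi) = of_int (-1) * ogen Phi" by (simp add: N1_J_def d_odd_ogen)
  note p1 = eJ[OF this, of a2]
  have "?L (xp 1) = of_int 2 * xp 1" using deriv_xp[of 1] by (simp add: N1_L_def xp_mult_xp)
  note x2 = eL[OF this, of a1]
  let ?c = "fls_const (unit_inv a2)"
  have u: "unit_inv a2 \<in> Lam_units L" by (rule Lam_unitsD(7)[OF a(2)])
  have "?L (?c * ogen Phi) = of_int 1 * (?c * ogen Phi)"
  proof -
    have "d_odd Phi (?c * ogen Phi) = ?c"
      using gderiv_Lam[OF Lam_unitsD(2)[OF u], of Phi] Lam_unitsD(3)[OF u] by (simp add: d_odd_mult d_odd_ogen grass_even_iff)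
    then have "N1_L At_0 0 (?c * ogen Phi) = - (scal (1 / 2) * (?c * ogen Phi))"
      using const_unit_inverse(5)[OF u, of "ogen Phi"] by (simp add: N1_L_def mult.assoc)
    then have "?L (?c * ogen Phi) = (scal (1 / 2) + scal (1 / 2)) * (?c * ogen Phi)"
      by (simp add: mult_2 distrib_right)
    then show ?thesis by (simp flip: scal_add)
  qed
  note p2 = eL[OF this, of a1]
  have z: "zpow a1 2 = a1 * a1" "zpow a2 (-1) = unit_inv a2"
    by (simp_all add: zpow_def power2_eq_square)
  show "pow_op a1 L' (pow_op a2 J' (A (xp 1))) = A (fls_const (a1 * a1) * xp 1)"
    unfolding x1 zpow_0 fls_const_1 mult_1 x2 z A(4)[OF Lam_units_mult[OF a(1,1)]] ..
  show "pow_op a1 L' (pow_op a2 J' (A (ogen Phi))) = A (fls_const (a1 * unit_inv a2) * ogen Phi)"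
    unfolding p1 z A(4)[OF u, symmetric] p2 zpow_1 unfolding A(4)[OF a(1), symmetric] by (simp flip: mult.assoc)
qed

lemma unit_inv_minus: "a \<in> Lam_units L \<Longrightarrow> unit_inv (- a) = - unit_inv a"
  by (rule unit_inv_eq) (simp_all add: Lam_unitsD)

lemma fo_const:
  assumes c: "c \<in> Lam L {}" "c \<in> grass_even"
  shows "fo a b b1 b2 (fls_const c * h) = fls_const c * fo a b b1 b2 h"
proof -
  have e: "even_s (fls_const c)" by (rule even_s_intros(10)[OF c(2)])
  have d: "d_odd g (fls_const c * h) = fls_const c * d_odd g h" if "\<And>k. g \<noteq> Zeta k" for g
    using gderiv_Lam[OF c(1), of g] that e by (simp add: d_odd_mult even_s_def)
  have "fls_deriv (fls_const c * h) = fls_const c * fls_deriv h" by simp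
  then show ?thesis
    unfolding fo_def using d[of Phi] d[of Phi1] d[of Phi2]
    by (simp add: distrib_left even_mult_left[OF e] flip: mult.assoc even_s_commute[OF e])
qed

lemma exp_op_const:
  assumes T: "raising (fo a b b1 b2)" and c: "c \<in> Lam L {}" "c \<in> grass_even"
  shows "exp_op (fo a b b1 b2) (fls_const c * h) = fls_const c * exp_op (fo a b b1 b2) h"
proof (rule exp_op_intertwine[where P = "\<lambda>_. True" and A = "\<lambda>f. fls_const c * f", OF T])
  show "bounded_additive (\<lambda>f. fls_const c * f)" by (rule bounded_additive_left_mult)
  show "fls_const c * (scal z * f) = scal z * (fls_const c * f)" for z f by (rule scal_left_commute)
  show "fls_const c * fo a b b1 b2 g = fo a b b1 b2 (fls_const c * g)" for g by (rule fo_const[OF c, symmetric])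
qed simp_all

lemma the_elem_pair: "f x = f y \<Longrightarrow> the_elem (f ` {x, y}) = f x"
  by simp

lemma E_op_0_N1:
  assumes s: "s \<in> seqs L" and b: "b1 \<in> Lam_units L" "b2 \<in> Lam_units L"
  defines "E \<equiv> E_op_0 (N1_L At_0) (N1_J At_0) (N1_G 1 At_0) (N1_G 2 At_0) s (b1, b2)"
  shows "E (xp 1) = exp_op (vop (vf1 s)) (fls_const (b1 * b1) * xp 1)"
    "E (ogen Phi) = exp_op (vop (vf1 s)) (fls_const (b1 * unit_inv b2) * ogen Phi)"
proof -
  have i: "(\<lambda>h. - (\<Sum>\<^sub>\<infinity>n\<in>{1..}. gen_0 (N1_L At_0) (N1_J At_0) (N1_G 1 At_0) (N1_G 2 At_0) s h n)) = vop (vf1 s)"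
    using infsumI[OF gen_0_N1[OF s]] by (simp add: fun_eq_iff)
  note pw = pow_op_N1[OF b coeffwise_N1(2,1), of "\<lambda>f. f"]
  show "E (xp 1) = exp_op (vop (vf1 s)) (fls_const (b1 * b1) * xp 1)"
    "E (ogen Phi) = exp_op (vop (vf1 s)) (fls_const (b1 * unit_inv b2) * ogen Phi)"
    unfolding E_def E_op_0_gen i by (subst pw; simp)+
qed

text \<open>Only \<open>a1^2\<close> and \<open>a1 / a2\<close> enter, and both are unchanged when
  the two units change sign together, so the two representatives of the coset give one
  value.\<close>

lemma E1_0_eq:
  assumes s: "s \<in> seqs L" and a: "a1 \<in> Lam_units L" "a2 \<in> Lam_units L"
  shows "E1_0 ({(a1, a2), (- a1, - a2)}, s) =
    (fls_const (a1 * a1) * fst (exp1 (vf1 s)), fls_const (a1 * unit_inv a2) * snd (exp1 (vf1 s)))"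
proof -
  let ?E = "\<lambda>a. E_op_0 (N1_L At_0) (N1_J At_0) (N1_G 1 At_0) (N1_G 2 At_0) s a"
  have r: "raising (vop (vf1 s))" by (rule vfieldsD(1)[OF vf1_vfields[OF s]])
  have u: "unit_inv b \<in> Lam_units L" if "b \<in> Lam_units L" for b by (rule Lam_unitsD(7)[OF that])
  have *: "map_prod (?E (b1, b2)) (?E (b1, b2)) (id1 At_0) =
      (fls_const (b1 * b1) * fst (exp1 (vf1 s)), fls_const (b1 * unit_inv b2) * snd (exp1 (vf1 s)))"
    if b: "b1 \<in> Lam_units L" "b2 \<in> Lam_units L" for b1 b2
  proof -
    note c = Lam_units_mult[OF b(1,1)] Lam_units_mult[OF b(1) u[OF b(2)]]
    show ?thesis
      unfolding id1_def xpow_xp map_prod_simp E_op_0_N1[OF s b] exp1_def fst_conv snd_conv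
      using exp_op_const[OF r[unfolded vop_def] Lam_unitsD(2,3)[OF c(1)]]
        exp_op_const[OF r[unfolded vop_def] Lam_unitsD(2,3)[OF c(2)]]
      unfolding vop_def by simp
  qed
  show ?thesis
    unfolding E1_0_def prod.case Let_def
    by (subst the_elem_pair) (simp_all only: * a Lam_units_minus unit_inv_minus[OF a(2)] minus_mult_minus)
qed

lemma lead1_unique:
  assumes l: "lead1 c d f" "lead1 c' d' f"
    and u: "c \<in> Lam_units L" "d \<in> Lam_units L" "c' \<in> Lam_units L" "d' \<in> Lam_units L"
  shows "c = c'" "d = d'"
proof -
  have "W 3 ((fst f - fls_const c' * xp 1) - (fst f - fls_const c * xp 1))"
    by (rule W_arith(2)) (use l in \<open>simp_all add: lead1_def\<close>)
  then have "W 3 (fls_const (c - c') * xp 1)" by (simp add: left_diff_distrib flip: fls_minus_const)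
  from W_over_empty[OF this, of L 1] have "ord_ge 2 (fls_const (c - c') * xp 1)"
    using Lam_unitsD(2)[OF u(1)] Lam_unitsD(2)[OF u(3)]
    by (simp add: over_mult over_const over_arith Lam_arith)
  then have "(fls_const (c - c') * xp 1) $$ 1 = 0" by (simp add: ord_ge_def)
  then show "c = c'" by (simp add: xp_nth)
  have e: "d - d' \<in> Lam L {}" "d - d' \<in> grass_even"
    using Lam_unitsD(2,3)[OF u(2)] Lam_unitsD(2,3)[OF u(4)] by (simp_all add: Lam_arith even_arith)
  have "W 2 ((snd f - fls_const d' * ogen Phi) - (snd f - fls_const d * ogen Phi))"
    by (rule W_arith(2)) (use l in \<open>simp_all add: lead1_def\<close>)
  then have "W 2 (fls_const (d - d') * ogen Phi)" by (simp add: left_diff_distrib flip: fls_minus_const)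
  then have "W (2 - 1) (d_odd Phi (fls_const (d - d') * ogen Phi))" by (rule W_d_odd)
  moreover have "d_odd Phi (fls_const (d - d') * ogen Phi) = fls_const (d - d')"
    using gderiv_Lam[OF e(1), of Phi] e(2) by (simp add: d_odd_mult d_odd_ogen grass_even_iff del: fls_minus_const)
  ultimately have "W 1 (fls_const (d - d'))" by simp
  from W_over_empty[OF this over_const[OF e(1)], of 0] have "ord_ge 1 (fls_const (d - d'))" by simp
  then have "fls_const (d - d') $$ 0 = 0" unfolding ord_ge_def by (rule spec[of _ 0, THEN mp]) simp
  then show "d = d'" by simp
qed

lemma E1_0_lead:
  assumes s: "s \<in> seqs L" and a: "a1 \<in> Lam_units L" "a2 \<in> Lam_units L"
  shows "typed1 L (E1_0 ({(a1, a2), (- a1, - a2)}, s))"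
    "lead1 (a1 * a1) (a1 * unit_inv a2) (E1_0 ({(a1, a2), (- a1, - a2)}, s))"
    "E1_0 ({(a1, a2), (- a1, - a2)}, s) = comp1 At_0 (dil1 (a1 * a1) (a1 * unit_inv a2)) (exp1 (vf1 s))"
proof -
  note v = vf1_vfields[OF s]
  note u = Lam_units_mult[OF a(1,1)] Lam_units_mult[OF a(1) Lam_unitsD(7)[OF a(2)]]
  obtain ok: "subst_ok (fst (exp1 (vf1 s))) (ogen(Phi := snd (exp1 (vf1 s))))"
    using exp1_SA_0(3)[OF v] by (rule SA_0_E)
  show e: "E1_0 ({(a1, a2), (- a1, - a2)}, s) = comp1 At_0 (dil1 (a1 * a1) (a1 * unit_inv a2)) (exp1 (vf1 s))"
    unfolding E1_0_eq[OF s a] comp1_At_0 dil1_def map_prod_simp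
      sub1_const[OF ok Lam_unitsD(2)[OF u(1)]] sub1_const[OF ok Lam_unitsD(2)[OF u(2)]] sub1_simps(1,2)[OF ok] ..
  note cl = comp1_typed_lead[OF dil1_SA_0(1,2)[OF u] u exp1_SA_0(1,2)[OF v] Lam_units_1 Lam_units_1]
  show "typed1 L (E1_0 ({(a1, a2), (- a1, - a2)}, s))"
    "lead1 (a1 * a1) (a1 * unit_inv a2) (E1_0 ({(a1, a2), (- a1, - a2)}, s))"
    unfolding e using cl by simp_all
qed

text \<open>The leading units \<open>a1^2\<close> and \<open>a1 / a2\<close> fix the pair up to a
  common sign, and once they are cancelled the flow fixes the sequences. Conversely a square root of
  the coefficient of x supplies \<open>a1\<close>.\<close>

theorem bij_E1_0: "bij_betw E1_0 (params L) (SA_0_carrier L)"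
  unfolding bij_betw_def
proof
  show "inj_on E1_0 (params L)"
  proof (rule inj_onI)
    fix p q assume "p \<in> params L" "q \<in> params L" and e: "E1_0 p = E1_0 q"
    from \<open>p \<in> params L\<close> obtain a1 a2 s where p: "p = ({(a1, a2), (- a1, - a2)}, s)" "s \<in> seqs L"
        "a1 \<in> Lam_units L" "a2 \<in> Lam_units L" by (rule params_E)
    from \<open>q \<in> params L\<close> obtain b1 b2 s' where q: "q = ({(b1, b2), (- b1, - b2)}, s')" "s' \<in> seqs L"
        "b1 \<in> Lam_units L" "b2 \<in> Lam_units L" by (rule params_E)
    let ?d = "a1 * unit_inv a2" and ?d' = "b1 * unit_inv b2"
    note ua = Lam_units_mult[OF p(3,3)] Lam_units_mult[OF p(3) Lam_unitsD(7)[OF p(4)]]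
    note ub = Lam_units_mult[OF q(3,3)] Lam_units_mult[OF q(3) Lam_unitsD(7)[OF q(4)]]
    note P = E1_0_lead[OF p(2-4)] and Q = E1_0_lead[OF q(2-4)]
    have "lead1 (b1 * b1) ?d' (E1_0 ({(a1, a2), (- a1, - a2)}, s))"
      using Q(2) e unfolding p(1) q(1) by (simp only:)
    note cd = lead1_unique[OF P(2) this ua ub]
    have v: "fls_const u * h = fls_const u * h' \<Longrightarrow> h = h'" if "u \<in> Lam_units L" for u h h'
      using const_unit_inverse(2)[OF that] by (metis mult.assoc mult_1)
    have e': "fls_const (b1 * b1) * fst (exp1 (vf1 s)) = fls_const (b1 * b1) * fst (exp1 (vf1 s'))"
      "fls_const ?d' * snd (exp1 (vf1 s)) = fls_const ?d' * snd (exp1 (vf1 s'))"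
      using e unfolding p(1) q(1) E1_0_eq[OF p(2-4)] E1_0_eq[OF q(2-4)] cd prod.inject by blast+
    have "exp1 (vf1 s) = exp1 (vf1 s')"
      by (rule prod_eqI[OF v[OF ub(1) e'(1)] v[OF ub(2) e'(2)]])
    then have "vf1 s = vf1 s'" by (rule exp1_inj[OF vf1_vfields[OF p(2)] vf1_vfields[OF q(2)]])
    then have s: "s = s'" by (rule vf1_inj[OF p(2) q(2)])
    have ab: "a1 = b1 \<or> a1 = - b1" by (rule Lam_units_sqrt_unique[OF p(3) q(3) cd(1)])
    have a2: "a2 * ?d = a1" "b2 * ?d' = b1"
      using Lam_unitsD(8)[OF p(3), of "unit_inv a2"] Lam_unitsD(8)[OF q(3), of "unit_inv b2"]
        Lam_unitsD(5)[OF p(4)] Lam_unitsD(5)[OF q(4)] by (simp_all flip: mult.assoc)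
    have "(a2 * ?d) * unit_inv ?d = a2" "(b2 * ?d') * unit_inv ?d' = b2"
      unfolding mult.assoc[of a2 ?d] mult.assoc[of b2 ?d'] Lam_unitsD(5)[OF ua(2)] Lam_unitsD(5)[OF ub(2)]
      by (rule mult_1_right)+
    then have "a1 * unit_inv ?d' = a2" "b1 * unit_inv ?d' = b2" unfolding cd(2) a2(1)[unfolded cd(2)] a2(2) by blast+
    then have "(a1, a2) = (b1, b2) \<or> (a1, a2) = (- b1, - b2)"
      using ab by (metis mult_minus_left)
    then show "p = q" unfolding p(1) q(1) s by auto
  qed
  show "E1_0 ` params L = SA_0_carrier L"
  proof
    show "E1_0 ` params L \<subseteq> SA_0_carrier L"
    proof
      fix f assume "f \<in> E1_0 ` params L"
      then obtain p where "f = E1_0 p" "p \<in> params L" by blast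
      then obtain a1 a2 s where f: "f = E1_0 ({(a1, a2), (- a1, - a2)}, s)" "s \<in> seqs L"
        "a1 \<in> Lam_units L" "a2 \<in> Lam_units L" using params_E by metis
      show "f \<in> SA_0_carrier L"
        unfolding SA_0_carrier_iff f(1)
        using E1_0_lead(1,2)[OF f(2-4)] Lam_units_mult[OF f(3,3)] Lam_units_mult[OF f(3) Lam_unitsD(7)[OF f(4)]]
        by blast
    qed
    show "SA_0_carrier L \<subseteq> E1_0 ` params L"
    proof
      fix f assume "f \<in> SA_0_carrier L"
      then obtain c d where cd: "c \<in> Lam_units L" "d \<in> Lam_units L" and t: "typed1 L f" "lead1 c d f" by (rule SA_0_E)
      obtain p where p: "p \<in> vfields L" and fp: "f = comp1 At_0 (dil1 c d) (exp1 p)"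
        using SA_0_factor[OF cd t] by metis
      obtain s where s: "s \<in> seqs L" "vf1 s = p" using vf1_surj[OF p] by metis
      obtain a1 where a1: "a1 \<in> Lam_units L" "a1 * a1 = c" using Lam_units_sqrt[OF cd(1)] by metis
      \<comment> \<open>The solution of \<open>a1 / a2 = d\<close>.\<close>
      define a2 where "a2 = a1 * unit_inv d"
      have a2: "a2 \<in> Lam_units L" unfolding a2_def by (intro Lam_units_mult a1(1) Lam_unitsD(7)[OF cd(2)])
      have "unit_inv a2 = d * unit_inv a1"
      proof (rule unit_inv_eq)
        show "a2 * (d * unit_inv a1) = 1"
        proof -
          have "a2 * (d * unit_inv a1) = a1 * (unit_inv d * d) * unit_inv a1" by (simp only: a2_def mult.assoc)
          then show ?thesis using Lam_unitsD(6)[OF cd(2)] Lam_unitsD(5)[OF a1(1)] by simp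
        qed
        show "d * unit_inv a1 * a2 = 1"
        proof -
          have "d * unit_inv a1 * a2 = d * (unit_inv a1 * a1) * unit_inv d" by (simp only: a2_def mult.assoc)
          then show ?thesis using Lam_unitsD(5)[OF cd(2)] Lam_unitsD(6)[OF a1(1)] by simp
        qed
      qed
      then have "a1 * unit_inv a2 = a1 * unit_inv a1 * d"
        using Lam_unitsD(8)[OF cd(2), of "unit_inv a1"] by (simp add: mult.assoc)
      then have d: "a1 * unit_inv a2 = d" using Lam_unitsD(5)[OF a1(1)] by simp
      have "E1_0 ({(a1, a2), (- a1, - a2)}, s) = f"
        unfolding E1_0_lead(3)[OF s(1) a1(1) a2] a1(2) d s(2) fp ..
      moreover have "({(a1, a2), (- a1, - a2)}, s) \<in> params L"
        by (rule params_I[OF s(1) a1(1) a2])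
      ultimately show "f \<in> E1_0 ` params L" by blast
    qed
  qed
qed

section \<open>Chiral functions\<close>

text \<open>A separate constant, so that the rules below can collect factors of the imaginary unit
  on the left and cancel their powers.\<close>

definition ii :: sfun where "ii = scal \<i>"

lemma ii_simps [simp]: "ii * ii = - 1" "ii * (ii * h) = - h" "sbar ii = ii" "d_odd g ii = 0" "fls_deriv ii = 0"
  "d_odd g (ii * h) = ii * d_odd g h"
proof -
  show e: "ii * ii = - 1" by (simp add: ii_def scal_minus flip: scal_mult)
  then show "ii * (ii * h) = - h" by (simp flip: mult.assoc)
qed (simp_all add: ii_def)

text \<open>The \<open>NO_MATCH\<close> guards keep the rewriting from exchanging two copies of
  \<open>ii\<close> forever.\<close>

lemma ii_left: "NO_MATCH ii h \<Longrightarrow> h * ii = ii * h" "NO_MATCH ii h \<Longrightarrow> h * (ii * k) = ii * (h * k)"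
  unfolding ii_def by (metis scal_commute, metis scal_left_commute)

lemma ii_cancel: "a - ii * b = 0 \<and> a + ii * b = 0 \<longleftrightarrow> a = 0 \<and> b = 0"
proof
  assume *: "a - ii * b = 0 \<and> a + ii * b = 0"
  have "a + a = (a - ii * b) + (a + ii * b)" by simp
  then have "a + a = 0 + 0" using * by simp
  then have a: "a = 0" by (rule sfun_halve)
  then have "ii * (ii * b) = ii * 0" using * by simp
  then show "a = 0 \<and> b = 0" using a by (simp only: ii_simps) simp
qed simp

lemma phi_order: "ogen Phi2 * ogen Phi1 = - (ogen Phi1 * ogen Phi2)"
  "ogen Phi2 * (ogen Phi1 * h) = - (ogen Phi1 * (ogen Phi2 * h))"
proof -
  show e: "ogen Phi2 * ogen Phi1 = - (ogen Phi1 * ogen Phi2)"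
    by (rule odd_s_anticommute) (rule odd_s_intros)+
  show "ogen Phi2 * (ogen Phi1 * h) = - (ogen Phi1 * (ogen Phi2 * h))"
    unfolding mult.assoc[symmetric] e by simp
qed

lemma even_s_ii: "even_s ii" and over_ii: "over L V ii" and W_ii: "W 0 ii"
  by (simp_all add: ii_def even_s_intros over_arith W_scal)

lemma gderiv_anticommute: "gderiv g (gderiv h a) = - gderiv h (gderiv g a)"
proof (induction a rule: grass_induct)
  case (gen k a)
  have d: "gderiv g (a - b) = gderiv g a - gderiv g b" for g a b
    by (metis gderiv_add diff_add_cancel add_diff_cancel)
  have "gderiv g (gderiv h (ggen k * a)) = (if h = k then gderiv g a else 0) - (if g = k then gderiv h a else 0)
      + ggen k * gderiv g (gderiv h a)" for g h
    by (simp add: gderiv_ggen_mult d)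
  then show ?case using gen by simp
qed simp_all

lemma d_odd_anticommute: "d_odd g (d_odd h f) = - d_odd h (d_odd g f)"
  by (rule fls_eqI) (simp add: gderiv_anticommute[of g h])

text \<open>Odd derivations described through \<open>sbar\<close>, a form visibly stable under sums
  and complex multiples. This gives \<open>Dp\<close> and \<open>Dm\<close>;
  \<open>oder_sder\<close> converts it to the form that the chain rule uses.\<close>

definition oder :: "(sfun \<Rightarrow> sfun) \<Rightarrow> bool" where
  "oder \<delta> \<longleftrightarrow> bounded_additive \<delta> \<and> (\<forall>z. \<delta> (scal z) = 0) \<and> (\<forall>k. \<delta> (ogen (Zeta k)) = 0) \<and>
     (\<forall>w h. \<delta> (w * h) = \<delta> w * h + sbar w * \<delta> h) \<and> (\<forall>w. sbar (\<delta> w) = - \<delta> (sbar w))"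

lemma oder_sder: assumes "oder \<delta>" shows "sder (-1) \<delta>"
proof -
  have m: "\<delta> (- w) = - \<delta> w" for w using assms bounded_additive_minus unfolding oder_def by blast
  show ?thesis
    unfolding sder_def
  proof (intro conjI allI impI)
    fix w r assume "even_s w" "odd_s r"
    then show "\<delta> w * r = scal (- 1) * r * \<delta> w"
      using assms odd_s_anticommute[of "\<delta> w" r] by (simp add: oder_def even_s_def odd_s_def scal_minus)
  next
    fix w r assume "odd_s w" "odd_s r"
    then show "\<delta> w * r = - (scal (- 1) * r * \<delta> w)"
      using assms even_s_commute[of "\<delta> w" r] by (simp add: oder_def even_s_def odd_s_def scal_minus m)
  qed (use assms in \<open>auto simp: oder_def even_s_def odd_s_def scal_minus\<close>)
qed

lemma oder_add: "oder \<delta> \<Longrightarrow> oder \<epsilon> \<Longrightarrow> oder (\<lambda>h. \<delta> h + \<epsilon> h)"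
  unfolding oder_def by (auto simp: bounded_additive_plus distrib_left distrib_right)

lemma oder_scal: "oder \<delta> \<Longrightarrow> oder (\<lambda>h. scal z * \<delta> h)"
  unfolding oder_def
  using bounded_additive_comp[OF bounded_additive_left_mult[of "scal z"], of \<delta>]
  by (auto simp: distrib_left scal_left_commute[of "sbar _"] mult.assoc)

lemma oder_sderiv: assumes "\<And>k. g \<noteq> Zeta k" shows "oder (sderiv g)"
proof -
  have 1: "oder (d_odd g)"
    unfolding oder_def using assms by (auto simp: bounded_additive_d_odd d_odd_ogen d_odd_mult d_odd_sbar)
  have "bounded_additive (\<lambda>h. ogen g * fls_deriv h)"
    by (rule bounded_additive_comp[OF bounded_additive_left_mult bounded_additive_deriv])
  moreover have "ogen g * fls_deriv (w * h) = ogen g * fls_deriv w * h + sbar w * (ogen g * fls_deriv h)" for w h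
    using odd_mult_bar[OF odd_s_intros(6)[of g], of "sbar w" "fls_deriv h"]
    unfolding deriv_mult by (simp add: distrib_left mult.assoc)
  ultimately have 2: "oder (\<lambda>h. ogen g * fls_deriv h)"
    unfolding oder_def by (simp add: deriv_sbar del: fls_deriv_mult)
  show ?thesis using oder_add[OF 1 2] by (simp add: sderiv_def[abs_def])
qed

definition Dp :: "sfun \<Rightarrow> sfun" where "Dp h = sderiv Phi1 h + ii * sderiv Phi2 h"
definition Dm :: "sfun \<Rightarrow> sfun" where "Dm h = sderiv Phi1 h - ii * sderiv Phi2 h"

lemma oder_Dp: "oder Dp" and oder_Dm: "oder Dm"
proof -
  have s: "oder (sderiv Phi1)" "oder (sderiv Phi2)" by (rule oder_sderiv; simp)+
  show "oder Dp" using oder_add[OF s(1) oder_scal[OF s(2), of \<i>]] by (simp add: Dp_def[abs_def] ii_def)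
  have "oder (\<lambda>h. sderiv Phi1 h + scal (- \<i>) * sderiv Phi2 h)" by (rule oder_add[OF s(1) oder_scal[OF s(2)]])
  then show "oder Dm" by (simp add: Dm_def[abs_def] ii_def scal_minus)
qed

lemma oderD:
  assumes "oder \<delta>"
  shows "\<delta> (f + h) = \<delta> f + \<delta> h" "\<delta> (f - h) = \<delta> f - \<delta> h" "\<delta> (- f) = - \<delta> f" "\<delta> 0 = 0"
    "\<delta> (f * h) = \<delta> f * h + sbar f * \<delta> h" "\<delta> (scal z * f) = scal z * \<delta> f" "\<delta> (ii * f) = ii * \<delta> f"
    "odd_s f \<Longrightarrow> even_s (\<delta> f)" "even_s f \<Longrightarrow> odd_s (\<delta> f)"
proof -
  have b: "bounded_additive \<delta>" using assms by (simp add: oder_def)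
  show "\<delta> (f + h) = \<delta> f + \<delta> h" "\<delta> (f - h) = \<delta> f - \<delta> h" "\<delta> 0 = 0" and m: "\<delta> (- f) = - \<delta> f"
    using bounded_additive_add[OF b] bounded_additive_diff[OF b] bounded_additive_0[OF b] bounded_additive_minus[OF b]
    by simp_all
  show "\<delta> (f * h) = \<delta> f * h + sbar f * \<delta> h" using assms by (simp add: oder_def)
  show s: "\<delta> (scal z * f) = scal z * \<delta> f" for z using assms by (simp add: oder_def)
  show "\<delta> (ii * f) = ii * \<delta> f" unfolding ii_def by (rule s)
  show "odd_s f \<Longrightarrow> even_s (\<delta> f)" "even_s f \<Longrightarrow> odd_s (\<delta> f)"
    using assms m by (simp_all add: oder_def even_s_def odd_s_def)
qed

lemmas DpD = oderD[OF oder_Dp] and DmD = oderD[OF oder_Dm]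
lemmas sderivD = oderD[OF oder_sderiv]

lemma over_D: "over L V f \<Longrightarrow> {Phi1, Phi2} \<subseteq> V \<Longrightarrow> over L V (Dp f)"
  unfolding Dp_def sderiv_def d_x.simps by (intro over_arith over_mult over_ii) auto

lemma W_Dp: "W m f \<Longrightarrow> W (m - 1) (Dp f)"
proof -
  assume f: "W m f"
  have s: "W (m - 1) (sderiv g f)" if "W 1 (ogen g)" for g
  proof -
    have "W (1 + (m - 2)) (ogen g * fls_deriv f)" by (intro W_mult that W_deriv f)
    then have "W (m - 1) (ogen g * fls_deriv f)" by simp
    then show ?thesis unfolding sderiv_def d_x.simps by (rule W_arith(1)[OF W_d_odd[OF f]])
  qed
  show ?thesis unfolding Dp_def ii_def by (intro W_arith(1) W_arith(4) s W_ogen_Phi)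
qed

text \<open>Each D^(j) squares to d/dx and the two anticommute, so in the square of D^(1) + i D^(2)
  the two copies of d/dx cancel.\<close>

lemma Dp_Dp: "Dp (Dp f) = 0"
  unfolding Dp_def sderiv_def d_x.simps
  by (simp add: d_odd_mult d_odd_ogen d_odd_deriv deriv_mult algebra_simps ii_left phi_order d_odd_anticommute[of Phi2 Phi1]
      del: fls_deriv_mult)

definition iy :: sfun where "iy = xp 1 + ii * (ogen Phi1 * ogen Phi2)"
definition ith :: sfun where "ith = ogen Phi1 - ii * ogen Phi2"

text \<open>Pulls a function of x and Phi back along the chiral coordinates x + i Phi1 Phi2 and Phi1
  - i Phi2, both annihilated by \<open>Dm\<close>.\<close>

definition iota :: "sfun \<Rightarrow> sfun" where
  "iota = subst iy (ogen(Phi := ith))"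

lemma inverse_nilpotent:
  assumes u: "u * w = 1" "w * u = 1" and n: "even_s n" "n * n = (0::sfun)"
  shows "(u + n) * (w - w * n * w) = 1" "(w - w * n * w) * (u + n) = 1"
proof -
  have nw: "n * w = w * n" "n * (w * k) = w * (n * k)" for k
    using even_s_commute[OF n(1)] even_mult_left[OF n(1)] by auto
  have nn: "n * (n * k) = 0" for k using n(2) by (simp flip: mult.assoc)
  have c: "u * (w * k) = k" "w * (u * k) = k" for k using u by (simp_all flip: mult.assoc)
  have nu: "n * u = u * n" using even_s_commute[OF n(1)] by auto
  show "(u + n) * (w - w * n * w) = 1"
    by (simp add: distrib_right right_diff_distrib mult.assoc c u nw nn n(2))
  show "(w - w * n * w) * (u + n) = 1"
    by (simp add: distrib_left left_diff_distrib mult.assoc c u nw nn nu n(2))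
qed

lemma subst_okI:
  assumes "even_s u" "W 2 u" "u * w = 1" "w * u = 1" "W (-2) w"
    "\<And>g. odd_s (v g)" "\<And>g. W (wt {g}) (v g)"
  shows "subst_ok u v"
proof -
  have "W 0 (gsubst v d)" for d by (rule W_gsubst[OF assms(7)]) (simp add: sum_nonneg wt_bounds)
  then show ?thesis unfolding subst_ok_def using assms by blast
qed

lemma subst_ok_comp:
  assumes ok: "subst_ok u v" and v: "\<And>g. W (wt {g}) (v g)" and ok': "subst_ok u' v'" and v': "\<And>g. W (wt {g}) (v' g)"
  shows "subst_ok (subst u v u') (\<lambda>g. subst u v (v' g))"
proof -
  from ok' obtain w where w: "even_s u'" "W 2 u'" "u' * w = 1" "w * u' = 1" "W (-2) w"
    unfolding subst_ok_def by blast
  show ?thesis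
  proof (rule subst_okI)
    show "even_s (subst u v u')" by (rule parity_subst(1)[OF ok w(1)])
    show "W 2 (subst u v u')" "W (-2) (subst u v w)" by (rule W_subst[OF ok _ v], rule w)+
    show "subst u v u' * subst u v w = 1" "subst u v w * subst u v u' = 1"
      using w(3,4) by (simp_all flip: subst_mult[OF ok])
    show "odd_s (subst u v (v' g))" for g by (rule parity_subst(2)[OF ok subst_okD(1)[OF ok']])
    show "W (wt {g}) (subst u v (v' g))" for g by (rule W_subst[OF ok v' v])
  qed
qed

lemma iy_inverse:
  obtains w where "iy * w = 1" "w * iy = 1" "W (-2) w" "\<And>L. over L {Phi1, Phi2} w"
proof -
  let ?n = "ii * (ogen Phi1 * ogen Phi2)"
  let ?w = "xp (-1) - xp (-1) * ?n * xp (-1)"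
  have e: "even_s ?n" by (intro even_s_intros(4,5) even_s_ii odd_s_intros(6))
  have z: "?n * ?n = 0" by (simp add: ii_left mult.assoc phi_order)
  have x: "xp 1 * xp (-1) = (1::sfun)" "xp (-1) * xp 1 = (1::sfun)" by (simp_all add: xp_mult_xp)
  note i = inverse_nilpotent[OF x e z]
  have n: "W (0 + (1 + 1)) ?n" by (intro W_mult W_ii W_ogen_Phi)
  have "W (2 * (-1) + (0 + (1 + 1)) + 2 * (-1)) (xp (-1) * ?n * xp (-1))"
    by (intro W_mult[OF W_mult[OF W_xp n] W_xp])
  moreover have "W (2 * (-1)) (xp (-1))" by (rule W_xp)
  ultimately have "W (-2) ?w" by (intro W_arith(2)) simp_all
  moreover have "over L {Phi1, Phi2} ?w" for L by (intro over_arith over_mult over_ii) auto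
  ultimately show ?thesis using that i by (simp add: iy_def)
qed

lemma iota_data:
  "subst_ok iy (ogen(Phi := ith))" "W (wt {g}) ((ogen(Phi := ith)) g)" "over L {Phi1, Phi2} (zpow iy n)"
  "over L {Phi1, Phi2} ith" "odd_s ith"
proof -
  obtain w where w: "iy * w = 1" "w * iy = 1" "W (-2) w" "\<And>L. over L {Phi1, Phi2} w" by (rule iy_inverse) blast
  have n: "W (0 + (1 + 1)) (ii * (ogen Phi1 * ogen Phi2))" by (intro W_mult W_ii W_ogen_Phi)
  have y: "W 2 iy" unfolding iy_def by (rule W_arith(1)) (use n W_xp[of 1] in simp_all)
  have e: "even_s iy" unfolding iy_def by (intro even_s_intros(1,4,5,7) even_s_ii odd_s_intros(6))
  show o: "odd_s ith" unfolding ith_def by (intro odd_s_intros(2,4,6) even_s_ii)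
  have "W (0 + 1) (ii * ogen Phi2)" by (intro W_mult W_ii W_ogen_Phi)
  then have t: "W 1 ith" unfolding ith_def by (intro W_arith(2) W_ogen_Phi) simp
  show wt: "W (wt {g}) ((ogen(Phi := ith)) g)" for g using t W_ogen[of g] by simp
  show "subst_ok iy (ogen(Phi := ith))"
    by (rule subst_okI[OF e y w(1-3) _ wt]) (simp add: o odd_s_intros)
  have "over L {Phi1, Phi2} iy" unfolding iy_def by (intro over_arith over_mult over_ii) auto
  then show "over L {Phi1, Phi2} (zpow iy n)"
    using over_power w(4) by (simp add: zpow_def unit_inv_eq[OF w(1,2)])
  show "over L {Phi1, Phi2} ith" unfolding ith_def by (intro over_arith over_mult over_ii) auto
qed

lemmas iota_ok = iota_data(1)
lemmas iota_ring = subst_add[OF iota_ok, folded iota_def] subst_diff[OF iota_ok, folded iota_def]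
  subst_mult[OF iota_ok, folded iota_def] subst_uminus[OF iota_ok, folded iota_def]
  subst_0[OF iota_ok, folded iota_def] subst_scal[of iy "ogen(Phi := ith)", folded iota_def]
  subst_1[of iy "ogen(Phi := ith)", folded iota_def]

lemma iota_gen: "iota (xp 1) = iy" "iota (ogen Phi) = ith" "g \<noteq> Phi \<Longrightarrow> iota (ogen g) = ogen g" "iota ii = ii"
  unfolding iota_def ii_def by (simp_all add: subst_ogen[OF iota_ok])

lemma parity_iota: "even_s f \<Longrightarrow> even_s (iota f)" "odd_s f \<Longrightarrow> odd_s (iota f)"
  unfolding iota_def by (rule parity_subst[OF iota_ok]; assumption)+

lemma W_iota: "W m f \<Longrightarrow> W m (iota f)"
  unfolding iota_def by (rule W_subst[OF iota_ok _ iota_data(2)])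

lemma over_iota: "over L {Phi} f \<Longrightarrow> over L {Phi1, Phi2} (iota f)"
  unfolding iota_def
  by (rule over_subst[OF iota_ok]) (auto simp: iota_data over_Zeta)

lemma iota_const: "c \<in> Lam L {} \<Longrightarrow> iota (fls_const c) = fls_const c"
  unfolding iota_def subst_const by (rule gsubst_Lam) simp_all

lemma iota_chain:
  assumes h: "over L {Phi} h"
  shows "fls_deriv (iota h) = iota (fls_deriv h)"
    "d_odd Phi1 (iota h) = ii * (ogen Phi2 * iota (fls_deriv h)) + iota (d_odd Phi h)"
    "d_odd Phi2 (iota h) = - (ii * (ogen Phi1 * iota (fls_deriv h)) + ii * iota (d_odd Phi h))"
    "Dm (iota h) = 0"
proof -
  have z: "d_odd Phi1 h = 0" "d_odd Phi2 h = 0" by (rule d_odd_over[OF h]; simp)+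
  have zeta: "(ogen(Phi := ith)) (Zeta k) = ogen (Zeta k)" for k by simp
  have x: "fls_deriv (xp 1 :: sfun) = 1" using deriv_xp[of 1] by simp
  have d: "fls_deriv iy = 1" "fls_deriv ith = 0" "d_odd Phi1 iy = ii * ogen Phi2" "d_odd Phi1 ith = 1"
    "d_odd Phi2 iy = - (ii * ogen Phi1)" "d_odd Phi2 ith = - ii"
    unfolding iy_def ith_def by (simp_all add: x d_odd_ogen d_odd_ogen_mult)
  note c = chain_rule[OF _ iota_ok zeta, folded iota_def, of _ _ h, unfolded z iota_ring]
  show 1: "fls_deriv (iota h) = iota (fls_deriv h)"
    using c[OF sder_deriv] by (simp add: d)
  show 2: "d_odd Phi1 (iota h) = ii * (ogen Phi2 * iota (fls_deriv h)) + iota (d_odd Phi h)"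
    using c[OF sder_d_odd[of Phi1]] by (simp add: d mult.assoc)
  show 3: "d_odd Phi2 (iota h) = - (ii * (ogen Phi1 * iota (fls_deriv h)) + ii * iota (d_odd Phi h))"
    using c[OF sder_d_odd[of Phi2]] by (simp add: d mult.assoc)
  show "Dm (iota h) = 0"
    unfolding Dm_def sderiv_def d_x.simps 1 2 3 by (simp add: algebra_simps ii_left)
qed

text \<open>A left inverse of \<open>iota\<close>: for Phi2 = 0 the chiral coordinates become x and
  Phi1, and Phi1 is renamed to Phi.\<close>

definition rho :: "sfun \<Rightarrow> sfun" where
  "rho = subst (xp 1) (ogen(Phi1 := ogen Phi, Phi2 := 0))"

lemma subst_ok_xp1:
  assumes "\<And>g. odd_s (v g)" "\<And>g. W (wt {g}) (v g)" shows "subst_ok (xp 1) v"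
  by (rule subst_okI[where w = "xp (-1)"])
    (use W_xp[of 1] W_xp[of "-1"] in \<open>simp_all add: even_s_intros xp_mult_xp assms\<close>)

lemma rho_ok: "subst_ok (xp 1) (ogen(Phi1 := ogen Phi, Phi2 := 0))"
  "W (wt {g}) ((ogen(Phi1 := ogen Phi, Phi2 := 0)) g)"
proof -
  show w: "W (wt {g}) ((ogen(Phi1 := ogen Phi, Phi2 := 0)) g)" for g
    using W_ogen[of g] W_ogen_Phi(1) by simp
  show "subst_ok (xp 1) (ogen(Phi1 := ogen Phi, Phi2 := 0))"
    by (rule subst_ok_xp1[OF _ w]) (simp add: odd_s_intros)
qed

lemma over_gens: "over L V f \<Longrightarrow> gcoeff (f $$ n) S \<noteq> 0 \<Longrightarrow> g \<in> S \<Longrightarrow> g \<in> V \<or> (\<exists>k. g = Zeta k)"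
  unfolding over_def spt_def by blast

lemma rho_iota:
  assumes h: "over L {Phi} h" shows "rho (iota h) = h"
proof -
  let ?v = "ogen(Phi1 := ogen Phi, Phi2 := 0)"
  have "rho (iota h) = subst (rho iy) (\<lambda>g. rho ((ogen(Phi := ith)) g)) h"
    unfolding rho_def iota_def
    by (rule subst_subst[OF rho_ok(1) iota_ok subst_ok_comp[OF rho_ok iota_data(1,2)]])
  also have "rho iy = xp 1" unfolding rho_def iy_def ii_def
    by (simp add: subst_add[OF rho_ok(1)] subst_mult[OF rho_ok(1)] subst_ogen[OF rho_ok(1)])
  also have "subst (xp 1) (\<lambda>g. rho ((ogen(Phi := ith)) g)) h = subst (xp 1) ogen h"
  proof (rule subst_cong)
    fix n S g assume "gcoeff (h $$ n) S \<noteq> 0" "g \<in> S"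
    then have "g = Phi \<or> (\<exists>k. g = Zeta k)" using over_gens[OF h] by blast
    then show "rho ((ogen(Phi := ith)) g) = ogen g" unfolding rho_def ith_def ii_def
      by (auto simp: subst_diff[OF rho_ok(1)] subst_mult[OF rho_ok(1)] subst_ogen[OF rho_ok(1)])
  qed
  finally show ?thesis by (simp add: subst_id)
qed

section \<open>The \<open>N = 2\<close> superconformal condition in chiral form\<close>

definition sub2 :: "fun2 \<Rightarrow> sfun \<Rightarrow> sfun" where
  "sub2 g = subst (fst g) (ogen(Phi1 := fst (snd g), Phi2 := snd (snd g)))"

lemma comp2_At_0: "comp2 At_0 f g = map_prod (sub2 g) (map_prod (sub2 g) (sub2 g)) f"
  by (cases f; cases g) (simp add: sub2_def Let_def)

definition chY :: "fun2 \<Rightarrow> sfun" where "chY = (\<lambda>(X, P1, P2). X + ii * (P1 * P2))"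
definition chM :: "fun2 \<Rightarrow> sfun" where "chM = (\<lambda>(X, P1, P2). P1 - ii * P2)"
definition chP :: "fun2 \<Rightarrow> sfun" where "chP = (\<lambda>(X, P1, P2). P1 + ii * P2)"

definition typed2 :: "enat \<Rightarrow> fun2 \<Rightarrow> bool" where
  "typed2 L = (\<lambda>(X, P1, P2). even_s X \<and> odd_s P1 \<and> odd_s P2 \<and>
     over L {Phi1, Phi2} X \<and> over L {Phi1, Phi2} P1 \<and> over L {Phi1, Phi2} P2)"

lemma ch_inj: "chY g = chY g' \<Longrightarrow> chM g = chM g' \<Longrightarrow> chP g = chP g' \<Longrightarrow> g = g'"
proof -
  assume e: "chY g = chY g'" "chM g = chM g'" "chP g = chP g'"
  obtain X P1 P2 where g: "g = (X, P1, P2)" by (cases g) auto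
  obtain X' P1' P2' where g': "g' = (X', P1', P2')" by (cases g') auto
  have "(P1 - P1') - ii * (P2 - P2') = 0" "(P1 - P1') + ii * (P2 - P2') = 0"
    using e by (simp_all add: g g' chM_def chP_def algebra_simps)
  then have "P1 - P1' = 0" "P2 - P2' = 0" using ii_cancel[of "P1 - P1'" "P2 - P2'"] by simp_all
  then show ?thesis using e(1) by (simp add: g g' chY_def)
qed

text \<open>The first two conditions, combined with the factors i and -i, are the statements on
  \<open>P1 - ii * P2\<close> and \<open>P1 + ii * P2\<close>. Given these, the last two conditions
  combine in the same way, the derivative of \<open>ii * (P1 * P2)\<close> supplying the mixed
  terms.\<close>

lemma superconformal_iff:
  assumes "even_s X" "odd_s P1" "odd_s P2"
  shows "superconformal (X, P1, P2) \<longleftrightarrow> Dm (P1 - ii * P2) = 0 \<and> Dp (P1 + ii * P2) = 0 \<and>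
     Dm (X + ii * (P1 * P2)) = 0 \<and> Dp (X + ii * (P1 * P2)) = (P1 + ii * P2) * Dp (P1 - ii * P2)"
proof -
  define a1 b1 a2 b2 where "a1 = sderiv Phi1 P1" "b1 = sderiv Phi1 P2" "a2 = sderiv Phi2 P1" "b2 = sderiv Phi2 P2"
  note ab = this
  have ev: "even_s a1" "even_s b1" "even_s a2" "even_s b2"
    unfolding ab by (rule sderivD(8); simp add: assms)+
  have c: "a1 * P = P * a1" "b1 * P = P * b1" "a2 * P = P * a2" "b2 * P = P * b2" for P
    using ev even_s_commute by blast+
  define c1 c2 where "c1 = sderiv Phi1 X - P1 * a1 - P2 * b1" "c2 = sderiv Phi2 X - P1 * a2 - P2 * b2"
  note c12 = this
  have sb: "sbar P1 = - P1" "sbar P2 = - P2" using assms by (simp_all add: odd_s_def)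
  have si: "sderiv g ii = 0" for g by (simp add: sderiv_def)
  have s1: "sderiv Phi1 (f + h) = sderiv Phi1 f + sderiv Phi1 h" "sderiv Phi2 (f + h) = sderiv Phi2 f + sderiv Phi2 h"
    "sderiv Phi1 (f - h) = sderiv Phi1 f - sderiv Phi1 h" "sderiv Phi2 (f - h) = sderiv Phi2 f - sderiv Phi2 h"
    "sderiv Phi1 (ii * f) = ii * sderiv Phi1 f" "sderiv Phi2 (ii * f) = ii * sderiv Phi2 f"
    "sderiv Phi1 (f * h) = sderiv Phi1 f * h + sbar f * sderiv Phi1 h"
    "sderiv Phi2 (f * h) = sderiv Phi2 f * h + sbar f * sderiv Phi2 h" for f h
    by (rule sderivD; simp)+
  have 1: "superconformal (X, P1, P2) \<longleftrightarrow> (a1 - b2 = 0 \<and> b1 + a2 = 0) \<and> (c1 = 0 \<and> c2 = 0)"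
    by (simp add: ab c12)
  have "Dm (P1 - ii * P2) = (a1 - b2) - ii * (b1 + a2)" "Dp (P1 + ii * P2) = (a1 - b2) + ii * (b1 + a2)"
    unfolding Dm_def Dp_def by (simp_all add: s1 si ab algebra_simps)
  then have 2: "Dm (P1 - ii * P2) = 0 \<and> Dp (P1 + ii * P2) = 0 \<longleftrightarrow> a1 - b2 = 0 \<and> b1 + a2 = 0"
    using ii_cancel[of "a1 - b2" "b1 + a2"] by simp
  have 3: "Dm (X + ii * (P1 * P2)) = 0 \<and> Dp (X + ii * (P1 * P2)) = (P1 + ii * P2) * Dp (P1 - ii * P2)
      \<longleftrightarrow> c1 = 0 \<and> c2 = 0" if h: "a1 - b2 = 0 \<and> b1 + a2 = 0"
  proof -
    have b: "b2 = a1" "a2 = - b1" using h by (simp_all add: eq_neg_iff_add_eq_0 add.commute)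
    have "Dm (X + ii * (P1 * P2)) = c1 - ii * c2"
      unfolding Dm_def s1 si sb c12 ab[symmetric] b by (simp add: algebra_simps c ii_left)
    moreover have "Dp (X + ii * (P1 * P2)) - (P1 + ii * P2) * Dp (P1 - ii * P2) = c1 + ii * c2"
      unfolding Dp_def s1 si sb c12 ab[symmetric] b by (simp add: algebra_simps c ii_left)
    ultimately show ?thesis using ii_cancel[of c1 c2] by (metis eq_iff_diff_eq_0)
  qed
  show ?thesis unfolding 1 using 2 3 by blast
qed

lemma superconformalD:
  assumes "even_s X" "odd_s P1" "odd_s P2" "superconformal (X, P1, P2)"
  shows "Dp P2 = ii * Dp P1" "Dm P2 = - (ii * Dm P1)"
    "Dp X = Dp P1 * (P1 + ii * P2)" "Dm X = Dm P1 * (P1 - ii * P2)"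
proof -
  define a1 b1 a2 b2 where "a1 = sderiv Phi1 P1" "b1 = sderiv Phi1 P2" "a2 = sderiv Phi2 P1" "b2 = sderiv Phi2 P2"
  note ab = this
  have ev: "even_s a1" "even_s b1" "even_s a2" "even_s b2"
    unfolding ab by (rule sderivD(8); simp add: assms)+
  have c: "a1 * P = P * a1" "b1 * P = P * b1" "a2 * P = P * a2" "b2 * P = P * b2" for P
    using ev even_s_commute by blast+
  have "a1 - b2 = 0" "b1 + a2 = 0" using assms(4) by (simp_all add: ab)
  then have b: "b2 = a1" "a2 = - b1" by (simp_all add: eq_neg_iff_add_eq_0 add.commute)
  have X: "sderiv Phi1 X = P1 * a1 + P2 * b1" "sderiv Phi2 X = P1 * a2 + P2 * b2"
    using assms(4) by (simp_all add: ab algebra_simps)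
  show "Dp P2 = ii * Dp P1" "Dm P2 = - (ii * Dm P1)"
    unfolding Dp_def Dm_def ab[symmetric] b by (simp_all add: algebra_simps)
  show "Dp X = Dp P1 * (P1 + ii * P2)" "Dm X = Dm P1 * (P1 - ii * P2)"
    unfolding Dp_def Dm_def X ab[symmetric] b by (simp_all add: algebra_simps c ii_left)
qed

section \<open>Lifting \<open>N = 1\<close> functions to \<open>N = 2\<close> superconformal functions\<close>

definition good2 :: "enat \<Rightarrow> fun2 \<Rightarrow> bool" where
  "good2 L g \<longleftrightarrow> typed2 L g \<and> W 2 (fst g) \<and> W 1 (fst (snd g)) \<and> W 1 (snd (snd g)) \<and>
     (\<exists>w. fst g * w = 1 \<and> w * fst g = 1 \<and> W (-2) w \<and> over L {Phi1, Phi2} w)"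

definition lifts :: "fun1 \<Rightarrow> fun2 \<Rightarrow> bool" where
  "lifts f g \<longleftrightarrow> iota (fst f) = chY g \<and> iota (snd f) = chM g"

text \<open>An intermediate description that carries enough invertibility to substitute at once.
  \<open>SC_0_carrier_eq\<close> identifies it with the set defined by vanishing at the origin and
  the existence of an inverse.\<close>

definition SC2 :: "enat \<Rightarrow> fun2 set" where
  "SC2 L = {g. good2 L g \<and> superconformal g \<and> (\<exists>f\<in>SA_0_carrier L. lifts f g)}"

lemma good2_data:
  assumes "good2 L g"
  defines "v \<equiv> ogen(Phi1 := fst (snd g), Phi2 := snd (snd g))"
  shows "subst_ok (fst g) v" "W (wt {k}) (v k)" "over L {Phi1, Phi2} (zpow (fst g) n)"
    "over L {Phi1, Phi2} h \<Longrightarrow> over L {Phi1, Phi2} (sub2 g h)" "W m h \<Longrightarrow> W m (sub2 g h)"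
    "even_s h \<Longrightarrow> even_s (sub2 g h)" "odd_s h \<Longrightarrow> odd_s (sub2 g h)"
proof -
  obtain X P1 P2 where g: "g = (X, P1, P2)" by (cases g) auto
  note a = assms(1)[unfolded good2_def typed2_def g fst_conv snd_conv prod.case]
  then obtain w where w: "X * w = 1" "w * X = 1" "W (-2) w" "over L {Phi1, Phi2} w" by blast
  show v: "W (wt {k}) (v k)" for k using a W_ogen[of k] by (simp add: v_def g)
  show ok: "subst_ok (fst g) v"
    by (rule subst_okI[OF _ _ _ _ w(3) _ v]) (use a w in \<open>simp_all add: g v_def odd_s_intros\<close>)
  show z: "over L {Phi1, Phi2} (zpow (fst g) n)" for n
    using a w over_power by (simp add: g zpow_def unit_inv_eq[OF w(1,2)])
  show "over L {Phi1, Phi2} (sub2 g h)" if "over L {Phi1, Phi2} h"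
    unfolding sub2_def v_def[symmetric]
    by (rule over_subst[OF ok that z]) (use a in \<open>auto simp: v_def g over_Zeta\<close>)
  show "W m h \<Longrightarrow> W m (sub2 g h)" unfolding sub2_def v_def[symmetric] by (rule W_subst[OF ok _ v])
  show "even_s h \<Longrightarrow> even_s (sub2 g h)" "odd_s h \<Longrightarrow> odd_s (sub2 g h)"
    unfolding sub2_def v_def[symmetric] by (rule parity_subst[OF ok]; assumption)+
qed

lemma sub2_ring:
  assumes "good2 L g"
  shows "sub2 g (f + h) = sub2 g f + sub2 g h" "sub2 g (f - h) = sub2 g f - sub2 g h"
    "sub2 g (f * h) = sub2 g f * sub2 g h" "sub2 g 0 = 0" "sub2 g 1 = 1" "sub2 g ii = ii"
    "sub2 g (xp 1) = fst g" "sub2 g (ogen Phi1) = fst (snd g)" "sub2 g (ogen Phi2) = snd (snd g)"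
    "k \<noteq> Phi1 \<Longrightarrow> k \<noteq> Phi2 \<Longrightarrow> sub2 g (ogen k) = ogen k"
proof -
  note ok = good2_data(1)[OF assms]
  show "sub2 g (f + h) = sub2 g f + sub2 g h" "sub2 g (f - h) = sub2 g f - sub2 g h"
    "sub2 g (f * h) = sub2 g f * sub2 g h" "sub2 g 0 = 0" "sub2 g 1 = 1" "sub2 g ii = ii" "sub2 g (xp 1) = fst g"
    unfolding sub2_def ii_def
    by (simp_all add: subst_add[OF ok] subst_diff[OF ok] subst_mult[OF ok] subst_0[OF ok])
  show "sub2 g (ogen Phi1) = fst (snd g)" "sub2 g (ogen Phi2) = snd (snd g)"
    "k \<noteq> Phi1 \<Longrightarrow> k \<noteq> Phi2 \<Longrightarrow> sub2 g (ogen k) = ogen k"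
    unfolding sub2_def by (simp_all add: subst_ogen[OF ok])
qed

lemma good2_comp:
  assumes f: "good2 L f" and g: "good2 L g" shows "good2 L (comp2 At_0 f g)"
proof -
  obtain X P1 P2 where f': "f = (X, P1, P2)" by (cases f) auto
  note a = f[unfolded good2_def typed2_def f' fst_conv snd_conv prod.case]
  then obtain w where w: "X * w = 1" "w * X = 1" "W (-2) w" "over L {Phi1, Phi2} w" by blast
  have "sub2 g X * sub2 g w = 1" "sub2 g w * sub2 g X = 1"
    using w(1,2) sub2_ring(5)[OF g] by (simp_all flip: sub2_ring(3)[OF g])
  then show ?thesis
    unfolding good2_def typed2_def comp2_At_0 f' map_prod_simp fst_conv snd_conv prod.case
    using a w(3,4) good2_data(4-7)[OF g] by blast
qed

text \<open>For superconformal \<open>g\<close> the relations of \<open>superconformalD\<close> let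
  one factor be taken out of the chain rule. Superconformal maps thus merely rescale D^+ and D^-,
  and this is why they are closed under composition.\<close>

lemma chain2:
  assumes g: "good2 L g" and s: "superconformal g"
  shows "Dp (sub2 g h) = Dp (fst (snd g)) * sub2 g (Dp h)" "Dm (sub2 g h) = Dm (fst (snd g)) * sub2 g (Dm h)"
proof -
  obtain X P1 P2 where g': "g = (X, P1, P2)" by (cases g) auto
  have t: "even_s X" "odd_s P1" "odd_s P2" using g by (auto simp: good2_def typed2_def g')
  note D = superconformalD[OF t s[unfolded g']]
  have zeta: "(ogen(Phi1 := fst (snd g), Phi2 := snd (snd g))) (Zeta k) = ogen (Zeta k)" for k by simp
  have z: "Dp (ogen Phi) = 0" "Dm (ogen Phi) = 0"
    by (simp_all add: Dp_def Dm_def sderiv_def d_odd_ogen)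
  note c = chain_rule[OF oder_sder good2_data(1)[OF g] zeta, folded sub2_def, unfolded g' fst_conv snd_conv]
  have eDp: "sub2 g (Dp h) = sub2 g (d_odd Phi1 h) + P1 * sub2 g (fls_deriv h)
      + ii * (sub2 g (d_odd Phi2 h) + P2 * sub2 g (fls_deriv h))"
    unfolding Dp_def sderiv_def d_x.simps sub2_ring[OF g] by (simp add: g')
  have eDm: "sub2 g (Dm h) = sub2 g (d_odd Phi1 h) + P1 * sub2 g (fls_deriv h)
      - ii * (sub2 g (d_odd Phi2 h) + P2 * sub2 g (fls_deriv h))"
    unfolding Dm_def sderiv_def d_x.simps sub2_ring[OF g] by (simp add: g')
  have "Dp (sub2 g h) = Dp X * sub2 g (fls_deriv h) + Dp P1 * sub2 g (d_odd Phi1 h) + Dp P2 * sub2 g (d_odd Phi2 h)"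
    using c[OF oder_Dp, of h] z by (simp add: g')
  then show "Dp (sub2 g h) = Dp (fst (snd g)) * sub2 g (Dp h)"
    unfolding D eDp by (simp add: g' algebra_simps ii_left)
  have "Dm (sub2 g h) = Dm X * sub2 g (fls_deriv h) + Dm P1 * sub2 g (d_odd Phi1 h) + Dm P2 * sub2 g (d_odd Phi2 h)"
    using c[OF oder_Dm, of h] z by (simp add: g')
  then show "Dm (sub2 g h) = Dm (fst (snd g)) * sub2 g (Dm h)"
    unfolding D eDm by (simp add: g' algebra_simps ii_left)
qed

lemma superconformal_comp:
  assumes f: "good2 L f" "superconformal f" and g: "good2 L g" "superconformal g"
  shows "superconformal (comp2 At_0 f g)"
proof -
  obtain X P1 P2 where f': "f = (X, P1, P2)" by (cases f) auto
  have t: "even_s X" "odd_s P1" "odd_s P2" using f by (auto simp: good2_def typed2_def f')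
  note S = f(2)[unfolded f' superconformal_iff[OF t]]
  let ?s = "sub2 g"
  note r = sub2_ring[OF g(1), symmetric]
  have m: "?s P1 - ii * ?s P2 = ?s (P1 - ii * P2)" "?s P1 + ii * ?s P2 = ?s (P1 + ii * P2)"
    "?s X + ii * (?s P1 * ?s P2) = ?s (X + ii * (P1 * P2))" by (simp_all add: sub2_ring[OF g(1)])
  define nu where "nu = Dp (fst (snd g))"
  have "even_s nu" unfolding nu_def by (rule DpD(8)) (use g(1) in \<open>auto simp: good2_def typed2_def split: prod.splits\<close>)
  then have nu: "nu * (a * b) = a * (nu * b)" for a b by (rule even_mult_left)
  have t': "even_s (?s X)" "odd_s (?s P1)" "odd_s (?s P2)" using t good2_data(6,7)[OF g(1)] by blast+
  show ?thesis
    unfolding comp2_At_0 f' map_prod_simp superconformal_iff[OF t'] m chain2[OF g] nu_def[symmetric]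
    using S by (simp add: sub2_ring[OF g(1)] nu)
qed

text \<open>Both sides are double substitutions into \<open>h\<close>, and the lifting relation says
  precisely that their values for x and Phi agree.\<close>

lemma lifts_sub:
  assumes f: "f \<in> SA_0_carrier L" and g: "good2 L g" and l: "lifts f g" and h: "over L {Phi} h"
  shows "iota (sub1 f h) = sub2 g (iota h)"
proof -
  obtain c d where c: "c \<in> Lam_units L" "lead1 c d f" "typed1 L f"
    and ok: "subst_ok (fst f) (ogen(Phi := snd f))" using f by (rule SA_0_E)
  have "W 1 (snd f)" using c(2) W_lead_odd W_ogen_Phi(1) unfolding lead1_def by blast
  then have wf: "W (wt {k}) ((ogen(Phi := snd f)) k)" for k using W_ogen[of k] by simp
  note okg = good2_data(1,2)[OF g]
  let ?vg = "ogen(Phi1 := fst (snd g), Phi2 := snd (snd g))"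
  have "sub2 g (iota h) = subst (sub2 g iy) (\<lambda>k. sub2 g ((ogen(Phi := ith)) k)) h"
    unfolding iota_def sub2_def
    by (rule subst_subst[OF okg(1) iota_ok subst_ok_comp[OF okg iota_data(1,2)]])
  also have "sub2 g iy = chY g"
    unfolding iy_def sub2_ring[OF g] by (simp add: chY_def case_prod_beta)
  also have "\<dots> = iota (fst f)" using l by (simp add: lifts_def)
  also have "subst (iota (fst f)) (\<lambda>k. sub2 g ((ogen(Phi := ith)) k)) h =
      subst (iota (fst f)) (\<lambda>k. iota ((ogen(Phi := snd f)) k)) h"
  proof (rule subst_cong)
    fix n S k assume "gcoeff (h $$ n) S \<noteq> 0" "k \<in> S"
    then have k: "k = Phi \<or> (\<exists>j. k = Zeta j)" using over_gens[OF h] by blast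
    have "sub2 g ith = chM g" unfolding ith_def sub2_ring[OF g] by (simp add: chM_def case_prod_beta)
    then show "sub2 g ((ogen(Phi := ith)) k) = iota ((ogen(Phi := snd f)) k)"
      using k l by (auto simp: lifts_def sub2_ring(10)[OF g] iota_gen(3))
  qed
  also have "\<dots> = iota (sub1 f h)"
    unfolding iota_def sub1_def
    by (rule subst_subst[OF iota_ok ok subst_ok_comp[OF iota_data(1,2) ok wf], symmetric])
  finally show ?thesis ..
qed

lemma lifts_comp:
  assumes f: "f \<in> SA_0_carrier L" "good2 L F" "lifts f F" and g: "g \<in> SA_0_carrier L" "good2 L G" "lifts g G"
  shows "lifts (comp1 At_0 f g) (comp2 At_0 F G)"
proof -
  have "typed1 L f" using f(1) by (simp add: SA_0_carrier_iff)
  then have o: "over L {Phi} (fst f)" "over L {Phi} (snd f)" by (simp_all add: typed1_def)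
  obtain X P1 P2 where F: "F = (X, P1, P2)" by (cases F) auto
  show ?thesis
    using f(3) unfolding lifts_def comp1_At_0 comp2_At_0
    by (cases f) (use lifts_sub[OF g o(1)] lifts_sub[OF g o(2)] in
        \<open>simp add: F chY_def chM_def sub2_ring[OF g(2)]\<close>)
qed

lemma SC2_closed: "f \<in> SC2 L \<Longrightarrow> g \<in> SC2 L \<Longrightarrow> comp2 At_0 f g \<in> SC2 L"
  unfolding SC2_def mem_Collect_eq
  using good2_comp superconformal_comp lifts_comp SA_0_closed by blast

text \<open>Since \<open>Dp ith = 2\<close>, the leading coefficient is twice the unit
  \<open>d\<close>, hence a unit.\<close>

lemma Dp_iota_inverse:
  assumes f: "f \<in> SA_0_carrier L"
  obtains w where "Dp (iota (snd f)) * w = 1" "w * Dp (iota (snd f)) = 1" "W 0 w" "over L {Phi1, Phi2} w" "even_s w"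
proof -
  obtain c d where d: "d \<in> Lam_units L" "lead1 c d f" "typed1 L f" using f by (rule SA_0_E)
  let ?P = "snd f" and ?q = "Dp (iota (snd f))"
  have P: "odd_s ?P" "over L {Phi} ?P" "W 2 (?P - fls_const d * ogen Phi)"
    using d by (auto simp: typed1_def lead1_def)
  have dz: "d_odd g (fls_const d) = 0" if "\<And>k. g \<noteq> Zeta k" for g
    using gderiv_Lam[OF Lam_unitsD(2)[OF d(1)]] that by simp
  have Dd: "Dp (fls_const d) = 0" by (simp add: Dp_def sderiv_def dz)
  have th: "Dp ith = 2"
    unfolding Dp_def sderiv_def ith_def by (simp add: d_odd_ogen algebra_simps)
  have "W (2 - 1) (Dp (iota (?P - fls_const d * ogen Phi)))" by (rule W_Dp[OF W_iota[OF P(3)]])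
  moreover have "Dp (iota (?P - fls_const d * ogen Phi)) = ?q - fls_const d * 2"
    using const_unit_inverse(3)[OF d(1)]
    by (simp add: iota_ring iota_gen iota_const[OF Lam_unitsD(2)[OF d(1)]] DpD(2) DpD(5) Dd th even_s_def)
  moreover have "fls_const d * 2 = fls_const (d + d)"
    by (simp add: mult_2_right fls_plus_const)
  ultimately have q: "W 1 (?q - fls_const (d + d))" by simp
  have "d + d \<in> Lam_units L"
    by (rule Lam_units_if_body) (use Lam_unitsD(2-4)[OF d(1)] in \<open>simp_all add: Lam_arith even_arith\<close>)
  then obtain w where w: "?q * w = 1" "w * ?q = 1" "W 0 w" "\<And>V. over L V ?q \<Longrightarrow> over L V w"
    using inverse_lead_const[OF _ q] by metis
  have "even_s ?q" by (rule DpD(8)[OF parity_iota(2)[OF P(1)]])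
  then have "even_s w" by (rule even_s_inverse[OF _ w(1,2)])
  moreover have "over L {Phi1, Phi2} w" by (rule w(4)[OF over_D[OF over_iota[OF P(2)]]]) simp
  ultimately show ?thesis using that w(1-3) by blast
qed

text \<open>The last chiral condition reads \<open>Dp (chY g) = chP g * Dp (chM g)\<close> with an
  invertible right factor, so \<open>chP g\<close> is determined by the other two
  combinations.\<close>

lemma lift_unique:
  assumes f: "f \<in> SA_0_carrier L"
    and g: "typed2 L g" "superconformal g" "lifts f g" and g': "typed2 L g'" "superconformal g'" "lifts f g'"
  shows "g = g'"
proof -
  obtain w where w: "Dp (iota (snd f)) * w = 1" using Dp_iota_inverse[OF f] by metis
  have *: "Dp (chY h) = chP h * Dp (chM h)" if "typed2 L h" "superconformal h" for h
    using that superconformal_iff by (cases h) (auto simp: typed2_def chY_def chM_def chP_def)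
  have e: "chY g = chY g'" "chM g = chM g'" using g(3) g'(3) by (simp_all add: lifts_def)
  have "chP g * Dp (chM g) = chP g' * Dp (chM g)" using *[OF g(1,2)] *[OF g'(1,2)] e by simp
  then have "chP g * (Dp (chM g) * w) = chP g' * (Dp (chM g) * w)" by (simp flip: mult.assoc)
  moreover have "Dp (chM g) * w = 1" using w g(3) by (simp add: lifts_def)
  ultimately have "chP g = chP g'" by simp
  then show ?thesis using e ch_inj by blast
qed

text \<open>The missing combination \<open>P\<close> is \<open>Dp ?Y\<close> divided by
  \<open>Dp ?M\<close>. The condition \<open>Dp P = 0\<close> then follows from
  \<open>Dp_Dp\<close>, once the inverse of \<open>Dp ?M\<close> is seen to be killed by
  \<open>Dp\<close> too.\<close>

lemma lift_exists:
  assumes f: "f \<in> SA_0_carrier L" obtains g where "good2 L g" "superconformal g" "lifts f g"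
proof -
  obtain c d where c: "c \<in> Lam_units L" "lead1 c d f" "typed1 L f" using f by (rule SA_0_E)
  have X1: "even_s (fst f)" "over L {Phi} (fst f)" "W 3 (fst f - fls_const c * xp 1)"
    and P0: "odd_s (snd f)" "over L {Phi} (snd f)" "W 2 (snd f - fls_const d * ogen Phi)"
    using c by (auto simp: typed1_def lead1_def)
  obtain w1 where w1: "fst f * w1 = 1" "w1 * fst f = 1" "W (-2) w1" "over L {Phi} w1"
    using inverse_lead[OF c(1) X1(3)] X1(2) by metis
  let ?Y = "iota (fst f)" and ?M = "iota (snd f)"
  have Y: "even_s ?Y" "over L {Phi1, Phi2} ?Y" "W 2 ?Y"
    using X1 by (auto intro: parity_iota over_iota W_iota W_lead)
  have M: "odd_s ?M" "over L {Phi1, Phi2} ?M" "W 1 ?M"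
    using P0 W_lead_odd[OF P0(3) W_ogen_Phi(1)] by (auto intro: parity_iota over_iota W_iota)
  obtain w where w: "Dp ?M * w = 1" "w * Dp ?M = 1" "W 0 w" "over L {Phi1, Phi2} w" "even_s w"
    using Dp_iota_inverse[OF f] by metis
  define P where "P = w * Dp ?Y"
  define P1 where "P1 = scal (1 / 2) * (P + ?M)"
  define P2 where "P2 = scal (1 / 2) * (ii * (?M - P))"
  have half: "scal (1 / 2) * h + scal (1 / 2) * h = h" for h
  proof -
    have "scal (1 / 2) + scal (1 / 2) = 1" by (simp flip: scal_add)
    then show ?thesis by (simp only: mult_1 flip: distrib_right)
  qed
  have iP2: "ii * P2 = scal (1 / 2) * P - scal (1 / 2) * ?M"
    unfolding P2_def ii_def scal_left_commute[of "scal \<i>" "1 / 2"]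
    by (simp add: right_diff_distrib flip: ii_def)
  have PM: "P1 - ii * P2 = ?M" "P1 + ii * P2 = P"
    using half[of ?M] half[of P] unfolding iP2 unfolding P1_def distrib_left by (simp_all add: algebra_simps)
  have Po: "odd_s P" unfolding P_def by (rule odd_s_intros(4)[OF w(5) DpD(9)[OF Y(1)]])
  have Pov: "over L {Phi1, Phi2} P" unfolding P_def by (rule over_mult[OF w(4) over_D[OF Y(2)]]) simp
  have "W (0 + (2 - 1)) P" unfolding P_def by (rule W_mult[OF w(3) W_Dp[OF Y(3)]])
  then have PW: "W 1 P" by simp
  have o: "odd_s P1" "odd_s P2"
    unfolding P1_def P2_def by (intro odd_s_intros(1,2,4) even_s_intros(6) even_s_ii Po M(1))+
  have ov: "over L {Phi1, Phi2} P1" "over L {Phi1, Phi2} P2"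
    unfolding P1_def P2_def by (intro over_mult over_arith(1,2,4) over_ii Pov M(2))+
  have "W (0 + 1) (ii * (?M - P))" by (intro W_mult W_ii W_arith(2) PW M(3))
  then have WP: "W 1 P1" "W 1 P2"
    unfolding P1_def P2_def
    by (rule_tac [1] W_arith(4), rule_tac [1] W_arith(1)[OF PW M(3)], rule_tac W_arith(4), simp)
  \<comment> \<open>Recovers X from the chiral combination \<open>?Y\<close>. The correction has
    square zero, so X inherits an inverse from \<open>?Y\<close> by
    \<open>inverse_nilpotent\<close>.\<close>
  define n where "n = - (ii * (P1 * P2))"
  have n: "even_s n" unfolding n_def by (intro even_s_intros(3,4,5) even_s_ii o)
  have nn: "n * n = 0"
  proof -
    have "P2 * (P1 * P2) = - (P1 * (P2 * P2))"
      using odd_s_anticommute[OF o(2,1)] by (simp flip: mult.assoc)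
    then have "P2 * (P1 * P2) = 0" by (simp add: odd_s_square[OF o(2)])
    then have "(P1 * P2) * (P1 * P2) = 0" by (simp add: mult.assoc)
    then show ?thesis by (simp add: n_def ii_left mult.assoc)
  qed
  have "W (0 + (1 + 1)) (ii * (P1 * P2))" by (intro W_mult W_ii WP)
  then have nW: "W 2 n" unfolding n_def by (intro W_arith(3)) simp
  have nov: "over L {Phi1, Phi2} n" unfolding n_def by (intro over_arith(3) over_mult over_ii ov)
  define X where "X = ?Y + n"
  have Yi: "?Y * iota w1 = 1" "iota w1 * ?Y = 1" using w1(1,2) by (simp_all add: iota_ring flip: iota_ring(3))
  note Xi = inverse_nilpotent[OF Yi n nn]
  have "W (-2 + 2 + -2) (iota w1 * n * iota w1)" by (intro W_mult W_iota w1(3) nW)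
  then have Wi: "W (-2) (iota w1 - iota w1 * n * iota w1)" by (intro W_arith(2) W_iota w1(3)) simp
  have oi: "over L {Phi1, Phi2} (iota w1 - iota w1 * n * iota w1)"
    by (intro over_arith(2) over_mult over_iota w1(4) nov)
  have X: "even_s X" "over L {Phi1, Phi2} X" "W 2 X" unfolding X_def
    by (rule even_s_intros(1)[OF Y(1) n] over_arith(1)[OF Y(2) nov] W_arith(1)[OF Y(3) nW])+
  have Xe: "X + ii * (P1 * P2) = ?Y" by (simp add: X_def n_def)
  have Xv: "X * (iota w1 - iota w1 * n * iota w1) = 1" "(iota w1 - iota w1 * n * iota w1) * X = 1"
    unfolding X_def by (rule Xi)+
  have "good2 L (X, P1, P2)"
    unfolding good2_def typed2_def prod.case fst_conv snd_conv using X o ov WP Xv Wi oi by blast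
  moreover have "superconformal (X, P1, P2)"
    unfolding superconformal_iff[OF X(1) o] Xe PM(1) PM(2)
  proof (intro conjI)
    show "Dm ?M = 0" "Dm ?Y = 0" by (rule iota_chain(4)[OF P0(2)] iota_chain(4)[OF X1(2)])+
    have q: "even_s (Dp ?M)" by (rule DpD(8)[OF M(1)])
    show "Dp ?Y = P * Dp ?M"
      unfolding P_def mult.assoc even_s_commute[OF q, of "Dp ?Y", symmetric]
      unfolding mult.assoc[symmetric] w(2) by simp
    \<comment> \<open>Applying \<open>Dp\<close> to \<open>Dp ?M * w = 1\<close> yields
      \<open>Dp w = 0\<close>, because \<open>Dp (Dp ?M) = 0\<close> and \<open>Dp ?M\<close> is
      invertible.\<close>
    have "Dp (scal 1) = 0" using oder_Dp unfolding oder_def by blast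
    then have "Dp (Dp ?M * w) = 0" unfolding w(1) by simp
    then have "Dp ?M * Dp w = 0" using q by (simp add: DpD(5) Dp_Dp even_s_def)
    then have "w * (Dp ?M * Dp w) = 0" by simp
    then have "Dp w = 0" using w(2) by (simp flip: mult.assoc)
    then show "Dp P = 0" unfolding P_def by (simp add: DpD(5) Dp_Dp)
  qed
  moreover have "lifts f (X, P1, P2)" by (simp add: lifts_def chY_def chM_def Xe PM)
  ultimately show ?thesis using that by blast
qed

section \<open>The bijection between superconformal functions and N = 1 functions\<close>

definition lower :: "fun2 \<Rightarrow> fun1" where
  "lower g = (rho (chY g), rho (chM g))"

lemma lower_lifts: "f \<in> SA_0_carrier L \<Longrightarrow> lifts f g \<Longrightarrow> lower g = f"
  using rho_iota[of L "fst f"] rho_iota[of L "snd f"]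
  by (cases f) (simp add: lower_def lifts_def SA_0_carrier_iff typed1_def)

lemma SC2_lower: "g \<in> SC2 L \<Longrightarrow> lower g \<in> SA_0_carrier L \<and> lifts (lower g) g"
proof -
  assume "g \<in> SC2 L"
  then obtain f where f: "f \<in> SA_0_carrier L" "lifts f g" unfolding SC2_def by auto
  then show ?thesis using lower_lifts[OF f] by simp
qed

lemma bij_lower: "bij_betw lower (SC2 L) (SA_0_carrier L)"
  unfolding bij_betw_def
proof
  show "inj_on lower (SC2 L)"
  proof (rule inj_onI)
    fix g g' assume g: "g \<in> SC2 L" "g' \<in> SC2 L" and e: "lower g = lower g'"
    show "g = g'"
      by (rule lift_unique[of "lower g" L])
        (use SC2_lower[OF g(1)] SC2_lower[OF g(2)] e g in \<open>auto simp: SC2_def good2_def\<close>)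
  qed
  show "lower ` SC2 L = SA_0_carrier L"
  proof
    show "lower ` SC2 L \<subseteq> SA_0_carrier L" using SC2_lower by blast
    show "SA_0_carrier L \<subseteq> lower ` SC2 L"
    proof
      fix f assume f: "f \<in> SA_0_carrier L"
      obtain g where g: "good2 L g" "superconformal g" "lifts f g" using lift_exists[OF f] by metis
      then have "g \<in> SC2 L" using f by (auto simp: SC2_def)
      moreover have "lower g = f" by (rule lower_lifts[OF f g(3)])
      ultimately show "f \<in> lower ` SC2 L" by blast
    qed
  qed
qed

lemma lower_comp:
  assumes "f \<in> SC2 L" "g \<in> SC2 L" shows "lower (comp2 At_0 f g) = comp1 At_0 (lower f) (lower g)"
proof (rule lower_lifts)
  note F = SC2_lower[OF assms(1)] and G = SC2_lower[OF assms(2)]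
  show "comp1 At_0 (lower f) (lower g) \<in> SA_0_carrier L" by (rule SA_0_closed) (use F G in simp_all)
  show "lifts (comp1 At_0 (lower f) (lower g)) (comp2 At_0 f g)"
    by (rule lifts_comp[of _ L]) (use F G assms in \<open>simp_all add: SC2_def\<close>)
qed

section \<open>Vanishing at the origin in terms of weights and bodies\<close>

lemma W_over2: assumes "over L {Phi1, Phi2} f" "W 1 f" shows "ord_ge 0 f"
  unfolding ord_ge_def
proof (intro allI impI grass_eqI)
  fix n :: int and S assume n: "n < 0"
  show "gcoeff (f $$ n) S = gcoeff 0 S"
  proof (rule ccontr)
    assume "gcoeff (f $$ n) S \<noteq> gcoeff 0 S"
    then have nz: "gcoeff (f $$ n) S \<noteq> 0" by simp
    \<comment> \<open>At most two odd variables occur, so a term with negative exponent of x has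
      weight at most 0.\<close>
    have "S \<inter> {Phi, Phi1, Phi2} \<subseteq> {Phi1, Phi2}" using over_gens[OF assms(1) nz] by blast
    then have "card (S \<inter> {Phi, Phi1, Phi2}) \<le> card {Phi1, Phi2}" by (intro card_mono) auto
    moreover have "1 \<le> 2 * n + wt S" using assms(2) nz unfolding W_def by (rule sptD)
    ultimately show False using n by (simp add: wt_def)
  qed
qed

lemma over_split2:
  assumes f: "over L {Phi1, Phi2} f"
  obtains f0 f1 f2 where "f = f0 + ogen Phi1 * f1 + ogen Phi2 * f2" "over L {} f0" "over L {} f1" "over L {Phi1} f2"
    "\<And>m. W m f \<Longrightarrow> W m f0 \<and> W (m - 1) f1 \<and> W (m - 1) f2"
    "\<And>m. ord_ge m f \<Longrightarrow> ord_ge m f0 \<and> ord_ge m f1 \<and> ord_ge m f2"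
proof -
  define f2 where "f2 = d_odd Phi2 f"
  define c where "c = f - ogen Phi2 * f2"
  define f1 where "f1 = d_odd Phi1 c"
  define f0 where "f0 = c - ogen Phi1 * f1"
  have "over L (insert Phi2 {Phi1}) f" using f by (simp add: insert_commute)
  note 2 = over_split[OF this, folded f2_def, folded c_def]
  note 1 = over_split[OF 2(2), folded f1_def, folded f0_def]
  have w: "W m f0 \<and> W (m - 1) f1 \<and> W (m - 1) f2" if "W m f" for m
  proof -
    have f2: "W (m - 1) f2" unfolding f2_def by (rule W_d_odd[OF that])
    have "W (1 + (m - 1)) (ogen Phi2 * f2)" by (rule W_mult[OF W_ogen_Phi(3) f2])
    then have c: "W m c" unfolding c_def using W_arith(2)[OF that] by simp
    have f1: "W (m - 1) f1" unfolding f1_def by (rule W_d_odd[OF c])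
    have "W (1 + (m - 1)) (ogen Phi1 * f1)" by (rule W_mult[OF W_ogen_Phi(2) f1])
    then have "W m f0" unfolding f0_def using W_arith(2)[OF c] by simp
    then show ?thesis using f1 f2 by simp
  qed
  have o: "ord_ge m f0 \<and> ord_ge m f1 \<and> ord_ge m f2" if "ord_ge m f" for m
    using that unfolding f0_def f1_def c_def f2_def by (simp add: ord_ge_def)
  have "f = f0 + ogen Phi1 * f1 + ogen Phi2 * f2" by (simp add: f0_def c_def)
  then show ?thesis using that 1(2) 1(1) 2(1) w o by blast
qed

text \<open>Negative powers of 0 are unspecified and are left as they stand; in
  \<open>sub2_0\<close> they meet vanishing coefficients.\<close>

lemma zpow_zero: "zpow (0 :: sfun) n = (if n = 0 then 1 else if 0 < n then 0 else zpow 0 n)"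
  by (simp add: zpow_def power_0_left)

lemma sub2_0: assumes "ord_ge 0 f" shows "sub2 (0, 0, 0) f = gsubst (ogen(Phi1 := 0, Phi2 := 0)) (f $$ 0)"
proof -
  let ?v = "ogen(Phi1 := 0, Phi2 := 0)"
  have e: "gsubst ?v (f $$ n) * zpow 0 n = (if n \<in> {0} then gsubst ?v (f $$ 0) else 0)" for n
    using assms zpow_zero[of n] by (cases "n < 0") (auto simp: ord_ge_def)
  have "((\<lambda>n. gsubst ?v (f $$ n) * zpow 0 n) has_sum gsubst ?v (f $$ 0)) UNIV"
    using has_sum_finite_support[of "{0::int}" "\<lambda>_. gsubst ?v (f $$ 0)"] unfolding e by simp
  then show ?thesis unfolding sub2_def subst_def by (simp add: infsumI)
qed

lemma gsubst_split:
  assumes v: "\<And>g. odd_s (v g)" and f: "f = f0 + ogen g * f1 + ogen k * f2"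
  shows "gsubst v (f $$ n) = gsubst v (f0 $$ n) + v g * gsubst v (f1 $$ n) + v k * gsubst v (f2 $$ n)"
  unfolding f by (simp add: gsubst_add gsubst_gen_mult[OF v])

text \<open>In a power series the monomials of weight 0 are those without x and without formal odd
  variables, and evaluation at the origin reads off exactly these.\<close>

lemma W1_iff: assumes f: "over L {Phi1, Phi2} f" shows "W 1 f \<longleftrightarrow> ord_ge 0 f \<and> sub2 (0, 0, 0) f = 0"
proof -
  let ?v = "ogen(Phi1 := 0, Phi2 := 0)"
  have v: "odd_s (?v g)" for g by (simp add: odd_s_intros)
  obtain f0 f1 f2 where s: "f = f0 + ogen Phi1 * f1 + ogen Phi2 * f2" and o0: "over L {} f0"
    and w: "\<And>m. W m f \<Longrightarrow> W m f0 \<and> W (m - 1) f1 \<and> W (m - 1) f2"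
    and o: "\<And>m. ord_ge m f \<Longrightarrow> ord_ge m f0 \<and> ord_ge m f1 \<and> ord_ge m f2"
    using over_split2[OF f] by metis
  have "f0 $$ 0 \<in> Lam L {}" using o0 by (simp add: over_iff)
  then have "gsubst ?v (f $$ 0) = fls_const (f0 $$ 0)"
    unfolding gsubst_split[OF v s] by (subst gsubst_Lam[of ?v "f0 $$ 0" L]) simp_all
  then have e: "ord_ge 0 f \<Longrightarrow> sub2 (0, 0, 0) f = 0 \<longleftrightarrow> f0 $$ 0 = 0"
    using sub2_0[of f] by (metis fls_const_0 fls_const_nth)
  show ?thesis
  proof
    assume W: "W 1 f"
    then have "ord_ge ((1 + 1) div 2) f0" using w W_over_empty[OF _ o0, of 1 0] by simp
    then have "f0 $$ 0 = 0" by (simp add: ord_ge_def)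
    then show "ord_ge 0 f \<and> sub2 (0, 0, 0) f = 0" using e W_over2[OF f W] by simp
  next
    assume *: "ord_ge 0 f \<and> sub2 (0, 0, 0) f = 0"
    then have 1: "ord_ge 0 f0" "ord_ge 0 f1" "ord_ge 0 f2" "f0 $$ 0 = 0" using o e by simp_all
    have "ord_ge 1 f0"
      unfolding ord_ge_def
    proof (intro allI impI)
      fix n :: int assume "n < 1"
      then show "f0 $$ n = 0" using 1(1,4) by (cases "n = 0") (simp_all add: ord_ge_def)
    qed
    then have "W 1 f0" using W_mono[OF ord_ge_W[of 1 f0]] by simp
    moreover have "W (1 + 2 * 0) (ogen Phi1 * f1)" "W (1 + 2 * 0) (ogen Phi2 * f2)"
      by (intro W_mult W_ogen_Phi ord_ge_W 1)+
    ultimately show "W 1 f" unfolding s by (intro W_arith(1)) simp_all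
  qed
qed

lemma vanishing_fun2_iff:
  "(X, P1, P2) \<in> vanishing_fun2 L \<longleftrightarrow> typed2 L (X, P1, P2) \<and> W 1 X \<and> W 1 P1 \<and> W 1 P2"
proof -
  have "(X, P1, P2) \<in> vanishing_fun2 L \<longleftrightarrow> typed2 L (X, P1, P2) \<and> (ord_ge 0 X \<and> sub2 (0, 0, 0) X = 0)
      \<and> (ord_ge 0 P1 \<and> sub2 (0, 0, 0) P1 = 0) \<and> (ord_ge 0 P2 \<and> sub2 (0, 0, 0) P2 = 0)"
    unfolding vanishing_fun2_def mem_Collect_eq comp2_At_0 map_prod_simp mem_Times_iff fst_conv snd_conv
      series_even_iff series_odd_iff typed2_def prod.case prod.inject by argo
  then show ?thesis using W1_iff[of L] by (auto simp only: typed2_def prod.case)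
qed

lemmas rho_ring = subst_add[OF rho_ok(1), folded rho_def] subst_diff[OF rho_ok(1), folded rho_def]
  subst_mult[OF rho_ok(1), folded rho_def] subst_0[OF rho_ok(1), folded rho_def]

lemma rho_gen: "rho (ogen Phi2) = 0"
  unfolding rho_def by (simp add: subst_ogen[OF rho_ok(1)])

lemma parity_rho: "even_s f \<Longrightarrow> even_s (rho f)" "odd_s f \<Longrightarrow> odd_s (rho f)"
  unfolding rho_def by (rule parity_subst[OF rho_ok(1)]; assumption)+

lemma over_rho: "over L {Phi1, Phi2} f \<Longrightarrow> over L {Phi} (rho f)"
  unfolding rho_def by (rule over_subst[OF rho_ok(1)]) (auto simp: over_Zeta intro: over_arith)

lemma W_rho: "W m f \<Longrightarrow> W m (rho f)"
  unfolding rho_def by (rule W_subst[OF rho_ok(1) _ rho_ok(2)])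

text \<open>Renaming Phi back to Phi1 undoes \<open>rho\<close> on functions without Phi2.\<close>

lemma rho_inj: assumes f: "over L {Phi1} f" and "rho f = 0" shows "f = 0"
proof -
  let ?v = "ogen(Phi := ogen Phi1)" and ?r = "ogen(Phi1 := ogen Phi, Phi2 := 0)"
  have w: "W (wt {g}) (?v g)" for g using W_ogen[of g] W_ogen_Phi(2) by simp
  have ok: "subst_ok (xp 1) ?v" by (rule subst_ok_xp1[OF _ w]) (simp add: odd_s_intros)
  have "subst (xp 1) ?v (rho f) = subst (subst (xp 1) ?v (xp 1)) (\<lambda>g. subst (xp 1) ?v (?r g)) f"
    unfolding rho_def by (rule subst_subst[OF ok rho_ok(1) subst_ok_comp[OF ok w rho_ok]])
  also have "\<dots> = subst (subst (xp 1) ?v (xp 1)) ogen f"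
  proof (rule subst_cong)
    fix n S g assume "gcoeff (f $$ n) S \<noteq> 0" "g \<in> S"
    then have "g = Phi1 \<or> (\<exists>k. g = Zeta k)" using over_gens[OF f] by blast
    then show "subst (xp 1) ?v (?r g) = ogen g" by (auto simp: subst_ogen[OF ok])
  qed
  also have "\<dots> = f" by (simp add: subst_id)
  finally show ?thesis using assms(2) subst_0[OF ok] by simp
qed

text \<open>A function killed by \<open>Dm\<close> and \<open>rho\<close> is \<open>ogen Phi2\<close> times something; applying \<open>Dm\<close> to the
  product shows that it vanishes.\<close>

lemma Dm_zero: assumes f: "over L {Phi1, Phi2} f" and d: "Dm f = 0" shows "iota (rho f) = f"
proof -
  define e where "e = f - iota (rho f)"
  define k where "k = d_odd Phi2 e"
  have oe: "over L {Phi1, Phi2} e"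
    unfolding e_def by (rule over_arith(2)[OF f over_iota[OF over_rho[OF f]]])
  have de: "Dm e = 0"
    unfolding e_def by (simp add: DmD(2) d iota_chain(4)[OF over_rho[OF f]])
  have re: "rho e = 0" unfolding e_def by (simp add: rho_ring rho_iota[OF over_rho[OF f]])
  have "over L (insert Phi2 {Phi1}) e" using oe by (simp add: insert_commute)
  note s = over_split(2)[OF this, folded k_def]
  have "rho (e - ogen Phi2 * k) = 0" by (simp add: rho_ring rho_gen re)
  then have e: "e = ogen Phi2 * k" using rho_inj[OF s] by simp
  have "Dm (ogen Phi2) = - ii" by (simp add: Dm_def sderiv_def d_odd_ogen)
  then have "- (ii * k) - ogen Phi2 * Dm k = 0"
    using de unfolding e by (simp add: DmD(5) odd_s_intros(6)[unfolded odd_s_def])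
  then have "ii * (ogen Phi2 * (- (ii * k) - ogen Phi2 * Dm k)) = 0" by simp
  then have "e = 0" unfolding e by (simp add: right_diff_distrib ii_left)
  then show ?thesis by (simp add: e_def)
qed

lemma lifts_lower:
  assumes t: "typed2 L g" and s: "superconformal g"
  shows "lifts (lower g) g" "typed1 L (lower g)"
proof -
  obtain X P1 P2 where g: "g = (X, P1, P2)" by (cases g) auto
  have e: "even_s X" "odd_s P1" "odd_s P2" "over L {Phi1, Phi2} X" "over L {Phi1, Phi2} P1" "over L {Phi1, Phi2} P2"
    using t by (auto simp: typed2_def g)
  have d: "Dm (chM g) = 0" "Dm (chY g) = 0"
    using s[unfolded g superconformal_iff[OF e(1-3)]] by (simp_all add: g chM_def chY_def)
  have o: "over L {Phi1, Phi2} (chM g)" "over L {Phi1, Phi2} (chY g)"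
    unfolding g chM_def chY_def prod.case by (intro over_arith over_mult over_ii e)+
  show "lifts (lower g) g" by (simp add: lifts_def lower_def Dm_zero[OF o(1) d(1)] Dm_zero[OF o(2) d(2)])
  have "even_s (chY g)" "odd_s (chM g)"
    unfolding g chM_def chY_def prod.case
    by (intro even_s_intros(1,4,5) even_s_ii e odd_s_intros(2,4))+
  then show "typed1 L (lower g)"
    using o by (simp add: typed1_def lower_def parity_rho over_rho)
qed

text \<open>For a power series this is the complex number obtained by setting x and all generators
  to 0. On constants it detects units, by \<open>Lam_units_if_body\<close>.\<close>

definition bd :: "sfun \<Rightarrow> complex" where "bd f = gcoeff (f $$ 0) {}"

lemma bd_simps [simp]: "bd (f + g) = bd f + bd g" "bd (f - g) = bd f - bd g" "bd (- f) = - bd f" "bd 0 = 0"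
  "bd (ogen k * f) = 0" "bd (ii * f) = \<i> * bd f" "bd (fls_const c) = gcoeff c {}" "bd (fls_const c * f) = gcoeff c {} * bd f"
  "bd (ogen k) = 0" "bd 1 = 1"
  using ogen_mult_nth[of k 1 0] by (simp_all add: bd_def ii_def ogen_nth gcoeff_ggen gcoeff_gscal gcoeff_1)

lemma bd_mult: "ord_ge 0 f \<Longrightarrow> ord_ge 0 g \<Longrightarrow> bd (f * g) = bd f * bd g"
  by (simp add: bd_def fls_times_nth_bounds)

lemma bd_W: "W 1 f \<Longrightarrow> bd f = 0"
  unfolding W_def bd_def using sptD[of _ f 0 "{}"] by force

lemma bd_odd: "odd_s f \<Longrightarrow> bd f = 0"
  unfolding bd_def odd_s_iff grass_odd_def by fastforce

lemma ord_ge_0_deriv: "ord_ge 0 f \<Longrightarrow> ord_ge 0 (fls_deriv f)" "ord_ge 1 f \<Longrightarrow> ord_ge 0 (fls_deriv f)"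
proof -
  have c: "ord_ge 0 (fls_deriv f)" if "\<And>k. k < 0 \<Longrightarrow> f $$ k = 0"
    unfolding ord_ge_def
  proof (intro allI impI)
    fix k :: int assume "k < 0"
    then show "fls_deriv f $$ k = 0" using that[of "k + 1"] by (cases "k = - 1") simp_all
  qed
  show "ord_ge 0 f \<Longrightarrow> ord_ge 0 (fls_deriv f)" "ord_ge 1 f \<Longrightarrow> ord_ge 0 (fls_deriv f)"
    by (rule c, simp add: ord_ge_def)+
qed

lemma ord_ge_ogen_mult: "ord_ge m f \<Longrightarrow> ord_ge m (ogen g * f)" "ord_ge m f \<Longrightarrow> ord_ge m (ii * f)"
  "ord_ge m f \<Longrightarrow> ord_ge m (d_odd g f)"
  by (simp_all add: ord_ge_def ii_def)

lemma bd_iota: assumes F: "over L {} F" "ord_ge 0 F" shows "bd (iota F) = bd F"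
proof -
  have "F $$ 0 \<in> Lam L {}" using F(1) by (simp add: over_iff)
  then have c: "iota (fls_const (F $$ 0)) = fls_const (F $$ 0)" by (rule iota_const)
  have "ord_ge 1 (F - fls_const (F $$ 0))" using F(2) by (auto simp: ord_ge_def)
  then have "W 1 (F - fls_const (F $$ 0))" using ord_ge_W[of 1] W_mono by fastforce
  from bd_W[OF W_iota[OF this]] show ?thesis by (simp add: iota_ring c bd_def)
qed

lemma Dp_iota:
  assumes h: "over L {Phi} h"
  defines "A \<equiv> iota (d_odd Phi h) + (ogen Phi1 + ii * ogen Phi2) * iota (fls_deriv h)"
  shows "Dp (iota h) = A + A"
  unfolding Dp_def sderiv_def d_x.simps A_def iota_chain(1-3)[OF h] by (simp add: algebra_simps ii_left)

lemma sub2_linear: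
  assumes f: "typed2 L (X, P1, P2)" "W 2 X" "W 1 P1" "W 1 P2"
    and h: "over L {Phi1, Phi2} h" "W 1 h" and nz: "sub2 (X, P1, P2) h \<noteq> 0"
  obtains b c where "b \<in> Lam L {}" "c \<in> Lam L {}" "W 2 (sub2 (X, P1, P2) h - P1 * fls_const b - P2 * fls_const c)"
proof -
  let ?v = "ogen(Phi1 := P1, Phi2 := P2)"
  define F where "F n = gsubst ?v (h $$ n) * zpow X n" for n
  have v: "odd_s (?v g)" "W (wt {g}) (?v g)" for g
    using f W_ogen[of g] by (simp_all add: typed2_def odd_s_intros)
  have W: "W 0 (gsubst ?v d)" for d by (rule W_gsubst[OF v(2)]) (simp add: sum_nonneg wt_bounds)
  have s: "sub2 (X, P1, P2) h = (\<Sum>\<^sub>\<infinity>n. F n)" by (simp add: sub2_def subst_def F_def)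
  then have "F summable_on UNIV" using nz infsum_not_exists by fastforce
  then have hs: "(F has_sum sub2 (X, P1, P2) h) UNIV" unfolding s by simp
  have "((\<lambda>n. if n \<in> {0} then F n else 0) has_sum F 0) UNIV"
    using has_sum_finite_support[of "{0::int}" F] by simp
  from has_sum_add[OF hs bounded_additive_has_sum[OF bounded_additive_uminus[OF bounded_additive_id] this]]
  have hs': "((\<lambda>n. F n - (if n \<in> {0} then F n else 0)) has_sum sub2 (X, P1, P2) h - F 0) UNIV" by simp
  have o: "ord_ge 0 h" by (rule W_over2[OF h])
  have 1: "W 2 (sub2 (X, P1, P2) h - F 0)"
  proof (rule W_has_sum[OF _ hs'])
    fix n :: int
    consider "n < 0" | "n = 0" | k where "n = int (Suc k)" by (metis int_cases zero_less_Suc neg_equal_iff_equal negative_zless nat_int of_nat_0 not0_implies_Suc linorder_neqE_linordered_idom)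
    then show "W 2 (F n - (if n \<in> {0} then F n else 0))"
    proof cases
      case 3
      have "W (int (Suc k) * 2) (X ^ Suc k)" by (rule W_power[OF f(2)])
      then have "W 2 (X ^ Suc k)" by (rule W_mono) simp
      from W_mult[OF W this] have "W 2 (gsubst ?v (h $$ n) * X ^ Suc k)" by simp
      moreover have "zpow X n = X ^ Suc k" using 3 by (simp add: zpow_def del: of_nat_Suc power_Suc)
      ultimately show ?thesis using 3 by (simp add: F_def)
    qed (use o in \<open>simp_all add: F_def ord_ge_def\<close>)
  qed
  obtain h0 h1 h2 where sp: "h = h0 + ogen Phi1 * h1 + ogen Phi2 * h2" and o0: "over L {} h0" "over L {} h1" "over L {Phi1} h2"
    and w: "W 1 h0"
    using over_split2[OF h(1)] h(2) by metis
  have "ord_ge ((1 + 1) div 2) h0" by (rule W_over_empty[OF w o0(1), of 0]) simp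
  then have z: "h0 $$ 0 = 0" by (simp add: ord_ge_def)
  \<comment> \<open>A second splitting isolates the monomial Phi1 Phi2, whose value has weight at
    least 2.\<close>
  define k1 where "k1 = d_odd Phi1 h2"
  define k0 where "k0 = h2 - ogen Phi1 * k1"
  note s2 = over_split[OF o0(3), folded k1_def, folded k0_def]
  have sp2: "h2 = k0 + ogen Phi1 * k1 + ogen Phi1 * 0" by (simp add: k0_def)
  have L: "h1 $$ 0 \<in> Lam L {}" "k0 $$ 0 \<in> Lam L {}" "k1 $$ 0 \<in> Lam L {}" using s2 o0 by (simp_all add: over_iff)
  have g: "gsubst ?v (h1 $$ 0) = fls_const (h1 $$ 0)" "gsubst ?v (k0 $$ 0) = fls_const (k0 $$ 0)"
    "gsubst ?v (k1 $$ 0) = fls_const (k1 $$ 0)"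
    by (rule gsubst_Lam; use L in simp)+
  have "F 0 = P1 * fls_const (h1 $$ 0) + P2 * (fls_const (k0 $$ 0) + P1 * fls_const (k1 $$ 0))"
    unfolding F_def gsubst_split[OF v(1) sp] gsubst_split[OF v(1) sp2] z g by (simp add: g)
  then have e: "sub2 (X, P1, P2) h - P1 * fls_const (h1 $$ 0) - P2 * fls_const (k0 $$ 0)
      = (sub2 (X, P1, P2) h - F 0) + P2 * (P1 * fls_const (k1 $$ 0))"
    by (simp add: algebra_simps)
  have "W (1 + (1 + 0)) (P2 * (P1 * fls_const (k1 $$ 0)))" by (intro W_mult f W_const)
  then have "W 2 (sub2 (X, P1, P2) h - P1 * fls_const (h1 $$ 0) - P2 * fls_const (k0 $$ 0))"
    unfolding e by (intro W_arith(1)[OF 1]) simp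
  then show ?thesis using that L by blast
qed

lemma bd_d_odd_const: "c \<in> Lam L {} \<Longrightarrow> (\<And>k. g \<noteq> Zeta k) \<Longrightarrow> bd (d_odd g (P * fls_const c)) = bd (d_odd g P) * gcoeff c {}"
  using gderiv_Lam[of c L "{}" g] by (simp add: d_odd_mult bd_def)

text \<open>Vanishing at the origin and a left inverse already force the leading units. By
  superconformality the bodies of the odd derivatives of \<open>P1\<close> and \<open>P2\<close> at
  the origin form a matrix with rows (p, q) and (-q, p). The left inverse makes its determinant p^2
  + q^2 nonzero, and the leading bodies turn out to be p + i q for Phi and p^2 + q^2 for x.\<close>

lemma SC_0_lower: assumes "g \<in> SC_0_carrier L" shows "lower g \<in> SA_0_carrier L"
proof -
  obtain X P1 P2 where g: "g = (X, P1, P2)" by (cases g) auto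
  from assms obtain g' where g': "g' \<in> vanishing_fun2 L" "comp2 At_0 g' g = id2 At_0"
    and s: "superconformal (X, P1, P2)" and "g \<in> vanishing_fun2 L"
    unfolding SC_0_carrier_def g by blast
  then have t: "typed2 L (X, P1, P2)" and w: "W 1 X" "W 1 P1" "W 1 P2"
    by (simp_all add: g vanishing_fun2_iff)
  have e: "even_s X" "odd_s P1" "odd_s P2" and ov: "over L {Phi1, Phi2} X" "over L {Phi1, Phi2} P1" "over L {Phi1, Phi2} P2"
    using t by (auto simp: typed2_def)
  have oP: "ord_ge 0 P1" "ord_ge 0 P2" by (rule W_over2[OF ov(2) w(2)] W_over2[OF ov(3) w(3)])+
  define hY hM where "hY = rho (chY g)" "hM = rho (chM g)"
  have low: "lower g = (hY, hM)" by (simp add: lower_def hY_hM_def)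
  have l: "iota hY = chY g" "iota hM = chM g"
    using lifts_lower[OF t s] by (simp_all add: lifts_def low flip: g)
  have ty: "even_s hY" "odd_s hM" "over L {Phi} hY" "over L {Phi} hM"
    using lifts_lower(2)[OF t s] by (simp_all add: typed1_def low flip: g)
  have "W (0 + (1 + 1)) (ii * (P1 * P2))" by (intro W_mult W_ii w)
  then have wPP: "W 2 (ii * (P1 * P2))" by simp
  have wY: "W 1 hY" unfolding hY_hM_def g chY_def prod.case
    by (rule W_rho[OF W_arith(1)[OF w(1) W_mono[OF wPP]]]) simp
  have "W (0 + 1) (ii * P2)" by (intro W_mult W_ii w)
  then have wM: "W 1 hM" and wP: "W 1 (P1 + ii * P2)" unfolding hY_hM_def g chM_def prod.case
    by (auto intro!: W_rho W_arith(1,2)[OF w(2)])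
  define G H where "G = d_odd Phi hY" "H = d_odd Phi hM"
  define F R where "F = hY - ogen Phi * G" "R = hM - ogen Phi * H"
  have sY: "over L {} G" "over L {} F" and sM: "over L {} H" "over L {} R"
    using over_split[of L Phi "{}" hY] over_split[of L Phi "{}" hM] ty
    by (simp_all add: G_H_def F_R_def)
  have W0: "W 0 G" "W 0 H" using W_d_odd[OF wY, of Phi] W_d_odd[OF wM, of Phi] by (simp_all add: G_H_def)
  have "W (1 + 0) (ogen Phi * G)" "W (1 + 0) (ogen Phi * H)" by (intro W_mult W_ogen_Phi W0)+
  then have W1: "W 1 F" "W 1 R" unfolding F_R_def using W_arith(2)[OF wY] W_arith(2)[OF wM] by simp_all
  have oF: "ord_ge 1 F" "ord_ge 1 R" using W_over_empty[OF W1(1) sY(2), of 0] W_over_empty[OF W1(2) sM(2), of 0] by simp_all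
  have oG: "ord_ge 0 G" "ord_ge 0 H" using W_over_empty[OF W0(1) sY(1), of 0] W_over_empty[OF W0(2) sM(1), of 0] by simp_all
  have par: "odd_s G" "even_s H" unfolding G_H_def using parity_d_odd ty by blast+
  have par': "even_s F" "odd_s R"
    unfolding F_R_def 
    by (rule even_s_intros(2)[OF ty(1) even_s_intros(5)[OF odd_s_intros(6) par(1)]]
        odd_s_intros(2)[OF ty(2) odd_s_intros(5)[OF odd_s_intros(6) par(2)]])+
  have Y: "hY = F + ogen Phi * G" and M: "hM = R + ogen Phi * H" by (simp_all add: F_R_def)
  define A where "A = iota G + (ogen Phi1 + ii * ogen Phi2) * iota (fls_deriv hY)"
  have AA: "Dp (chY g) = A + A" using Dp_iota[OF ty(3)] by (simp add: l A_def G_H_def)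
  have DY: "Dp (chY g) = (P1 + ii * P2) * Dp (chM g)"
    using s unfolding superconformal_iff[OF e] by (simp add: g chY_def chM_def)
  have wchM: "W 1 (chM g)" using W_iota[OF wM] by (simp add: l)
  \<comment> \<open>That \<open>G\<close> starts with x does not follow from vanishing at the
    origin. It follows from \<open>DY\<close>, whose right side has weight at least 1, because up to
    terms of weight 1 half of the left side is \<open>iota G\<close>.\<close>
  have wG: "ord_ge 1 G"
  proof -
    have "W (1 + (1 - 1)) (A + A)" unfolding AA[symmetric] DY by (rule W_mult[OF wP W_Dp[OF wchM]])
    then have "W 1 (scal (1 / 2) * (A + A))" using W_arith(4) by simp
    moreover have "scal (1 / 2) * (A + A) = A"
      by (simp add: distrib_left flip: distrib_right scal_add)
    ultimately have a: "W 1 A" by simp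
    have b: "W (1 + 2 * 0) ((ogen Phi1 + ii * ogen Phi2) * iota (fls_deriv hY))"
    proof (intro W_mult W_iota ord_ge_W ord_ge_0_deriv(1))
      have "W (0 + 1) (ii * ogen Phi2)" by (intro W_mult W_ii W_ogen_Phi)
      then show "W 1 (ogen Phi1 + ii * ogen Phi2)" using W_arith(1)[OF W_ogen_Phi(2)] by simp
      show "ord_ge 0 hY" unfolding Y using ord_ge_mono[OF oF(1), of 0]
        by (intro ord_ge_add ord_ge_ogen_mult(1) oG) simp
    qed
    have "iota G = A - (ogen Phi1 + ii * ogen Phi2) * iota (fls_deriv hY)" by (simp add: A_def)
    then have "W 1 (iota G)" using W_arith(2)[OF a, of "(ogen Phi1 + ii * ogen Phi2) * iota (fls_deriv hY)"] b by simp
    from W_rho[OF this] have "W 1 G" using rho_iota[OF over_mono[OF sY(1)]] by simp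
    from W_over_empty[OF this sY(1), of 0] show ?thesis by simp
  qed
  have "W (1 + 2 * 1) (ogen Phi * G)" by (rule W_mult[OF W_ogen_Phi(1) ord_ge_W[OF wG]])
  then have "W 2 (ogen Phi * G)" by (rule W_mono) simp
  then have "W 2 hY" unfolding Y using ord_ge_W[OF oF(1)] by (intro W_arith(1)) simp_all
  then have "W 2 (chY g - ii * (P1 * P2))" using W_arith(2)[OF W_iota wPP] l by metis
  then have wX: "W 2 X" by (simp add: g chY_def)
  define p q where "p = bd (d_odd Phi1 P1)" "q = bd (d_odd Phi2 P1)"
  have se: "bd (sderiv k P) = bd (d_odd k P)" for k P by (simp add: sderiv_def)
  have "sderiv Phi1 P1 - sderiv Phi2 P2 = 0" "sderiv Phi1 P2 + sderiv Phi2 P1 = 0" using s by simp_all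
  from this[THEN arg_cong[where f = bd]]
  have pq: "bd (d_odd Phi1 P2) = - q" "bd (d_odd Phi2 P2) = p"
    by (simp_all add: se p_q_def eq_neg_iff_add_eq_0)
  have nz: "p * p + q * q \<noteq> 0"
  proof
    assume z: "p * p + q * q = 0"
    obtain X' P1' P2' where g'': "g' = (X', P1', P2')" by (cases g') auto
    have i: "sub2 (X, P1, P2) P1' = ogen Phi1"
      using g'(2)[unfolded g'' g comp2_At_0 id2_def] by simp
    have 1: "over L {Phi1, Phi2} P1'" "W 1 P1'" using g'(1) unfolding g'' vanishing_fun2_iff by (auto simp: typed2_def)
    have "bd (d_odd Phi1 (ogen Phi1)) = 1" by (simp add: d_odd_ogen)
    \<comment> \<open>The composite with the inverse is nonzero, which is how
      \<open>sub2_linear\<close> obtains convergence.\<close>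
    then have 0: "ogen Phi1 \<noteq> 0" by auto
    obtain b c where bc: "b \<in> Lam L {}" "c \<in> Lam L {}" "W 2 (ogen Phi1 - P1 * fls_const b - P2 * fls_const c)"
      using sub2_linear[OF t wX w(2,3) 1] 0 unfolding i by metis
    have "bd (d_odd k (ogen Phi1 - P1 * fls_const b - P2 * fls_const c)) = 0" for k
      using bd_W[of "d_odd k (ogen Phi1 - P1 * fls_const b - P2 * fls_const c)"] W_d_odd[OF bc(3), of k]
      by simp
    from this[of Phi1] this[of Phi2]
    \<comment> \<open>The bodies of the two odd derivatives give a linear system with determinant
      p^2 + q^2. If this were 0, then p and q would both vanish, against the first equation.\<close>
    have e: "p * gcoeff b {} - q * gcoeff c {} = 1" "q * gcoeff b {} + p * gcoeff c {} = 0"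
      by (simp_all add: d_odd_ogen bd_d_odd_const[OF bc(1)] bd_d_odd_const[OF bc(2)] pq neg_eq_iff_add_eq_0 algebra_simps flip: p_q_def)
    have "p = p * (p * gcoeff b {} - q * gcoeff c {}) + q * (q * gcoeff b {} + p * gcoeff c {})"
      unfolding e by simp
    also have "\<dots> = (p * p + q * q) * gcoeff b {}" by (simp add: algebra_simps)
    finally have p: "p = 0" using z by simp
    have "- q = p * (q * gcoeff b {} + p * gcoeff c {}) - q * (p * gcoeff b {} - q * gcoeff c {})"
      unfolding e by simp
    also have "\<dots> = (p * p + q * q) * gcoeff c {}" by (simp add: algebra_simps)
    finally show False using z e(1) p by simp
  qed
  have bM: "bd (d_odd Phi1 (chM g)) = p + \<i> * q" "bd (d_odd Phi2 (chM g)) = q - \<i> * p"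
    by (simp_all add: g chM_def pq flip: p_q_def)
  have "bd (d_odd Phi1 (iota hM)) = bd (iota H)"
    unfolding iota_chain(2)[OF ty(4)] by (simp add: ii_left G_H_def)
  then have bH: "bd H = p + \<i> * q" by (simp add: l bM bd_iota[OF sM(1) oG(2)])
  have fac: "(p + \<i> * q) * (p - \<i> * q) = p * p + q * q" by (simp add: algebra_simps)
  have H0: "bd H \<noteq> 0" using nz fac bH by auto
  have oM: "ord_ge 0 (chM g)" "ord_ge 0 (P1 + ii * P2)"
    unfolding g chM_def prod.case by (intro ord_ge_diff ord_ge_add ord_ge_ogen_mult oP)+
  have oD: "ord_ge 0 (Dp (chM g))"
    unfolding Dp_def sderiv_def d_x.simps by (intro ord_ge_add ord_ge_ogen_mult ord_ge_0_deriv(1) oM(1))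
  \<comment> \<open>Both sides of \<open>DY\<close> are differentiated in Phi1 at the origin; the
    comparison yields the body of the coefficient of x.\<close>
  have "bd (d_odd Phi1 ((P1 + ii * P2) * Dp (chM g))) = (p - \<i> * q) * (2 * (p + \<i> * q))"
  proof -
    have "bd (Dp (chM g)) = 2 * (p + \<i> * q)"
      by (simp add: Dp_def se bM algebra_simps)
    moreover have "bd (d_odd Phi1 (P1 + ii * P2)) = p - \<i> * q" by (simp add: pq flip: p_q_def)
    moreover have "bd (sbar (P1 + ii * P2) * d_odd Phi1 (Dp (chM g))) = 0"
      using bd_mult[OF ord_ge_sbar[OF oM(2)] ord_ge_ogen_mult(3)[OF oD]] bd_odd[OF e(2)] bd_odd[OF e(3)] e(2,3)
      by (simp add: odd_s_def)
    ultimately show ?thesis unfolding d_odd_mult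
      by (simp add: bd_mult[OF ord_ge_ogen_mult(3)[OF oM(2)] oD] del: d_odd_add)
  qed
  moreover have "bd (d_odd Phi1 (A + A)) = 2 * gcoeff (F $$ 1) {}"
  proof -
    have "bd (d_odd Phi1 (iota G)) = 0"
      using iota_chain(2)[OF over_mono[OF sY(1)]] d_odd_over[OF sY(1), of Phi] iota_ring
      by (simp add: ii_left)
    moreover have "bd (iota (fls_deriv hY)) = gcoeff (F $$ 1) {}"
    proof -
      have "fls_deriv hY = fls_deriv F + ogen Phi * fls_deriv G" by (simp add: Y deriv_mult)
      then have "bd (iota (fls_deriv hY)) = bd (iota (fls_deriv F)) + bd (ith * iota (fls_deriv G))"
        by (simp add: iota_ring iota_gen)
      also have "bd (ith * iota (fls_deriv G)) = 0" by (simp add: ith_def left_diff_distrib mult.assoc)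
      also have "bd (iota (fls_deriv F)) = gcoeff (F $$ 1) {}"
        using bd_iota[OF _ ord_ge_0_deriv(2)[OF oF(1)]] over_arith(10)[OF sY(2)] by (simp add: bd_def)
      finally show ?thesis by simp
    qed
    ultimately show ?thesis
      unfolding A_def by (simp add: d_odd_mult d_odd_ogen odd_s_def distrib_right mult.assoc)
  qed
  ultimately have "2 * gcoeff (F $$ 1) {} = (p - \<i> * q) * (2 * (p + \<i> * q))" using AA DY by simp
  also have "\<dots> = 2 * (p * p + q * q)" unfolding fac[symmetric] by (simp only: mult.commute mult.left_commute)
  finally have "gcoeff (F $$ 1) {} = p * p + q * q" unfolding mult_cancel_left by simp
  then have F0: "gcoeff (F $$ 1) {} \<noteq> 0" using nz by simp
  have mem: "F \<in> series (Lam_even L) 1" "G \<in> series (Lam_odd L) 1" "R \<in> series (Lam_odd L) 1" "H \<in> series (Lam_even L) 0"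
    unfolding series_even_iff series_odd_iff using sY sM par par' oF oG wG by simp_all
  have "F $$ 1 \<in> Lam_units L" "H $$ 0 \<in> Lam_units L"
    using mem F0 H0 by (auto intro!: Lam_units_if_body simp: series_def bd_def)
  then show ?thesis unfolding SA_0_carrier_def low Y M using mem by blast
qed

text \<open>By uniqueness the given lift is the one from \<open>lift_exists\<close>, so the
  invertibility required in \<open>good2\<close> is inherited from it.\<close>

lemma SC2_I: "typed2 L g \<Longrightarrow> superconformal g \<Longrightarrow> lifts f g \<Longrightarrow> f \<in> SA_0_carrier L \<Longrightarrow> g \<in> SC2 L"
proof -
  assume g: "typed2 L g" "superconformal g" "lifts f g" and f: "f \<in> SA_0_carrier L"
  obtain g' where g': "good2 L g'" "superconformal g'" "lifts f g'" using f by (rule lift_exists)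
  have "g = g'" by (rule lift_unique[OF f g _ g'(2,3)]) (use g'(1) in \<open>simp add: good2_def\<close>)
  then show "g \<in> SC2 L" unfolding SC2_def using g' f by blast
qed

section \<open>The isomorphism at zero\<close>

lemma group_transport:
  assumes "group G" and b: "bij_betw \<phi> (carrier H) (carrier G)"
    and cl: "\<And>x y. x \<in> carrier H \<Longrightarrow> y \<in> carrier H \<Longrightarrow> x \<otimes>\<^bsub>H\<^esub> y \<in> carrier H"
    and hom: "\<And>x y. x \<in> carrier H \<Longrightarrow> y \<in> carrier H \<Longrightarrow> \<phi> (x \<otimes>\<^bsub>H\<^esub> y) = \<phi> x \<otimes>\<^bsub>G\<^esub> \<phi> y"
    and one: "\<one>\<^bsub>H\<^esub> \<in> carrier H" "\<phi> \<one>\<^bsub>H\<^esub> = \<one>\<^bsub>G\<^esub>"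
  shows "group H" "H \<cong> G"
proof -
  interpret G: group G by fact
  have i: "x = y" if "\<phi> x = \<phi> y" "x \<in> carrier H" "y \<in> carrier H" for x y
    using b that by (auto simp: bij_betw_def dest: inj_onD)
  have c: "\<phi> x \<in> carrier G" if "x \<in> carrier H" for x using b that by (auto simp: bij_betw_def)
  show "group H"
  proof (rule groupI)
    fix x assume x: "x \<in> carrier H"
    obtain y where y: "y \<in> carrier H" "\<phi> y = inv\<^bsub>G\<^esub> (\<phi> x)"
      using b G.inv_closed[OF c[OF x]] unfolding bij_betw_def by (metis imageE)
    have "y \<otimes>\<^bsub>H\<^esub> x = \<one>\<^bsub>H\<^esub>" by (rule i) (use x y cl one c in \<open>simp_all add: hom\<close>)
    then show "\<exists>y\<in>carrier H. y \<otimes>\<^bsub>H\<^esub> x = \<one>\<^bsub>H\<^esub>" using y by blast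
    show "\<one>\<^bsub>H\<^esub> \<otimes>\<^bsub>H\<^esub> x = x" by (rule i) (use x cl one c in \<open>simp_all add: hom\<close>)
  next
    fix x y z assume x: "x \<in> carrier H" "y \<in> carrier H" "z \<in> carrier H"
    show "x \<otimes>\<^bsub>H\<^esub> y \<otimes>\<^bsub>H\<^esub> z = x \<otimes>\<^bsub>H\<^esub> (y \<otimes>\<^bsub>H\<^esub> z)"
      by (rule i) (use x cl c in \<open>simp_all add: hom G.m_assoc\<close>)
  qed (use cl one in auto)
  show "H \<cong> G" using b hom c unfolding is_iso_def iso_def hom_def by blast
qed

lemma id2_SC2: "id2 At_0 \<in> SC2 L" "lower (id2 At_0) = id1 At_0" "id1 At_0 \<in> SA_0_carrier L"
proof -
  show 1: "id1 At_0 \<in> SA_0_carrier L"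
    using monoid.one_closed[OF group.is_monoid[OF group_SA_0[of L]]] by (simp add: SA_0_def)
  have l: "lifts (id1 At_0) (id2 At_0)"
    by (simp add: lifts_def id1_def id2_def iota_gen chY_def chM_def iy_def ith_def)
  show "id2 At_0 \<in> SC2 L"
  proof (rule SC2_I[OF _ _ l 1])
    show "typed2 L (id2 At_0)"
      by (auto simp: typed2_def id2_def intro!: even_s_intros odd_s_intros over_arith)
    have "fls_deriv (xp 1 :: sfun) = 1" using deriv_xp[of 1] by simp
    then show "superconformal (id2 At_0)" by (simp add: id2_def sderiv_def d_odd_ogen)
  qed
  show "lower (id2 At_0) = id1 At_0" by (rule lower_lifts[OF 1 l])
qed

text \<open>One inclusion rests on \<open>SC_0_lower\<close>. For the other, the inverse in the N =
  1 group is lifted, and injectivity of \<open>lower\<close> shows that the lift is a two-sided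
  inverse.\<close>

lemma SC_0_carrier_eq: "SC_0_carrier L = SC2 L"
proof (intro equalityI subsetI)
  fix g assume g: "g \<in> SC_0_carrier L"
  then have t: "typed2 L g" "superconformal g"
    unfolding SC_0_carrier_def by (cases g; simp add: vanishing_fun2_iff)+
  show "g \<in> SC2 L" by (rule SC2_I[OF t lifts_lower(1)[OF t] SC_0_lower[OF g]])
next
  fix g assume g: "g \<in> SC2 L"
  have v: "h \<in> vanishing_fun2 L" if "h \<in> SC2 L" for h
    using that W_mono by (cases h) (auto simp: SC2_def good2_def vanishing_fun2_iff)
  note b = bij_lower[of L, unfolded bij_betw_def]
  have "lower g \<in> carrier (SA_0 L)" using b g by (auto simp: SA_0_def)
  note iv = group.inv_closed[OF group_SA_0 this] group.l_inv[OF group_SA_0 this] group.r_inv[OF group_SA_0 this]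
  obtain f where f: "f \<in> SA_0_carrier L" "comp1 At_0 f (lower g) = id1 At_0" "comp1 At_0 (lower g) f = id1 At_0"
    by (rule that[of "inv\<^bsub>SA_0 L\<^esub> (lower g)"]) (use iv in \<open>simp_all add: SA_0_def\<close>)
  then have "f \<in> lower ` SC2 L" using b by simp
  then obtain g' where g': "g' \<in> SC2 L" "lower g' = f" by blast
  have i: "h = id2 At_0" if "h \<in> SC2 L" "lower h = id1 At_0" for h
    by (rule inj_onD[OF conjunct1[OF b]]) (use that id2_SC2(1)[of L] id2_SC2(2) in simp_all)
  have "comp2 At_0 g g' = id2 At_0" "comp2 At_0 g' g = id2 At_0"
    by (rule i; use g g' f in \<open>simp add: SC2_closed lower_comp[of _ L]\<close>)+
  moreover have "superconformal g" using g by (simp add: SC2_def)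
  ultimately show "g \<in> SC_0_carrier L"
    unfolding SC_0_carrier_def mem_Collect_eq using v[OF g] v[OF g'(1)] by blast
qed

theorem SC_0_SA_0: "group (SC_0 L)" "SC_0 L \<cong> SA_0 L"
proof -
  have *: "bij_betw lower (carrier (SC_0 L)) (carrier (SA_0 L))"
    using bij_lower by (simp add: SC_0_def SA_0_def SC_0_carrier_eq)
  show "group (SC_0 L)" "SC_0 L \<cong> SA_0 L"
    by (rule group_transport[OF group_SA_0 *];
        simp add: SC_0_def SA_0_def SC_0_carrier_eq SC2_closed lower_comp[of _ L] id2_SC2)+
qed

section \<open>The exponential map of the N = 2 derivations\<close>

definition Pp :: sfun where "Pp = ogen Phi1 + ii * ogen Phi2"

lemma odd_s_Pp: "odd_s Pp" and over_Pp: "over L {Phi1, Phi2} Pp"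
  unfolding Pp_def by (intro odd_s_intros(1,4,6) even_s_ii) (intro over_arith over_mult over_ii; simp)

lemma scal_scal: "scal z * (scal w * h) = scal (z * w) * h"
  by (simp add: scal_mult mult.assoc)

lemma half_double: "scal (1 / 2) * (h + h) = h"
  by (simp add: distrib_left flip: distrib_right scal_add)

lemma ii_scal: "ii * (scal z * h) = scal (\<i> * z) * h"
  by (simp add: ii_def scal_scal)

lemma unchiral:
  assumes "odd_s P" "odd_s M"
  defines "P1 \<equiv> scal (1 / 2) * (P + M)" and "P2 \<equiv> scal (- \<i> / 2) * (P - M)"
  shows "P1 - ii * P2 = M" "P1 + ii * P2 = P" "ii * (P1 * P2) = - (scal (1 / 2) * (P * M))"
proof -
  have e: "ii * P2 = scal (1 / 2) * (P - M)" unfolding P2_def ii_scal by simp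
  have "P1 - ii * P2 = scal (1 / 2) * (M + M)" "P1 + ii * P2 = scal (1 / 2) * (P + P)"
    unfolding e P1_def by (simp_all add: distrib_left right_diff_distrib)
  then show "P1 - ii * P2 = M" "P1 + ii * P2 = P" by (simp_all only: half_double)
  have "(P + M) * (P - M) = - (P * M + P * M)"
    using odd_s_anticommute[OF assms(2,1)] odd_s_square[OF assms(1)] odd_s_square[OF assms(2)]
    by (simp add: distrib_right right_diff_distrib)
  moreover have "ii * (P1 * P2) = scal (1 / 2) * (scal (1 / 2) * ((P + M) * (P - M)))"
    unfolding P1_def P2_def mult.assoc scal_left_commute[of "P + M"] ii_scal scal_scal by simp
  ultimately show "ii * (P1 * P2) = - (scal (1 / 2) * (P * M))"
    by (simp only: half_double mult_minus_right)
qed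

lemma Pp_ith: "Pp * ith = - (ii * (ogen Phi1 * ogen Phi2) + ii * (ogen Phi1 * ogen Phi2))"
  unfolding Pp_def ith_def by (simp add: algebra_simps ii_left phi_order)

lemma chiral_phi: "ogen Phi1 = scal (1 / 2) * (Pp + ith)" "ogen Phi2 = scal (- \<i> / 2) * (Pp - ith)"
proof -
  have "Pp + ith = ogen Phi1 + ogen Phi1" by (simp add: Pp_def ith_def)
  then show "ogen Phi1 = scal (1 / 2) * (Pp + ith)" by (simp only: half_double)
  have "Pp - ith = ii * (ogen Phi2 + ogen Phi2)" by (simp add: Pp_def ith_def distrib_left)
  then have "scal (- \<i> / 2) * (Pp - ith) = scal (1 / 2) * (ogen Phi2 + ogen Phi2)"
    by (simp add: ii_def scal_scal)
  then show "ogen Phi2 = scal (- \<i> / 2) * (Pp - ith)" by (simp only: half_double)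
qed

text \<open>Both sides are annihilated by \<open>Dm\<close> and agree after \<open>rho\<close>, so
  \<open>Dm_zero\<close> identifies them; no expansion of powers of the chiral coordinate is carried
  out.\<close>

lemma iota_Taylor:
  assumes c: "over L {} c" shows "iota c = c + ii * (ogen Phi1 * (ogen Phi2 * fls_deriv c))"
proof -
  let ?e = "c + ii * (ogen Phi1 * (ogen Phi2 * fls_deriv c))"
  have z: "d_odd Phi1 c = 0" "d_odd Phi2 c = 0" "d_odd Phi1 (fls_deriv c) = 0" "d_odd Phi2 (fls_deriv c) = 0"
    by (rule d_odd_over[OF c] d_odd_over[OF over_arith(10)[OF c]]; simp)+
  have o: "over L {Phi1, Phi2} ?e"
    using over_mono[OF c] over_mono[OF over_arith(10)[OF c]] by (intro over_arith over_mult over_ii) auto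
  have "Dm ?e = 0"
    unfolding Dm_def sderiv_def d_x.simps
    by (simp add: d_odd_mult d_odd_ogen d_odd_ogen_mult deriv_mult z algebra_simps ii_left phi_order del: fls_deriv_mult)
  from Dm_zero[OF o this] have "?e = iota (rho c + rho (ii * (ogen Phi1 * (ogen Phi2 * fls_deriv c))))"
    by (simp add: rho_ring(1))
  also have "rho (ii * (ogen Phi1 * (ogen Phi2 * fls_deriv c))) = 0" by (simp add: rho_ring rho_gen)
  also have "rho c = c"
  proof -
    have "rho c = subst (xp 1) ogen c"
      unfolding rho_def by (rule subst_cong) (use over_gens[OF c] in auto)
    then show ?thesis by (simp add: subst_id)
  qed
  finally show ?thesis by simp
qed

text \<open>The component along d/dx, and in \<open>be1\<close> and \<open>be2\<close> those along
  d/dPhi1 and d/dPhi2, of minus the sum of the N = 2 derivations.\<close>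

definition al2 :: "seqs \<Rightarrow> sfun" where
  "al2 = (\<lambda>(A1, A2, M1, M2). xp 1 * ps A1 + ogen Phi1 * ps M1 + ogen Phi2 * ps M2)"

definition be1 :: "seqs \<Rightarrow> sfun" where
  "be1 = (\<lambda>(A1, A2, M1, M2). ogen Phi1 * (scal (1 / 2) * fls_deriv (xp 1 * ps A1)) + ii * (ogen Phi2 * ps A2)
     + ps M1 + ogen Phi1 * (ogen Phi2 * fls_deriv (ps M2)))"

definition be2 :: "seqs \<Rightarrow> sfun" where
  "be2 = (\<lambda>(A1, A2, M1, M2). ogen Phi2 * (scal (1 / 2) * fls_deriv (xp 1 * ps A1)) - ii * (ogen Phi1 * ps A2)
     + ps M2 - ogen Phi1 * (ogen Phi2 * fls_deriv (ps M1)))"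

definition vop2 :: "seqs \<Rightarrow> sfun \<Rightarrow> sfun" where
  "vop2 s = fo (al2 s) 0 (be1 s) (be2 s)"

text \<open>The factor by which the field rescales \<open>Dp\<close> infinitesimally, see
  \<open>Dp_vop2\<close>.\<close>

definition mu2 :: "seqs \<Rightarrow> sfun" where "mu2 s = Dp (be1 s)"

lemma vop2_typed:
  assumes "s \<in> seqs L"
  shows "even_s (al2 s)" "odd_s (be1 s)" "odd_s (be2 s)" "over L {Phi1, Phi2} (al2 s)" "over L {Phi1, Phi2} (be1 s)"
    "over L {Phi1, Phi2} (be2 s)" "W 3 (al2 s)" "W 2 (be1 s)" "W 2 (be2 s)"
proof -
  obtain A1 A2 M1 M2 where s: "s = (A1, A2, M1, M2)" by (cases s) auto
  note p = seqsD[OF assms[unfolded s]]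
  note d = al2_def be1_def be2_def s prod.case
  let ?r = "scal (1 / 2) * fls_deriv (xp 1 * ps A1)"
  have e: "even_s (ogen g * ps M1)" "even_s (ogen g * ps M2)" "odd_s (ogen g * ?r)" "odd_s (ogen g * ps A2)"
    "odd_s (ogen g * (ogen g' * fls_deriv (ps M1)))" "odd_s (ogen g * (ogen g' * fls_deriv (ps M2)))" for g g'
    by (rule even_s_intros(5)[OF odd_s_intros(6) p(7)] even_s_intros(5)[OF odd_s_intros(6) p(8)]
        odd_s_intros(5)[OF odd_s_intros(6) p(13)] odd_s_intros(5)[OF odd_s_intros(6) p(6)]
        odd_s_intros(5)[OF odd_s_intros(6) even_s_intros(5)[OF odd_s_intros(6) parity_deriv(1)[OF p(7)]]]
        odd_s_intros(5)[OF odd_s_intros(6) even_s_intros(5)[OF odd_s_intros(6) parity_deriv(1)[OF p(8)]]])+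
  note o = over_mono[OF _ empty_subsetI, of L _ "{Phi1, Phi2}"]
  have w: "W (1 + 2) (ogen g * ps M1)" "W (1 + 2) (ogen g * ps M2)" "W (1 + 2) (ogen g * ?r)" "W (0 + (1 + 2)) (ii * (ogen g * ps A2))"
    "W (1 + (1 + (2 - 2))) (ogen g * (ogen g' * fls_deriv (ps M1)))"
    "W (1 + (1 + (2 - 2))) (ogen g * (ogen g' * fls_deriv (ps M2)))"
    if "W 1 (ogen g)" "W 1 (ogen g')" for g g'
    by (intro W_mult that p W_ii W_deriv)+
  have w0: "W (2 * 1 + 2) (xp 1 * ps A1)" by (rule W_mult[OF W_xp p(9)])
  note W_ogen_Phi(2,3)[intro] W_mono[intro]
  show "even_s (al2 s)" unfolding d by (intro even_s_intros(1) e even_s_intros(4)[OF even_s_intros(7) p(5)])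
  show "odd_s (be1 s)" "odd_s (be2 s)" unfolding d
    by (intro odd_s_intros(1,2) e odd_s_intros(4)[OF even_s_ii] p)+
  show "over L {Phi1, Phi2} (al2 s)" "over L {Phi1, Phi2} (be1 s)" "over L {Phi1, Phi2} (be2 s)" unfolding d
    by (intro over_arith(1,2) over_mult over_ii over_arith(4,5,8,10) o p; simp)+
  have w': "W 3 (ogen g * ps M1)" "W 3 (ogen g * ps M2)" "W 2 (ogen g * ?r)" "W 2 (ii * (ogen g * ps A2))"
     "W 2 (ogen Phi1 * (ogen Phi2 * fls_deriv (ps M1)))" "W 2 (ogen Phi1 * (ogen Phi2 * fls_deriv (ps M2)))"
    if "g = Phi1 \<or> g = Phi2" for g
    using that w(1-4)[of g g] w(5,6)[of Phi1 Phi2] W_ogen_Phi(2,3) by (auto elim!: W_mono)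
  note w' = w'[OF disjI1[OF refl]] w'[OF disjI2[OF refl]]
  show "W 3 (al2 s)" unfolding d by (intro W_arith(1) w' W_mono[OF w0]) simp_all
  show "W 2 (be1 s)" unfolding d by (intro W_arith(1) w' p(11))
  show "W 2 (be2 s)" unfolding d by (intro W_arith(1) W_arith(2) w' p(12))
qed

lemma vop2_props:
  assumes "s \<in> seqs L"
  shows "raising (vop2 s)" "vop2 s (f * g) = vop2 s f * g + f * vop2 s g" "sbar (vop2 s f) = vop2 s (sbar f)"
    "over L {Phi1, Phi2} f \<Longrightarrow> over L {Phi1, Phi2} (vop2 s f)" "vop2 s 0 = 0"
proof -
  note p = vop2_typed[OF assms]
  have z: "odd_s 0" by (simp add: odd_s_def)
  show r: "raising (vop2 s)" unfolding vop2_def by (rule raising_fo) (use p in simp_all)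
  show "vop2 s (f * g) = vop2 s f * g + f * vop2 s g" "sbar (vop2 s f) = vop2 s (sbar f)"
    unfolding vop2_def by (rule fo_mult[OF p(1) z p(2,3)] fo_sbar[OF p(1) z p(2,3)])+
  show "over L {Phi1, Phi2} f \<Longrightarrow> over L {Phi1, Phi2} (vop2 s f)"
    unfolding vop2_def by (rule over_fo) (use p in \<open>simp_all add: over_arith\<close>)
  show "vop2 s 0 = 0" by (simp add: vop2_def fo_def bounded_additive_0[OF bounded_additive_d_odd])
qed

lemma Dp_gen: "Dp (ogen Phi1) = 1" "Dp (ogen Phi2) = ii" "Dp Pp = 0" "Dp ith = 2"
  unfolding Dp_def sderiv_def ith_def Pp_def by (simp_all add: d_odd_ogen algebra_simps)

lemma Dp_over: assumes c: "over L {} c" shows "Dp c = Pp * fls_deriv c"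
proof -
  have "d_odd Phi1 c = 0" "d_odd Phi2 c = 0" by (rule d_odd_over[OF c]; simp)+
  then show ?thesis by (simp add: Dp_def sderiv_def Pp_def distrib_right mult.assoc)
qed

lemma Dp_even_mult: "even_s f \<Longrightarrow> Dp (f * h) = Dp f * h + f * Dp h"
  and Dp_odd_mult: "odd_s f \<Longrightarrow> Dp (f * h) = Dp f * h - f * Dp h"
  by (simp_all add: DpD(5) even_s_def odd_s_def)

text \<open>The first two are linearised superconformal conditions. The left sides of the last two
  are the derivatives of x + i Phi1 Phi2 and Phi1 - i Phi2 along the field; they match the N = 1
  field with the same parameters.\<close>

lemma vop2_eqs:
  assumes "s \<in> seqs L"
  shows "Dp (be2 s) = ii * mu2 s" "Dp (al2 s) - (be1 s + ii * be2 s) = mu2 s * Pp"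
    "al2 s + ii * (be1 s * ogen Phi2 - be2 s * ogen Phi1) = iota (alpha1 s)" "be1 s - ii * be2 s = iota (beta1 s)"
proof -
  obtain A1 A2 M1 M2 where s: "s = (A1, A2, M1, M2)" by (cases s) auto
  note p = seqsD[OF assms[unfolded s]]
  define q where "q = xp 1 * ps A1"
  define r where "r = scal (1 / 2) * fls_deriv q"
  note q_r_def = q_def r_def
  have qo: "over L {} q" "over L {} r" using p by (auto simp: q_r_def intro: over_mult over_arith)
  have q': "fls_deriv q = r + r" by (simp add: r_def half_double flip: distrib_left)
  note d = al2_def be1_def be2_def mu2_def s prod.case q_r_def[symmetric]
  have ev: "even_s r" "even_s (fls_deriv r)" "even_s (ps A2)" "even_s (fls_deriv (ps A2))" "even_s (r + r)"
    by (rule p(6) parity_deriv(2)[OF p(6)] p(13)[folded q_def, folded r_def] parity_deriv(2)[OF p(13)[folded q_def, folded r_def]]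
        even_s_intros(1)[OF p(13)[folded q_def, folded r_def] p(13)[folded q_def, folded r_def]])+
  have od: "odd_s (ps M1)" "odd_s (fls_deriv (ps M1))" "odd_s (ps M2)" "odd_s (fls_deriv (ps M2))"
    by (rule p(7,8) parity_deriv(1)[OF p(7)] parity_deriv(1)[OF p(8)])+
  have c1: "c * ogen g = ogen g * c" "c * (ogen g * h) = ogen g * (c * h)" if "even_s c" for c g h
    using even_s_commute[OF that, of "ogen g"] even_mult_left[OF that, of "ogen g" h] by auto
  have c2: "c * ogen g = - (ogen g * c)" "c * (ogen g * h) = - (ogen g * (c * h))" if "odd_s c" for c g h
    using odd_s_anticommute[OF that odd_s_intros(6)[of g]] by (simp_all flip: mult.assoc)
  note c = c1[OF ev(1)] c1[OF ev(2)] c1[OF ev(3)] c1[OF ev(4)] c2[OF od(1)] c2[OF od(2)] c2[OF od(3)] c2[OF od(4)]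
  have D: "Dp r = Pp * fls_deriv r" "Dp q = Pp * (r + r)" "Dp (ps A2) = Pp * fls_deriv (ps A2)" "Dp (ps M1) = Pp * fls_deriv (ps M1)"
    "Dp (ps M2) = Pp * fls_deriv (ps M2)" "Dp (fls_deriv (ps M1)) = Pp * fls_deriv (fls_deriv (ps M1))"
    "Dp (fls_deriv (ps M2)) = Pp * fls_deriv (fls_deriv (ps M2))"
    using Dp_over[OF qo(1)] Dp_over[OF qo(2)] Dp_over[OF p(2)] Dp_over[OF p(3)] Dp_over[OF p(4)]
      Dp_over[OF over_arith(10)[OF p(3)]] Dp_over[OF over_arith(10)[OF p(4)]] by (simp_all add: q')
  note D' = DpD(1,2,7) Dp_odd_mult[OF odd_s_intros(6)] Dp_gen D
  have mu: "Dp (be1 s) = (r - ps A2) - ii * (ogen Phi1 * (ogen Phi2 * fls_deriv r)) + ii * (ogen Phi1 * (ogen Phi2 * fls_deriv (ps A2)))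
      + Pp * (fls_deriv (ps M1) - ii * fls_deriv (ps M2))"
    unfolding d D' Pp_def by (simp add: algebra_simps ii_left phi_order c)
  show "Dp (be2 s) = ii * mu2 s"
    unfolding mu2_def mu unfolding d D' Pp_def by (simp add: algebra_simps ii_left phi_order c)
  show "Dp (al2 s) - (be1 s + ii * be2 s) = mu2 s * Pp"
    unfolding mu2_def mu unfolding d D' Pp_def by (simp add: algebra_simps ii_left phi_order c)
  have ia: "iota q = q + ii * (ogen Phi1 * (ogen Phi2 * (r + r)))" "iota (ps A2) = ps A2 + ii * (ogen Phi1 * (ogen Phi2 * fls_deriv (ps A2)))"
    "iota (ps M1) = ps M1 + ii * (ogen Phi1 * (ogen Phi2 * fls_deriv (ps M1)))" "iota (ps M2) = ps M2 + ii * (ogen Phi1 * (ogen Phi2 * fls_deriv (ps M2)))"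
    "iota r = r + ii * (ogen Phi1 * (ogen Phi2 * fls_deriv r))"
    using iota_Taylor[OF qo(1)] iota_Taylor[OF p(2)] iota_Taylor[OF p(3)] iota_Taylor[OF p(4)] iota_Taylor[OF qo(2)]
    by (simp_all add: q')
  note i' = alpha1_def beta1_def s prod.case q_r_def[symmetric] ii_def[symmetric] iota_ring iota_gen ia ith_def
  show "al2 s + ii * (be1 s * ogen Phi2 - be2 s * ogen Phi1) = iota (alpha1 s)"
    unfolding i' d by (simp add: algebra_simps ii_left phi_order c)
  show "be1 s - ii * be2 s = iota (beta1 s)"
    unfolding i' d by (simp add: algebra_simps ii_left phi_order c)
qed

text \<open>The infinitesimal counterpart of \<open>chain2\<close>: by the linearised conditions the
  field commutes with \<open>Dp\<close> up to a multiple of \<open>Dp\<close>.\<close>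

lemma Dp_vop2: assumes "s \<in> seqs L" shows "Dp (vop2 s h) = vop2 s (Dp h) + mu2 s * Dp h"
proof -
  note t = vop2_typed(1-3)[OF assms] and e = vop2_eqs(1,2)[OF assms]
  have 1: "Dp (fls_deriv h) = fls_deriv (Dp h)"
    by (simp add: Dp_def sderiv_def d_odd_deriv deriv_mult del: fls_deriv_mult)
  have 2: "d_odd Phi1 (Dp h) = fls_deriv h - Dp (d_odd Phi1 h)" "d_odd Phi2 (Dp h) = ii * fls_deriv h - Dp (d_odd Phi2 h)"
    unfolding Dp_def sderiv_def d_x.simps
    by (simp_all add: d_odd_ogen_mult d_odd_deriv algebra_simps ii_left d_odd_anticommute[of Phi2 Phi1])
  have a: "Dp (al2 s) = mu2 s * Pp + (be1 s + ii * be2 s)" using e(2) by (metis diff_add_cancel)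
  have Dh: "Dp h = d_odd Phi1 h + ii * d_odd Phi2 h + Pp * fls_deriv h"
    by (simp add: Dp_def sderiv_def Pp_def algebra_simps)
  have "Dp (vop2 s h) = vop2 s (Dp h) + mu2 s * (d_odd Phi1 h + ii * d_odd Phi2 h + Pp * fls_deriv h)"
    unfolding vop2_def fo_def 1[symmetric] 2
    by (simp add: DpD(1) Dp_even_mult[OF t(1)] Dp_odd_mult[OF t(2)] Dp_odd_mult[OF t(3)] a e(1) mu2_def[symmetric]
        algebra_simps ii_left)
  then show ?thesis unfolding Dh[symmetric] .
qed

lemma vop2_iota:
  assumes "s \<in> seqs L" "over L {Phi} h" shows "iota (vop (vf1 s) h) = vop2 s (iota h)"
proof -
  have "vop2 s (iota h) = (al2 s + ii * (be1 s * ogen Phi2 - be2 s * ogen Phi1)) * iota (fls_deriv h)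
      + (be1 s - ii * be2 s) * iota (d_odd Phi h)"
    unfolding vop2_def fo_def iota_chain(1-3)[OF assms(2)] by (simp add: algebra_simps ii_left)
  also have "\<dots> = iota (vop (vf1 s) h)"
    unfolding vop2_eqs(3,4)[OF assms(1)] by (simp add: vop_def fo_def vf1_def iota_ring)
  finally show ?thesis ..
qed

lemma exp_vop2_iota:
  assumes s: "s \<in> seqs L" and h: "over L {Phi} h"
  shows "exp_op (vop2 s) (iota h) = iota (exp_op (vop (vf1 s)) h)"
proof (rule exp_op_intertwine[where P = "over L {Phi}" and A = iota, OF vfieldsD(1)[OF vf1_vfields[OF s]]])
  show "bounded_additive iota" unfolding iota_def by (rule bounded_additive_subst[OF iota_ok])
  show "iota (scal z * f) = scal z * iota f" for z f unfolding iota_def by (rule subst_scal_mult[OF iota_ok])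
qed (use vfieldsD(4)[OF vf1_vfields[OF s]] vop2_iota[OF s] h in simp_all)

text \<open>The commutator relation makes \<open>Dp\<close> carry exp V to exp (V + mu). The latter
  is multiplicative only in the twisted sense of \<open>exp_op_mult\<close>, with exp V on the left
  factor; that suffices to carry \<open>Dp Y = P * Dp M\<close> along the flow.\<close>

lemma exp_vop2_Dp:
  assumes s: "s \<in> seqs L"
  defines "U \<equiv> \<lambda>h. vop2 s h + mu2 s * h"
  shows "Dp (exp_op (vop2 s) h) = exp_op U (Dp h)" "exp_op U (f * h) = exp_op (vop2 s) f * exp_op U h" "exp_op U 0 = 0"
proof -
  note r = vop2_props(1)[OF s]
  have mu: "even_s (mu2 s)" unfolding mu2_def by (rule DpD(8)[OF vop2_typed(2)[OF s]])
  have "W (2 - 1) (mu2 s)" unfolding mu2_def by (rule W_Dp[OF vop2_typed(8)[OF s]])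
  then have w: "W (1 + m) (mu2 s * f)" if "W m f" for m f using W_mult that by fastforce
  have U: "raising U"
    unfolding raising_def
  proof (intro conjI allI impI)
    fix f g z m
    show "U (f + g) = U f + U g" "U (scal z * f) = scal z * U f"
      using r by (simp_all add: U_def raising_def distrib_left scal_left_commute[of "mu2 s"])
    show "W (m + 1) (U f)" if "W m f"
    proof -
      have "W (m + 1) (vop2 s f)" using r that by (simp add: raising_def)
      moreover have "W (m + 1) (mu2 s * f)" using w[OF that] by (simp add: add.commute)
      ultimately show ?thesis unfolding U_def by (rule W_arith(1))
    qed
  qed
  show "Dp (exp_op (vop2 s) h) = exp_op U (Dp h)"
  proof (rule exp_op_intertwine[where P = "\<lambda>_. True" and A = Dp, OF r, symmetric])
    show "bounded_additive Dp" using oder_Dp by (simp add: oder_def)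
  qed (simp_all add: DpD(6) Dp_vop2[OF s] U_def)
  show "exp_op U (f * h) = exp_op (vop2 s) f * exp_op U h"
    by (rule exp_op_mult[OF r U])
      (simp add: U_def vop2_props(2)[OF s] distrib_left even_mult_left[OF mu] add_ac)
  show "exp_op U 0 = 0" by (rule exp_op_fix[OF U]) (simp add: U_def vop2_props(5)[OF s])
qed

lemma gen_0_N2:
  assumes s: "s \<in> seqs L"
  shows "(gen_0 (N2_L At_0) (N2_J At_0) (N2_G1 At_0) (N2_G2 At_0) s h has_sum - vop2 s h) {1..}"
proof -
  obtain A1 A2 M1 M2 where s': "s = (A1, A2, M1, M2)" by (cases s) auto
  note p = seqsD[OF s[unfolded s']]
  let ?d1 = "d_odd Phi1 h" and ?d2 = "d_odd Phi2 h" and ?h = "fls_deriv h" and ?f1 = "ogen Phi1" and ?f2 = "ogen Phi2"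
  let ?k = "?f1 * ?d1 + ?f2 * ?d2" and ?j = "?f1 * ?d2 - ?f2 * ?d1"
  have um: "((\<lambda>n. - F n) has_sum - S) {1..}" if "(F has_sum S) {1..}" for F :: "nat \<Rightarrow> sfun" and S
    using bounded_additive_has_sum[OF bounded_additive_uminus[OF bounded_additive_id] that] .
  have sm: "((\<lambda>n. scal z * F n) has_sum scal z * S) {1..}" if "(F has_sum S) {1..}" for F :: "nat \<Rightarrow> sfun" and S z
    using bounded_additive_has_sum[OF bounded_additive_left_mult that] .
  have 1: "((\<lambda>n. fls_const (A1 n) * N2_L At_0 (int n) h) has_sum
      - (ps A1 * (xp 1 * ?h) + scal (1 / 2) * (fls_deriv (ps A1 * xp 1) * ?k))) {1..}"
  proof -
    have "fls_const (A1 n) * N2_L At_0 (int n) h = - (fls_const (A1 n) * (xp (int n + 1) * ?h) +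
        scal (1 / 2) * (fls_const (A1 n) * (scal (of_int (int n + 1)) * (xp (int n + 1 - 1) * ?k))))" for n
    proof -
      have "scal ((of_int (int n) + 1) / 2) = scal (1 / 2) * scal (of_int (int n + 1))"
        by (simp flip: scal_mult)
      then show ?thesis
        unfolding N2_L_def xpow_xp d_x.simps
        by (simp only: scal_left_commute[of "fls_const _"] mult_minus_right distrib_left mult.assoc add_diff_cancel_right')
    qed
    then show ?thesis
      by (simp only: um has_sum_add[OF has_sum_ps_shift sm[OF has_sum_ps_deriv]])
  qed
  have 2: "((\<lambda>n. fls_const (A2 n) * N2_J At_0 (int n) h) has_sum ii * (ps A2 * ?j)) {1..}"
    using sm[OF has_sum_ps_mult[of A2 ?j], of \<i>] unfolding N2_J_def xpow_xp ii_def
    by (simp add: mult.assoc scal_left_commute[of "fls_const _"])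
  have 3: "((\<lambda>n. fls_const (M1 n) * N2_G1 At_0 (int n) h) has_sum
      - (ps M1 * (?d1 - ?f1 * ?h)) + fls_deriv (ps M1 * xp 0) * (?f1 * (?f2 * ?d2))) {1..}"
  proof -
    have "fls_const (M1 n) * N2_G1 At_0 (int n) h = - (fls_const (M1 n) * (xp (int n) * (?d1 - ?f1 * ?h)))
        + fls_const (M1 n) * (scal (of_int (int n + 0)) * (xp (int n + 0 - 1) * (?f1 * (?f2 * ?d2))))" for n
      unfolding N2_G1_def xpow_xp d_x.simps by (simp add: right_diff_distrib distrib_left mult.assoc)
    then show ?thesis by (simp only: has_sum_add[OF um[OF has_sum_ps_mult] has_sum_ps_deriv])
  qed
  have 4: "((\<lambda>n. fls_const (M2 n) * N2_G2 At_0 (int n) h) has_sum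
      - (ps M2 * (?d2 - ?f2 * ?h)) + - (fls_deriv (ps M2 * xp 0) * (?f1 * (?f2 * ?d1)))) {1..}"
  proof -
    have "fls_const (M2 n) * N2_G2 At_0 (int n) h = - (fls_const (M2 n) * (xp (int n) * (?d2 - ?f2 * ?h)))
        + - (fls_const (M2 n) * (scal (of_int (int n + 0)) * (xp (int n + 0 - 1) * (?f1 * (?f2 * ?d1)))))" for n
      unfolding N2_G2_def xpow_xp d_x.simps by (simp add: right_diff_distrib distrib_left mult.assoc)
    then show ?thesis by (simp only: has_sum_add[OF um[OF has_sum_ps_mult] um[OF has_sum_ps_deriv]])
  qed
  have "- (ps A1 * (xp 1 * ?h) + scal (1 / 2) * (fls_deriv (ps A1 * xp 1) * ?k)) + ii * (ps A2 * ?j)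
      + (- (ps M1 * (?d1 - ?f1 * ?h)) + fls_deriv (ps M1 * xp 0) * (?f1 * (?f2 * ?d2)))
      + (- (ps M2 * (?d2 - ?f2 * ?h)) + - (fls_deriv (ps M2 * xp 0) * (?f1 * (?f2 * ?d1)))) = - vop2 s h" (is "?S = _")
  proof -
    define r where "r = scal (1 / 2) * fls_deriv (xp 1 * ps A1)"
    have r: "scal (1 / 2) * (fls_deriv (ps A1 * xp 1) * k) = r * k" for k
      unfolding r_def xp_commute[of "ps A1"] mult.assoc ..
    define m1 m2 where "m1 = fls_deriv (ps M1)" "m2 = fls_deriv (ps M2)"
    have m: "odd_s m1" "odd_s m2" "fls_deriv (ps M1 * xp 0) = m1" "fls_deriv (ps M2 * xp 0) = m2"
      unfolding m1_m2_def xp_0 mult_1_right by (rule parity_deriv(1)[OF p(7)] parity_deriv(1)[OF p(8)] refl)+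
    have c: "c * (ogen g * k) = - (ogen g * (c * k))" if "odd_s c" for c g k
      using odd_s_anticommute[OF that odd_s_intros(6)[of g]] by (simp flip: mult.assoc)
    have c': "c * (ogen g * k) = ogen g * (c * k)" if "even_s c" for c g k by (rule even_mult_left[OF that])
    have x: "ps A1 * (xp 1 * k) = xp 1 * (ps A1 * k)" for k using xp_commute[of "ps A1" 1] by (simp flip: mult.assoc)
    note c = c[OF m(1)] c[OF m(2)] c[OF p(7)] c[OF p(8)] c'[OF p(6)] c'[OF p(13)[folded r_def]] x
    show ?thesis
      unfolding vop2_def fo_def al2_def be1_def be2_def s' prod.case r r_def[symmetric] m(3,4) m1_m2_def[symmetric]
      by (simp add: algebra_simps c ii_left)
  qed
  moreover have "gen_0 (N2_L At_0) (N2_J At_0) (N2_G1 At_0) (N2_G2 At_0) s h = (\<lambda>n.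
      fls_const (A1 n) * N2_L At_0 (int n) h + fls_const (A2 n) * N2_J At_0 (int n) h
       + fls_const (M1 n) * N2_G1 At_0 (int n) h + fls_const (M2 n) * N2_G2 At_0 (int n) h)"
    by (rule ext) (simp only: gen_0_def s' prod.case)
  ultimately show ?thesis
    using has_sum_add[OF has_sum_add[OF has_sum_add[OF 1 2] 3] 4] by (simp only:)
qed

definition euler2 :: "sfun \<Rightarrow> sfun" where "euler2 f = ogen Phi1 * d_odd Phi1 f + ogen Phi2 * d_odd Phi2 f"

lemma coeffwise_N2:
  "coeffwise (\<lambda>h. - N2_J e 0 h)" "coeffwise (\<lambda>h. - 2 * N2_L At_0 0 h)" "coeffwise (\<lambda>h. 2 * N2_L At_inf 0 h)"
proof -
  show "coeffwise (\<lambda>h. - N2_J e 0 h)"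
    by (rule coeffwiseI[of _ "\<lambda>n c. - (gscal \<i> * (ggen Phi1 * gderiv Phi2 c - ggen Phi2 * gderiv Phi1 c))"])
      (cases e; simp add: N2_J_def mult.assoc algebra_simps)+
  show "coeffwise (\<lambda>h. - 2 * N2_L At_0 0 h)"
    by (rule coeffwiseI[of _ "\<lambda>n c. 2 * (of_int n * c + gscal (1 / 2) * (ggen Phi1 * gderiv Phi1 c + ggen Phi2 * gderiv Phi2 c))"])
      (unfold numeral_2_nth, simp_all add: N2_L_def xp_mult_nth mult.assoc algebra_simps)
  show "coeffwise (\<lambda>h. 2 * N2_L At_inf 0 h)"
    by (rule coeffwiseI[of _ "\<lambda>n c. 2 * (of_int n * c - gscal (1 / 2) * (ggen Phi1 * gderiv Phi1 c + ggen Phi2 * gderiv Phi2 c))"])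
      (simp_all add: mult_2 N2_L_def xp_mult_nth mult.assoc algebra_simps flip: xp_def)
qed

text \<open>The variables Phi1 and Phi2 are not eigenvectors of -J_0, but the chiral combinations
  \<open>Pp\<close> and \<open>ith\<close> are, with eigenvalues 1 and -1. As -2 L_0 acts on both
  with eigenvalue 1, they are scaled by \<open>a1 * a2\<close> and \<open>a1 / a2\<close>.\<close>

lemma pow_op_N2:
  assumes a: "a1 \<in> Lam_units L" "a2 \<in> Lam_units L" and cw: "coeffwise L'" "coeffwise J'"
    and A: "\<And>f. L' (A f) = A (- 2 * N2_L At_0 0 f)" "\<And>f. J' (A f) = A (- N2_J At_0 0 f)"
      "\<And>z f. A (scal z * f) = scal z * A f" "\<And>c f. c \<in> Lam_units L \<Longrightarrow> A (fls_const c * f) = fls_const c * A f"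
      "\<And>f g. A (f + g) = A f + A g"
  defines "E \<equiv> \<lambda>f. pow_op a1 L' (pow_op a2 J' f)"
    and "P \<equiv> fls_const (a1 * a2) * Pp" and "M \<equiv> fls_const (a1 * unit_inv a2) * ith"
  shows "E (A (xp 1)) = A (fls_const (a1 * a1) * xp 1)" "E (A (ogen Phi1)) = A (scal (1 / 2) * (P + M))"
    "E (A (ogen Phi2)) = A (scal (- \<i> / 2) * (P - M))"
proof -
  let ?J = "\<lambda>h. - N2_J At_0 0 h" and ?L = "\<lambda>h. - 2 * N2_L At_0 0 h"
  note eJ = pow_op_eigen[where A = A and K = ?J, OF cw(2) A(3,2)] and eL = pow_op_eigen[where A = A and K = ?L, OF cw(1) A(3,1)]
  have "?J (xp 1) = of_int 0 * xp 1" by (simp add: N2_J_def)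
  note x1 = eJ[OF this, of a2]
  have "?L (xp 1) = of_int 2 * xp 1" using deriv_xp[of 1] by (simp add: N2_L_def xp_mult_xp)
  note x2 = eL[OF this, of a1]
  have z: "zpow a1 2 = a1 * a1" by (simp add: zpow_def power2_eq_square)
  show "E (A (xp 1)) = A (fls_const (a1 * a1) * xp 1)"
    unfolding E_def x1 zpow_0 fls_const_1 mult_1 x2 z A(4)[OF Lam_units_mult[OF a(1,1)]] ..
  have u: "unit_inv a2 \<in> Lam_units L" by (rule Lam_unitsD(7)[OF a(2)])
  have Js: "?J (scal z * f) = scal z * ?J f" for z f
    by (simp add: N2_J_def mult.assoc scal_left_commute[of "ogen _"] right_diff_distrib) (simp add: scal_left_commute[of "scal \<i>"])
  have JP: "?J Pp = Pp" and JM: "?J ith = - ith"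
    by (simp_all add: N2_J_def Pp_def ith_def d_odd_ogen ii_left algebra_simps flip: ii_def)
  have ec: "euler2 (fls_const c * f) = fls_const c * euler2 f" if c: "c \<in> Lam_units L" for c f
  proof -
    have "even_s (fls_const c)" by (rule even_s_intros(10)[OF Lam_unitsD(3)[OF c]])
    note e = this even_mult_left[OF this, of "ogen _"]
    have "d_odd g (fls_const c * f) = fls_const c * d_odd g f" if "\<And>k. g \<noteq> Zeta k" for g
      using gderiv_Lam[OF Lam_unitsD(2)[OF c], of g] that e(1) by (simp add: d_odd_mult even_s_def)
    then show ?thesis by (simp add: euler2_def distrib_left e(2))
  qed
  have es: "euler2 (scal z * f) = scal z * euler2 f" "euler2 (f + g) = euler2 f + euler2 g" for z f g
    by (simp_all add: euler2_def scal_left_commute[of "ogen _"] distrib_left add_ac)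
  have eP: "euler2 Pp = Pp" "euler2 ith = ith"
    by (simp_all add: euler2_def Pp_def ith_def d_odd_ogen ii_left)
  have *: "E (A (scal z * Pp + scal y * ith)) = A (scal z * P + scal y * M)" for z y
  proof -
    define F where "F k = (if k = 1 then A (scal z * Pp) else A (scal y * ith))" for k :: int
    have F: "J' (F k) = of_int k * F k" if "k \<in> {1, -1}" for k
      using that A(3)[of "- 1"] JP JM unfolding F_def by (auto simp: A(2) Js scal_minus simp del: minus_mult_left)
    have "pow_op a2 J' (\<Sum>k\<in>{1, -1}. F k) = (\<Sum>k\<in>{1, -1}. fls_const (zpow a2 k) * F k)"
      by (rule pow_op_coeffwise[OF cw(2) _ F]) simp_all
    then have 1: "pow_op a2 J' (A (scal z * Pp + scal y * ith)) =
        A (fls_const a2 * (scal z * Pp) + fls_const (unit_inv a2) * (scal y * ith))" (is "_ = A ?f")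
      by (simp add: F_def zpow_def A(4,5) a(2) u)
    have "euler2 ?f = ?f" by (simp only: es ec[OF a(2)] ec[OF u] eP)
    moreover have "fls_deriv ?f = 0" by (simp add: Pp_def ith_def deriv_mult del: fls_deriv_mult)
    ultimately have "N2_L At_0 0 ?f = - (scal (1 / 2) * ?f)"
      unfolding N2_L_def euler2_def by (simp add: mult.assoc)
    then have "?L ?f = scal (1 / 2) * (?f + ?f)" by (simp add: mult_2 distrib_left)
    then have "?L ?f = of_int 1 * ?f" unfolding half_double by simp
    from eL[OF this, of a1] show ?thesis
      unfolding E_def 1 P_def M_def zpow_1 A(4)[OF a(1), symmetric]
      by (simp add: distrib_left scal_left_commute[of "fls_const _"] mult.assoc flip: fls_const_mult_const)
  qed
  show "E (A (ogen Phi1)) = A (scal (1 / 2) * (P + M))"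
    using *[of "1 / 2" "1 / 2"] unfolding distrib_left[symmetric] chiral_phi(1)[symmetric] .
  have "scal (- \<i> / 2) * Pp + scal (\<i> / 2) * ith = ogen Phi2"
    unfolding chiral_phi(2) right_diff_distrib by (simp add: scal_minus)
  then show "E (A (ogen Phi2)) = A (scal (- \<i> / 2) * (P - M))"
    using *[of "- \<i> / 2" "\<i> / 2"] by (simp add: right_diff_distrib scal_minus)
qed

lemma E_op_0_N2:
  assumes s: "s \<in> seqs L" and b: "b1 \<in> Lam_units L" "b2 \<in> Lam_units L"
  defines "E \<equiv> E_op_0 (N2_L At_0) (N2_J At_0) (N2_G1 At_0) (N2_G2 At_0) s (b1, b2)"
    and "P \<equiv> fls_const (b1 * b2) * Pp" and "M \<equiv> fls_const (b1 * unit_inv b2) * ith"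
  shows "E (xp 1) = exp_op (vop2 s) (fls_const (b1 * b1) * xp 1)"
    "E (ogen Phi1) = exp_op (vop2 s) (scal (1 / 2) * (P + M))"
    "E (ogen Phi2) = exp_op (vop2 s) (scal (- \<i> / 2) * (P - M))"
proof -
  have i: "(\<lambda>h. - (\<Sum>\<^sub>\<infinity>n\<in>{1..}. gen_0 (N2_L At_0) (N2_J At_0) (N2_G1 At_0) (N2_G2 At_0) s h n)) = vop2 s"
    using infsumI[OF gen_0_N2[OF s]] by (simp add: fun_eq_iff)
  note pw = pow_op_N2[OF b coeffwise_N2(2,1), of "\<lambda>f. f"]
  show "E (xp 1) = exp_op (vop2 s) (fls_const (b1 * b1) * xp 1)"
    "E (ogen Phi1) = exp_op (vop2 s) (scal (1 / 2) * (P + M))"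
    "E (ogen Phi2) = exp_op (vop2 s) (scal (- \<i> / 2) * (P - M))"
    unfolding E_def P_def M_def E_op_0_gen i by (subst pw; simp)+
qed

lemma E2_0_eq:
  assumes s: "s \<in> seqs L" and a: "a1 \<in> Lam_units L" "a2 \<in> Lam_units L"
  defines "P \<equiv> fls_const (a1 * a2) * Pp" and "M \<equiv> fls_const (a1 * unit_inv a2) * ith"
  shows "E2_0 ({(a1, a2), (- a1, - a2)}, s) = (exp_op (vop2 s) (fls_const (a1 * a1) * xp 1),
     exp_op (vop2 s) (scal (1 / 2) * (P + M)), exp_op (vop2 s) (scal (- \<i> / 2) * (P - M)))"
  unfolding E2_0_def prod.case Let_def P_def M_def
  by (subst the_elem_pair)
    (simp_all only: id2_def xpow_xp map_prod_simp E_op_0_N2[OF s] a Lam_units_minus unit_inv_minus[OF a(2)] minus_mult_minus)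

text \<open>Superconformality is checked in chiral form. On the chiral coordinates the flow is the N
  = 1 flow by \<open>exp_vop2_iota\<close>, so the conditions on \<open>Dm\<close> come from
  \<open>iota_chain\<close>; those on \<open>Dp\<close> hold for the dilation and are carried along
  by \<open>exp_vop2_Dp\<close>.\<close>

theorem E2_0_SC2: assumes p: "p \<in> params L" shows "E2_0 p \<in> SC2 L" "lower (E2_0 p) = E1_0 p"
proof -
  obtain a1 a2 s where p': "p = ({(a1, a2), (- a1, - a2)}, s)" and s: "s \<in> seqs L"
    and a: "a1 \<in> Lam_units L" "a2 \<in> Lam_units L" using p by (rule params_E)
  let ?e = "a1 * a2" and ?d = "a1 * unit_inv a2" and ?c = "a1 * a1"
  have u: "?e \<in> Lam_units L" "?d \<in> Lam_units L" "?c \<in> Lam_units L"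
    by (intro Lam_units_mult Lam_unitsD(7) a)+
  note L = Lam_unitsD(2)[OF u(1)] Lam_unitsD(2)[OF u(2)] Lam_unitsD(2)[OF u(3)]
    and G = Lam_unitsD(3)[OF u(1)] Lam_unitsD(3)[OF u(2)] Lam_unitsD(3)[OF u(3)]
  note ev = even_s_intros(10)[OF G(1)] even_s_intros(10)[OF G(2)] even_s_intros(10)[OF G(3)]
  let ?P = "fls_const ?e * Pp" and ?M = "fls_const ?d * ith" and ?T = "exp_op (vop2 s)"
  define P1 where "P1 = scal (1 / 2) * (?P + ?M)"
  define P2 where "P2 = scal (- \<i> / 2) * (?P - ?M)"
  define X where "X = fls_const ?c * xp 1"
  have g: "E2_0 p = (?T X, ?T P1, ?T P2)" unfolding p' E2_0_eq[OF s a] X_def P1_def P2_def ..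
  note v = vop2_props[OF s]
  have Tm: "?T (f * h) = ?T f * ?T h" for f h by (rule exp_op_mult[OF v(1,1,2)])
  have Tii: "?T ii = ii" unfolding ii_def
    by (rule exp_op_fix[OF v(1)]) (simp add: vop2_def fo_def)
  note Ta = exp_op_add[OF v(1)] exp_op_diff[OF v(1)] Tm Tii
  have oPM: "odd_s ?P" "odd_s ?M" by (rule odd_s_intros(4) ev odd_s_Pp iota_data(5))+
  note uc = unchiral[OF oPM, folded P1_def P2_def]
  have ovPM: "over L {Phi1, Phi2} ?P" "over L {Phi1, Phi2} ?M"
    by (rule over_mult[OF over_mono[OF over_const[OF L(1)] empty_subsetI] over_Pp]
        over_mult[OF over_mono[OF over_const[OF L(2)] empty_subsetI] iota_data(4)])+
  have ty: "odd_s P1" "odd_s P2" "even_s X" "over L {Phi1, Phi2} P1" "over L {Phi1, Phi2} P2" "over L {Phi1, Phi2} X"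
    unfolding P1_def P2_def X_def
    by (rule odd_s_intros(4)[OF even_s_intros(6) odd_s_intros(1)[OF oPM]]
        odd_s_intros(4)[OF even_s_intros(6) odd_s_intros(2)[OF oPM]] even_s_intros(4)[OF ev(3) even_s_intros(7)]
        over_mult[OF over_arith(4) over_arith(1)[OF ovPM]] over_mult[OF over_arith(4) over_arith(2)[OF ovPM]]
        over_mult[OF over_mono[OF over_const[OF L(3)] empty_subsetI] over_arith(5)])+
  note par = parity_exp_op[OF v(1,3)]
  have typed: "typed2 L (E2_0 p)"
    unfolding g typed2_def prod.case
    using par ty over_exp_op[OF v(1) _ v(4)] by blast
  \<comment> \<open>The scale of x is the product of the scales of the two chiral odd variables,
    which makes the dilation superconformal.\<close>
  have ce: "fls_const ?c = fls_const ?e * fls_const ?d"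
  proof -
    have "a2 * (a1 * unit_inv a2) = a1"
      unfolding Lam_unitsD(8)[OF a(1), of "unit_inv a2"] by (simp add: Lam_unitsD(5)[OF a(2)] flip: mult.assoc)
    then have "?e * ?d = ?c" by (simp add: mult.assoc)
    then show ?thesis by (simp only: fls_const_mult_const)
  qed
  have PMe: "?P * ?M = fls_const ?c * (Pp * ith)"
  proof -
    have "?P * ?M = fls_const ?e * (fls_const ?d * (Pp * ith))"
      unfolding mult.assoc even_mult_left[OF ev(2), of Pp] ..
    then show ?thesis by (simp only: ce mult.assoc)
  qed
  have "X + ii * (P1 * P2) = fls_const ?c * iy"
    unfolding uc(3) PMe Pp_ith X_def iy_def mult_minus_right minus_minus distrib_left[of "fls_const ?c"] half_double ..
  then have Y: "chY (E2_0 p) = ?T (fls_const ?c * iy)"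
    unfolding g chY_def prod.case by (simp only: Ta flip: \<open>X + ii * (P1 * P2) = fls_const ?c * iy\<close>)
  have M: "chM (E2_0 p) = ?T ?M" unfolding g chM_def prod.case uc(1)[symmetric] by (simp only: Ta)
  have P: "chP (E2_0 p) = ?T ?P" unfolding g chP_def prod.case uc(2)[symmetric] by (simp only: Ta)
  have cT: "?T (fls_const c * h) = fls_const c * ?T h" if "c \<in> Lam_units L" for c h
    unfolding vop2_def by (rule exp_op_const[OF v(1)[unfolded vop2_def] Lam_unitsD(2,3)[OF that]])
  have ex: "?T iy = iota (fst (exp1 (vf1 s)))" "?T ith = iota (snd (exp1 (vf1 s)))"
    using exp_vop2_iota[OF s, of "xp 1"] exp_vop2_iota[OF s, of "ogen Phi"]
    by (simp_all add: exp1_def iota_gen over_arith)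
  have l: "lifts (E1_0 p) (E2_0 p)"
    unfolding lifts_def p' E1_0_eq[OF s a] fst_conv snd_conv Y[unfolded p'] M[unfolded p']
    by (simp add: iota_ring iota_const[OF L(3)] iota_const[OF L(2)] cT[OF u(3)] cT[OF u(2)] ex)
  have p1: "E1_0 p \<in> SA_0_carrier L" using bij_E1_0 p by (auto simp: bij_betw_def)
  then have "typed1 L (E1_0 p)" by (simp add: SA_0_carrier_iff)
  then have o: "over L {Phi} (fst (E1_0 p))" "over L {Phi} (snd (E1_0 p))" by (simp_all add: typed1_def)
  have Dm: "Dm (chY (E2_0 p)) = 0" "Dm (chM (E2_0 p)) = 0"
    using l iota_chain(4)[OF o(1)] iota_chain(4)[OF o(2)] by (simp_all add: lifts_def)
  note D = exp_vop2_Dp[OF s]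
  have Dc: "Dp (fls_const c * h) = fls_const c * Dp h" if "c \<in> Lam_units L" for c h
    using Dp_even_mult[OF even_s_intros(10)[OF Lam_unitsD(3)[OF that]]]
      Dp_over[OF over_const[OF Lam_unitsD(2)[OF that]]] by simp
  have DP: "Dp (chP (E2_0 p)) = 0" unfolding P D(1) Dc[OF u(1)] Dp_gen by (simp add: D(3))
  have DY: "Dp (chY (E2_0 p)) = chP (E2_0 p) * Dp (chM (E2_0 p))"
  proof -
    have "Dp iy = Pp * 2"
      using Dp_iota[of L "xp 1"] deriv_xp[of 1] by (simp add: iota_gen iota_ring over_arith mult_2_right Pp_def)
    then have "Dp (fls_const ?c * iy) = fls_const ?c * (Pp * 2)" by (simp add: Dc[OF u(3)])
    also have "\<dots> = ?P * (fls_const ?d * 2)"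
      unfolding ce mult.assoc even_mult_left[OF ev(2), of Pp] ..
    finally show ?thesis unfolding Y P M D(1) by (simp add: D(2) Dc[OF u(2)] Dp_gen)
  qed
  have sc: "superconformal (E2_0 p)"
  proof -
    have t: "even_s (?T X)" "odd_s (?T P1)" "odd_s (?T P2)" using par ty by blast+
    show ?thesis unfolding g superconformal_iff[OF t]
      using Dm DP DY unfolding g chY_def chM_def chP_def prod.case by simp
  qed
  show "E2_0 p \<in> SC2 L" by (rule SC2_I[OF typed sc l p1])
  show "lower (E2_0 p) = E1_0 p" by (rule lower_lifts[OF p1 l])
qed

theorem bij_E2_0: "bij_betw E2_0 (params L) (SC_0_carrier L)"
proof -
  have "bij_betw (lower \<circ> E2_0) (params L) (SA_0_carrier L)"
    using bij_E1_0 by (rule bij_betw_cong[THEN iffD2, rotated]) (simp add: E2_0_SC2(2))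
  then show ?thesis
    unfolding SC_0_carrier_eq using bij_betw_comp_iff2[OF bij_lower, of E2_0 "params L"] E2_0_SC2(1) by blast
qed

section \<open>The change of coordinates at infinity\<close>

definition twist :: "odd_gen set \<Rightarrow> complex \<Rightarrow> int \<Rightarrow> odd_gen \<Rightarrow> sfun" where
  "twist S z n g = (if g \<in> S then scal z * (ogen g * xp n) else ogen g)"

text \<open>A function at infinity is already a series in 1/x. Composition with I or its inverse
  therefore leaves the Laurent variable in place and only rescales the odd variables in
  \<open>S\<close>.\<close>

definition chart :: "odd_gen set \<Rightarrow> complex \<Rightarrow> int \<Rightarrow> sfun \<Rightarrow> sfun" where
  "chart S z n = subst (xp 1) (twist S z n)"

text \<open>\<open>to0\<close> is composition with $I^{-1}$, and \<open>toinf\<close> its inverse.\<close>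

abbreviation to0 :: "odd_gen set \<Rightarrow> sfun \<Rightarrow> sfun" where "to0 S \<equiv> chart S (- \<i>) (- 1)"
abbreviation toinf :: "odd_gen set \<Rightarrow> sfun \<Rightarrow> sfun" where "toinf S \<equiv> chart S \<i> 1"

lemma sum_wt_le: "(\<Sum>g\<in>S. wt {g}) \<le> 3"
proof (cases "finite S")
  case True
  then have "(\<Sum>g\<in>S. wt {g}) = wt S"
  proof (induction S rule: finite_induct)
    case (insert g S)
    then show ?case using wt_insert[of g S] by simp
  qed simp
  then show ?thesis using wt_bounds(2)[of S] by simp
qed simp

text \<open>Here the odd variables may receive values of weight -1, such as phi/x. As only three of
  them exist, a monomial loses at most a bounded weight, which is all that convergence
  requires.\<close>

lemma subst_okI_low:
  assumes "even_s u" "W 2 u" "u * w = 1" "w * u = 1" "W (-2) w"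
    "\<And>g. odd_s (v g)" "\<And>g. W (- wt {g}) (v g)"
  shows "subst_ok u v"
proof -
  have "W (-3) (gsubst v d)" for d
    by (rule W_gsubst[OF assms(7)]) (use sum_wt_le in \<open>simp add: sum_negf\<close>)
  then show ?thesis unfolding subst_ok_def using assms by blast
qed

lemma odd_s_twist: "odd_s (twist S z n g)"
  unfolding twist_def
  using odd_s_intros(4)[OF even_s_intros(6) odd_s_intros(5)[OF odd_s_intros(6) even_s_intros(7)]]
  by (simp add: odd_s_intros)

lemma W_twist:
  assumes "S \<subseteq> {Phi, Phi1, Phi2}" shows "W (wt {g} + (if g \<in> S then 2 * n else 0)) (twist S z n g)"
proof -
  have "W (0 + (wt {g} + 2 * n)) (scal z * (ogen g * xp n))" by (intro W_mult W_scal W_ogen W_xp)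
  then show ?thesis using W_ogen[of g] by (simp add: twist_def)
qed

lemma chart_ok: assumes S: "S \<subseteq> {Phi, Phi1, Phi2}" and n: "n \<ge> -1" shows "subst_ok (xp 1) (twist S z n)"
proof (rule subst_okI_low[where w = "xp (-1)"])
  fix g
  have "wt {g} = 1" if "g \<in> S" using S that by auto
  then show "W (- wt {g}) (twist S z n g)"
    using n by (intro W_mono[OF W_twist[OF S, of g n z]]) (use wt_bounds(1)[of "{g}"] in auto)
qed (use W_xp[of 1] W_xp[of "-1"] in \<open>simp_all add: even_s_intros xp_mult_xp odd_s_twist\<close>)

context
  fixes S :: "odd_gen set" and z :: complex and n :: int
  assumes S: "S \<subseteq> {Phi, Phi1, Phi2}" and n: "n \<ge> -1"
begin

lemmas ok = chart_ok[OF S n, of z]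
lemmas chart_ring = subst_add[OF ok, folded chart_def] subst_diff[OF ok, folded chart_def]
  subst_mult[OF ok, folded chart_def] subst_uminus[OF ok, folded chart_def] subst_0[OF ok, folded chart_def]
  subst_scal_mult[OF ok, folded chart_def] bounded_additive_subst[OF ok, folded chart_def]

lemma chart_gen: "chart S z n (ogen g) = twist S z n g" "chart S z n (xp m) = xp m" "chart S z n 1 = 1" "chart S z n (scal y) = scal y"
  unfolding chart_def by (simp_all add: subst_ogen[OF ok])

lemma parity_chart: "even_s f \<Longrightarrow> even_s (chart S z n f)" "odd_s f \<Longrightarrow> odd_s (chart S z n f)"
  unfolding chart_def by (rule parity_subst[OF ok]; assumption)+

lemma over_chart: "over L V f \<Longrightarrow> over L V (chart S z n f)"
  unfolding chart_def
  by (rule over_subst[OF ok]) (use S in \<open>auto simp: twist_def over_Zeta intro!: over_mult over_arith(4,5,8)\<close>)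

lemma chart_Lam: assumes "over L {} f" shows "chart S z n f = f"
proof -
  have "chart S z n f = subst (xp 1) ogen f"
    unfolding chart_def by (rule subst_cong) (use over_gens[OF assms] S in \<open>auto simp: twist_def\<close>)
  then show ?thesis by (simp add: subst_id)
qed

lemma chart_const: "c \<in> Lam L {} \<Longrightarrow> chart S z n (fls_const c) = fls_const c"
  by (rule chart_Lam[OF over_const])

lemma chart_chart:
  assumes m: "m \<ge> -1" and e: "y * z = 1" "m + n = 0" shows "chart S z n (chart S y m f) = f"
proof -
  have t: "subst (xp 1) (twist S z n) (twist S y m g) = ogen g" for g
  proof (cases "g \<in> S")
    case True
    have "scal y * (scal z * (ogen g * xp n) * xp m) = scal (y * z) * (ogen g * (xp n * xp m))"
      by (simp add: scal_mult mult.assoc)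
    then show ?thesis
      using True e by (simp add: twist_def[of S y] subst_scal_mult[OF ok] subst_ogen_mult[OF ok])
        (simp add: twist_def xp_mult_xp add.commute)
  qed (simp add: twist_def[of S y] subst_ogen[OF ok], simp add: twist_def)
  have "chart S z n (chart S y m f) = subst (subst (xp 1) (twist S z n) (xp 1)) (\<lambda>g. subst (xp 1) (twist S z n) (twist S y m g)) f"
    unfolding chart_def by (rule subst_subst[OF ok chart_ok[OF S m]]) (simp add: t subst_ok_id)
  then show ?thesis by (simp add: t subst_id)
qed

end

lemma to0_toinf: "S \<subseteq> {Phi, Phi1, Phi2} \<Longrightarrow> to0 S (toinf S f) = f" "S \<subseteq> {Phi, Phi1, Phi2} \<Longrightarrow> toinf S (to0 S f) = f"
  by (rule chart_chart; simp)+

lemma W_toinf: assumes "S \<subseteq> {Phi, Phi1, Phi2}" "W m f" shows "W m (toinf S f)"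
  unfolding chart_def
  by (rule W_subst[OF chart_ok[OF assms(1)] assms(2) W_mono[OF W_twist[OF assms(1)]]]) simp_all

text \<open>The function substituted on the left is I^{-1} composed with the function at infinity
  whose image in the chart is \<open>Y\<close> and \<open>v\<close>. The chart thus turns the
  product at infinity into plain composition; both sides are double substitutions with equal values
  on x and on every generator.\<close>

lemma to0_comp:
  assumes S: "S \<subseteq> {Phi, Phi1, Phi2}" and Y: "even_s Y" "W 2 Y" "Y * w = 1" "w * Y = 1" "W (-2) w"
    and v: "\<And>g. odd_s (v g)" "\<And>g. W (wt {g}) (v g)"
  shows "to0 S (subst (toinf S Y) (\<lambda>g. if g \<in> S then scal (- \<i>) * (toinf S (v g) * toinf S w) else toinf S (v g)) h) =
    subst Y v (to0 S h)"
proof -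
  let ?v = "\<lambda>g. if g \<in> S then scal (- \<i>) * (toinf S (v g) * toinf S w) else toinf S (v g)"
  let ?v' = "\<lambda>g. if g \<in> S then scal (- \<i>) * (v g * w) else v g"
  note r = chart_ring[OF S, of 1 \<i>] and r0 = chart_ring[OF S, of "-1" "- \<i>"]
  have e: "even_s w" by (rule even_s_inverse[OF Y(1,3,4)])
  have low: "W (- wt {g}) (if g \<in> S then scal (- \<i>) * (a * b) else a)" if "W (wt {g}) a" "W (-2) b" for g a b
  proof (cases "g \<in> S")
    case True
    then have "wt {g} = 1" using S by auto
    moreover have "W (0 + (wt {g} + -2)) (scal (- \<i>) * (a * b))" by (intro W_mult W_scal that)
    ultimately show ?thesis using True by simp
  next
    case False
    then show ?thesis using W_mono[OF that(1)] wt_bounds(1)[of "{g}"] by simp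
  qed
  have odd: "odd_s (if g \<in> S then scal (- \<i>) * (a * b) else a)" if "odd_s a" "even_s b" for g a b
    using that odd_s_intros(4)[OF even_s_intros(6) odd_s_intros(5)[OF that]] by simp
  have okY: "subst_ok (toinf S Y) ?v"
    by (rule subst_okI_low[where w = "toinf S w"])
      (use Y e v S in \<open>simp_all add: parity_chart W_toinf chart_gen odd low flip: r(3)\<close>)
  have ok': "subst_ok Y ?v'" by (rule subst_okI_low[OF Y odd[OF v(1) e] low[OF v(2) Y(5)]])
  have okv: "subst_ok Y v" by (rule subst_okI[OF Y v])
  have c0: "to0 S (toinf S Y) = Y" "to0 S (?v g) = ?v' g" for g
    using S by (simp_all add: to0_toinf r0(3,6) chart_gen)
  have c1: "subst Y v (twist S (- \<i>) (-1) g) = ?v' g" for g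
    by (simp add: twist_def subst_scal_mult[OF okv] subst_ogen_mult[OF okv] subst_ogen[OF okv] zpow_minus_1[OF Y(3,4)])
  have "to0 S (subst (toinf S Y) ?v h) = subst (to0 S (toinf S Y)) (\<lambda>g. to0 S (?v g)) h"
    unfolding chart_def[of S "- \<i>"]
    by (rule subst_subst[OF chart_ok[OF S] okY]) (use ok' c0 in \<open>simp_all add: chart_def[of S "- \<i>"]\<close>)
  also have "\<dots> = subst (subst Y v (xp 1)) (\<lambda>g. subst Y v (twist S (- \<i>) (-1) g)) h"
    unfolding c0 c1 by simp
  also have "\<dots> = subst Y v (to0 S h)"
    unfolding chart_def by (rule subst_subst[OF okv chart_ok[OF S], symmetric]) (use ok' c1 in simp_all)
  finally show ?thesis .
qed

section \<open>The groups at infinity\<close>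

abbreviation map3 :: "(sfun \<Rightarrow> sfun) \<Rightarrow> fun2 \<Rightarrow> fun2" where "map3 f \<equiv> map_prod f (map_prod f f)"

lemma series_twist:
  assumes "G \<in> series (Lam L {} \<inter> A) m" "A = grass_even \<or> A = grass_odd"
  shows "scal z * (xp n * G) \<in> series (Lam L {} \<inter> A) (n + m)"
proof -
  have o: "ord_ge (n + m) (scal z * (xp n * G))" if "ord_ge m G"
    using ord_ge_mult[OF ord_ge_xp that, of n] by (simp add: ord_ge_def)
  show ?thesis
    using assms(2)
  proof
    assume [simp]: "A = grass_even"
    show ?thesis using assms(1) o unfolding \<open>A = grass_even\<close> series_even_iff
      by (simp add: over_mult over_arith even_s_intros(4,6,7))
  next
    assume "A = grass_odd"
    show ?thesis using assms(1) o unfolding \<open>A = grass_odd\<close> series_odd_iff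
      by (simp add: over_mult over_arith even_s_intros(6,7) odd_s_intros(4))
  qed
qed

lemma chart_split:
  assumes "F \<in> series (Lam L {} \<inter> A) a" "G \<in> series (Lam L {} \<inter> B) b" "n \<ge> -1"
  shows "chart {Phi} z n (F + ogen Phi * G) = F + ogen Phi * (scal z * (xp n * G))"
proof -
  have o: "over L {} F" "over L {} G" using assms(1,2) by (auto simp: series_def over_iff)
  have "chart {Phi} z n (ogen Phi * G) = scal z * (ogen Phi * xp n) * G"
    using assms(3) by (simp add: chart_ring chart_gen chart_Lam[OF _ _ o(2)] twist_def)
  then show ?thesis
    using assms(3) by (simp add: chart_ring chart_Lam[OF _ _ o(1)] mult.assoc scal_left_commute[of "ogen Phi"])
qed

text \<open>The chart divides the coefficient of Phi by the Laurent variable, up to the factor -i,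
  so the orders 2 and 1 prescribed at infinity become the orders 1 and 0 prescribed at zero.\<close>

lemma SA_inf_carrier_iff: "f \<in> SA_inf_carrier L \<longleftrightarrow> map_prod (to0 {Phi}) (to0 {Phi}) f \<in> SA_0_carrier L"
proof
  have u: "(scal z * (xp n * H)) $$ k \<in> Lam_units L" if "z \<noteq> 0" "H \<in> series (Lam_even L) m" "H $$ (k - n) \<in> Lam_units L" for z n H k m
  proof (rule Lam_units_if_body)
    show "(scal z * (xp n * H)) $$ k \<in> Lam_even L"
      using series_twist[OF that(2), of z n] by (auto simp: series_def)
    show "gcoeff ((scal z * (xp n * H)) $$ k) {} \<noteq> 0"
      using that(1) Lam_unitsD(4)[OF that(3)] by (simp add: xp_mult_nth gcoeff_gscal)
  qed
  assume "f \<in> SA_inf_carrier L"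
  then obtain F G R H where f: "f = (F + ogen Phi * G, R + ogen Phi * H)"
    and m: "F \<in> series (Lam_even L) 1" "G \<in> series (Lam_odd L) 2" "R \<in> series (Lam_odd L) 1" "H \<in> series (Lam_even L) 1"
    and un: "F $$ 1 \<in> Lam_units L" "H $$ 1 \<in> Lam_units L"
    unfolding SA_inf_carrier_def by blast
  have "map_prod (to0 {Phi}) (to0 {Phi}) f =
      (F + ogen Phi * (scal (- \<i>) * (xp (-1) * G)), R + ogen Phi * (scal (- \<i>) * (xp (-1) * H)))"
    by (simp add: f chart_split[OF m(1,2)] chart_split[OF m(3,4)])
  moreover have "scal (- \<i>) * (xp (-1) * G) \<in> series (Lam_odd L) 1" "scal (- \<i>) * (xp (-1) * H) \<in> series (Lam_even L) 0"
    using series_twist[OF m(2), of "- \<i>" "-1"] series_twist[OF m(4), of "- \<i>" "-1"] by simp_all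
  moreover have "(scal (- \<i>) * (xp (-1) * H)) $$ 0 \<in> Lam_units L" by (rule u[OF _ m(4)]) (use un in simp_all)
  ultimately show "map_prod (to0 {Phi}) (to0 {Phi}) f \<in> SA_0_carrier L"
    unfolding SA_0_carrier_def using m un by blast
next
  have u: "(scal z * (xp n * H)) $$ k \<in> Lam_units L" if "z \<noteq> 0" "H \<in> series (Lam_even L) m" "H $$ (k - n) \<in> Lam_units L" for z n H k m
  proof (rule Lam_units_if_body)
    show "(scal z * (xp n * H)) $$ k \<in> Lam_even L"
      using series_twist[OF that(2), of z n] by (auto simp: series_def)
    show "gcoeff ((scal z * (xp n * H)) $$ k) {} \<noteq> 0"
      using that(1) Lam_unitsD(4)[OF that(3)] by (simp add: xp_mult_nth gcoeff_gscal)
  qed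
  assume "map_prod (to0 {Phi}) (to0 {Phi}) f \<in> SA_0_carrier L"
  then obtain F G R H where f: "map_prod (to0 {Phi}) (to0 {Phi}) f = (F + ogen Phi * G, R + ogen Phi * H)"
    and m: "F \<in> series (Lam_even L) 1" "G \<in> series (Lam_odd L) 1" "R \<in> series (Lam_odd L) 1" "H \<in> series (Lam_even L) 0"
    and un: "F $$ 1 \<in> Lam_units L" "H $$ 0 \<in> Lam_units L"
    unfolding SA_0_carrier_def by blast
  have "f = map_prod (toinf {Phi}) (toinf {Phi}) (map_prod (to0 {Phi}) (to0 {Phi}) f)"
    by (cases f) (simp add: to0_toinf)
  also have "\<dots> = (F + ogen Phi * (scal \<i> * (xp 1 * G)), R + ogen Phi * (scal \<i> * (xp 1 * H)))"
    by (simp add: f chart_split[OF m(1,2)] chart_split[OF m(3,4)])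
  finally have "f = (F + ogen Phi * (scal \<i> * (xp 1 * G)), R + ogen Phi * (scal \<i> * (xp 1 * H)))" .
  moreover have "scal \<i> * (xp 1 * G) \<in> series (Lam_odd L) 2" "scal \<i> * (xp 1 * H) \<in> series (Lam_even L) 1"
    using series_twist[OF m(2), of \<i> 1] series_twist[OF m(4), of \<i> 1] by simp_all
  moreover have "(scal \<i> * (xp 1 * H)) $$ 1 \<in> Lam_units L" by (rule u[OF _ m(4)]) (use un in simp_all)
  ultimately show "f \<in> SA_inf_carrier L"
    unfolding SA_inf_carrier_def using m un by blast
qed

abbreviation S2 :: "odd_gen set" where "S2 \<equiv> {Phi1, Phi2}"

lemma unit_inv_xp: "unit_inv (xp (-1) :: sfun) = xp 1"
  by (rule unit_inv_eq) (simp_all add: xp_mult_xp)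

lemma SC_inf_carrier_iff: "f \<in> SC_inf_carrier L \<longleftrightarrow> map3 (to0 S2) f \<in> SC_0_carrier L"
proof -
  obtain X P1 P2 where f: "f = (X, P1, P2)" by (cases f) auto
  have t: "(\<forall>n. X $$ n \<in> Lam2 L \<inter> grass_even \<and> P1 $$ n \<in> Lam2 L \<inter> grass_odd \<and> P2 $$ n \<in> Lam2 L \<inter> grass_odd)
      \<longleftrightarrow> typed2 L f"
    by (auto simp: f typed2_def over_iff even_s_iff odd_s_iff)
  have "ogen(Phi1 := scal (- \<i>) * ogen Phi1 * xp (-1), Phi2 := scal (- \<i>) * ogen Phi2 * xp (-1)) = twist S2 (- \<i>) (-1)"
    by (auto simp: twist_def mult.assoc)
  then have c: "comp2 At_inf f (I2_inv At_0) = map3 (to0 S2) f"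
    by (simp add: f I2_inv_def unit_inv_xp chart_def Let_def)
  have "typed2 L f" if "map3 (to0 S2) f \<in> SC_0_carrier L"
  proof -
    have "typed2 L (map3 (to0 S2) f)" using that by (simp add: SC_0_carrier_eq SC2_def good2_def)
    then have "typed2 L (map3 (toinf S2) (map3 (to0 S2) f))"
      by (simp add: f typed2_def over_chart parity_chart)
    then show ?thesis by (simp add: f to0_toinf)
  qed
  then show ?thesis using t c by (auto simp: SC_inf_carrier_def f)
qed

lemma comp1_inf:
  assumes f: "f \<in> SA_inf_carrier L" and g: "g \<in> SA_inf_carrier L"
  defines "C \<equiv> map_prod (to0 {Phi}) (to0 {Phi})"
  shows "C (comp1 At_inf f (comp1 At_0 (I1_inv At_0) g)) = comp1 At_0 (C f) (C g)"
proof -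
  obtain Y Q where CG: "C g = (Y, Q)" by (cases "C g") auto
  have "(Y, Q) \<in> SA_0_carrier L" using g unfolding SA_inf_carrier_iff CG[symmetric] C_def .
  then obtain c d where c: "c \<in> Lam_units L" "lead1 c d (Y, Q)" "typed1 L (Y, Q)" by (rule SA_0_E)
  then have Y: "even_s Y" "W 3 (Y - fls_const c * xp 1)" and Q: "odd_s Q" "W 2 (Q - fls_const d * ogen Phi)"
    by (simp_all add: typed1_def lead1_def)
  obtain w where w: "Y * w = 1" "w * Y = 1" "W (-2) w" using inverse_lead[OF c(1) Y(2)] by metis
  let ?v = "ogen(Phi := Q)"
  have WQ: "W 1 Q" by (rule W_lead_odd[OF Q(2) W_ogen_Phi(1)])
  have v: "odd_s (?v k)" "W (wt {k}) (?v k)" for k using WQ W_ogen[of k] Q(1) by (simp_all add: odd_s_intros)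
  have "g = map_prod (toinf {Phi}) (toinf {Phi}) (C g)" by (cases g) (simp add: C_def to0_toinf)
  then have g': "g = (toinf {Phi} Y, toinf {Phi} Q)" by (simp add: CG)
  have iv: "toinf {Phi} Y * toinf {Phi} w = 1" "toinf {Phi} w * toinf {Phi} Y = 1"
    using w(1,2) by (simp_all add: chart_gen flip: chart_ring(3))
  have ok: "subst_ok (toinf {Phi} Y) (ogen(Phi := toinf {Phi} Q))"
    by (rule subst_okI[OF _ _ iv])
      (use Y(1) W_lead[OF Y(2)] w(3) Q(1) WQ W_ogen in \<open>simp_all add: parity_chart W_toinf odd_s_intros\<close>)
  \<comment> \<open>Composing with I^{-1} inverts the first component; as the outer function is a
    series in 1/x, its Laurent variable is then replaced by the first component of \<open>g\<close>
    itself.\<close>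
  have 1: "comp1 At_0 (I1_inv At_0) g = (toinf {Phi} w, scal (- \<i>) * (toinf {Phi} Q * toinf {Phi} w))"
    by (simp add: I1_inv_def g' zpow_minus_1[OF iv] mult.assoc subst_scal_mult[OF ok] subst_ogen_mult[OF ok])
  have e: "(\<lambda>k. if k \<in> {Phi} then scal (- \<i>) * (toinf {Phi} (?v k) * toinf {Phi} w) else toinf {Phi} (?v k)) =
      ogen(Phi := scal (- \<i>) * (toinf {Phi} Q * toinf {Phi} w))"
    by (auto simp: chart_gen twist_def)
  have t: "to0 {Phi} (subst (toinf {Phi} Y) (ogen(Phi := scal (- \<i>) * (toinf {Phi} Q * toinf {Phi} w))) h) =
      subst Y ?v (to0 {Phi} h)" for h
    by (rule to0_comp[OF _ Y(1) W_lead[OF Y(2)] w v, of "{Phi}", unfolded e]) simp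
  show ?thesis
    unfolding 1 unfolding comp1_At_0 CG by (cases f) (simp add: C_def unit_inv_eq[OF iv(2,1)] sub1_def t Let_def)
qed

lemma comp2_inf:
  assumes f: "f \<in> SC_inf_carrier L" and g: "g \<in> SC_inf_carrier L"
  defines "C \<equiv> map3 (to0 S2)"
  shows "C (comp2 At_inf f (comp2 At_0 (I2_inv At_0) g)) = comp2 At_0 (C f) (C g)"
proof -
  obtain Y Q R where CG: "C g = (Y, Q, R)" by (cases "C g") auto
  have "(Y, Q, R) \<in> SC2 L" using g unfolding SC_inf_carrier_iff SC_0_carrier_eq CG[symmetric] C_def .
  then have Y: "even_s Y" "W 2 Y" and Q: "odd_s Q" "odd_s R" "W 1 Q" "W 1 R"
    and "\<exists>w. Y * w = 1 \<and> w * Y = 1 \<and> W (-2) w"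
    by (auto simp: SC2_def good2_def typed2_def)
  then obtain w where w: "Y * w = 1" "w * Y = 1" "W (-2) w" by blast
  let ?v = "ogen(Phi1 := Q, Phi2 := R)"
  have v: "odd_s (?v k)" "W (wt {k}) (?v k)" for k using Q W_ogen[of k] by (simp_all add: odd_s_intros)
  have "g = map3 (toinf S2) (C g)" by (cases g) (simp add: C_def to0_toinf)
  then have g': "g = (toinf S2 Y, toinf S2 Q, toinf S2 R)" by (simp add: CG)
  have iv: "toinf S2 Y * toinf S2 w = 1" "toinf S2 w * toinf S2 Y = 1"
    using w(1,2) by (simp_all add: chart_gen flip: chart_ring(3))
  have ok: "subst_ok (toinf S2 Y) (ogen(Phi1 := toinf S2 Q, Phi2 := toinf S2 R))"
    by (rule subst_okI[OF _ _ iv])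
      (use Y Q w(3) W_ogen in \<open>simp_all add: parity_chart W_toinf odd_s_intros\<close>)
  have 1: "comp2 At_0 (I2_inv At_0) g = (toinf S2 w, scal (- \<i>) * (toinf S2 Q * toinf S2 w), scal (- \<i>) * (toinf S2 R * toinf S2 w))"
    by (simp add: I2_inv_def g' zpow_minus_1[OF iv] mult.assoc subst_scal_mult[OF ok] subst_ogen_mult[OF ok])
  have e: "(\<lambda>k. if k \<in> S2 then scal (- \<i>) * (toinf S2 (?v k) * toinf S2 w) else toinf S2 (?v k)) =
      ogen(Phi1 := scal (- \<i>) * (toinf S2 Q * toinf S2 w), Phi2 := scal (- \<i>) * (toinf S2 R * toinf S2 w))"
    by (auto simp: chart_gen twist_def)
  have t: "to0 S2 (subst (toinf S2 Y) (ogen(Phi1 := scal (- \<i>) * (toinf S2 Q * toinf S2 w),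
      Phi2 := scal (- \<i>) * (toinf S2 R * toinf S2 w))) h) = subst Y ?v (to0 S2 h)" for h
    by (rule to0_comp[OF _ Y w v, of S2, unfolded e]) simp
  show ?thesis
    unfolding 1 unfolding comp2_At_0 CG by (cases f) (simp add: C_def unit_inv_eq[OF iv(2,1)] sub2_def t Let_def)
qed

lemma I_inf: "map_prod (toinf {Phi}) (toinf {Phi}) (id1 At_0) = I1 At_inf" "map3 (toinf S2) (id2 At_0) = I2 At_inf"
  by (simp_all add: id1_def id2_def I1_def I2_def chart_gen twist_def mult.assoc)

lemma bij_chart_1: "bij_betw (map_prod (to0 {Phi}) (to0 {Phi})) (SA_inf_carrier L) (SA_0_carrier L)"
  by (rule bij_betw_byWitness[where f' = "map_prod (toinf {Phi}) (toinf {Phi})"])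
    (auto simp: to0_toinf SA_inf_carrier_iff)

lemma bij_chart_2: "bij_betw (map3 (to0 S2)) (SC_inf_carrier L) (SC_0_carrier L)"
  by (rule bij_betw_byWitness[where f' = "map3 (toinf S2)"]) (auto simp: to0_toinf SC_inf_carrier_iff)

theorem SA_inf_SA_0: "group (SA_inf L)" "SA_inf L \<cong> SA_0 L"
proof -
  let ?C = "map_prod (to0 {Phi}) (to0 {Phi})"
  have b: "bij_betw ?C (carrier (SA_inf L)) (carrier (SA_0 L))"
    using bij_chart_1 by (simp add: SA_inf_def SA_0_def)
  have i: "?C (I1 At_inf) = id1 At_0" unfolding I_inf(1)[symmetric] by (simp add: id1_def to0_toinf)
  have cl: "comp1 At_inf f (comp1 At_0 (I1_inv At_0) g) \<in> SA_inf_carrier L"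
    if "f \<in> SA_inf_carrier L" "g \<in> SA_inf_carrier L" for f g
    using SA_0_closed that comp1_inf[OF that] unfolding SA_inf_carrier_iff by simp
  show "group (SA_inf L)" "SA_inf L \<cong> SA_0 L"
    by (rule group_transport[OF group_SA_0 b];
        simp add: SA_inf_def SA_0_def cl comp1_inf i SA_inf_carrier_iff id2_SC2(3) SA_0_closed)+
qed

theorem SC_inf_SC_0: "group (SC_inf L)" "SC_inf L \<cong> SC_0 L"
proof -
  let ?C = "map3 (to0 S2)"
  have b: "bij_betw ?C (carrier (SC_inf L)) (carrier (SC_0 L))"
    using bij_chart_2 by (simp add: SC_inf_def SC_0_def)
  have i: "?C (I2 At_inf) = id2 At_0" unfolding I_inf(2)[symmetric] by (simp add: id2_def to0_toinf)
  have cl: "comp2 At_inf f (comp2 At_0 (I2_inv At_0) g) \<in> SC_inf_carrier L"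
    if "f \<in> SC_inf_carrier L" "g \<in> SC_inf_carrier L" for f g
    using SC2_closed that comp2_inf[OF that] unfolding SC_inf_carrier_iff SC_0_carrier_eq by simp
  show "group (SC_inf L)" "SC_inf L \<cong> SC_0 L"
    by (rule group_transport[OF SC_0_SA_0(1) b];
        simp add: SC_inf_def SC_0_def cl comp2_inf i SC_inf_carrier_iff SC_0_carrier_eq id2_SC2(1) SC2_closed)+
qed

section \<open>The derivations at infinity\<close>

lemma to0_chain:
  assumes S: "S = {Phi} \<or> S = S2"
  defines "E \<equiv> \<lambda>k. \<Sum>g\<in>S. ogen g * d_odd g k"
  shows "g \<in> S \<Longrightarrow> to0 S (d_odd g h) = ii * (xp 1 * d_odd g (to0 S h))"
    "to0 S (d_x At_inf h) = - (xp 2 * fls_deriv (to0 S h) + xp 1 * E (to0 S h))"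
    "g \<in> S \<Longrightarrow> to0 S (ogen g) = - (ii * (xp (-1) * ogen g))" "to0 S ii = ii"
proof -
  have sub: "S \<subseteq> {Phi, Phi1, Phi2}" using S by auto
  let ?t = "twist S (- \<i>) (-1)"
  note ok = chart_ok[OF sub, of "-1" "- \<i>"]
  have zeta: "?t (Zeta k) = ogen (Zeta k)" for k using S by (auto simp: twist_def)
  have t: "?t g = - (ii * (xp (-1) * ogen g))" if "g \<in> S" for g
    using that xp_commute[of "ogen g" "-1"] by (simp add: twist_def scal_minus ii_def)
  have t': "?t g = ogen g" if "g \<notin> S" for g using that by (simp add: twist_def)
  show 3: "to0 S (ogen g) = - (ii * (xp (-1) * ogen g))" if "g \<in> S" for g
    using chart_gen(1)[OF sub] t[OF that] by simp
  show "to0 S ii = ii" using chart_gen(4)[OF sub] by (simp add: ii_def)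
  note c = chain_rule[OF _ ok zeta, folded chart_def]
  have xc: "x * xp n = xp n * x" for x :: sfun and n by (rule xp_commute)
  have dx: "d_odd g (xp n) = 0" for g n by (rule fls_eqI) (simp add: xp_nth)
  have dt: "d_odd g (?t k) = (if g = k then (if k \<in> S then - (ii * xp (-1)) else 1) else 0)" for g k
    by (cases "k \<in> S") (simp_all add: t t' d_odd_mult d_odd_ogen dx even_s_intros(7)[unfolded even_s_def])
  \<comment> \<open>The value substituted for an odd variable depends on x, so differentiating in x
    produces a further term; this is the origin of the Euler operator \<open>E\<close>.\<close>
  have ft: "fls_deriv (?t k) = (if k \<in> S then ii * (xp (-2) * ogen k) else 0)" for k
  proof (cases "k \<in> S")
    case True
    have "fls_deriv (xp (-1) :: sfun) = - xp (-2)" using deriv_xp[of "-1"] by (simp add: scal_minus)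
    then show ?thesis using True by (simp add: t deriv_mult del: fls_deriv_mult)
  qed (simp add: t')
  have 1: "to0 S (d_odd g h) = ii * (xp 1 * d_odd g (to0 S h))" if g: "g \<in> S" for g h
  proof -
    have "d_odd g (to0 S h) = - (ii * (xp (-1) * to0 S (d_odd g h)))"
      using c[OF sder_d_odd, of g h] g S by (auto simp: dt dx mult.assoc)
    then show ?thesis by (simp add: ii_left) (simp add: xp_mult_xp flip: mult.assoc)
  qed
  then show "g \<in> S \<Longrightarrow> to0 S (d_odd g h) = ii * (xp 1 * d_odd g (to0 S h))" .
  have "fls_deriv (to0 S h) = to0 S (fls_deriv h) + (\<Sum>g\<in>S. ii * (xp (-2) * ogen g) * to0 S (d_odd g h))"
    using c[OF sder_deriv, of h] deriv_xp[of 1] S by (auto simp: ft)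
  also have "(\<Sum>g\<in>S. ii * (xp (-2) * ogen g) * to0 S (d_odd g h)) = (\<Sum>g\<in>S. - (xp (-1) * (ogen g * d_odd g (to0 S h))))"
  proof (rule sum.cong[OF refl])
    fix g assume "g \<in> S"
    have "ogen g * (xp 1 * k) = xp 1 * (ogen g * k)" for k using xc[of "ogen g" 1] by (simp flip: mult.assoc)
    then have "ii * (xp (-2) * ogen g) * (ii * (xp 1 * k)) = - (xp (-2) * (xp 1 * (ogen g * k)))" for k
      by (simp add: mult.assoc ii_left)
    then show "ii * (xp (-2) * ogen g) * to0 S (d_odd g h) = - (xp (-1) * (ogen g * d_odd g (to0 S h)))"
      unfolding 1[OF \<open>g \<in> S\<close>] by (simp add: xp_mult_xp flip: mult.assoc)
  qed
  also have "\<dots> = - (xp (-1) * E (to0 S h))" by (simp add: E_def sum_distrib_left sum_negf)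
  finally have "to0 S (fls_deriv h) = fls_deriv (to0 S h) + xp (-1) * E (to0 S h)" by simp
  moreover have "to0 S (d_x At_inf h) = - (xp 2 * to0 S (fls_deriv h))"
    by (simp add: chart_ring[OF sub] chart_gen[OF sub] flip: xp_def)
  ultimately show "to0 S (d_x At_inf h) = - (xp 2 * fls_deriv (to0 S h) + xp 1 * E (to0 S h))"
    by (simp add: distrib_left xp_mult_xp flip: mult.assoc)
qed

lemma xp_left: "ogen g * (xp n * h) = xp n * (ogen g * h)" "scal z * (xp n * h) = xp n * (scal z * h)"
  "xp m * (xp n * h) = xp (m + n) * h" "ogen g * (scal z * h) = scal z * (ogen g * h)"
  using xp_commute[of "ogen g" n] xp_commute[of "scal z" n] scal_left_commute[of "ogen g" z h]
  by (simp_all add: xp_mult_xp flip: mult.assoc)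

text \<open>Replacing n by -n in L, or by 1 - n in G, leaves an extra 1 in the coefficient, which
  cancels against the Euler operator of \<open>to0_chain\<close>.\<close>

lemma scal_index: "scal ((of_int (- n) + 1) / 2) = 1 - scal ((of_int n + 1) / 2)" "scal (of_int (1 - n)) = 1 - scal (of_int n)"
proof -
  have "(of_int (- n) + 1) / 2 = 1 - (of_int n + 1) / (2 :: complex)" by (simp add: field_simps)
  then show "scal ((of_int (- n) + 1) / 2) = 1 - scal ((of_int n + 1) / 2)" by (simp only: scal_diff scal_1)
  show "scal (of_int (1 - n)) = 1 - scal (of_int n)" by (simp add: scal_diff)
qed

lemma to0_N1:
  "to0 {Phi} (N1_L At_inf (- n) h) = - N1_L At_0 n (to0 {Phi} h)"
  "to0 {Phi} (N1_J At_inf (- n) h) = N1_J At_0 n (to0 {Phi} h)"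
  "to0 {Phi} (N1_G j At_inf (1 - n) h) = ii * N1_G j At_0 n (to0 {Phi} h)"
proof -
  have S: "{Phi} = {Phi} \<or> {Phi} = S2" and sub: "{Phi} \<subseteq> {Phi, Phi1, Phi2}" by auto
  note r = chart_ring[OF sub, of "-1" "- \<i>"] chart_gen(2,3,4)[OF sub, of "-1" "- \<i>"]
  note c = to0_chain(1,3)[OF S, of Phi] to0_chain(2,4)[OF S]
  define \<sigma> where "\<sigma> = scal ((of_int n + 1) / 2)"
  have s: "h * (\<sigma> * k) = \<sigma> * (h * k)" for h k unfolding \<sigma>_def by (rule scal_left_commute)
  define k where "k = to0 {Phi} h"
  have rs: "to0 {Phi} \<sigma> = \<sigma>" unfolding \<sigma>_def by (simp add: r)
  show "to0 {Phi} (N1_L At_inf (- n) h) = - N1_L At_0 n (to0 {Phi} h)"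
    unfolding N1_L_def xpow_xp scal_index \<sigma>_def[symmetric] d_x.simps(1)
    by (simp add: r rs c mult.assoc left_diff_distrib xp_left ii_left algebra_simps s[of "xp _"] s[of "ogen _"] del: d_x.simps
        flip: \<sigma>_def) 
  show "to0 {Phi} (N1_J At_inf (- n) h) = N1_J At_0 n (to0 {Phi} h)"
    unfolding N1_J_def xpow_xp by (simp add: r c mult.assoc xp_left ii_left)
  define \<tau> \<upsilon> where "\<tau> = scal ((- \<i>) ^ (j + 1))" "\<upsilon> = scal ((- 1) ^ j)"
  have s': "h * (\<tau> * k) = \<tau> * (h * k)" "h * (\<upsilon> * k) = \<upsilon> * (h * k)" for h k unfolding \<tau>_\<upsilon>_def by (rule scal_left_commute)+
  have r': "to0 {Phi} \<tau> = \<tau>" "to0 {Phi} \<upsilon> = \<upsilon>" unfolding \<tau>_\<upsilon>_def by (simp_all add: r)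
  show "to0 {Phi} (N1_G j At_inf (1 - n) h) = ii * N1_G j At_0 n (to0 {Phi} h)"
    unfolding N1_G_def xpow_xp d_x.simps(1) \<tau>_\<upsilon>_def[symmetric]
    by (simp add: r r' c s'(1)[of \<upsilon>] mult.assoc xp_left ii_left algebra_simps s'[of "xp _"] s'[of "ogen _"] del: d_x.simps)
qed

lemma to0_N2:
  "to0 S2 (N2_L At_inf (- n) h) = - N2_L At_0 n (to0 S2 h)"
  "to0 S2 (N2_J At_inf (- n) h) = N2_J At_0 n (to0 S2 h)"
  "to0 S2 (N2_G1 At_inf (1 - n) h) = ii * N2_G1 At_0 n (to0 S2 h)"
  "to0 S2 (N2_G2 At_inf (1 - n) h) = ii * N2_G2 At_0 n (to0 S2 h)"
proof -
  have S: "S2 = {Phi} \<or> S2 = S2" and sub: "S2 \<subseteq> {Phi, Phi1, Phi2}" by auto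
  note r = chart_ring[OF sub, of "-1" "- \<i>"] chart_gen(2,3,4)[OF sub, of "-1" "- \<i>"]
  note c = to0_chain(1,3)[OF S, of Phi1] to0_chain(1,3)[OF S, of Phi2] to0_chain(2,4)[OF S]
  define \<sigma> where "\<sigma> = scal ((of_int n + 1) / 2)"
  have s: "h * (\<sigma> * k) = \<sigma> * (h * k)" for h k unfolding \<sigma>_def by (rule scal_left_commute)
  have rs: "to0 S2 \<sigma> = \<sigma>" unfolding \<sigma>_def by (simp add: r)
  show "to0 S2 (N2_L At_inf (- n) h) = - N2_L At_0 n (to0 S2 h)"
    unfolding N2_L_def xpow_xp scal_index \<sigma>_def[symmetric] d_x.simps(1)
    by (simp add: r rs c mult.assoc left_diff_distrib xp_left ii_left algebra_simps s[of "xp _"] s[of "ogen _"] del: d_x.simps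
        flip: \<sigma>_def)
  show "to0 S2 (N2_J At_inf (- n) h) = N2_J At_0 n (to0 S2 h)"
    unfolding N2_J_def xpow_xp ii_def[symmetric] by (simp add: r c mult.assoc xp_left ii_left right_diff_distrib)
  define \<tau> where "\<tau> = scal (of_int n)"
  have s': "h * (\<tau> * k) = \<tau> * (h * k)" for h k unfolding \<tau>_def by (rule scal_left_commute)
  have r': "to0 S2 \<tau> = \<tau>" unfolding \<tau>_def by (simp add: r)
  have n1: "1 - n - 1 = - n" by simp
  show "to0 S2 (N2_G1 At_inf (1 - n) h) = ii * N2_G1 At_0 n (to0 S2 h)"
    unfolding N2_G1_def xpow_xp n1 d_x.simps(1) scal_index \<tau>_def[symmetric]
    by (simp add: r r' c mult.assoc left_diff_distrib xp_left ii_left algebra_simps phi_order s'[of "xp _"] s'[of "ogen _"] del: d_x.simps)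
  show "to0 S2 (N2_G2 At_inf (1 - n) h) = ii * N2_G2 At_0 n (to0 S2 h)"
    unfolding N2_G2_def xpow_xp n1 d_x.simps(1) scal_index \<tau>_def[symmetric]
    by (simp add: r r' c mult.assoc left_diff_distrib xp_left ii_left algebra_simps phi_order s'[of "xp _"] s'[of "ogen _"] del: d_x.simps)
qed

definition gen_inf :: "ops \<Rightarrow> ops \<Rightarrow> ops \<Rightarrow> ops \<Rightarrow> seqs \<Rightarrow> sfun \<Rightarrow> nat \<Rightarrow> sfun" where
  "gen_inf L J G1 G2 s h n = (case s of (A1, A2, M1, M2) \<Rightarrow>
     fls_const (A1 n) * L (- int n) h - fls_const (A2 n) * J (- int n) h
       + scal \<i> * fls_const (M1 n) * G1 (1 - int n) h + scal \<i> * fls_const (M2 n) * G2 (1 - int n) h)"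

lemma E_op_inf_gen:
  "E_op_inf L J G1 G2 s (a1, a2) f =
     exp_op (\<lambda>h. \<Sum>\<^sub>\<infinity>n\<in>{1..}. gen_inf L J G1 G2 s h n)
       (pow_op a1 (\<lambda>h. 2 * L 0 h) (pow_op a2 (\<lambda>h. - J 0 h) f))"
  by (cases s) (simp add: gen_inf_def)

text \<open>The operator families are kept abstract so that N = 1 and N = 2 share the proof. The
  coefficients 1, -1, i, i in the exponent at infinity turn the signs in \<open>op\<close> into a
  common minus sign, so the chart conjugates the operator at infinity to \<open>T\<close>.\<close>

lemma E_op_inf_conj:
  assumes S: "S \<subseteq> {Phi, Phi1, Phi2}" and s: "s \<in> seqs L"
    and op: "\<And>n h. to0 S (L' (- n) h) = - L0 n (to0 S h)" "\<And>n h. to0 S (J' (- n) h) = J0 n (to0 S h)"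
      "\<And>n h. to0 S (G1' (1 - n) h) = ii * G1 n (to0 S h)" "\<And>n h. to0 S (G2' (1 - n) h) = ii * G2 n (to0 S h)"
    and T: "raising T" "\<And>h. (gen_0 L0 J0 G1 G2 s h has_sum - T h) {1..}"
  shows "exp_op (\<lambda>h. \<Sum>\<^sub>\<infinity>n\<in>{1..}. gen_inf L' J' G1' G2' s h n) (toinf S f) = toinf S (exp_op T f)"
    "2 * L' 0 (toinf S f) = toinf S (- 2 * L0 0 f)" "- J' 0 (toinf S f) = toinf S (- J0 0 f)"
proof -
  obtain A1 A2 M1 M2 where s': "s = (A1, A2, M1, M2)" by (cases s) auto
  note r0 = chart_ring[OF S, of "-1" "- \<i>"] and ri = chart_ring[OF S, of 1 \<i>]
  have c: "to0 S (fls_const (A1 n)) = fls_const (A1 n)" "to0 S (fls_const (A2 n)) = fls_const (A2 n)"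
    "to0 S (fls_const (M1 n)) = fls_const (M1 n)" "to0 S (fls_const (M2 n)) = fls_const (M2 n)" if "n \<in> {1..}" for n
    using s that chart_const[OF S, of "-1"] unfolding s' seqs_def by (auto simp: PiE_def Pi_def)
  have g: "gen_inf L' J' G1' G2' s h n = - toinf S (gen_0 L0 J0 G1 G2 s (to0 S h) n)" if n: "n \<in> {1..}" for h n
  proof -
    have "to0 S (gen_inf L' J' G1' G2' s h n) = - gen_0 L0 J0 G1 G2 s (to0 S h) n"
      unfolding gen_inf_def gen_0_def s' prod.case
      using chart_gen(4)[OF S, of "-1" "- \<i>" \<i>]
      by (simp add: r0 c[OF n] op mult.assoc ii_left flip: ii_def)
    then have "toinf S (to0 S (gen_inf L' J' G1' G2' s h n)) = - toinf S (gen_0 L0 J0 G1 G2 s (to0 S h) n)"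
      by (simp add: ri)
    then show ?thesis by (simp add: to0_toinf(2)[OF S])
  qed
  have V: "(\<Sum>\<^sub>\<infinity>n\<in>{1..}. gen_inf L' J' G1' G2' s h n) = toinf S (T (to0 S h))" for h
  proof (rule infsumI)
    have "((\<lambda>n. - toinf S (gen_0 L0 J0 G1 G2 s (to0 S h) n)) has_sum - toinf S (- T (to0 S h))) {1..}"
      by (rule bounded_additive_has_sum[OF bounded_additive_uminus[OF ri(7)] T(2)]) simp
    then have "((\<lambda>n. - toinf S (gen_0 L0 J0 G1 G2 s (to0 S h) n)) has_sum toinf S (T (to0 S h))) {1..}"
      by (simp add: ri)
    then show "(gen_inf L' J' G1' G2' s h has_sum toinf S (T (to0 S h))) {1..}"
      by (rule has_sum_cong[THEN iffD1, rotated]) (simp add: g)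
  qed
  show "exp_op (\<lambda>h. \<Sum>\<^sub>\<infinity>n\<in>{1..}. gen_inf L' J' G1' G2' s h n) (toinf S f) = toinf S (exp_op T f)"
    unfolding V
    by (rule exp_op_intertwine[where P = "\<lambda>_. True" and A = "toinf S", OF T(1)])
      (simp_all add: ri to0_toinf(1)[OF S] chart_gen(4)[OF S, of 1 \<i>])
  have e: "h = toinf S k" if "to0 S h = k" for h k using that to0_toinf(2)[OF S, of h] by simp
  show "2 * L' 0 (toinf S f) = toinf S (- 2 * L0 0 f)"
    by (rule e) (use op(1)[of 0] in \<open>simp add: mult_2 r0 to0_toinf(1)[OF S]\<close>)
  show "- J' 0 (toinf S f) = toinf S (- J0 0 f)"
    by (rule e) (use op(2)[of 0] in \<open>simp add: r0 to0_toinf(1)[OF S]\<close>)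
qed

lemma the_elem_map_pair: "f x = f y \<Longrightarrow> the_elem ((\<lambda>a. g (f a)) ` {x, y}) = g (the_elem (f ` {x, y}))"
  by simp

lemma E1_inf_conj:
  assumes p: "p \<in> params L" shows "E1_inf p = map_prod (toinf {Phi}) (toinf {Phi}) (E1_0 p)"
proof -
  obtain a1 a2 s where p': "p = ({(a1, a2), (- a1, - a2)}, s)" and s: "s \<in> seqs L"
    and a: "a1 \<in> Lam_units L" "a2 \<in> Lam_units L" using p by (rule params_E)
  have S: "{Phi} \<subseteq> {Phi, Phi1, Phi2}" by simp
  let ?E = "\<lambda>a. E_op_0 (N1_L At_0) (N1_J At_0) (N1_G 1 At_0) (N1_G 2 At_0) s a"
    and ?F = "\<lambda>a. E_op_inf (N1_L At_inf) (N1_J At_inf) (N1_G 1 At_inf) (N1_G 2 At_inf) s a"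
  note cj = E_op_inf_conj[OF S s to0_N1(1,2,3,3) vfieldsD(1)[OF vf1_vfields[OF s]] gen_0_N1[OF s]]
  note ri = chart_ring[OF S, of 1 \<i>]
  have *: "?F (b1, b2) (toinf {Phi} f) = toinf {Phi} (?E (b1, b2) f)"
    if b: "b1 \<in> Lam_units L" "b2 \<in> Lam_units L" and f: "f = xp 1 \<or> f = ogen Phi" for b1 b2 f
  proof -
    have cc: "toinf {Phi} (fls_const c * h) = fls_const c * toinf {Phi} h" if "c \<in> Lam_units L" for c h
      using ri(3) chart_const[OF S _ Lam_unitsD(2)[OF that]] by simp
    note pw = pow_op_N1[OF b coeffwise_N1(3,1), of "toinf {Phi}", OF cj(2,3) ri(6) cc]
    show ?thesis
      using f by (elim disjE) (simp_all only: E_op_inf_gen pw cj(1) E_op_0_N1[OF s b])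
  qed
  have neg: "- a1 \<in> Lam_units L" "- a2 \<in> Lam_units L" by (rule Lam_units_minus[OF a(1)] Lam_units_minus[OF a(2)])+
  let ?m = "\<lambda>a. map_prod (?E a) (?E a) (id1 At_0)"
  have G: "map_prod (?F b) (?F b) (I1 At_inf) = map_prod (toinf {Phi}) (toinf {Phi}) (?m b)"
    if bm: "b \<in> {(a1, a2), (- a1, - a2)}" for b
  proof -
    obtain b1 b2 where b: "b = (b1, b2)" "b1 \<in> Lam_units L" "b2 \<in> Lam_units L" using bm a neg by blast
    show ?thesis
      unfolding b(1) I_inf(1)[symmetric] id1_def xpow_xp map_prod_simp
      by (simp only: *[OF b(2,3) disjI1[OF refl]] *[OF b(2,3) disjI2[OF refl]])
  qed
  \<comment> \<open>Both representatives give the same value, so \<open>the_elem\<close> commutes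
    with the chart.\<close>
  have eq: "?m (a1, a2) = ?m (- a1, - a2)"
    unfolding id1_def xpow_xp map_prod_simp E_op_0_N1[OF s a] E_op_0_N1[OF s neg] unit_inv_minus[OF a(2)]
      minus_mult_minus ..
  have "E1_inf p = the_elem ((\<lambda>b. map_prod (toinf {Phi}) (toinf {Phi}) (?m b)) ` {(a1, a2), (- a1, - a2)})"
    unfolding E1_inf_def p' prod.case Let_def by (rule arg_cong[where f = the_elem], rule image_cong[OF refl G])
  also have "\<dots> = map_prod (toinf {Phi}) (toinf {Phi}) (E1_0 p)"
    unfolding E1_0_def p' prod.case Let_def
    by (rule the_elem_map_pair[where f = ?m and g = "map_prod (toinf {Phi}) (toinf {Phi})", OF eq])
  finally show ?thesis .
qed

lemma E2_inf_conj:
  assumes p: "p \<in> params L" shows "E2_inf p = map3 (toinf S2) (E2_0 p)"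
proof -
  obtain a1 a2 s where p': "p = ({(a1, a2), (- a1, - a2)}, s)" and s: "s \<in> seqs L"
    and a: "a1 \<in> Lam_units L" "a2 \<in> Lam_units L" using p by (rule params_E)
  have S: "S2 \<subseteq> {Phi, Phi1, Phi2}" by simp
  let ?E = "\<lambda>a. E_op_0 (N2_L At_0) (N2_J At_0) (N2_G1 At_0) (N2_G2 At_0) s a"
    and ?F = "\<lambda>a. E_op_inf (N2_L At_inf) (N2_J At_inf) (N2_G1 At_inf) (N2_G2 At_inf) s a"
  note cj = E_op_inf_conj[OF S s to0_N2 vop2_props(1)[OF s] gen_0_N2[OF s]]
  note ri = chart_ring[OF S, of 1 \<i>]
  have *: "?F (b1, b2) (toinf S2 f) = toinf S2 (?E (b1, b2) f)"
    if b: "b1 \<in> Lam_units L" "b2 \<in> Lam_units L" and f: "f = xp 1 \<or> f = ogen Phi1 \<or> f = ogen Phi2" for b1 b2 f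
  proof -
    have cc: "toinf S2 (fls_const c * h) = fls_const c * toinf S2 h" if "c \<in> Lam_units L" for c h
      using ri(3) chart_const[OF S _ Lam_unitsD(2)[OF that]] by simp
    note pw = pow_op_N2[OF b coeffwise_N2(3,1), of "toinf S2", OF cj(2,3) ri(6) cc ri(1)]
    show ?thesis
      using f by (elim disjE) (simp_all only: E_op_inf_gen pw cj(1) E_op_0_N2[OF s b])
  qed
  have neg: "- a1 \<in> Lam_units L" "- a2 \<in> Lam_units L" by (rule Lam_units_minus[OF a(1)] Lam_units_minus[OF a(2)])+
  let ?m = "\<lambda>a. map3 (?E a) (id2 At_0)"
  have G: "map3 (?F b) (I2 At_inf) = map3 (toinf S2) (?m b)"
    if bm: "b \<in> {(a1, a2), (- a1, - a2)}" for b
  proof -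
    obtain b1 b2 where b: "b = (b1, b2)" "b1 \<in> Lam_units L" "b2 \<in> Lam_units L" using bm a neg by blast
    show ?thesis
      unfolding b(1) I_inf(2)[symmetric] id2_def xpow_xp map_prod_simp
      by (simp only: *[OF b(2,3) disjI1[OF refl]] *[OF b(2,3) disjI2[OF disjI1[OF refl]]] *[OF b(2,3) disjI2[OF disjI2[OF refl]]])
  qed
  have eq: "?m (a1, a2) = ?m (- a1, - a2)"
    unfolding id2_def xpow_xp map_prod_simp E_op_0_N2[OF s a] E_op_0_N2[OF s neg] unit_inv_minus[OF a(2)]
      minus_mult_minus ..
  have "E2_inf p = the_elem ((\<lambda>b. map3 (toinf S2) (?m b)) ` {(a1, a2), (- a1, - a2)})"
    unfolding E2_inf_def p' prod.case Let_def by (rule arg_cong[where f = the_elem], rule image_cong[OF refl G])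
  also have "\<dots> = map3 (toinf S2) (E2_0 p)"
    unfolding E2_0_def p' prod.case Let_def
    by (rule the_elem_map_pair[where f = ?m and g = "map3 (toinf S2)", OF eq])
  finally show ?thesis .
qed

section \<open>Bijectivity at infinity and the isomorphisms\<close>

lemma bij_betw_cancel_left:
  assumes h: "bij_betw h B C" and hf: "bij_betw (\<lambda>x. h (f x)) A C" and f: "f ` A \<subseteq> B"
  shows "bij_betw f A B"
  using bij_betw_comp_iff2[OF h f] hf by (simp add: o_def)

theorem bij_E1_inf: "bij_betw E1_inf (params L) (SA_inf_carrier L)"
proof (rule bij_betw_cancel_left[OF bij_chart_1])
  have e: "map_prod (to0 {Phi}) (to0 {Phi}) (E1_inf p) = E1_0 p" if "p \<in> params L" for p
    by (cases "E1_0 p") (simp add: E1_inf_conj[OF that] to0_toinf)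
  show "bij_betw (\<lambda>p. map_prod (to0 {Phi}) (to0 {Phi}) (E1_inf p)) (params L) (SA_0_carrier L)"
    using bij_E1_0 by (rule bij_betw_cong[THEN iffD2, rotated]) (rule e)
  show "E1_inf ` params L \<subseteq> SA_inf_carrier L"
    using bij_betwE[OF bij_E1_0, of L] by (intro image_subsetI) (simp add: SA_inf_carrier_iff e)
qed

theorem bij_E2_inf: "bij_betw E2_inf (params L) (SC_inf_carrier L)"
proof (rule bij_betw_cancel_left[OF bij_chart_2])
  have e: "map3 (to0 S2) (E2_inf p) = E2_0 p" if "p \<in> params L" for p
    by (cases "E2_0 p") (simp add: E2_inf_conj[OF that] to0_toinf)
  show "bij_betw (\<lambda>p. map3 (to0 S2) (E2_inf p)) (params L) (SC_0_carrier L)"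
    using bij_E2_0 by (rule bij_betw_cong[THEN iffD2, rotated]) (rule e)
  show "E2_inf ` params L \<subseteq> SC_inf_carrier L"
    using bij_betwE[OF bij_E2_0, of L] by (intro image_subsetI) (simp add: SC_inf_carrier_iff e)
qed

text \<open>The reversal of the factors in \<open>pulled_back\<close> is compensated by inversion.\<close>

lemma pulled_back_group:
  assumes H: "group H" and b: "bij_betw E P (carrier H)"
  shows "group (pulled_back P E H)" "pulled_back P E H \<cong> H"
proof -
  interpret H: group H by fact
  have E: "E g \<in> carrier H" if "g \<in> P" for g using b that by (auto simp: bij_betw_def)
  have i: "inv_into P E x \<in> P" "E (inv_into P E x) = x" if "x \<in> carrier H" for x
    using b that by (auto simp: bij_betw_def inv_into_into f_inv_into_f)
  have "bij_betw (\<lambda>x. inv\<^bsub>H\<^esub> x) (carrier H) (carrier H)"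
    by (rule bij_betw_byWitness[where f' = "\<lambda>x. inv\<^bsub>H\<^esub> x"]) auto
  from bij_betw_trans[OF b this]
  have "bij_betw (\<lambda>g. inv\<^bsub>H\<^esub> (E g)) (carrier (pulled_back P E H)) (carrier H)"
    by (simp add: pulled_back_def o_def)
  note t = group_transport[OF H this]
  show "group (pulled_back P E H)" "pulled_back P E H \<cong> H"
    by (rule t; simp add: pulled_back_def E i H.inv_mult_group)+
qed

theorem theorem6p24:
  fixes L :: enat
  shows "group (param_group_0 L) \<and> group (param_group_0' L) \<and>
           param_group_0 L \<cong> param_group_0' L \<and>
         group (SC_0 L) \<and> group (SA_0 L) \<and> SC_0 L \<cong> SA_0 L \<and>
         group (param_group_inf L) \<and> group (param_group_inf' L) \<and>
           param_group_inf L \<cong> param_group_inf' L \<and>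
         group (SC_inf L) \<and> group (SA_inf L) \<and> SC_inf L \<cong> SA_inf L"
proof -
  have b: "bij_betw E2_0 (params L) (carrier (SC_0 L))" "bij_betw E1_0 (params L) (carrier (SA_0 L))"
    "bij_betw E2_inf (params L) (carrier (SC_inf L))" "bij_betw E1_inf (params L) (carrier (SA_inf L))"
    using bij_E2_0 bij_E1_0 bij_E2_inf bij_E1_inf by (simp_all add: SC_0_def SA_0_def SC_inf_def SA_inf_def)
  note p = pulled_back_group[OF SC_0_SA_0(1) b(1), folded param_group_0_def]
    pulled_back_group[OF group_SA_0 b(2), folded param_group_0'_def]
    pulled_back_group[OF SC_inf_SC_0(1) b(3), folded param_group_inf_def]
    pulled_back_group[OF SA_inf_SA_0(1) b(4), folded param_group_inf'_def]
  have inf: "SC_inf L \<cong> SA_inf L"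
    by (rule iso_trans[OF iso_trans[OF SC_inf_SC_0(2) SC_0_SA_0(2)] group.iso_sym[OF SA_inf_SA_0]])
  have "param_group_0 L \<cong> param_group_0' L"
    by (rule iso_trans[OF iso_trans[OF p(2) SC_0_SA_0(2)] group.iso_sym[OF p(3,4)]])
  moreover have "param_group_inf L \<cong> param_group_inf' L"
    by (rule iso_trans[OF iso_trans[OF p(6) inf] group.iso_sym[OF p(7,8)]])
  ultimately show ?thesis using p SC_0_SA_0 group_SA_0 SC_inf_SC_0(1) SA_inf_SA_0(1) inf by blast
qed

end
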